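(* Let $0<p<\infty$. Then $T_+\colon H^p(\Omega_+)\to H^p(\mathbb{C}_+)$, $T_+F(z)=F(\Phi_+(z))(\Phi_+'(z))^{1/p}$, and $T_-\colon H^p(\Omega_-)\to H^p(\mathbb{C}_-)$, $T_-F(z)=F(\Phi_-(z))(\Phi_-'(z))^{1/p}$, are both (well-defined,) linear, one-to-one, onto and bounded, with $$5^{-\frac1p}\leqslant\lVert T_+\rVert\leqslant1\quad\text{and}\quad 6^{-\frac1p}\leqslant\lVert T_-\rVert\leqslant1.$$ Their inverses $T_\pm^{-1}$ are also bounded.
   Context: Fix $\sigma>0$. For $s>0$, $t\in\mathbb{R}$ let $D_{s,t}=\{u+\mathrm{i}v: |u|<s,\ v>t\}$ and $\Gamma_{s,t}=\partial D_{s,t}$. Put $\Omega_+=D_{\sigma,0}$, $\Omega_-=\mathbb{C}\setminus\overline{D_{\sigma,0}}$. $H^p(\Omega_+)$ is the set of $F$ analytic on $\Omega_+$ with $\lVert F\rVert_{H^p(\Omega_+)}=\sup_{0<s<\sigma,\,t>0}\big(\int_{\Gamma_{s,t}}|F(w)|^p|\mathrm{d}w|\big)^{1/p}<\infty$; $H^p(\Omega_-)$ is the set of $F$ analytic on $\Omega_-$ with $\lVert F\rVert_{H^p(\Omega_-)}=\sup_{s>\sigma,\,t<0}\big(\int_{\Gamma_{s,t}}|F(w)|^p|\mathrm{d}w|\big)^{1/p}<\infty$. $\mathbb{C}_\pm$ are the open upper and lower half planes, and $H^p(\mathbb{C}_\pm)$ the classical Hardy spaces, with $\lVert f\rVert_{H^p(\mathbb{C}_\pm)}=\sup_{\pm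 y>0}\big(\int_{\mathbb{R}}|f(x+\mathrm{i}y)|^p\,\mathrm{d}x\big)^{1/p}$. (For $p<1$ these are not norms; the word is used for convenience.) $\lVert T\rVert$ is the operator norm $\sup_{F\neq0}\lVert TF\rVert/\lVert F\rVert$ with respect to these quantities. $\Phi_+$ is the conformal map of $\mathbb{C}_+$ onto $\Omega_+$ given by $\Phi_+(z)=\frac{2\sigma}{\pi}\int_0^z\frac{\mathrm{d}\xi}{\sqrt{1-\xi^2}}$ with the branch of $\sqrt{1-\xi^2}$ analytic on $\mathbb{C}_+$ and positive on $(-1,1)$ (so $\Phi_+(z)=\frac{2\sigma}{\pi}\arcsin z$); $\Phi_-$ is the conformal map of $\mathbb{C}_-$ onto $\Omega_-$ given by $\Phi_-(z)=\frac{4\sigma}{\pi}\int_0^z\sqrt{1-\xi^2}\,\mathrm{d}\xi$ with the branch of $\sqrt{1-\xi^2}$ analytic on $\mathbb{C}_-$ and positive on $(-1,1)$. Both satisfy $\Phi_\pm(-1)=-\sigma$, $\Phi_\pm(1)=\sigma$. The powers $(\Phi_\pm')^{1/p}$ are fixed analytic branches (the derivatives do not vanish). *)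

theory Defs
  imports "HOL-Complex_Analysis.Complex_Analysis"
begin

section \<open>Domains and boundary curves\<close>

definition D :: "real \<Rightarrow> real \<Rightarrow> complex set" where
  "D s t = {w. \<bar>Re w\<bar> < s \<and> t < Im w}"

definition Omega_plus :: "real \<Rightarrow> complex set" where
  "Omega_plus \<sigma> = D \<sigma> 0"

definition Omega_minus :: "real \<Rightarrow> complex set" where
  "Omega_minus \<sigma> = - closure (D \<sigma> 0)"

definition upper_half_plane :: "complex set" where
  "upper_half_plane = {z. 0 < Im z}"

definition lower_half_plane :: "complex set" where
  "lower_half_plane = {z. Im z < 0}"

text \<open>
  Arc-length parametrization of the boundary of \<open>D s t\<close> by the real line: down the left
  ray, along the bottom segment (for \<open>- s \<le> x \<le> s\<close>), up the right ray. It has unit speed, so the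
  integral with respect to \<open>|dw|\<close> is the integral along it with respect to Lebesgue measure.
\<close>

definition Gamma_path :: "real \<Rightarrow> real \<Rightarrow> real \<Rightarrow> complex" where
  "Gamma_path s t x =
     (if x < - s then Complex (- s) (t + (- s - x))
      else if x \<le> s then Complex x t
      else Complex s (t + (x - s)))"

definition arc_integral :: "real \<Rightarrow> real \<Rightarrow> (complex \<Rightarrow> ennreal) \<Rightarrow> ennreal" where
  "arc_integral s t h = (\<integral>\<^sup>+ x. h (Gamma_path s t x) \<partial>lborel)"

lemma open_D: "open (D s t)"
proof -
  have "D s t = {w. Re w < s} \<inter> {w. Re w > - s} \<inter> {w. Im w > t}"
    by (auto simp: D_def)
  then show ?thesis
    by (simp add: open_Int open_halfspace_Re_lt open_halfspace_Re_gt open_halfspace_Im_gt)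
qed

lemma closure_D:
  assumes "0 < s"
  shows "closure (D s t) = {w. \<bar>Re w\<bar> \<le> s \<and> t \<le> Im w}"
proof
  have "closed ({w. Re w \<le> s} \<inter> {w. Re w \<ge> - s} \<inter> {w. Im w \<ge> t})"
    by (intro closed_Int closed_halfspace_Re_le closed_halfspace_Re_ge closed_halfspace_Im_ge)
  also have "{w. Re w \<le> s} \<inter> {w. Re w \<ge> - s} \<inter> {w. Im w \<ge> t} = {w. \<bar>Re w\<bar> \<le> s \<and> t \<le> Im w}"
    by auto
  finally show "closure (D s t) \<subseteq> {w. \<bar>Re w\<bar> \<le> s \<and> t \<le> Im w}"
    by (intro closure_minimal) (auto simp: D_def)
next
  show "{w. \<bar>Re w\<bar> \<le> s \<and> t \<le> Im w} \<subseteq> closure (D s t)"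
  proof
    fix w assume w: "w \<in> {w. \<bar>Re w\<bar> \<le> s \<and> t \<le> Im w}"
    define f where "f n = Complex ((1 - inverse (real (Suc n))) * Re w)
      (Im w + inverse (real (Suc n)))" for n
    have inD: "f n \<in> D s t" for n
    proof -
      define e where "e = inverse (real (Suc n))"
      have e: "0 < e" "e \<le> 1" by (auto simp: e_def field_simps)
      have "\<bar>(1 - e) * Re w\<bar> = (1 - e) * \<bar>Re w\<bar>" using e by (simp add: abs_mult)
      also have "\<dots> \<le> (1 - e) * s" using e w by (intro mult_left_mono) auto
      also have "\<dots> < s" using e assms by (simp add: algebra_simps)
      finally show ?thesis using e w unfolding f_def e_def[symmetric] by (auto simp: D_def)
    qed
    have "(\<lambda>n. Complex ((1 - inverse (real (Suc n))) * Re w) (Im w + inverse (real (Suc n))))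
      \<longlonglongrightarrow> Complex ((1 - 0) * Re w) (Im w + 0)"
      by (intro tendsto_intros LIMSEQ_inverse_real_of_nat)
    then have "f \<longlonglongrightarrow> w" by (simp add: f_def[abs_def])
    with inD show "w \<in> closure (D s t)" unfolding closure_sequential by blast
  qed
qed

lemma range_Gamma_path:
  assumes "0 < s"
  shows "range (Gamma_path s t) = frontier (D s t)"
proof -
  have fr: "frontier (D s t) = {w. \<bar>Re w\<bar> \<le> s \<and> t \<le> Im w} - {w. \<bar>Re w\<bar> < s \<and> t < Im w}"
    unfolding frontier_def interior_open[OF open_D] closure_D[OF assms] by (simp add: D_def)
  show ?thesis unfolding fr
  proof (intro equalityI subsetI)
    fix w assume "w \<in> range (Gamma_path s t)"
    then show "w \<in> {w. \<bar>Re w\<bar> \<le> s \<and> t \<le> Im w} - {w. \<bar>Re w\<bar> < s \<and> t < Im w}"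
      using assms by (auto simp: Gamma_path_def)
  next
    fix w assume w: "w \<in> {w. \<bar>Re w\<bar> \<le> s \<and> t \<le> Im w} - {w. \<bar>Re w\<bar> < s \<and> t < Im w}"
    then consider "Im w = t" "\<bar>Re w\<bar> \<le> s" | "Im w > t" "Re w = s" | "Im w > t" "Re w = - s"
      by fastforce
    then show "w \<in> range (Gamma_path s t)"
    proof cases
      case 1
      then show ?thesis
        by (intro range_eqI[of _ _ "Re w"]) (auto simp: Gamma_path_def complex_eq_iff)
    next
      case 2
      then show ?thesis using assms
        by (intro range_eqI[of _ _ "s + (Im w - t)"]) (auto simp: Gamma_path_def complex_eq_iff)
    next
      case 3
      then show ?thesis using assms
        by (intro range_eqI[of _ _ "- s - (Im w - t)"]) (auto simp: Gamma_path_def complex_eq_iff)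
    qed
  qed
qed

lemma inj_Gamma_path: "0 < s \<Longrightarrow> inj (Gamma_path s t)"
  by (auto simp: inj_def Gamma_path_def split: if_splits)


section \<open>Hardy spaces\<close>

definition enn_root :: "real \<Rightarrow> ennreal \<Rightarrow> ennreal" where
  "enn_root p x = (if x = \<infinity> then \<infinity> else ennreal (enn2real x powr (1 / p)))"

definition norm_Omega_plus :: "real \<Rightarrow> real \<Rightarrow> (complex \<Rightarrow> complex) \<Rightarrow> ennreal" where
  "norm_Omega_plus \<sigma> p F =
     (SUP (s, t) \<in> {0<..<\<sigma>} \<times> {0<..}. enn_root p (arc_integral s t (\<lambda>w. ennreal (cmod (F w) powr p))))"

definition norm_Omega_minus :: "real \<Rightarrow> real \<Rightarrow> (complex \<Rightarrow> complex) \<Rightarrow> ennreal" where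
  "norm_Omega_minus \<sigma> p F =
     (SUP (s, t) \<in> {\<sigma><..} \<times> {..<0}. enn_root p (arc_integral s t (\<lambda>w. ennreal (cmod (F w) powr p))))"

definition norm_upper :: "real \<Rightarrow> (complex \<Rightarrow> complex) \<Rightarrow> ennreal" where
  "norm_upper p f =
     (SUP y \<in> {0<..}. enn_root p (\<integral>\<^sup>+ x. ennreal (cmod (f (Complex x y)) powr p) \<partial>lborel))"

definition norm_lower :: "real \<Rightarrow> (complex \<Rightarrow> complex) \<Rightarrow> ennreal" where
  "norm_lower p f =
     (SUP y \<in> {..<0}. enn_root p (\<integral>\<^sup>+ x. ennreal (cmod (f (Complex x y)) powr p) \<partial>lborel))"

text \<open>
  A function on an open set \<open>A\<close> is represented by its extension by \<open>0\<close> to the whole plane, so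
  that two elements of a Hardy space are equal iff they agree on \<open>A\<close>, and the zero element is
  \<open>\<lambda>_. 0\<close>. The values outside \<open>A\<close> enter neither analyticity nor the norms.
\<close>

definition hardy_space ::
  "complex set \<Rightarrow> ((complex \<Rightarrow> complex) \<Rightarrow> ennreal) \<Rightarrow> (complex \<Rightarrow> complex) set" where
  "hardy_space A N = {F. F holomorphic_on A \<and> (\<forall>z. z \<notin> A \<longrightarrow> F z = 0) \<and> N F < \<infinity>}"

definition Hp_Omega_plus :: "real \<Rightarrow> real \<Rightarrow> (complex \<Rightarrow> complex) set" where
  "Hp_Omega_plus \<sigma> p = hardy_space (Omega_plus \<sigma>) (norm_Omega_plus \<sigma> p)"

definition Hp_Omega_minus :: "real \<Rightarrow> real \<Rightarrow> (complex \<Rightarrow> complex) set" where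
  "Hp_Omega_minus \<sigma> p = hardy_space (Omega_minus \<sigma>) (norm_Omega_minus \<sigma> p)"

definition Hp_upper :: "real \<Rightarrow> (complex \<Rightarrow> complex) set" where
  "Hp_upper p = hardy_space upper_half_plane (norm_upper p)"

definition Hp_lower :: "real \<Rightarrow> (complex \<Rightarrow> complex) set" where
  "Hp_lower p = hardy_space lower_half_plane (norm_lower p)"


section \<open>Linear operators between function spaces\<close>

definition complex_subspace :: "(complex \<Rightarrow> complex) set \<Rightarrow> bool" where
  "complex_subspace V \<longleftrightarrow> (\<lambda>_. 0) \<in> V \<and> (\<forall>F\<in>V. \<forall>G\<in>V. (\<lambda>z. F z + G z) \<in> V)
     \<and> (\<forall>c. \<forall>F\<in>V. (\<lambda>z. c * F z) \<in> V)"

definition linear_between ::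
  "(complex \<Rightarrow> complex) set \<Rightarrow> (complex \<Rightarrow> complex) set
    \<Rightarrow> ((complex \<Rightarrow> complex) \<Rightarrow> (complex \<Rightarrow> complex)) \<Rightarrow> bool" where
  "linear_between V W T \<longleftrightarrow> complex_subspace V \<and> complex_subspace W
     \<and> (\<forall>F\<in>V. T F \<in> W)
     \<and> (\<forall>F\<in>V. \<forall>G\<in>V. T (\<lambda>z. F z + G z) = (\<lambda>z. T F z + T G z))
     \<and> (\<forall>c. \<forall>F\<in>V. T (\<lambda>z. c * F z) = (\<lambda>z. c * T F z))"

definition op_norm ::
  "(complex \<Rightarrow> complex) set \<Rightarrow> ((complex \<Rightarrow> complex) \<Rightarrow> ennreal) \<Rightarrow> ((complex \<Rightarrow> complex) \<Rightarrow> ennreal)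
    \<Rightarrow> ((complex \<Rightarrow> complex) \<Rightarrow> (complex \<Rightarrow> complex)) \<Rightarrow> ennreal" where
  "op_norm V NV NW T = (SUP F \<in> {F \<in> V. F \<noteq> (\<lambda>_. 0)}. NW (T F) / NV F)"


section \<open>The conformal maps and the operators\<close>

text \<open>
  The principal branch \<open>csqrt (1 - \<xi>\<^sup>2)\<close> is analytic off the two real half-lines \<open>|\<xi>| \<ge> 1\<close> and positive
  on \<open>(-1, 1)\<close>, so it is the required branch on the upper as well as on the lower half plane.
\<close>

definition Phi_plus :: "real \<Rightarrow> complex \<Rightarrow> complex" where
  "Phi_plus \<sigma> z = of_real (2 * \<sigma> / pi) * contour_integral (linepath 0 z) (\<lambda>\<xi>. 1 / csqrt (1 - \<xi>\<^sup>2))"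

definition Phi_minus :: "real \<Rightarrow> complex \<Rightarrow> complex" where
  "Phi_minus \<sigma> z = of_real (4 * \<sigma> / pi) * contour_integral (linepath 0 z) (\<lambda>\<xi>. csqrt (1 - \<xi>\<^sup>2))"

text \<open>\<open>g\<close> is an analytic branch of the power \<open>h\<^sup>a\<close> on \<open>A\<close>, coming from an analytic logarithm of \<open>h\<close>.\<close>

definition power_branch ::
  "complex set \<Rightarrow> (complex \<Rightarrow> complex) \<Rightarrow> real \<Rightarrow> (complex \<Rightarrow> complex) \<Rightarrow> bool" where
  "power_branch A h a g \<longleftrightarrow>
     (\<exists>L. L holomorphic_on A \<and> (\<forall>z\<in>A. exp (L z) = h z \<and> g z = exp (of_real a * L z)))"

text \<open>In both operators \<open>g\<close> stands for the chosen branch of the \<open>1 / p\<close>-th power of the derivative.\<close>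

definition T_plus ::
  "real \<Rightarrow> (complex \<Rightarrow> complex) \<Rightarrow> (complex \<Rightarrow> complex) \<Rightarrow> complex \<Rightarrow> complex" where
  "T_plus \<sigma> g F z = (if z \<in> upper_half_plane then F (Phi_plus \<sigma> z) * g z else 0)"

definition T_minus ::
  "real \<Rightarrow> (complex \<Rightarrow> complex) \<Rightarrow> (complex \<Rightarrow> complex) \<Rightarrow> complex \<Rightarrow> complex" where
  "T_minus \<sigma> g F z = (if z \<in> lower_half_plane then F (Phi_minus \<sigma> z) * g z else 0)"

end

theory Submission
  imports Defs "HOL-Real_Asymp.Real_Asymp"
begin

text \<open>
  Substituting \<open>w = \<Phi> z\<close> turns \<open>\<integral>|F|\<^sup>p |dw|\<close> over the boundary of \<open>\<Omega>\<close> into \<open>\<integral>|T F|\<^sup>p dx\<close> over the real line,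
  so on boundary values \<open>T\<close> would be an isometry. The quasi-norms, however, are suprema over curves inside
  the domains, and \<open>\<Phi>\<close> does not carry the curves of one family to those of the other. Both operators
  are treated at once in the locale \<open>half_strip_transfer\<close>; the sign \<open>e\<close> selects the half plane.

  \<^item> \<open>T\<close> has norm at most 1 (\<open>line_mean_T_le\<close>). The affine map \<open>w \<mapsto> \<i> t + (s / \<sigma>) w\<close> sends \<open>\<Omega>\<close> into itself and
    its boundary onto \<open>\<Gamma>\<^bsub>s,t\<^esub>\<close>. Composed with it, \<open>F\<close> becomes bounded and continuous up to the
    boundary, and the isometry is available there. A Phragmen-Lindelof argument (\<open>line_mean_le_limit\<close>)
    then bounds the means over all lines by the boundary integral, and Fatou's lemma removes the dilation.

  \<^item> The inverse is bounded (\<open>arc_mean_T_inv_le\<close>). With \<open>\<psi> = \<Phi>\<^sup>-\<^sup>1\<close>, the integral of \<open>|T\<^sup>-\<^sup>1 f|\<^sup>p\<close> over \<open>\<Gamma>\<^bsub>s,t\<^esub>\<close> is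
    that of \<open>|f|\<^sup>p\<close> with respect to arc length over \<open>\<psi>(\<Gamma>\<^bsub>s,t\<^esub>)\<close>. Since \<open>\<psi>'\<close> stays in one quadrant on each half
    of \<open>\<Omega>\<close>, the image curve falls into four pieces along which both coordinates are monotone.
    Arc length on such a piece is a Carleson measure with a constant that does not depend on the piece
    (\<open>carleson_monotone_curve\<close>): in the coordinate \<open>Re z \<plusminus> Im z\<close> the piece is a graph, \<open>|f|\<^bsup>p/2\<^esup>\<close> is
    at most the Poisson integral of its boundary values (\<open>poisson_majorant\<close>), and the Poisson integral
    is bounded from \<open>L\<^sup>2\<close> of the line to \<open>L\<^sup>2\<close> of the graph (\<open>poisson_square_integral_on_graph\<close>).

  \<^item> The lower bounds come from \<open>F w = (\<sigma> \<mp> \<i> w)\<^bsup>-2/p\<^esup>\<close>, for which \<open>|F|\<^sup>p\<close> is an inverse square distance.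
    Its norm is at most \<open>(2 \<pi> / \<sigma>)\<^bsup>1/p\<^esup>\<close> in the half-strip and \<open>(3 \<pi> / \<sigma>)\<^bsup>1/p\<^esup>\<close> outside, whereas the bottom
    edge of the boundary alone contributes \<open>\<pi> / (2 \<sigma>)\<close> to the \<open>p\<close>-th power of the norm of the image. The ratios
    of the \<open>p\<close>-th powers are \<open>1 / 4\<close> and \<open>1 / 6\<close>.

  The concrete part is the verification of the locale assumptions. On the upper half plane the inverse map is
  an explicit sine. On the lower half plane the map is \<open>2 \<omega> + sin (2 \<omega>)\<close> in the variable \<open>\<omega> = Arcsin z\<close>,
  up to a factor; it is injective because its derivative with respect to \<open>z\<close> has positive real part, and
  onto because its image is open and relatively closed in the connected set \<open>Omega_minus \<sigma>\<close>.
\<close>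

section \<open>The Poisson kernel and an \<open>L\<^sup>2\<close> estimate on graphs\<close>

definition poisson_kernel :: "real \<Rightarrow> real \<Rightarrow> real" where
  "poisson_kernel y x = y / (pi * (x\<^sup>2 + y\<^sup>2))"

lemma poisson_kernel_nonneg [simp]: "0 \<le> y \<Longrightarrow> 0 \<le> poisson_kernel y x"
  by (simp add: poisson_kernel_def)

lemma poisson_kernel_minus [simp]: "poisson_kernel y (- x) = poisson_kernel y x"
  by (simp add: poisson_kernel_def)

lemma poisson_kernel_commute: "poisson_kernel y (x - t) = poisson_kernel y (t - x)"
  by (simp add: poisson_kernel_def power2_commute)

lemma poisson_kernel_le: "0 < y \<Longrightarrow> poisson_kernel y x \<le> 1 / (pi * y)"
  unfolding poisson_kernel_def
  by (subst divide_le_eq) (auto simp: field_simps power2_eq_square add_nonneg_pos intro!: mult_pos_pos)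

lemma measurable_poisson_kernel [measurable]:
  assumes [measurable]: "f \<in> borel_measurable M" "g \<in> borel_measurable M"
  shows "(\<lambda>x. poisson_kernel (f x) (g x)) \<in> borel_measurable M"
  unfolding poisson_kernel_def by measurable

lemma poisson_kernel_primitive:
  assumes "0 < y"
  shows "((\<lambda>x. arctan (x / y) / pi) has_real_derivative poisson_kernel y x) (at x)"
proof -
  have "((\<lambda>x. arctan (x / y)) has_real_derivative (1 / y) * inverse (1 + (x / y)\<^sup>2)) (at x)"
    using assms by (auto intro!: derivative_eq_intros simp: field_simps)
  then have "((\<lambda>x. arctan (x / y) / pi) has_real_derivative (1 / y) * inverse (1 + (x / y)\<^sup>2) / pi) (at x)"
    by (rule DERIV_cdivide)
  also have "(1 / y) * inverse (1 + (x / y)\<^sup>2) = y / (x\<^sup>2 + y\<^sup>2)"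
  proof -
    have "1 + (x / y)\<^sup>2 = (x\<^sup>2 + y\<^sup>2) / y\<^sup>2" using assms by (simp add: field_simps)
    then show ?thesis using assms by (simp add: power2_eq_square)
  qed
  finally show ?thesis by (simp add: poisson_kernel_def mult.commute)
qed

lemma nn_integral_poisson_kernel_halfline:
  assumes "0 < y"
  shows "(\<integral>\<^sup>+x. ennreal (poisson_kernel y x) * indicator {0..} x \<partial>lborel) = ennreal (1/2)"
proof -
  have "(\<integral>\<^sup>+x. ennreal (poisson_kernel y x) * indicator {0..} x \<partial>lborel)
     = ennreal (1/2 - arctan (0 / y) / pi)"
  proof (rule nn_integral_FTC_atLeast)
    show "poisson_kernel y \<in> borel_measurable borel" by measurable
    show "((\<lambda>x. arctan (x / y) / pi) has_real_derivative poisson_kernel y x) (at x)" for x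
      by (rule poisson_kernel_primitive[OF assms])
    show "0 \<le> poisson_kernel y x" for x using assms by simp
    have "((\<lambda>x. arctan (x / y)) \<longlongrightarrow> pi / 2) at_top"
    proof (rule filterlim_compose[OF tendsto_arctan_at_top])
      have "filterlim (\<lambda>x. inverse y * x) at_top at_top"
        using assms by (intro filterlim_tendsto_pos_mult_at_top[OF tendsto_const _ filterlim_ident]) auto
      then show "filterlim (\<lambda>x. x / y) at_top at_top" by (simp add: divide_inverse mult.commute)
    qed
    then have "((\<lambda>x. arctan (x / y) / pi) \<longlongrightarrow> (pi / 2) / pi) at_top"
      by (intro tendsto_intros) auto
    then show "((\<lambda>x. arctan (x / y) / pi) \<longlongrightarrow> 1/2) at_top" by simp
  qed
  then show ?thesis by simp
qed

lemma nn_integral_poisson_kernel: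
  assumes "0 < y"
  shows "(\<integral>\<^sup>+x. ennreal (poisson_kernel y x) \<partial>lborel) = 1"
proof -
  have "(\<integral>\<^sup>+x. ennreal (poisson_kernel y x) \<partial>lborel)
    = (\<integral>\<^sup>+x. ennreal (poisson_kernel y x) * indicator {0..} x
          + ennreal (poisson_kernel y x) * indicator {..<0} x \<partial>lborel)"
    by (intro nn_integral_cong) (auto split: split_indicator)
  also have "\<dots> = (\<integral>\<^sup>+x. ennreal (poisson_kernel y x) * indicator {0..} x \<partial>lborel)
      + (\<integral>\<^sup>+x. ennreal (poisson_kernel y x) * indicator {..<0} x \<partial>lborel)"
    by (intro nn_integral_add) auto
  also have "(\<integral>\<^sup>+x. ennreal (poisson_kernel y x) * indicator {..<0} x \<partial>lborel)
     = (\<integral>\<^sup>+x. ennreal (poisson_kernel y (- x)) * indicator {..<0} (- x) \<partial>lborel)"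
    by (subst nn_integral_real_affine[where c = "-1" and t = 0]) auto
  also have "\<dots> = (\<integral>\<^sup>+x. ennreal (poisson_kernel y x) * indicator {0..} x \<partial>lborel)"
    by (intro nn_integral_cong_AE, use AE_lborel_singleton[of "0::real"] in eventually_elim)
      (auto split: split_indicator)
  finally show ?thesis
    using nn_integral_poisson_kernel_halfline[OF assms]
      ennreal_plus[of "1/2" "1/2", symmetric] by simp
qed

lemma nn_integral_poisson_kernel_shift:
  assumes "0 < y"
  shows "(\<integral>\<^sup>+t. ennreal (poisson_kernel y (x - t)) \<partial>lborel) = 1"
proof -
  have "(\<integral>\<^sup>+t. ennreal (poisson_kernel y t) \<partial>lborel)
     = (\<integral>\<^sup>+t. ennreal (poisson_kernel y (x - t)) \<partial>lborel)"
    by (subst nn_integral_real_affine[where c = "-1" and t = x]) auto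
  then show ?thesis using nn_integral_poisson_kernel[OF assms] by simp
qed

lemma poisson_kernel_le_scaled:
  assumes "0 < y" "\<bar>u\<bar> \<le> 2 * \<bar>w\<bar>"
  shows "poisson_kernel y w \<le> 4 * poisson_kernel y u"
proof -
  have "u\<^sup>2 \<le> (2 * \<bar>w\<bar>)\<^sup>2" using assms(2) by (intro abs_le_square_iff[THEN iffD1]) (simp add: abs_mult)
  then have *: "u\<^sup>2 + y\<^sup>2 \<le> 4 * (w\<^sup>2 + y\<^sup>2)" by (simp add: power_mult_distrib) (smt (verit) zero_le_power2)
  have pos: "0 < u\<^sup>2 + y\<^sup>2" "0 < w\<^sup>2 + y\<^sup>2" using assms(1) by (simp_all add: add_nonneg_pos)
  have "y / (w\<^sup>2 + y\<^sup>2) \<le> y * 4 / (u\<^sup>2 + y\<^sup>2)"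
    using assms(1) pos mult_left_mono[OF *, of y] by (simp add: divide_simps algebra_simps)
  then have "y / (w\<^sup>2 + y\<^sup>2) / pi \<le> y * 4 / (u\<^sup>2 + y\<^sup>2) / pi"
    by (rule divide_right_mono) simp
  then show ?thesis by (simp add: poisson_kernel_def mult.commute)
qed

text \<open>
  One of the distances \<open>|x - t|\<close>, \<open>|x' - t|\<close> is at least half of \<open>|x - x'|\<close>, and the factor that
  belongs to it is at most four times its value at \<open>x - x'\<close>. This is the pointwise inequality
  behind the adjoint estimate \<open>T_adjoint_square\<close>.
\<close>
lemma poisson_kernel_mult_le:
  assumes "0 < y" "0 < y'"
  shows "poisson_kernel y (x - t) * poisson_kernel y' (x' - t)
    \<le> 4 * (poisson_kernel y (x - x') * poisson_kernel y' (x' - t)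
          + poisson_kernel y' (x' - x) * poisson_kernel y (x - t))"
proof -
  consider "\<bar>x - x'\<bar> \<le> 2 * \<bar>x - t\<bar>" | "\<bar>x' - x\<bar> \<le> 2 * \<bar>x' - t\<bar>"
    by (smt (verit))
  then show ?thesis
  proof cases
    case 1
    then have "poisson_kernel y (x - t) * poisson_kernel y' (x' - t)
        \<le> (4 * poisson_kernel y (x - x')) * poisson_kernel y' (x' - t)"
      using assms by (intro mult_right_mono poisson_kernel_le_scaled) auto
    moreover have "0 \<le> poisson_kernel y' (x' - x) * poisson_kernel y (x - t)" using assms by simp
    ultimately show ?thesis by (simp add: algebra_simps)
  next
    case 2
    then have "poisson_kernel y (x - t) * poisson_kernel y' (x' - t)
        \<le> poisson_kernel y (x - t) * (4 * poisson_kernel y' (x' - x))"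
      using assms by (intro mult_left_mono poisson_kernel_le_scaled) auto
    moreover have "0 \<le> poisson_kernel y (x - x') * poisson_kernel y' (x' - t)" using assms by simp
    ultimately show ?thesis by (simp add: algebra_simps)
  qed
qed

text \<open>
  Evaluating a Poisson integral on the graph of an arbitrary measurable height function \<open>y\<close> is a bounded
  operator from \<open>L\<^sup>2\<close> to \<open>L\<^sup>2\<close>. The lower bound \<open>c\<close> on the height and the restriction to \<open>[a, b]\<close> provide
  a finite constant to begin with, which a \<open>T T\<^sup>*\<close> argument then improves to an absolute one.
\<close>
context
  fixes a b c :: real and y :: "real \<Rightarrow> real"
  assumes c: "0 < c" and y_ge: "\<And>x. c \<le> y x" and meas_y [measurable]: "y \<in> borel_measurable borel"
begin

private lemma y_pos: "0 < y x" using c y_ge[of x] by linarith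

private definition T :: "(real \<Rightarrow> ennreal) \<Rightarrow> real \<Rightarrow> ennreal" where
  "T g x = (\<integral>\<^sup>+t. ennreal (poisson_kernel (y x) (x - t)) * g t \<partial>lborel)"

private lemma measurable_T [measurable]:
  assumes [measurable]: "g \<in> borel_measurable borel"
  shows "T g \<in> borel_measurable borel"
  unfolding T_def by measurable

private definition admissible :: "real \<Rightarrow> bool" where
  "admissible k \<longleftrightarrow> 0 \<le> k \<and> (\<forall>g\<in>borel_measurable borel. (\<integral>\<^sup>+t. (g t)\<^sup>2 \<partial>lborel) < top \<longrightarrow>
     (\<integral>\<^sup>+x. (T g x)\<^sup>2 * indicator {a..b} x \<partial>lborel) \<le> ennreal k * (\<integral>\<^sup>+t. (g t)\<^sup>2 \<partial>lborel))"

private lemma admissible_initial: "admissible (max 0 (b - a) / (pi * c))"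
  unfolding admissible_def
proof (intro conjI ballI impI)
  show "0 \<le> max 0 (b - a) / (pi * c)" using c by simp
  fix g :: "real \<Rightarrow> ennreal" assume g [measurable]: "g \<in> borel_measurable borel"
  have "(T g x)\<^sup>2 \<le> ennreal (1 / (pi * c)) * (\<integral>\<^sup>+t. (g t)\<^sup>2 \<partial>lborel)" for x
  proof -
    have "(T g x)\<^sup>2 \<le> (\<integral>\<^sup>+t. (ennreal (poisson_kernel (y x) (x - t)))\<^sup>2 \<partial>lborel) * (\<integral>\<^sup>+t. (g t)\<^sup>2 \<partial>lborel)"
      unfolding T_def by (rule Cauchy_Schwarz_nn_integral) auto
    also have "(\<integral>\<^sup>+t. (ennreal (poisson_kernel (y x) (x - t)))\<^sup>2 \<partial>lborel)
      \<le> (\<integral>\<^sup>+t. ennreal (1 / (pi * c)) * ennreal (poisson_kernel (y x) (x - t)) \<partial>lborel)"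
    proof (intro nn_integral_mono)
      fix t
      have "poisson_kernel (y x) (x - t) \<le> 1 / (pi * y x)" by (rule poisson_kernel_le[OF y_pos])
      also have "\<dots> \<le> 1 / (pi * c)" using c y_ge[of x] y_pos[of x] by (intro divide_left_mono) auto
      finally show "(ennreal (poisson_kernel (y x) (x - t)))\<^sup>2
          \<le> ennreal (1 / (pi * c)) * ennreal (poisson_kernel (y x) (x - t))"
        unfolding power2_eq_square by (intro mult_right_mono ennreal_leI) auto
    qed
    also have "\<dots> = ennreal (1 / (pi * c))"
      using y_pos[of x] by (subst nn_integral_cmult) (auto simp: nn_integral_poisson_kernel_shift)
    finally show ?thesis by (simp add: mult_right_mono)
  qed
  then have "(\<integral>\<^sup>+x. (T g x)\<^sup>2 * indicator {a..b} x \<partial>lborel)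
     \<le> (\<integral>\<^sup>+x. (ennreal (1 / (pi * c)) * (\<integral>\<^sup>+t. (g t)\<^sup>2 \<partial>lborel)) * indicator {a..b} x \<partial>lborel)"
    by (intro nn_integral_mono mult_right_mono) auto
  also have "\<dots> = ennreal (1 / (pi * c)) * (\<integral>\<^sup>+t. (g t)\<^sup>2 \<partial>lborel) * ennreal (max 0 (b - a))"
    by (subst nn_integral_cmult_indicator) (auto simp: max_def)
  also have "\<dots> = ennreal (max 0 (b - a) / (pi * c)) * (\<integral>\<^sup>+t. (g t)\<^sup>2 \<partial>lborel)"
  proof -
    have "ennreal (max 0 (b - a) / (pi * c)) = ennreal (1 / (pi * c)) * ennreal (max 0 (b - a))"
      using c by (subst ennreal_mult'[symmetric]) auto
    then show ?thesis by (simp only: ac_simps)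
  qed
  finally show "(\<integral>\<^sup>+x. (T g x)\<^sup>2 * indicator {a..b} x \<partial>lborel)
     \<le> ennreal (max 0 (b - a) / (pi * c)) * (\<integral>\<^sup>+t. (g t)\<^sup>2 \<partial>lborel)" .
qed

text \<open>
  With \<open>K x t\<close> the kernel of \<open>T\<close>, integrating \<open>K x t * K x' t\<close> over \<open>t\<close> gives at most
  \<open>4 (K x x' + K x' x)\<close> by \<open>poisson_kernel_mult_le\<close>, so that the square of the norm of \<open>T\<^sup>* h\<close>
  is controlled by \<open>\<langle>h, T h\<rangle>\<close>.
\<close>
private lemma T_adjoint_square:
  assumes [measurable]: "h \<in> borel_measurable borel"
  shows "(\<integral>\<^sup>+t. (\<integral>\<^sup>+x. h x * ennreal (poisson_kernel (y x) (x - t)) \<partial>lborel)\<^sup>2 \<partial>lborel)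
     \<le> 8 * (\<integral>\<^sup>+x. h x * T h x \<partial>lborel)"
proof -
  let ?K = "\<lambda>x t. ennreal (poisson_kernel (y x) (x - t))"
  have "(\<integral>\<^sup>+t. (\<integral>\<^sup>+x. h x * ?K x t \<partial>lborel)\<^sup>2 \<partial>lborel)
    = (\<integral>\<^sup>+t. (\<integral>\<^sup>+x. (\<integral>\<^sup>+x'. h x * h x' * (?K x t * ?K x' t) \<partial>lborel) \<partial>lborel) \<partial>lborel)"
  proof (rule nn_integral_cong)
    fix t
    have "(\<integral>\<^sup>+x. h x * ?K x t \<partial>lborel)\<^sup>2 = (\<integral>\<^sup>+x. h x * ?K x t * (\<integral>\<^sup>+x'. h x' * ?K x' t \<partial>lborel) \<partial>lborel)"
      unfolding power2_eq_square by (rule nn_integral_multc[symmetric]) measurable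
    also have "\<dots> = (\<integral>\<^sup>+x. (\<integral>\<^sup>+x'. h x * ?K x t * (h x' * ?K x' t) \<partial>lborel) \<partial>lborel)"
      by (intro nn_integral_cong nn_integral_cmult[symmetric]) measurable
    finally show "(\<integral>\<^sup>+x. h x * ?K x t \<partial>lborel)\<^sup>2
      = (\<integral>\<^sup>+x. (\<integral>\<^sup>+x'. h x * h x' * (?K x t * ?K x' t) \<partial>lborel) \<partial>lborel)"
      by (simp add: ac_simps)
  qed
  also have "\<dots> = (\<integral>\<^sup>+x. (\<integral>\<^sup>+x'. (\<integral>\<^sup>+t. h x * h x' * (?K x t * ?K x' t) \<partial>lborel) \<partial>lborel) \<partial>lborel)"
  proof -
    have "(\<integral>\<^sup>+t. (\<integral>\<^sup>+x. (\<integral>\<^sup>+x'. h x * h x' * (?K x t * ?K x' t) \<partial>lborel) \<partial>lborel) \<partial>lborel)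
      = (\<integral>\<^sup>+x. (\<integral>\<^sup>+t. (\<integral>\<^sup>+x'. h x * h x' * (?K x t * ?K x' t) \<partial>lborel) \<partial>lborel) \<partial>lborel)"
      by (rule lborel_pair.Fubini') measurable
    also have "\<dots> = (\<integral>\<^sup>+x. (\<integral>\<^sup>+x'. (\<integral>\<^sup>+t. h x * h x' * (?K x t * ?K x' t) \<partial>lborel) \<partial>lborel) \<partial>lborel)"
      by (intro nn_integral_cong lborel_pair.Fubini') measurable
    finally show ?thesis .
  qed
  also have "\<dots> \<le> (\<integral>\<^sup>+x. (\<integral>\<^sup>+x'. h x * h x' * (4 * (?K x x' + ?K x' x)) \<partial>lborel) \<partial>lborel)"
  proof (intro nn_integral_mono)
    fix x x'
    have "(\<integral>\<^sup>+t. ?K x t * ?K x' t \<partial>lborel)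
        \<le> (\<integral>\<^sup>+t. 4 * (?K x x' * ?K x' t + ?K x' x * ?K x t) \<partial>lborel)"
    proof (rule nn_integral_mono)
      fix t
      have nn: "0 \<le> poisson_kernel (y u) v" for u v using y_pos[of u] by simp
      have "?K x t * ?K x' t = ennreal (poisson_kernel (y x) (x - t) * poisson_kernel (y x') (x' - t))"
        by (simp add: ennreal_mult' nn)
      also have "\<dots> \<le> ennreal (4 * (poisson_kernel (y x) (x - x') * poisson_kernel (y x') (x' - t)
          + poisson_kernel (y x') (x' - x) * poisson_kernel (y x) (x - t)))"
        by (intro ennreal_leI poisson_kernel_mult_le y_pos)
      also have "\<dots> = 4 * (?K x x' * ?K x' t + ?K x' x * ?K x t)"
        by (simp add: ennreal_mult' ennreal_mult nn)
      finally show "?K x t * ?K x' t \<le> 4 * (?K x x' * ?K x' t + ?K x' x * ?K x t)" .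
    qed
    also have "\<dots> = 4 * (?K x x' + ?K x' x)"
    proof -
      have "(\<integral>\<^sup>+t. 4 * (?K x x' * ?K x' t + ?K x' x * ?K x t) \<partial>lborel)
        = 4 * ((\<integral>\<^sup>+t. ?K x x' * ?K x' t \<partial>lborel) + (\<integral>\<^sup>+t. ?K x' x * ?K x t \<partial>lborel))"
      proof -
        have "(\<integral>\<^sup>+t. 4 * (?K x x' * ?K x' t + ?K x' x * ?K x t) \<partial>lborel)
          = 4 * (\<integral>\<^sup>+t. ?K x x' * ?K x' t + ?K x' x * ?K x t \<partial>lborel)"
          by (rule nn_integral_cmult) measurable
        then show ?thesis by (subst (asm) nn_integral_add) auto
      qed
      also have "(\<integral>\<^sup>+t. ?K x x' * ?K x' t \<partial>lborel) = ?K x x'"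
        by (subst nn_integral_cmult) (auto simp: nn_integral_poisson_kernel_shift y_pos)
      also have "(\<integral>\<^sup>+t. ?K x' x * ?K x t \<partial>lborel) = ?K x' x"
        by (subst nn_integral_cmult) (auto simp: nn_integral_poisson_kernel_shift y_pos)
      finally show ?thesis .
    qed
    finally have KK: "(\<integral>\<^sup>+t. ?K x t * ?K x' t \<partial>lborel) \<le> 4 * (?K x x' + ?K x' x)" .
    have "(\<integral>\<^sup>+t. h x * h x' * (?K x t * ?K x' t) \<partial>lborel) = h x * h x' * (\<integral>\<^sup>+t. ?K x t * ?K x' t \<partial>lborel)"
      by (rule nn_integral_cmult) measurable
    then show "(\<integral>\<^sup>+t. h x * h x' * (?K x t * ?K x' t) \<partial>lborel) \<le> h x * h x' * (4 * (?K x x' + ?K x' x))"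
      using KK by (simp only: mult_left_mono zero_le)
  qed
  also have "\<dots> = (\<integral>\<^sup>+x. 4 * ((\<integral>\<^sup>+x'. h x * (?K x x' * h x') \<partial>lborel)
                    + (\<integral>\<^sup>+x'. h x' * (?K x' x * h x) \<partial>lborel)) \<partial>lborel)"
  proof (rule nn_integral_cong)
    fix x
    have "(\<integral>\<^sup>+x'. h x * h x' * (4 * (?K x x' + ?K x' x)) \<partial>lborel)
      = (\<integral>\<^sup>+x'. 4 * (h x * (?K x x' * h x') + h x' * (?K x' x * h x)) \<partial>lborel)"
      by (intro nn_integral_cong) (simp add: algebra_simps)
    also have "\<dots> = 4 * (\<integral>\<^sup>+x'. h x * (?K x x' * h x') + h x' * (?K x' x * h x) \<partial>lborel)"
      by (rule nn_integral_cmult) measurable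
    also have "(\<integral>\<^sup>+x'. h x * (?K x x' * h x') + h x' * (?K x' x * h x) \<partial>lborel)
      = (\<integral>\<^sup>+x'. h x * (?K x x' * h x') \<partial>lborel) + (\<integral>\<^sup>+x'. h x' * (?K x' x * h x) \<partial>lborel)"
      by (rule nn_integral_add) measurable
    finally show "(\<integral>\<^sup>+x'. h x * h x' * (4 * (?K x x' + ?K x' x)) \<partial>lborel)
      = 4 * ((\<integral>\<^sup>+x'. h x * (?K x x' * h x') \<partial>lborel) + (\<integral>\<^sup>+x'. h x' * (?K x' x * h x) \<partial>lborel))" .
  qed
  also have "\<dots> = 4 * ((\<integral>\<^sup>+x. (\<integral>\<^sup>+x'. h x * (?K x x' * h x') \<partial>lborel) \<partial>lborel)
                    + (\<integral>\<^sup>+x. (\<integral>\<^sup>+x'. h x' * (?K x' x * h x) \<partial>lborel) \<partial>lborel))"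
  proof -
    have "(\<integral>\<^sup>+x. 4 * ((\<integral>\<^sup>+x'. h x * (?K x x' * h x') \<partial>lborel)
          + (\<integral>\<^sup>+x'. h x' * (?K x' x * h x) \<partial>lborel)) \<partial>lborel)
      = 4 * (\<integral>\<^sup>+x. (\<integral>\<^sup>+x'. h x * (?K x x' * h x') \<partial>lborel)
          + (\<integral>\<^sup>+x'. h x' * (?K x' x * h x) \<partial>lborel) \<partial>lborel)"
      by (rule nn_integral_cmult) measurable
    then show ?thesis by (subst (asm) nn_integral_add) auto
  qed
  also have "(\<integral>\<^sup>+x. (\<integral>\<^sup>+x'. h x' * (?K x' x * h x) \<partial>lborel) \<partial>lborel)
           = (\<integral>\<^sup>+x. (\<integral>\<^sup>+x'. h x * (?K x x' * h x') \<partial>lborel) \<partial>lborel)"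
    by (rule lborel_pair.Fubini') measurable
  also have "(\<integral>\<^sup>+x. (\<integral>\<^sup>+x'. h x * (?K x x' * h x') \<partial>lborel) \<partial>lborel) = (\<integral>\<^sup>+x. h x * T h x \<partial>lborel)"
    unfolding T_def by (simp add: nn_integral_cmult)
  finally have "(\<integral>\<^sup>+t. (\<integral>\<^sup>+x. h x * ?K x t \<partial>lborel)\<^sup>2 \<partial>lborel)
     \<le> 4 * ((\<integral>\<^sup>+x. h x * T h x \<partial>lborel) + (\<integral>\<^sup>+x. h x * T h x \<partial>lborel))" .
  also have "\<dots> = 4 * (2 * (\<integral>\<^sup>+x. h x * T h x \<partial>lborel))" by (simp only: mult_2)
  also have "\<dots> = 8 * (\<integral>\<^sup>+x. h x * T h x \<partial>lborel)" by (simp only: mult.assoc[symmetric]) simp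
  finally show ?thesis .
qed

text \<open>
  For \<open>h = T g\<close> on \<open>[a, b]\<close> the quantity to be bounded is \<open>B = \<parallel>h\<parallel>\<^sup>2 = \<langle>T\<^sup>* h, g\<rangle>\<close>. Hence
  \<open>B\<^sup>2 \<le> \<parallel>g\<parallel>\<^sup>2 \<parallel>T\<^sup>* h\<parallel>\<^sup>2 \<le> 8 \<parallel>g\<parallel>\<^sup>2 \<langle>h, T h\<rangle>\<close>, and \<open>\<langle>h, T h\<rangle> \<le> sqrt k * B\<close> if \<open>k\<close> is admissible.
\<close>
private lemma admissible_step:
  assumes k: "admissible k"
  shows "admissible (8 * sqrt k)"
proof (cases "k = 0")
  case True
  then show ?thesis using k by simp
next
  case False
  then have k0: "0 < k" using k by (simp add: admissible_def)
  show ?thesis unfolding admissible_def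
  proof (intro conjI ballI impI)
    show "0 \<le> 8 * sqrt k" using k0 by simp
    fix g :: "real \<Rightarrow> ennreal" assume g [measurable]: "g \<in> borel_measurable borel"
    define G where "G = (\<integral>\<^sup>+t. (g t)\<^sup>2 \<partial>lborel)"
    assume "(\<integral>\<^sup>+t. (g t)\<^sup>2 \<partial>lborel) < top"
    then have G_fin: "G < top" by (simp add: G_def)
    define h where "h x = T g x * indicator {a..b} x" for x
    have [measurable]: "h \<in> borel_measurable borel" unfolding h_def by measurable
    define B where "B = (\<integral>\<^sup>+x. (T g x)\<^sup>2 * indicator {a..b} x \<partial>lborel)"
    have B_h: "B = (\<integral>\<^sup>+x. (h x)\<^sup>2 \<partial>lborel)"
      unfolding B_def h_def by (intro nn_integral_cong) (auto split: split_indicator)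
    have BG: "B \<le> ennreal k * G" using k g G_fin by (auto simp: admissible_def B_def G_def)
    show "B \<le> ennreal (8 * sqrt k) * G"
    proof -
      obtain rG where rG: "G = ennreal rG" "0 \<le> rG" using G_fin by (cases G) auto
      have "B \<noteq> top" using BG rG by (auto simp: ennreal_mult_eq_top_iff top_unique)
      define X where "X = (\<integral>\<^sup>+x. h x * T h x \<partial>lborel)"
      have "X = (\<integral>\<^sup>+x. h x * (T h x * indicator {a..b} x) \<partial>lborel)"
        unfolding X_def h_def by (intro nn_integral_cong) (auto split: split_indicator)
      then have "X\<^sup>2 \<le> (\<integral>\<^sup>+x. (h x)\<^sup>2 \<partial>lborel) * (\<integral>\<^sup>+x. (T h x * indicator {a..b} x)\<^sup>2 \<partial>lborel)"
        by (simp add: Cauchy_Schwarz_nn_integral)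
      also have "(\<integral>\<^sup>+x. (T h x * indicator {a..b} x)\<^sup>2 \<partial>lborel)
          = (\<integral>\<^sup>+x. (T h x)\<^sup>2 * indicator {a..b} x \<partial>lborel)"
        by (intro nn_integral_cong) (auto split: split_indicator)
      also have "\<dots> \<le> ennreal k * B"
        using k \<open>B \<noteq> top\<close> unfolding admissible_def B_h by (auto simp: less_top)
      finally have X2: "X\<^sup>2 \<le> B * (ennreal k * B)" by (simp add: B_h mult_left_mono)
      have "B = (\<integral>\<^sup>+x. (\<integral>\<^sup>+t. h x * (ennreal (poisson_kernel (y x) (x - t)) * g t) \<partial>lborel) \<partial>lborel)"
        unfolding B_def h_def T_def
        by (intro nn_integral_cong, subst nn_integral_cmult) (auto simp: power2_eq_square ac_simps)
      also have "\<dots> = (\<integral>\<^sup>+t. (\<integral>\<^sup>+x. h x * (ennreal (poisson_kernel (y x) (x - t)) * g t) \<partial>lborel) \<partial>lborel)"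
        by (rule lborel_pair.Fubini') measurable
      also have "\<dots> = (\<integral>\<^sup>+t. g t * (\<integral>\<^sup>+x. h x * ennreal (poisson_kernel (y x) (x - t)) \<partial>lborel) \<partial>lborel)"
        by (intro nn_integral_cong, subst nn_integral_cmult[symmetric]) (auto simp: ac_simps)
      finally have "B\<^sup>2 \<le> G * (\<integral>\<^sup>+t. (\<integral>\<^sup>+x. h x * ennreal (poisson_kernel (y x) (x - t)) \<partial>lborel)\<^sup>2 \<partial>lborel)"
        unfolding G_def by (simp add: Cauchy_Schwarz_nn_integral)
      also have "\<dots> \<le> G * (8 * X)"
        unfolding X_def by (intro mult_left_mono T_adjoint_square) auto
      finally have B2: "B\<^sup>2 \<le> G * (8 * X)" .
      obtain rB where rB: "B = ennreal rB" "0 \<le> rB" using \<open>B \<noteq> top\<close> by (cases B) auto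
      have "X \<noteq> top"
        using X2 rB k0 by (auto simp: ennreal_mult_eq_top_iff top_unique power2_eq_square)
      then obtain rX where rX: "X = ennreal rX" "0 \<le> rX" by (cases X) auto
      have "rX\<^sup>2 \<le> (sqrt k * rB)\<^sup>2"
      proof -
        have "ennreal (rX\<^sup>2) \<le> ennreal (rB * (k * rB))"
          using X2 k0 rB rX by (simp add: ennreal_mult' ennreal_power)
        then have "rX\<^sup>2 \<le> rB * (k * rB)" using k0 rB by (subst (asm) ennreal_le_iff) auto
        also have "\<dots> = (sqrt k * rB)\<^sup>2" using k0 by (simp add: power2_eq_square algebra_simps)
        finally show ?thesis .
      qed
      then have "rX \<le> sqrt k * rB"
        by (rule power2_le_imp_le) (use rB k0 in simp)
      then have "8 * rX \<le> 8 * (sqrt k * rB)" by simp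
      then have "rG * (8 * rX) \<le> rG * (8 * (sqrt k * rB))" using rG(2) by (rule mult_left_mono)
      moreover have "ennreal (rB\<^sup>2) \<le> ennreal (rG * (8 * rX))"
        using B2 rB rX rG by (simp add: ennreal_mult' ennreal_power)
      then have "rB\<^sup>2 \<le> rG * (8 * rX)" using rG rX by (subst (asm) ennreal_le_iff) auto
      ultimately have le: "rB * rB \<le> (8 * sqrt k * rG) * rB"
        by (simp add: power2_eq_square algebra_simps)
      have "rB \<le> 8 * sqrt k * rG"
      proof (cases "rB = 0")
        case True
        then show ?thesis using k0 rG by simp
      next
        case False
        then show ?thesis using rB mult_right_le_imp_le[OF le] by simp
      qed
      then have "ennreal rB \<le> ennreal (8 * sqrt k * rG)" by (rule ennreal_leI)
      also have "\<dots> = ennreal (8 * sqrt k) * ennreal rG" using k0 by (subst ennreal_mult') auto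
      finally show ?thesis unfolding rB(1) rG(1) .
    qed
  qed
qed

text \<open>
  The infimum \<open>k\<close> of the admissible constants is finite and itself admissible, so it satisfies
  \<open>k \<le> 8 * sqrt k\<close>, that is \<open>k \<le> 64\<close>.
\<close>
lemma poisson_square_integral_on_graph:
  assumes g: "g \<in> borel_measurable borel"
  shows "(\<integral>\<^sup>+x. (\<integral>\<^sup>+t. ennreal (poisson_kernel (y x) (x - t)) * g t \<partial>lborel)\<^sup>2 * indicator {a..b} x \<partial>lborel)
     \<le> 64 * (\<integral>\<^sup>+t. (g t)\<^sup>2 \<partial>lborel)"
proof -
  define k where "k = Inf (Collect admissible)"
  have ne: "Collect admissible \<noteq> {}" using admissible_initial by blast
  have bdd: "bdd_below (Collect admissible)" by (auto simp: bdd_below_def admissible_def)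
  have k0: "0 \<le> k" unfolding k_def using ne by (intro cInf_greatest) (auto simp: admissible_def)
  have "admissible k"
      unfolding admissible_def
  proof (intro conjI ballI impI k0)
    fix g :: "real \<Rightarrow> ennreal"
    assume g: "g \<in> borel_measurable borel" and fin: "(\<integral>\<^sup>+t. (g t)\<^sup>2 \<partial>lborel) < top"
    let ?G = "\<integral>\<^sup>+t. (g t)\<^sup>2 \<partial>lborel"
    let ?B = "\<integral>\<^sup>+x. (T g x)\<^sup>2 * indicator {a..b} x \<partial>lborel"
    have le: "?B \<le> ennreal l * ?G" if "admissible l" for l
      using that g fin by (auto simp: admissible_def)
    obtain G where G: "?G = ennreal G" "0 \<le> G" using fin by (cases ?G) auto
    have "?B \<noteq> top" using le[OF admissible_initial] G by (auto simp: ennreal_mult_eq_top_iff top_unique)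
    then obtain B where B: "?B = ennreal B" "0 \<le> B" by (cases ?B) auto
    have leB: "B \<le> l * G" if "admissible l" for l
      using le[OF that] G B that by (auto simp: ennreal_mult'[symmetric] admissible_def)
    have "B \<le> k * G"
    proof (cases "G = 0")
      case True
      then show ?thesis using leB[OF admissible_initial] by simp
    next
      case False
      then have "B / G \<le> l" if "admissible l" for l
        using leB[OF that] G by (simp add: field_simps)
      then have "B / G \<le> k" unfolding k_def using ne by (intro cInf_greatest) auto
      then show ?thesis using False G by (simp add: field_simps)
    qed
    then show "?B \<le> ennreal k * ?G"
      unfolding B G using k0 G by (simp add: ennreal_mult'[symmetric])
  qed
  then have "admissible (8 * sqrt k)" by (rule admissible_step)
  then have "k \<le> 8 * sqrt k" unfolding k_def using bdd by (intro cInf_lower) auto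
  then have "sqrt k * sqrt k \<le> 8 * sqrt k" using k0 by simp
  then have "sqrt k \<le> 8"
    using mult_right_le_imp_le[of "sqrt k" "sqrt k" 8] k0 by (cases "k = 0") auto
  then have "(sqrt k)\<^sup>2 \<le> 8\<^sup>2" using k0 by (intro power_mono) auto
  then have "ennreal k \<le> ennreal 64" using k0 by (intro ennreal_leI) simp
  then have k64: "ennreal k \<le> 64" by simp
  show ?thesis
  proof (cases "(\<integral>\<^sup>+t. (g t)\<^sup>2 \<partial>lborel) = top")
    case True
    then show ?thesis by (simp add: ennreal_mult_top)
  next
    case False
    then have "(\<integral>\<^sup>+x. (T g x)\<^sup>2 * indicator {a..b} x \<partial>lborel) \<le> ennreal k * (\<integral>\<^sup>+t. (g t)\<^sup>2 \<partial>lborel)"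
      using \<open>admissible k\<close> g unfolding admissible_def by (auto simp: less_top)
    also have "\<dots> \<le> 64 * (\<integral>\<^sup>+t. (g t)\<^sup>2 \<partial>lborel)"
      using k64 by (rule mult_right_mono) simp
    finally show ?thesis unfolding T_def .
  qed
qed

end

section \<open>Poisson majorants of powers of holomorphic functions\<close>

lemma mean_value_circlepath:
  assumes f: "f holomorphic_on cball z r" and r: "0 < r"
  shows "((\<lambda>t. f (circlepath z r t)) has_integral f z) {0..1}"
proof -
  have "((\<lambda>u. f u / (u - z)) has_contour_integral (2 * of_real pi * \<i> * f z)) (circlepath z r)"
    by (rule Cauchy_integral_circlepath_simple[OF f]) (use r in simp)
  then have "((\<lambda>t. f (circlepath z r t) / (circlepath z r t - z) *
      vector_derivative (circlepath z r) (at t within {0..1})) has_integral (2 * of_real pi * \<i> * f z)) {0..1}"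
    by (simp add: has_contour_integral_def)
  then have "((\<lambda>t. (2 * of_real pi * \<i>) * f (circlepath z r t)) has_integral (2 * of_real pi * \<i> * f z)) {0..1}"
  proof (rule has_integral_eq[rotated])
    fix t :: real assume t: "t \<in> {0..1}"
    have "vector_derivative (circlepath z r) (at t within {0..1}) = 2 * pi * \<i> * r * exp (2 * of_real pi * \<i> * t)"
      using t by (intro vector_derivative_circlepath01) auto
    moreover have "circlepath z r t - z = r * exp (2 * of_real pi * \<i> * t)" by (simp add: circlepath)
    ultimately show "f (circlepath z r t) / (circlepath z r t - z) *
      vector_derivative (circlepath z r) (at t within {0..1}) = (2 * of_real pi * \<i>) * f (circlepath z r t)"
      using r by simp
  qed
  then have "((\<lambda>t. 1 / (2 * of_real pi * \<i>) * ((2 * of_real pi * \<i>) * f (circlepath z r t))) has_integral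
      1 / (2 * of_real pi * \<i>) * (2 * of_real pi * \<i> * f z)) {0..1}"
    by (rule has_integral_mult_right)
  then show ?thesis by simp
qed

lemma poisson_kernel_eq_Im: "poisson_kernel (Im z) (Re z - t) = Im (1 / (of_real t - z)) / pi"
  by (simp add: poisson_kernel_def Im_divide cmod_power2 power2_commute[of t] mult.commute)

lemma poisson_kernel_mean_value:
  assumes "0 < r" "r < Im z"
  shows "(\<integral>\<^sup>+\<theta>. ennreal (poisson_kernel (Im (circlepath z r \<theta>)) (Re (circlepath z r \<theta>) - t)) * indicator {0..1} \<theta> \<partial>lborel)
     = ennreal (poisson_kernel (Im z) (Re z - t))"
proof -
  have Im_pos: "0 < Im w" if "w \<in> cball z r" for w
    using that assms abs_Im_le_cmod[of "z - w"] by (auto simp: dist_norm)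
  have on: "circlepath z r \<theta> \<in> cball z r" for \<theta>
    using assms by (simp add: circlepath dist_norm norm_mult)
  have "((\<lambda>\<theta>. 1 / (of_real t - circlepath z r \<theta>)) has_integral 1 / (of_real t - z)) {0..1}"
    using Im_pos by (intro mean_value_circlepath[where f = "\<lambda>w. 1 / (of_real t - w)"] holomorphic_intros assms) force
  then have "((\<lambda>\<theta>. Im (1 / (of_real t - circlepath z r \<theta>)) / pi) has_integral Im (1 / (of_real t - z)) / pi) {0..1}"
    by (intro has_integral_divide) (rule has_integral_Im)
  then have "((\<lambda>\<theta>. poisson_kernel (Im (circlepath z r \<theta>)) (Re (circlepath z r \<theta>) - t))
      has_integral poisson_kernel (Im z) (Re z - t)) {0..1}"
    by (simp only: poisson_kernel_eq_Im)
  then have "((\<lambda>\<theta>. if \<theta> \<in> {0..1} then poisson_kernel (Im (circlepath z r \<theta>)) (Re (circlepath z r \<theta>) - t) else 0)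
      has_integral poisson_kernel (Im z) (Re z - t)) UNIV"
    by (simp only: has_integral_restrict_UNIV)
  moreover have "continuous_on UNIV (circlepath z r)"
    unfolding circlepath by (intro continuous_intros)
  then have [measurable]: "circlepath z r \<in> borel_measurable borel" by (rule borel_measurable_continuous_onI)
  ultimately have "(\<integral>\<^sup>+\<theta>. ennreal (if \<theta> \<in> {0..1} then poisson_kernel (Im (circlepath z r \<theta>)) (Re (circlepath z r \<theta>) - t) else 0) \<partial>lborel)
      = ennreal (poisson_kernel (Im z) (Re z - t))"
    by (intro nn_integral_has_integral_lborel) (simp_all add: less_imp_le[OF Im_pos[OF on]])
  also have "(\<integral>\<^sup>+\<theta>. ennreal (if \<theta> \<in> {0..1} then poisson_kernel (Im (circlepath z r \<theta>)) (Re (circlepath z r \<theta>) - t) else 0) \<partial>lborel)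
    = (\<integral>\<^sup>+\<theta>. ennreal (poisson_kernel (Im (circlepath z r \<theta>)) (Re (circlepath z r \<theta>) - t)) * indicator {0..1} \<theta> \<partial>lborel)"
    by (intro nn_integral_cong) (auto split: split_indicator)
  finally show ?thesis .
qed

text \<open>
  The substitution \<open>t = Re z + Im z * s\<close> in the usual Poisson integral makes the formula meaningful on the real
  axis, where it returns the boundary function, and gives continuity up to the boundary by dominated convergence.
\<close>
definition poisson_integral :: "(real \<Rightarrow> real) \<Rightarrow> complex \<Rightarrow> real" where
  "poisson_integral g z = (\<integral>s. poisson_kernel 1 s * g (Re z + Im z * s) \<partial>lborel)"

lemma integrable_poisson_kernel: "0 < y \<Longrightarrow> integrable lborel (poisson_kernel y)"
  by (intro integrableI_nonneg) (auto simp: nn_integral_poisson_kernel)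

lemma integral_poisson_kernel: "0 < y \<Longrightarrow> (\<integral>x. poisson_kernel y x \<partial>lborel) = 1"
  by (intro integral_eq_nn_integral[THEN trans]) (auto simp: nn_integral_poisson_kernel)

context
  fixes g :: "real \<Rightarrow> real" and M :: real
  assumes cont: "continuous_on UNIV g" and bound: "\<And>t. \<bar>g t\<bar> \<le> M" and nonneg: "\<And>t. 0 \<le> g t"
begin

private lemma g_measurable: "g \<in> borel_measurable borel"
  using cont by (rule borel_measurable_continuous_onI)

lemma continuous_on_poisson_integral: "continuous_on UNIV (poisson_integral g)"
  unfolding continuous_on_sequentially
proof (intro ballI allI impI)
  note [measurable] = g_measurable
  fix z and u :: "nat \<Rightarrow> complex" assume "(\<forall>n. u n \<in> UNIV) \<and> u \<longlonglongrightarrow> z"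
  then have u: "u \<longlonglongrightarrow> z" by simp
  have g_tendsto: "(\<lambda>n. g (h n)) \<longlonglongrightarrow> g l" if "h \<longlonglongrightarrow> l" for h l
    using that cont by (auto simp: continuous_on_eq_continuous_at intro: isCont_tendsto_compose)
  show "(poisson_integral g \<circ> u) \<longlonglongrightarrow> poisson_integral g z"
    unfolding o_def poisson_integral_def
  proof (rule integral_dominated_convergence[where w = "\<lambda>s. poisson_kernel 1 s * M"])
    show "integrable lborel (\<lambda>s. poisson_kernel 1 s * M)" by (simp add: integrable_poisson_kernel)
    show "AE s in lborel. (\<lambda>i. poisson_kernel 1 s * g (Re (u i) + Im (u i) * s))
        \<longlonglongrightarrow> poisson_kernel 1 s * g (Re z + Im z * s)"
      using u by (intro AE_I2 tendsto_intros g_tendsto)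
    show "AE s in lborel. norm (poisson_kernel 1 s * g (Re (u i) + Im (u i) * s)) \<le> poisson_kernel 1 s * M" for i
      using bound by (intro AE_I2) (auto simp: abs_mult intro!: mult_left_mono)
  qed auto
qed

lemma poisson_integral_of_real: "Im z = 0 \<Longrightarrow> poisson_integral g z = g (Re z)"
  by (simp add: poisson_integral_def integral_poisson_kernel)

lemma poisson_integral_nonneg: "0 \<le> poisson_integral g z"
  unfolding poisson_integral_def using nonneg by (intro integral_nonneg_AE) simp

lemma ennreal_poisson_integral:
  assumes "0 < Im z"
  shows "ennreal (poisson_integral g z)
    = (\<integral>\<^sup>+t. ennreal (poisson_kernel (Im z) (Re z - t)) * ennreal (g t) \<partial>lborel)"
proof -
  note [measurable] = g_measurable
  have "integrable lborel (\<lambda>s. poisson_kernel 1 s * g (Re z + Im z * s))"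
  proof (rule Bochner_Integration.integrable_bound[where f = "\<lambda>s. poisson_kernel 1 s * M"])
    show "integrable lborel (\<lambda>s. poisson_kernel 1 s * M)" by (simp add: integrable_poisson_kernel)
    show "AE s in lborel. norm (poisson_kernel 1 s * g (Re z + Im z * s)) \<le> norm (poisson_kernel 1 s * M)"
      using bound by (intro AE_I2) (auto simp: abs_mult intro!: mult_left_mono order_trans[OF bound])
  qed auto
  then have "ennreal (poisson_integral g z) = (\<integral>\<^sup>+s. ennreal (poisson_kernel 1 s * g (Re z + Im z * s)) \<partial>lborel)"
    unfolding poisson_integral_def using nonneg by (intro nn_integral_eq_integral[symmetric]) auto
  also have "\<dots> = (\<integral>\<^sup>+s. ennreal (Im z) * (ennreal (poisson_kernel (Im z) (Re z - (Re z + Im z * s)))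
      * ennreal (g (Re z + Im z * s))) \<partial>lborel)"
  proof (rule nn_integral_cong)
    fix s
    have "poisson_kernel 1 s = Im z * poisson_kernel (Im z) (Im z * s)"
    proof -
      have "pi * ((Im z * s)\<^sup>2 + (Im z)\<^sup>2) = (Im z)\<^sup>2 * (pi * (s\<^sup>2 + 1))"
        by (simp add: power_mult_distrib algebra_simps)
      then show ?thesis using assms by (simp add: poisson_kernel_def power2_eq_square)
    qed
    then show "ennreal (poisson_kernel 1 s * g (Re z + Im z * s)) = ennreal (Im z) *
       (ennreal (poisson_kernel (Im z) (Re z - (Re z + Im z * s))) * ennreal (g (Re z + Im z * s)))"
      using assms nonneg by (simp add: ennreal_mult' mult.assoc)
  qed
  also have "\<dots> = ennreal (Im z) * (\<integral>\<^sup>+s. ennreal (poisson_kernel (Im z) (Re z - (Re z + Im z * s)))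
      * ennreal (g (Re z + Im z * s)) \<partial>lborel)"
    by (rule nn_integral_cmult) measurable
  also have "\<dots> = (\<integral>\<^sup>+t. ennreal (poisson_kernel (Im z) (Re z - t)) * ennreal (g t) \<partial>lborel)"
    using assms by (subst (2) nn_integral_real_affine[where c = "Im z" and t = "Re z"]) auto
  finally show ?thesis .
qed

lemma poisson_integral_mean_value:
  assumes "0 < r" "r < Im z"
  shows "((\<lambda>\<theta>. poisson_integral g (circlepath z r \<theta>)) has_integral poisson_integral g z) {0..1}"
proof -
  note [measurable] = g_measurable
  have Im_pos: "0 < Im (circlepath z r \<theta>)" for \<theta>
  proof -
    have "circlepath z r \<theta> \<in> cball z r" using assms by (simp add: circlepath dist_norm norm_mult)
    then show ?thesis using assms abs_Im_le_cmod[of "z - circlepath z r \<theta>"] by (auto simp: dist_norm)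
  qed
  have cont_circle: "continuous_on UNIV (circlepath z r)"
    unfolding circlepath by (intro continuous_intros)
  then have [measurable]: "circlepath z r \<in> borel_measurable borel" by (rule borel_measurable_continuous_onI)
  let ?k = "\<lambda>w t. ennreal (poisson_kernel (Im w) (Re w - t))"
  have cont_P: "continuous_on UNIV (\<lambda>\<theta>. poisson_integral g (circlepath z r \<theta>))"
    by (rule continuous_on_compose2[OF continuous_on_poisson_integral cont_circle]) auto
  have [measurable]: "(\<lambda>\<theta>. poisson_integral g (circlepath z r \<theta>)) \<in> borel_measurable borel"
    using cont_P by (rule borel_measurable_continuous_onI)
  have "(\<integral>\<^sup>+\<theta>. ennreal (if \<theta> \<in> {0..1} then poisson_integral g (circlepath z r \<theta>) else 0) \<partial>lborel)
     = (\<integral>\<^sup>+\<theta>. (\<integral>\<^sup>+t. ?k (circlepath z r \<theta>) t * ennreal (g t) * indicator {0..1} \<theta> \<partial>lborel) \<partial>lborel)"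
  proof (rule nn_integral_cong)
    fix \<theta>
    have "ennreal (if \<theta> \<in> {0..1} then poisson_integral g (circlepath z r \<theta>) else 0)
      = (\<integral>\<^sup>+t. ?k (circlepath z r \<theta>) t * ennreal (g t) \<partial>lborel) * indicator {0..1} \<theta>"
      by (simp add: ennreal_poisson_integral[OF Im_pos] split: split_indicator)
    also have "\<dots> = (\<integral>\<^sup>+t. ?k (circlepath z r \<theta>) t * ennreal (g t) * indicator {0..1} \<theta> \<partial>lborel)"
      by (rule nn_integral_multc[symmetric]) measurable
    finally show "ennreal (if \<theta> \<in> {0..1} then poisson_integral g (circlepath z r \<theta>) else 0) = \<dots>" .
  qed
  also have "\<dots> = (\<integral>\<^sup>+t. (\<integral>\<^sup>+\<theta>. ?k (circlepath z r \<theta>) t * ennreal (g t) * indicator {0..1} \<theta> \<partial>lborel) \<partial>lborel)"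
    by (rule lborel_pair.Fubini') measurable
  also have "\<dots> = (\<integral>\<^sup>+t. ?k z t * ennreal (g t) \<partial>lborel)"
  proof (rule nn_integral_cong)
    fix t
    have "(\<integral>\<^sup>+\<theta>. ?k (circlepath z r \<theta>) t * ennreal (g t) * indicator {0..1} \<theta> \<partial>lborel)
      = (\<integral>\<^sup>+\<theta>. ?k (circlepath z r \<theta>) t * indicator {0..1} \<theta> * ennreal (g t) \<partial>lborel)"
      by (simp only: ac_simps)
    also have "\<dots> = (\<integral>\<^sup>+\<theta>. ?k (circlepath z r \<theta>) t * indicator {0..1} \<theta> \<partial>lborel) * ennreal (g t)"
      by (rule nn_integral_multc) measurable
    also have "\<dots> = ?k z t * ennreal (g t)" by (simp only: poisson_kernel_mean_value[OF assms])
    finally show "(\<integral>\<^sup>+\<theta>. ?k (circlepath z r \<theta>) t * ennreal (g t) * indicator {0..1} \<theta> \<partial>lborel) = \<dots>" .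
  qed
  also have "\<dots> = ennreal (poisson_integral g z)"
    using assms by (intro ennreal_poisson_integral[symmetric]) auto
  finally have "((\<lambda>\<theta>. if \<theta> \<in> {0..1} then poisson_integral g (circlepath z r \<theta>) else 0)
      has_integral poisson_integral g z) UNIV"
    by (intro nn_integral_has_integral) (auto simp: poisson_integral_nonneg)
  then show ?thesis by (simp only: has_integral_restrict_UNIV)
qed

end

text \<open>
  \<open>|f|\<^sup>q\<close> is subharmonic and the Poisson integral of its boundary values is harmonic, so the maximum principle
  applies to their difference \<open>D\<close>. If \<open>D\<close> were positive somewhere, it would attain a positive maximum, and
  among the points of maximum there would be a lowest one, \<open>w\<close>, which is neither real nor a zero of \<open>f\<close>.
  Around \<open>w\<close> the function \<open>f\<close> has a holomorphic \<open>q\<close>-th power, whose mean value property forces \<open>D\<close> to be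
  constant on a small circle around \<open>w\<close>; the bottom of that circle is then a lower point of maximum.
\<close>
lemma poisson_majorant:
  fixes f :: "complex \<Rightarrow> complex" and q :: real
  assumes f: "f holomorphic_on U" and U: "open U" "{z. 0 \<le> Im z} \<subseteq> U" and q: "0 < q"
    and vanish: "\<And>e. 0 < e \<Longrightarrow> \<exists>R. \<forall>z. 0 \<le> Im z \<and> R \<le> cmod z \<longrightarrow> cmod (f z) < e"
    and z0: "0 < Im z0"
  shows "ennreal (cmod (f z0) powr q)
     \<le> (\<integral>\<^sup>+t. ennreal (poisson_kernel (Im z0) (Re z0 - t)) * ennreal (cmod (f (of_real t)) powr q) \<partial>lborel)"
proof -
  define v where "v z = cmod (f z) powr q" for z
  define g where "g t = v (of_real t)" for t :: real
  define H where "H = {z::complex. 0 \<le> Im z}"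
  have H: "closed H" unfolding H_def by (rule closed_halfspace_Im_ge)
  have cont_f: "continuous_on U f" using f by (rule holomorphic_on_imp_continuous_on)
  have cont_v: "continuous_on H v"
    unfolding v_def using q continuous_on_subset[OF cont_f] U(2)
    by (intro continuous_intros continuous_on_powr') (auto simp: H_def)
  have v_vanish: "\<exists>R. \<forall>z\<in>H. R \<le> cmod z \<longrightarrow> v z < e" if e: "0 < e" for e
  proof -
    obtain R where R: "\<forall>z. 0 \<le> Im z \<and> R \<le> cmod z \<longrightarrow> cmod (f z) < e powr (1/q)"
      using vanish[of "e powr (1/q)"] e by auto
    have "v z < e" if "z \<in> H" "R \<le> cmod z" for z
    proof -
      have "cmod (f z) < e powr (1/q)" using R that by (simp add: H_def)
      then have "v z < (e powr (1/q)) powr q" unfolding v_def using q by (intro powr_less_mono2) auto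
      then show ?thesis using q e by (simp add: powr_powr)
    qed
    then show ?thesis by blast
  qed
  obtain M where M: "\<And>z. z \<in> H \<Longrightarrow> v z \<le> M"
  proof -
    obtain R where R: "\<forall>z\<in>H. R \<le> cmod z \<longrightarrow> v z < 1" using v_vanish[of 1] by auto
    have "compact (H \<inter> cball 0 R)" using H by (intro closed_Int_compact) auto
    then have "compact (v ` (H \<inter> cball 0 R))"
      by (intro compact_continuous_image continuous_on_subset[OF cont_v]) auto
    then obtain B where "\<forall>x\<in>v ` (H \<inter> cball 0 R). norm x \<le> B" using compact_imp_bounded bounded_iff by metis
    then have "v z \<le> max B 1" if "z \<in> H" for z
    proof (cases "R \<le> cmod z")
      case True
      then have "v z < 1" using R that by blast
      then show ?thesis by simp
    next
      case False
      then have "v z \<in> v ` (H \<inter> cball 0 R)" using that by simp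
      then have "norm (v z) \<le> B" using \<open>\<forall>x\<in>v ` (H \<inter> cball 0 R). norm x \<le> B\<close> by blast
      then show ?thesis by simp
    qed
    then show thesis by (rule that)
  qed
  have g_cont: "continuous_on UNIV g"
    unfolding g_def by (rule continuous_on_compose2[OF cont_v]) (auto intro!: continuous_intros simp: H_def)
  have g_nonneg: "0 \<le> g t" for t by (simp add: g_def v_def)
  have g_bound: "\<bar>g t\<bar> \<le> M" for t using M[of "of_real t"] g_nonneg[of t] by (simp add: g_def H_def)
  note P = g_cont g_bound g_nonneg
  let ?P = "poisson_integral g"
  define D where "D z = v z - ?P z" for z
  have cont_P: "continuous_on UNIV ?P" by (rule continuous_on_poisson_integral[OF P])
  have cont_D: "continuous_on H D" unfolding D_def
    using cont_v continuous_on_subset[OF cont_P] by (intro continuous_intros) auto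
  have "D z0 \<le> 0"
  proof (rule ccontr)
    assume "\<not> D z0 \<le> 0"
    then have pos: "0 < D z0" by simp
    obtain R where R: "\<forall>z\<in>H. R \<le> cmod z \<longrightarrow> v z < D z0" using v_vanish[OF pos] by auto
    (* Outside K the function D is below D z0, because v is and the Poisson integral is nonnegative;
       hence D attains its maximum over the closed half plane in the compact set K. *)
    define K where "K = H \<inter> cball 0 (max R (cmod z0))"
    have K: "compact K" unfolding K_def using H by (intro closed_Int_compact) auto
    have z0K: "z0 \<in> K" using z0 by (simp add: K_def H_def)
    have "continuous_on K D" using cont_D by (rule continuous_on_subset) (auto simp: K_def)
    then obtain z1 where z1: "z1 \<in> K" "\<And>z. z \<in> K \<Longrightarrow> D z \<le> D z1"
      using continuous_attains_sup[OF K] z0K by blast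
    have D_le: "D z \<le> D z1" if "z \<in> H" for z
    proof (cases "z \<in> K")
      case False
      then have "v z < D z0" using R that by (auto simp: K_def)
      then have "D z \<le> D z0" using poisson_integral_nonneg[OF P, of z] by (simp add: D_def)
      then show ?thesis using z1(2)[OF z0K] by simp
    qed (rule z1)
    have D1: "0 < D z1" using z1(2)[OF z0K] pos by simp
    define S where "S = {z \<in> K. D z = D z1}"
    have "closedin (top_of_set K) (K \<inter> D -` {D z1})"
      using \<open>continuous_on K D\<close> by (intro continuous_closedin_preimage) auto
    moreover have "S = K \<inter> D -` {D z1}" by (auto simp: S_def)
    ultimately have "compact S" using K closedin_compact by auto
    moreover have "S \<noteq> {}" using z1(1) by (auto simp: S_def)
    moreover have "continuous_on S Im" by (intro continuous_intros)
    ultimately obtain w where w: "w \<in> S" "\<And>z. z \<in> S \<Longrightarrow> Im w \<le> Im z"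
      using continuous_attains_inf[of S Im] by metis
    have wD: "D w = D z1" and wH: "w \<in> H" using w(1) by (auto simp: S_def K_def)
    have "Im w \<noteq> 0"
    proof
      assume "Im w = 0"
      then have "?P w = g (Re w)" by (rule poisson_integral_of_real[OF P])
      also have "complex_of_real (Re w) = w" using \<open>Im w = 0\<close> by (simp add: complex_eq_iff)
      then have "g (Re w) = v w" by (simp add: g_def)
      finally show False using D1 wD by (simp add: D_def)
    qed
    then have Imw: "0 < Im w" using wH by (auto simp: H_def)
    have fw: "f w \<noteq> 0"
      using D1 wD poisson_integral_nonneg[OF P, of w] q by (auto simp: D_def v_def)
    have "open (U \<inter> {z. 0 < Im z})" using U by (intro open_Int open_halfspace_Im_gt) auto
    moreover have "continuous_on (U \<inter> {z. 0 < Im z}) f" using cont_f by (rule continuous_on_subset) auto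
    ultimately have "open ((U \<inter> {z. 0 < Im z}) \<inter> f -` (- {0}))"
      by (intro continuous_open_preimage) auto
    moreover have "w \<in> (U \<inter> {z. 0 < Im z}) \<inter> f -` (- {0})" using Imw fw U(2) by auto
    ultimately obtain \<rho> where \<rho>: "0 < \<rho>" "ball w \<rho> \<subseteq> (U \<inter> {z. 0 < Im z}) \<inter> f -` (- {0})"
      by (meson open_contains_ball)
    define r where "r = \<rho> / 2"
    have r: "0 < r" "cball w r \<subseteq> ball w \<rho>" using \<rho>(1) by (auto simp: r_def)
    have rIm: "r < Im w"
    proof -
      have "w - \<i> * r \<in> cball w r" using r(1) by (simp add: dist_norm norm_mult)
      then have "0 < Im (w - \<i> * r)" using r(2) \<rho>(2) by blast
      then show ?thesis by simp
    qed
    obtain L where L: "L holomorphic_on ball w \<rho>" "\<And>z. z \<in> ball w \<rho> \<Longrightarrow> f z = exp (L z)"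
    proof (rule holomorphic_logarithm_exists[of "ball w \<rho>" f w])
      show "f holomorphic_on ball w \<rho>" using holomorphic_on_subset[OF f] \<rho>(2) by auto
      show "f x \<noteq> 0" if "x \<in> ball w \<rho>" for x using that \<rho>(2) by auto
    qed (use \<rho>(1) that in auto)
    define h where "h z = exp (of_real q * L z)" for z
    have h: "cmod (h z) = v z" if "z \<in> ball w \<rho>" for z
      using L(2)[OF that] by (simp add: h_def v_def powr_def)
    have "h holomorphic_on cball w r" unfolding h_def
      using holomorphic_on_subset[OF L(1) r(2)] by (intro holomorphic_intros)
    then have mean_h: "((\<lambda>t. h (circlepath w r t)) has_integral h w) {0..1}"
      using r(1) by (rule mean_value_circlepath)
    have circ: "circlepath w r t \<in> cball w r" for t
      using r(1) by (simp add: circlepath dist_norm norm_mult)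
    then have circ_ball: "circlepath w r t \<in> ball w \<rho>" for t using r(2) by blast
    then have circ_H: "circlepath w r t \<in> H" for t
    proof -
      have "circlepath w r t \<in> {z. 0 < Im z}" using circ_ball[of t] \<rho>(2) by blast
      then show ?thesis by (simp add: H_def)
    qed
    have cont_circ: "continuous_on {0..1} (circlepath w r)"
      unfolding circlepath by (intro continuous_intros)
    have cv: "continuous_on {0..1} (\<lambda>t. v (circlepath w r t))"
      by (rule continuous_on_compose2[OF cont_v cont_circ]) (use circ_H in auto)
    have cP: "continuous_on {0..1} (\<lambda>t. ?P (circlepath w r t))"
      by (rule continuous_on_compose2[OF cont_P cont_circ]) auto
    have "v w = cmod (integral {0..1} (\<lambda>t. h (circlepath w r t)))"
      using mean_h h[of w] \<rho>(1) by (simp add: integral_unique)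
    also have "\<dots> \<le> integral {0..1} (\<lambda>t. v (circlepath w r t))"
      using has_integral_integrable[OF mean_h] integrable_continuous_real[OF cv]
      by (rule integral_norm_bound_integral) (simp add: h[OF circ_ball])
    finally have vw: "v w \<le> integral {0..1} (\<lambda>t. v (circlepath w r t))" .
    have Pw: "?P w = integral {0..1} (\<lambda>t. ?P (circlepath w r t))"
      using poisson_integral_mean_value[OF P r(1) rIm] by (simp add: integral_unique)
    define \<phi> where "\<phi> t = D w - D (circlepath w r t)" for t
    have \<phi>_nonneg: "0 \<le> \<phi> t" for t using D_le[OF circ_H] by (simp add: \<phi>_def wD)
    have c\<phi>: "continuous_on {0..1} \<phi>" unfolding \<phi>_def D_def by (intro continuous_intros cv cP)
    have "integral {0..1} \<phi> = D w - (integral {0..1} (\<lambda>t. v (circlepath w r t)) - integral {0..1} (\<lambda>t. ?P (circlepath w r t)))"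
      unfolding \<phi>_def D_def
      using cv cP by (subst Henstock_Kurzweil_Integration.integral_diff | intro integrable_continuous_real continuous_intros | simp)+
    also have "\<dots> \<le> 0" using vw Pw by (simp add: D_def)
    finally have "integral {0..1} \<phi> \<le> 0" .
    moreover have "0 \<le> integral {0..1} \<phi>"
      using integrable_continuous_real[OF c\<phi>] \<phi>_nonneg by (rule integral_nonneg)
    ultimately have "integral {0..1} \<phi> = 0" by (rule order_antisym)
    (* The parameter 3/4 is the lowest point of the circle. *)
    then have "\<phi> (3/4) = 0" using integral_eq_0_iff[OF c\<phi>] \<phi>_nonneg by auto
    moreover have "circlepath w r (3/4) = w - \<i> * r"
    proof -
      have "exp (2 * of_real pi * \<i> * of_real (3/4)) = cis (3/2*pi)"
        by (simp add: cis_conv_exp mult_ac)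
      also have "\<dots> = - \<i>"
        by (simp only: complex_eq_iff cis.sel cos_3over2_pi sin_3over2_pi) simp
      finally show ?thesis by (simp add: circlepath mult.commute)
    qed
    ultimately have Dwr: "D (w - \<i> * r) = D z1" by (simp add: \<phi>_def wD)
    have "w - \<i> * r \<in> K"
    proof (rule ccontr)
      assume "w - \<i> * r \<notin> K"
      moreover have inH: "w - \<i> * r \<in> H" using rIm by (simp add: H_def)
      ultimately have "v (w - \<i> * r) < D z0" using R by (auto simp: K_def)
      then have "D (w - \<i> * r) < D z0"
        using poisson_integral_nonneg[OF P, of "w - \<i> * r"] by (simp add: D_def)
      then show False using Dwr z1(2)[OF z0K] by simp
    qed
    then have "w - \<i> * r \<in> S" using Dwr by (simp add: S_def)
    then show False using w(2) r(1) by force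
  qed
  then have "ennreal (v z0) \<le> ennreal (?P z0)" by (intro ennreal_leI) (simp add: D_def)
  also have "\<dots> = (\<integral>\<^sup>+t. ennreal (poisson_kernel (Im z0) (Re z0 - t)) * ennreal (g t) \<partial>lborel)"
    by (rule ennreal_poisson_integral[OF P z0])
  finally show ?thesis by (simp add: g_def v_def)
qed

section \<open>Submean value inequalities over squares\<close>

text \<open>
  One side of a square with centre \<open>w\<close> and half side \<open>l\<close>: the unit vector \<open>c\<close> points from the centre
  to the middle of the side and \<open>d\<close> runs along it. On the side, \<open>|z - w| \<ge> l\<close>.
\<close>
lemma square_side_bound:
  fixes F :: "complex \<Rightarrow> complex"
  assumes F: "continuous_on U F" and l: "0 < l"
    and U: "\<And>u. \<bar>u\<bar> \<le> l \<Longrightarrow> w + of_real l * c + of_real u * d \<in> U"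
    and perp: "cmod c = 1" "cmod d = 1" "\<And>t::real. 1 \<le> cmod (c + of_real t * d)"
  shows "ennreal (cmod (contour_integral (linepath (w + of_real l * (c - d)) (w + of_real l * (c + d))) (\<lambda>z. F z / (z - w))))
    \<le> ennreal (1 / l) * (\<integral>\<^sup>+u. ennreal (cmod (F (w + of_real l * c + of_real u * d))) * indicator {-l..l} u \<partial>lborel)"
proof -
  define g where "g u = F (w + of_real l * c + of_real u * d)" for u :: real
  have g: "continuous_on {-l..l} g"
    unfolding g_def by (rule continuous_on_compose2[OF F]) (auto intro!: continuous_intros U)
  have away: "l \<le> cmod (of_real l * c + of_real u * d)" for u :: real
  proof -
    have "of_real l * c + of_real u * d = of_real l * (c + of_real (u / l) * d)"
      using l by (simp add: algebra_simps)
    then have "cmod (of_real l * c + of_real u * d) = l * cmod (c + of_real (u / l) * d)"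
      using l by (simp add: norm_mult)
    then show ?thesis using perp(3)[of "u / l"] l by (simp add: mult_le_cancel_left1)
  qed
  define G where "G u = ennreal (cmod (g u)) * indicator {-l..l} u" for u
  have [measurable]: "G \<in> borel_measurable borel"
  proof -
    have [measurable]: "(\<lambda>u. indicator {-l..l} u *\<^sub>R g u) \<in> borel_measurable borel"
      using g by (intro borel_measurable_continuous_on_indicator) auto
    have "G = (\<lambda>u. ennreal (cmod (indicator {-l..l} u *\<^sub>R g u)))"
      by (auto simp: G_def fun_eq_iff split: split_indicator)
    moreover have "(\<lambda>u. ennreal (cmod (indicator {-l..l} u *\<^sub>R g u))) \<in> borel_measurable borel" by measurable
    ultimately show ?thesis by simp
  qed
  define k where "k x = cmod (g ((2 * x - 1) * l)) * 2" for x :: real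
  have range: "(2 * x - 1) * l \<in> {-l..l}" if "x \<in> {0..1}" for x
    using that l by (auto simp: abs_le_iff[symmetric] abs_mult minus_le_iff field_simps)
  have cg: "continuous_on {0..1} (\<lambda>x. g ((2 * x - 1) * l))"
    by (rule continuous_on_compose2[OF g]) (intro continuous_intros, rule image_subsetI, erule range)
  then have k: "continuous_on {0..1} k"
    unfolding k_def by (intro continuous_intros)
  have lp: "linepath (w + of_real l * (c - d)) (w + of_real l * (c + d)) x
      = w + of_real l * c + of_real ((2 * x - 1) * l) * d" for x
    by (simp add: linepath_def scaleR_conv_of_real algebra_simps)
  have "cmod (contour_integral (linepath (w + of_real l * (c - d)) (w + of_real l * (c + d))) (\<lambda>z. F z / (z - w)))
    = cmod (integral {0..1} (\<lambda>x. g ((2 * x - 1) * l) / (of_real l * c + of_real ((2 * x - 1) * l) * d) * (2 * of_real l * d)))"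
    unfolding contour_integral_integral vector_derivative_linepath_at lp g_def by (simp add: algebra_simps)
  also have "\<dots> \<le> integral {0..1} k"
  proof (rule integral_norm_bound_integral)
    show "k integrable_on {0..1}" using k by (rule integrable_continuous_real)
    have ne: "of_real l * c + of_real u * d \<noteq> 0" for u :: real using away[of u] l by auto
    show "(\<lambda>x. g ((2 * x - 1) * l) / (of_real l * c + of_real ((2 * x - 1) * l) * d) * (2 * of_real l * d)) integrable_on {0..1}"
      by (intro integrable_continuous_real continuous_intros cg ballI) (rule ne)
    fix x :: real assume "x \<in> {0..1}"
    have "cmod (g ((2 * x - 1) * l)) / cmod (of_real l * c + of_real ((2 * x - 1) * l) * d) \<le> cmod (g ((2 * x - 1) * l)) / l"
      using away[of "(2 * x - 1) * l"] l by (intro divide_left_mono mult_pos_pos less_le_trans[OF l]) auto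
    then have "cmod (g ((2 * x - 1) * l)) / cmod (of_real l * c + of_real ((2 * x - 1) * l) * d) * (2 * l)
      \<le> cmod (g ((2 * x - 1) * l)) / l * (2 * l)" using l by (intro mult_right_mono) auto
    then show "norm (g ((2 * x - 1) * l) / (of_real l * c + of_real ((2 * x - 1) * l) * d) * (2 * of_real l * d)) \<le> k x"
      using l perp(2) by (simp add: norm_mult norm_divide k_def)
  qed
  finally have "ennreal (cmod (contour_integral (linepath (w + of_real l * (c - d)) (w + of_real l * (c + d))) (\<lambda>z. F z / (z - w))))
    \<le> ennreal (integral {0..1} k)" by (rule ennreal_leI)
  also have "\<dots> = (\<integral>\<^sup>+x. ennreal (k x) * indicator {0..1} x \<partial>lborel)"
  proof -
    have "(\<integral>\<^sup>+x. ennreal (indicator {0..1} x * k x) \<partial>lborel) = ennreal (integral {0..1} k)"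
    proof (rule nn_integral_has_integral_lebesgue)
      show "(k has_integral integral {0..1} k) {0..1}"
        using integrable_continuous_real[OF k] by (rule integrable_integral)
    qed (simp add: k_def)
    moreover have "(\<integral>\<^sup>+x. ennreal (k x) * indicator {0..1} x \<partial>lborel) = (\<integral>\<^sup>+x. ennreal (indicator {0..1} x * k x) \<partial>lborel)"
      by (intro nn_integral_cong) (auto split: split_indicator)
    ultimately show ?thesis by simp
  qed
  also have "\<dots> = (\<integral>\<^sup>+x. ennreal (1 / l) * ennreal (2 * l) * (ennreal (cmod (g (- l + 2 * l * x))) * indicator {-l..l} (- l + 2 * l * x)) \<partial>lborel)"
  proof (rule nn_integral_cong)
    fix x
    have mem: "(x \<in> {0..1}) = (- l + 2 * l * x \<in> {-l..l})"
      using l by (auto simp: zero_le_mult_iff)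
    show "ennreal (k x) * indicator {0..1} x
      = ennreal (1 / l) * ennreal (2 * l) * (ennreal (cmod (g (- l + 2 * l * x))) * indicator {-l..l} (- l + 2 * l * x))"
    proof (cases "x \<in> {0..1}")
      case True
      have "(2 * x - 1) * l = - l + 2 * l * x" by (simp add: algebra_simps)
      then have "ennreal (k x) = ennreal (cmod (g (- l + 2 * l * x))) * ennreal 2"
        unfolding k_def by (simp add: ennreal_mult')
      moreover have "ennreal (1 / l) * ennreal (2 * l) = ennreal 2"
        using l by (subst ennreal_mult'[symmetric]) auto
      ultimately show ?thesis using True mem
        by (simp only: indicator_simps mult_1_right mult_1_left mult.commute)
    next
      case False
      moreover from this have "- l + 2 * l * x \<notin> {-l..l}" using mem by blast
      ultimately show ?thesis by (simp del: atLeastAtMost_iff)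
    qed
  qed
  also have "\<dots> = ennreal (1 / l) * (ennreal (2 * l) * (\<integral>\<^sup>+x. G (- l + 2 * l * x) \<partial>lborel))"
    unfolding G_def[symmetric] by (subst nn_integral_cmult) (auto simp: mult.assoc)
  also have "ennreal (2 * l) * (\<integral>\<^sup>+x. G (- l + 2 * l * x) \<partial>lborel) = (\<integral>\<^sup>+u. G u \<partial>lborel)"
    using l by (subst (2) nn_integral_real_affine[where c = "2 * l" and t = "- l"]) auto
  finally show ?thesis by (simp add: g_def G_def)
qed

definition square :: "complex \<Rightarrow> real \<Rightarrow> complex set" where
  "square w r = {z. \<bar>Re z - Re w\<bar> \<le> r \<and> \<bar>Im z - Im w\<bar> \<le> r}"

lemma compact_square: "compact (square w r)"
proof -
  have "square w r = cbox (Complex (Re w - r) (Im w - r)) (Complex (Re w + r) (Im w + r))"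
    by (auto simp: square_def in_cbox_complex_iff)
  then show ?thesis by simp
qed

definition square_integral :: "(complex \<Rightarrow> real) \<Rightarrow> complex \<Rightarrow> real \<Rightarrow> ennreal" where
  "square_integral h w r = (\<integral>\<^sup>+y. (\<integral>\<^sup>+x. ennreal (h (Complex x y)) * indicator (square w r) (Complex x y) \<partial>lborel) \<partial>lborel)"

lemma measurable_Complex [measurable]:
  assumes [measurable]: "f \<in> borel_measurable M" "g \<in> borel_measurable M"
  shows "(\<lambda>x. Complex (f x) (g x)) \<in> borel_measurable M"
  unfolding Complex_eq by measurable

lemma measurable_square_integrand:
  assumes "continuous_on (square w r) h"
  shows "(\<lambda>z. ennreal (h z) * indicator (square w r) z) \<in> borel_measurable borel"
proof -
  have "(\<lambda>z. indicator (square w r) z *\<^sub>R h z) \<in> borel_measurable borel"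
    using assms compact_square[of w r]
    by (intro borel_measurable_continuous_on_indicator) (auto intro: borel_closed compact_imp_closed)
  then have "(\<lambda>z. ennreal (indicator (square w r) z *\<^sub>R h z)) \<in> borel_measurable borel" by measurable
  also have "(\<lambda>z. ennreal (indicator (square w r) z *\<^sub>R h z)) = (\<lambda>z. ennreal (h z) * indicator (square w r) z)"
    by (auto simp: fun_eq_iff split: split_indicator)
  finally show ?thesis .
qed

lemma square_integral_cmult:
  assumes h: "continuous_on (square w r) h" and c: "0 \<le> c"
  shows "square_integral (\<lambda>z. c * h z) w r = ennreal c * square_integral h w r"
proof -
  note [measurable] = measurable_square_integrand[OF h]
  have [measurable]: "(\<lambda>x. ennreal (h (Complex x y)) * indicator (square w r) (Complex x y)) \<in> borel_measurable borel" for y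
    by (rule measurable_compose[OF _ measurable_square_integrand[OF h]]) measurable
  have [measurable]: "(\<lambda>(y, x). ennreal (h (Complex x y)) * indicator (square w r) (Complex x y)) \<in> borel_measurable (lborel \<Otimes>\<^sub>M lborel)"
    unfolding split_beta' by (rule measurable_compose[OF _ measurable_square_integrand[OF h]]) measurable
  have "square_integral (\<lambda>z. c * h z) w r
     = (\<integral>\<^sup>+y. (\<integral>\<^sup>+x. ennreal c * (ennreal (h (Complex x y)) * indicator (square w r) (Complex x y)) \<partial>lborel) \<partial>lborel)"
    unfolding square_integral_def using c by (simp add: ennreal_mult' mult.assoc)
  also have "\<dots> = (\<integral>\<^sup>+y. ennreal c * (\<integral>\<^sup>+x. ennreal (h (Complex x y)) * indicator (square w r) (Complex x y) \<partial>lborel) \<partial>lborel)"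
    by (intro nn_integral_cong nn_integral_cmult) measurable
  also have "\<dots> = ennreal c * square_integral h w r"
    unfolding square_integral_def by (intro nn_integral_cmult) measurable
  finally show ?thesis .
qed

lemma nn_integral_reflect_shift:
  fixes a s :: real
  assumes [measurable]: "h \<in> borel_measurable borel" and "\<bar>s\<bar> = 1"
  shows "(\<integral>\<^sup>+u. h (a + s * u) \<partial>lborel) = (\<integral>\<^sup>+u. h u \<partial>lborel)"
  using assms(2) by (subst (2) nn_integral_real_affine[where c = s and t = a]) auto

lemma nn_integral_reflect_shift_plane:
  fixes h :: "real \<Rightarrow> real \<Rightarrow> ennreal" and a b s s' :: real
  assumes h [measurable]: "case_prod h \<in> borel_measurable (borel \<Otimes>\<^sub>M borel)" and "\<bar>s\<bar> = 1" "\<bar>s'\<bar> = 1"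
  shows "(\<integral>\<^sup>+l. (\<integral>\<^sup>+u. h (a + s * u) (b + s' * l) \<partial>lborel) \<partial>lborel) = (\<integral>\<^sup>+y. (\<integral>\<^sup>+x. h x y \<partial>lborel) \<partial>lborel)"
    and "(\<integral>\<^sup>+l. (\<integral>\<^sup>+u. h (a + s * l) (b + s' * u) \<partial>lborel) \<partial>lborel) = (\<integral>\<^sup>+y. (\<integral>\<^sup>+x. h x y \<partial>lborel) \<partial>lborel)"
proof -
  have *: "(\<integral>\<^sup>+l. (\<integral>\<^sup>+u. h (a + s * u) (b + s' * l) \<partial>lborel) \<partial>lborel) = (\<integral>\<^sup>+y. (\<integral>\<^sup>+x. h x y \<partial>lborel) \<partial>lborel)"
    if "case_prod h \<in> borel_measurable (borel \<Otimes>\<^sub>M borel)" "\<bar>s\<bar> = 1" "\<bar>s'\<bar> = 1" for h :: "real \<Rightarrow> real \<Rightarrow> ennreal" and s s' a b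
  proof -
    note [measurable] = that(1)
    have "(\<integral>\<^sup>+u. h (a + s * u) y \<partial>lborel) = (\<integral>\<^sup>+x. h x y \<partial>lborel)" for y
      using that(2) by (rule nn_integral_reflect_shift[rotated]) measurable
    moreover have "(\<integral>\<^sup>+l. (\<integral>\<^sup>+x. h x (b + s' * l) \<partial>lborel) \<partial>lborel) = (\<integral>\<^sup>+y. (\<integral>\<^sup>+x. h x y \<partial>lborel) \<partial>lborel)"
      using that(3) by (rule nn_integral_reflect_shift[rotated]) measurable
    ultimately show ?thesis by simp
  qed
  show "(\<integral>\<^sup>+l. (\<integral>\<^sup>+u. h (a + s * u) (b + s' * l) \<partial>lborel) \<partial>lborel) = (\<integral>\<^sup>+y. (\<integral>\<^sup>+x. h x y \<partial>lborel) \<partial>lborel)"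
    by (rule *[OF assms])
  have "(\<integral>\<^sup>+l. (\<integral>\<^sup>+u. h (a + s * l) (b + s' * u) \<partial>lborel) \<partial>lborel)
      = (\<integral>\<^sup>+y. (\<integral>\<^sup>+x. h y x \<partial>lborel) \<partial>lborel)"
    using assms by (intro *[of "\<lambda>x y. h y x"]) auto
  also have "\<dots> = (\<integral>\<^sup>+y. (\<integral>\<^sup>+x. h x y \<partial>lborel) \<partial>lborel)"
    by (rule lborel_pair.Fubini') measurable
  finally show "(\<integral>\<^sup>+l. (\<integral>\<^sup>+u. h (a + s * l) (b + s' * u) \<partial>lborel) \<partial>lborel) = (\<integral>\<^sup>+y. (\<integral>\<^sup>+x. h x y \<partial>lborel) \<partial>lborel)" .
qed

text \<open>
  Cauchy's formula on the concentric squares with half side \<open>l \<in> [r / 2, r]\<close>, integrated over \<open>l\<close>.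
  Each of the four families of parallel sides sweeps out a part of the square once.
\<close>
lemma area_mean_value_square:
  fixes F :: "complex \<Rightarrow> complex"
  assumes F: "F holomorphic_on square w r" and r: "0 < r"
  shows "ennreal (cmod (F w)) \<le> ennreal (8 / (pi * r\<^sup>2)) * square_integral (\<lambda>z. cmod (F z)) w r"
proof -
  have cont: "continuous_on (square w r) F" using F by (rule holomorphic_on_imp_continuous_on)
  define N where "N z = ennreal (cmod (F z)) * indicator (square w r) z" for z
  have [measurable]: "N \<in> borel_measurable borel"
    unfolding N_def by (intro measurable_square_integrand continuous_intros cont)
  define J where "J = (\<integral>\<^sup>+y. (\<integral>\<^sup>+x. N (Complex x y) \<partial>lborel) \<partial>lborel)"
  define B where "B c d l = (\<integral>\<^sup>+u. N (w + of_real l * c + of_real u * d) \<partial>lborel)" for c d :: complex and l :: real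
  have [measurable]: "B c d \<in> borel_measurable borel" for c d unfolding B_def by measurable
  let ?S = "\<lambda>c d l. contour_integral (linepath (w + of_real l * (c - d)) (w + of_real l * (c + d))) (\<lambda>z. F z / (z - w))"
  have side: "ennreal (cmod (?S c d l)) \<le> ennreal (2 / r) * B c d l"
    if l: "r / 2 \<le> l" "l \<le> r" and cd: "(c, d) \<in> {(- \<i>, 1), (1, \<i>), (\<i>, - 1), (- 1, - \<i>)}" for c d l
  proof -
    have in_sq: "w + of_real l * c + of_real u * d \<in> square w r" if "\<bar>u\<bar> \<le> l" for u
      using cd that l r by (auto simp: square_def)
    have norm: "cmod c = 1" "cmod d = 1" "\<And>t::real. 1 \<le> cmod (c + of_real t * d)"
      using cd by (auto simp: cmod_def)
    have "ennreal (cmod (?S c d l)) \<le> ennreal (1 / l) *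
        (\<integral>\<^sup>+u. ennreal (cmod (F (w + of_real l * c + of_real u * d))) * indicator {-l..l} u \<partial>lborel)"
      by (rule square_side_bound[OF cont _ in_sq norm]) (use l r in auto)
    also have "\<dots> \<le> ennreal (2 / r) * B c d l"
      unfolding B_def
    proof (intro mult_mono nn_integral_mono ennreal_leI)
      show "1 / l \<le> 2 / r" using l r by (simp add: field_simps)
      show "ennreal (cmod (F (w + of_real l * c + of_real u * d))) * indicator {-l..l} u
          \<le> N (w + of_real l * c + of_real u * d)" for u
        using in_sq[of u] by (cases "u \<in> {-l..l}") (auto simp: N_def abs_le_iff)
    qed auto
    finally show ?thesis .
  qed
  have key: "ennreal (2 * pi * cmod (F w))
      \<le> ennreal (2 / r) * (B (- \<i>) 1 l + (B 1 \<i> l + (B \<i> (- 1) l + B (- 1) (- \<i>) l)))"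
    if l: "r / 2 \<le> l" "l \<le> r" for l
  proof -
    define a1 a3 where "a1 = w + of_real l * (- 1 - \<i>)" and "a3 = w + of_real l * (1 + \<i>)"
    have l0: "0 < l" using l r by simp
    have cbox: "cbox a1 a3 \<subseteq> square w r"
      using l by (auto simp: a1_def a3_def in_cbox_complex_iff square_def)
    have box: "w \<in> box a1 a3" using l0 by (simp add: a1_def a3_def in_box_complex_iff)
    have path: "path_image (rectpath a1 a3) = cbox a1 a3 - box a1 a3"
      using l0 by (intro path_image_rectpath_cbox_minus_box) (auto simp: a1_def a3_def)
    have "((\<lambda>z. F z / (z - w)) has_contour_integral (2 * pi * \<i> * winding_number (rectpath a1 a3) w * F w)) (rectpath a1 a3)"
      using box path by (intro Cauchy_integral_formula_convex_simple[of "cbox a1 a3"] holomorphic_on_subset[OF F cbox])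
        (auto simp: interior_cbox)
    then have total: "((\<lambda>z. F z / (z - w)) has_contour_integral (2 * pi * \<i> * F w)) (rectpath a1 a3)"
      by (simp add: winding_number_rectpath[OF box])
    have contq: "continuous_on (path_image (rectpath a1 a3)) (\<lambda>z. F z / (z - w))"
      using box path cbox by (intro continuous_intros continuous_on_subset[OF cont]) auto
    have rect: "rectpath a1 a3 = linepath (w + of_real l * (- \<i> - 1)) (w + of_real l * (- \<i> + 1))
        +++ linepath (w + of_real l * (1 - \<i>)) (w + of_real l * (1 + \<i>))
        +++ linepath (w + of_real l * (\<i> - (- 1))) (w + of_real l * (\<i> + (- 1)))
        +++ linepath (w + of_real l * (- 1 - (- \<i>))) (w + of_real l * (- 1 + (- \<i>)))"
      unfolding rectpath_def Let_def
      by (intro arg_cong2[where f = "(+++)"] arg_cong2[where f = linepath])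
        (auto simp: a1_def a3_def complex_eq_iff algebra_simps)
    have seg: "((\<lambda>z. F z / (z - w)) has_contour_integral ?S c d l) (linepath (w + of_real l * (c - d)) (w + of_real l * (c + d)))"
      if cd: "(c, d) \<in> {(- \<i>, 1), (1, \<i>), (\<i>, - 1), (- 1, - \<i>)}" for c d
    proof -
      have "closed_segment (w + of_real l * (c - d)) (w + of_real l * (c + d)) \<subseteq> path_image (rectpath a1 a3)"
        unfolding rect using cd by (auto simp: path_image_join)
      then show ?thesis
        by (intro has_contour_integral_integral contour_integrable_continuous_linepath continuous_on_subset[OF contq])
    qed
    have "((\<lambda>z. F z / (z - w)) has_contour_integral
        (?S (- \<i>) 1 l + (?S 1 \<i> l + (?S \<i> (- 1) l + ?S (- 1) (- \<i>) l)))) (rectpath a1 a3)"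
    proof -
      define p where "p c d = linepath (w + of_real l * (c - d)) (w + of_real l * (c + d))" for c d
      have valid: "valid_path (p c d)" for c d by (simp add: p_def)
      have ends: "pathfinish (p 1 \<i>) = pathstart (p \<i> (- 1))" "pathfinish (p \<i> (- 1)) = pathstart (p (- 1) (- \<i>))"
        by (simp_all add: p_def add.commute)
      have v34: "valid_path (p \<i> (- 1) +++ p (- 1) (- \<i>))"
        by (rule valid_path_join[OF valid valid ends(2)])
      have v234: "valid_path (p 1 \<i> +++ p \<i> (- 1) +++ p (- 1) (- \<i>))"
        by (rule valid_path_join[OF valid v34]) (simp add: ends(1))
      define I where "I c d = contour_integral (p c d) (\<lambda>z. F z / (z - w))" for c d
      have seg': "((\<lambda>z. F z / (z - w)) has_contour_integral I c d) (p c d)"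
        if "(c, d) \<in> {(- \<i>, 1), (1, \<i>), (\<i>, - 1), (- 1, - \<i>)}" for c d
        unfolding I_def p_def by (rule seg[OF that])
      have rect': "rectpath a1 a3 = p (- \<i>) 1 +++ p 1 \<i> +++ p \<i> (- 1) +++ p (- 1) (- \<i>)"
        by (simp only: rect p_def)
      have s1: "((\<lambda>z. F z / (z - w)) has_contour_integral I (- \<i>) 1) (p (- \<i>) 1)" by (rule seg') simp
      have s2: "((\<lambda>z. F z / (z - w)) has_contour_integral I 1 \<i>) (p 1 \<i>)" by (rule seg') simp
      have s3: "((\<lambda>z. F z / (z - w)) has_contour_integral I \<i> (- 1)) (p \<i> (- 1))" by (rule seg') simp
      have s4: "((\<lambda>z. F z / (z - w)) has_contour_integral I (- 1) (- \<i>)) (p (- 1) (- \<i>))" by (rule seg') simp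
      have "((\<lambda>z. F z / (z - w)) has_contour_integral (I (- \<i>) 1 + (I 1 \<i> + (I \<i> (- 1) + I (- 1) (- \<i>))))) (rectpath a1 a3)"
        unfolding rect'
        by (rule has_contour_integral_join[OF s1 has_contour_integral_join[OF s2
              has_contour_integral_join[OF s3 s4 valid valid] valid v34] valid v234])
      then show ?thesis by (simp only: I_def p_def)
    qed
    then have "2 * pi * \<i> * F w = ?S (- \<i>) 1 l + (?S 1 \<i> l + (?S \<i> (- 1) l + ?S (- 1) (- \<i>) l))"
      by (rule has_contour_integral_unique[OF total])
    then have "cmod (2 * pi * \<i> * F w) \<le> cmod (?S (- \<i>) 1 l) + (cmod (?S 1 \<i> l) + (cmod (?S \<i> (- 1) l) + cmod (?S (- 1) (- \<i>) l)))"
      by (simp only:) (rule order_trans[OF norm_triangle_ineq add_left_mono[OF order_trans[OF norm_triangle_ineq add_left_mono[OF norm_triangle_ineq]]]])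
    then have "ennreal (2 * pi * cmod (F w)) \<le> ennreal (cmod (?S (- \<i>) 1 l) + (cmod (?S 1 \<i> l) + (cmod (?S \<i> (- 1) l) + cmod (?S (- 1) (- \<i>) l))))"
      by (intro ennreal_leI) (simp add: norm_mult)
    also have "\<dots> = ennreal (cmod (?S (- \<i>) 1 l)) + (ennreal (cmod (?S 1 \<i> l)) + (ennreal (cmod (?S \<i> (- 1) l)) + ennreal (cmod (?S (- 1) (- \<i>) l))))"
      by (simp only: ennreal_plus norm_ge_zero add_nonneg_nonneg)
    also have "\<dots> \<le> ennreal (2 / r) * B (- \<i>) 1 l + (ennreal (2 / r) * B 1 \<i> l + (ennreal (2 / r) * B \<i> (- 1) l + ennreal (2 / r) * B (- 1) (- \<i>) l))"
      by (intro add_mono side l) auto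
    finally show ?thesis by (simp only: distrib_left)
  qed
  have meas2 [measurable]: "(\<lambda>(x, y). N (Complex x y)) \<in> borel_measurable (borel \<Otimes>\<^sub>M borel)" by measurable
  have point: "w + of_real l * c + of_real u * d = Complex (Re w + l * Re c + u * Re d) (Im w + l * Im c + u * Im d)" for l u c d
    by (simp add: complex_eq_iff)
  (* B extends each side to a whole line, N vanishing off the square; the lines of one family
     fill the plane, so each family contributes the full integral J. *)
  have total: "(\<integral>\<^sup>+l. B c d l \<partial>lborel) = J" if "(c, d) \<in> {(- \<i>, 1), (1, \<i>), (\<i>, - 1), (- 1, - \<i>)}" for c d
    using that nn_integral_reflect_shift_plane[OF meas2, of 1 1 "Re w" "Im w"] nn_integral_reflect_shift_plane[OF meas2, of 1 "-1" "Re w" "Im w"]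
      nn_integral_reflect_shift_plane[OF meas2, of "-1" 1 "Re w" "Im w"] nn_integral_reflect_shift_plane[OF meas2, of "-1" "-1" "Re w" "Im w"]
    unfolding B_def J_def point by auto
  have "ennreal (2 * pi * cmod (F w)) * ennreal (r / 2) = (\<integral>\<^sup>+l. ennreal (2 * pi * cmod (F w)) * indicator {r/2..r} l \<partial>lborel)"
    using r by (subst nn_integral_cmult_indicator) auto
  also have "\<dots> \<le> (\<integral>\<^sup>+l. ennreal (2 / r) * (B (- \<i>) 1 l + (B 1 \<i> l + (B \<i> (- 1) l + B (- 1) (- \<i>) l))) \<partial>lborel)"
    using key by (intro nn_integral_mono) (auto split: split_indicator)
  also have "\<dots> = ennreal (2 / r) * (J + (J + (J + J)))"
    by (simp add: nn_integral_cmult nn_integral_add total)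
  also have "J + (J + (J + J)) = ennreal 4 * J"
  proof -
    have "(4::ennreal) = 1 + (1 + (1 + 1))" by simp
    then show ?thesis by (simp only: ennreal_numeral distrib_right mult_1)
  qed
  finally have "ennreal (2 * pi * cmod (F w)) * ennreal (r / 2) \<le> ennreal (2 / r) * (ennreal 4 * J)" .
  moreover have "ennreal (2 * pi * cmod (F w)) * ennreal (r / 2) = ennreal (pi * r * cmod (F w))"
    using r by (subst ennreal_mult'[symmetric]) auto
  moreover have "ennreal (2 / r) * (ennreal 4 * J) = ennreal (8 / r) * J"
    using r by (subst mult.assoc[symmetric], subst ennreal_mult'[symmetric]) auto
  ultimately have *: "ennreal (pi * r * cmod (F w)) \<le> ennreal (8 / r) * J" by simp
  have "ennreal (cmod (F w)) = ennreal (1 / (pi * r)) * ennreal (pi * r * cmod (F w))"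
    using r by (simp add: ennreal_mult'[symmetric])
  also have "\<dots> \<le> ennreal (1 / (pi * r)) * (ennreal (8 / r) * J)"
    using * by (rule mult_left_mono) simp
  also have "\<dots> = ennreal (8 / (pi * r\<^sup>2)) * J"
    using r by (subst mult.assoc[symmetric], subst ennreal_mult'[symmetric]) (auto simp: power2_eq_square mult_ac)
  finally show ?thesis by (simp add: J_def N_def square_integral_def)
qed

text \<open>
  For \<open>p \<le> 1\<close> the exponent is lowered from 1 to \<open>p\<close> by maximizing \<open>s = |F|\<^sup>p \<rho>\<^sup>2\<close>, where \<open>\<rho>\<close> is the distance to
  the boundary of the square in the maximum norm. On the square of half side \<open>\<rho> / 2\<close> around a maximum point
  \<open>w1\<close>, \<open>|F|\<^sup>p\<close> is at most \<open>4\<close> times its value at \<open>w1\<close>, so \<open>|F| \<le> m\<^bsup>1/p - 1\<^esup> |F|\<^sup>p\<close> with \<open>m = 4 |F w1|\<^sup>p\<close>, and the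
  case \<open>p = 1\<close> applies there.
\<close>
lemma powr_submean_square_le_one:
  fixes F :: "complex \<Rightarrow> complex"
  assumes p: "0 < p" "p \<le> 1" and F: "F holomorphic_on square w0 R" and R: "0 < R"
  shows "ennreal (cmod (F w0) powr p) \<le> ennreal (8 / pi * 4 powr (1 / p) / R\<^sup>2) * square_integral (\<lambda>z. cmod (F z) powr p) w0 R"
proof (cases "square_integral (\<lambda>z. cmod (F z) powr p) w0 R = top")
  case True
  then show ?thesis using R by (simp add: ennreal_mult_top)
next
  case False
  then obtain I where I: "square_integral (\<lambda>z. cmod (F z) powr p) w0 R = ennreal I" "0 \<le> I"
    by (cases "square_integral (\<lambda>z. cmod (F z) powr p) w0 R") auto
  define \<rho> where "\<rho> w = R - max \<bar>Re w - Re w0\<bar> \<bar>Im w - Im w0\<bar>" for w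
  define s where "s w = cmod (F w) powr p * (\<rho> w)\<^sup>2" for w
  have "continuous_on (square w0 R) F" using F by (rule holomorphic_on_imp_continuous_on)
  then have "continuous_on (square w0 R) s" unfolding s_def \<rho>_def using p
    by (intro continuous_intros continuous_on_powr') auto
  moreover have "w0 \<in> square w0 R" using R by (simp add: square_def)
  ultimately obtain w1 where w1: "w1 \<in> square w0 R" "\<And>w. w \<in> square w0 R \<Longrightarrow> s w \<le> s w1"
    using continuous_attains_sup[OF compact_square[of w0 R]] by blast
  have s0: "s w0 = cmod (F w0) powr p * R\<^sup>2" by (simp add: s_def \<rho>_def)
  have s01: "s w0 \<le> s w1" by (rule w1) fact
  have "s w1 \<le> 8 / pi * 4 powr (1 / p) * I"
  proof (cases "s w1 \<le> 0")
    case True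
    then show ?thesis using I by (smt (verit) divide_nonneg_pos mult_nonneg_nonneg pi_gt_zero powr_ge_zero)
  next
    case False
    define r where "r = \<rho> w1 / 2"
    have "\<rho> w1 \<noteq> 0" using False by (auto simp: s_def)
    moreover have "0 \<le> \<rho> w1" using w1(1) by (auto simp: \<rho>_def square_def)
    ultimately have r: "0 < r" by (simp add: r_def)
    have \<rho>_ge: "r \<le> \<rho> w" if "w \<in> square w1 r" for w
      using that unfolding square_def r_def \<rho>_def mem_Collect_eq by (smt (verit, best) field_sum_of_halves)
    have sub: "square w1 r \<subseteq> square w0 R"
    proof
      fix w assume "w \<in> square w1 r"
      then show "w \<in> square w0 R" using \<rho>_ge[of w] r by (auto simp: \<rho>_def square_def)
    qed
    define m where "m = s w1 / r\<^sup>2"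
    have m: "0 < m" using False r by (simp add: m_def)
    have Fm: "cmod (F w) powr p \<le> m" if "w \<in> square w1 r" for w
    proof -
      have "cmod (F w) powr p * r\<^sup>2 \<le> s w"
        unfolding s_def using \<rho>_ge[OF that] r by (intro mult_left_mono power_mono) auto
      also have "\<dots> \<le> s w1" using that sub by (intro w1) auto
      finally show ?thesis using r by (simp add: m_def field_simps)
    qed
    have F_le: "cmod (F w) \<le> m powr (1 / p - 1) * cmod (F w) powr p" if "w \<in> square w1 r" for w
    proof (cases "F w = 0")
      case False
      have "cmod (F w) = (cmod (F w) powr p) powr (1 / p - 1) * cmod (F w) powr p"
        using False p by (simp add: powr_powr powr_add[symmetric] algebra_simps)
      also have "\<dots> \<le> m powr (1 / p - 1) * cmod (F w) powr p"
        using Fm[OF that] p m by (intro mult_right_mono powr_mono2) auto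
      finally show ?thesis .
    qed simp
    have "ennreal (cmod (F w1)) \<le> ennreal (8 / (pi * r\<^sup>2)) * square_integral (\<lambda>z. cmod (F z)) w1 r"
      by (rule area_mean_value_square[OF holomorphic_on_subset[OF F sub] r])
    also have "square_integral (\<lambda>z. cmod (F z)) w1 r \<le> square_integral (\<lambda>z. m powr (1 / p - 1) * cmod (F z) powr p) w0 R"
      unfolding square_integral_def using F_le sub
      by (intro nn_integral_mono) (auto split: split_indicator intro!: ennreal_leI)
    also have "\<dots> = ennreal (m powr (1 / p - 1)) * square_integral (\<lambda>z. cmod (F z) powr p) w0 R"
      using \<open>continuous_on (square w0 R) F\<close> p
      by (intro square_integral_cmult continuous_intros continuous_on_powr') auto
    finally have "ennreal (cmod (F w1)) \<le> ennreal (8 / (pi * r\<^sup>2)) * (ennreal (m powr (1 / p - 1)) * ennreal I)"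
      unfolding I by (simp add: mult_left_mono)
    also have "\<dots> = ennreal (8 / (pi * r\<^sup>2) * (m powr (1 / p - 1) * I))"
      using r I(2) by (subst ennreal_mult'[symmetric], simp, subst ennreal_mult'[symmetric], auto)
    finally have "cmod (F w1) \<le> 8 / (pi * r\<^sup>2) * (m powr (1 / p - 1) * I)"
      using I(2) r by (subst (asm) ennreal_le_iff) auto
    moreover have "cmod (F w1) = (m / 4) powr (1 / p)"
    proof -
      have "m / 4 = cmod (F w1) powr p" using r by (simp add: m_def s_def r_def field_simps power2_eq_square)
      then show ?thesis using p by (simp add: powr_powr)
    qed
    moreover have "(m / 4) powr (1 / p) = m powr (1 / p - 1) * (m / 4 powr (1 / p))"
      using m by (simp add: powr_divide powr_diff)
    ultimately have "m powr (1 / p - 1) * (m / 4 powr (1 / p)) \<le> m powr (1 / p - 1) * (8 / (pi * r\<^sup>2) * I)"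
      by (simp add: mult_ac)
    then have "m / 4 powr (1 / p) \<le> 8 / (pi * r\<^sup>2) * I"
      by (rule mult_left_le_imp_le) (use m in simp)
    then have "m * r\<^sup>2 \<le> 8 / pi * 4 powr (1 / p) * I" using r by (simp add: field_simps)
    then show ?thesis using r by (simp add: m_def)
  qed
  then have "cmod (F w0) powr p * R\<^sup>2 \<le> 8 / pi * 4 powr (1 / p) * I" using s0 s01 by linarith
  then have "cmod (F w0) powr p \<le> 8 / pi * 4 powr (1 / p) / R\<^sup>2 * I" using R by (simp add: field_simps)
  then have "ennreal (cmod (F w0) powr p) \<le> ennreal (8 / pi * 4 powr (1 / p) / R\<^sup>2 * I)" by (rule ennreal_leI)
  then show ?thesis unfolding I(1) by (simp only: ennreal_mult''[OF I(2)])
qed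

text \<open>
  For exponents above 1 the previous case is applied to the power \<open>F\<^sup>n\<close> and the exponent \<open>p / n \<le> 1\<close>.
\<close>
lemma powr_submean_square:
  assumes p: "0 < p"
  obtains C where "0 < C" "\<And>F w R. F holomorphic_on square w R \<Longrightarrow> 0 < R \<Longrightarrow>
     ennreal (cmod (F w) powr p) \<le> ennreal (C / R\<^sup>2) * square_integral (\<lambda>z. cmod (F z) powr p) w R"
proof -
  define n where "n = nat \<lceil>p\<rceil>"
  have n: "p \<le> real n" "0 < n" using p unfolding n_def by linarith+
  have pow: "cmod (F z ^ n) powr (p / n) = cmod (F z) powr p" for F :: "complex \<Rightarrow> complex" and z
    using n by (cases "F z = 0") (auto simp: norm_power powr_realpow[symmetric] powr_powr)
  show thesis
  proof (rule that)
    show "0 < 8 / pi * 4 powr (1 / (p / n))" by simp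
    fix F :: "complex \<Rightarrow> complex" and w R assume F: "F holomorphic_on square w R" and R: "0 < (R::real)"
    have "(\<lambda>z. F z ^ n) holomorphic_on square w R" using F by (intro holomorphic_intros)
    then have "ennreal (cmod (F w ^ n) powr (p / n))
      \<le> ennreal (8 / pi * 4 powr (1 / (p / n)) / R\<^sup>2) * square_integral (\<lambda>z. cmod (F z ^ n) powr (p / n)) w R"
      using p n R by (intro powr_submean_square_le_one) auto
    then show "ennreal (cmod (F w) powr p) \<le> ennreal (8 / pi * 4 powr (1 / (p / n)) / R\<^sup>2) * square_integral (\<lambda>z. cmod (F z) powr p) w R"
      unfolding pow .
  qed
qed

section \<open>Means over horizontal lines\<close>

definition line_mean :: "(complex \<Rightarrow> complex) \<Rightarrow> real \<Rightarrow> real \<Rightarrow> ennreal" where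
  "line_mean f p y = (\<integral>\<^sup>+x. ennreal (cmod (f (Complex x y)) powr p) \<partial>lborel)"

lemma nn_integral_fatou_bound:
  fixes u :: "nat \<Rightarrow> 'a \<Rightarrow> ennreal"
  assumes u: "\<And>n. u n \<in> borel_measurable M"
    and lim: "AE x in M. (\<lambda>n. u n x) \<longlonglongrightarrow> v x"
    and bound: "\<And>n. (\<integral>\<^sup>+x. u n x \<partial>M) \<le> B"
  shows "(\<integral>\<^sup>+x. v x \<partial>M) \<le> B"
proof -
  have "(\<integral>\<^sup>+x. v x \<partial>M) = (\<integral>\<^sup>+x. liminf (\<lambda>n. u n x) \<partial>M)"
    using lim by (intro nn_integral_cong_AE, eventually_elim) (simp add: lim_imp_Liminf)
  also have "\<dots> \<le> liminf (\<lambda>n. \<integral>\<^sup>+x. u n x \<partial>M)" by (rule nn_integral_liminf[OF u])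
  also have "\<dots> \<le> liminf (\<lambda>n. B)" using bound by (intro Liminf_mono always_eventually) simp
  finally show ?thesis by (simp add: Liminf_const)
qed

lemma measurable_line:
  assumes f: "f holomorphic_on A" and A: "\<And>x. Complex x y \<in> A"
  shows "(\<lambda>x. f (Complex x y)) \<in> borel_measurable borel"
proof (rule borel_measurable_continuous_onI)
  show "continuous_on UNIV (\<lambda>x. f (Complex x y))"
    using A unfolding Complex_eq
    by (intro continuous_on_compose2[OF holomorphic_on_imp_continuous_on[OF f]] continuous_intros) (auto simp: Complex_eq)
qed

text \<open>
  The Poisson majorant is integrated over the line; the kernel has integral 1 in \<open>x\<close> as well.
\<close>
lemma line_mean_le_boundary:
  fixes f :: "complex \<Rightarrow> complex"
  assumes f: "f holomorphic_on U" and U: "open U" "{z. 0 \<le> Im z} \<subseteq> U" and p: "0 < p"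
    and vanish: "\<And>e. 0 < e \<Longrightarrow> \<exists>R. \<forall>z. 0 \<le> Im z \<and> R \<le> cmod z \<longrightarrow> cmod (f z) < e"
    and y: "0 < y"
  shows "line_mean f p y \<le> line_mean f p 0"
proof -
  have [measurable]: "(\<lambda>t. f (Complex t 0)) \<in> borel_measurable borel"
    by (rule measurable_line[OF f]) (use U in auto)
  have "line_mean f p y \<le> (\<integral>\<^sup>+x. (\<integral>\<^sup>+t. ennreal (poisson_kernel y (x - t)) * ennreal (cmod (f (Complex t 0)) powr p) \<partial>lborel) \<partial>lborel)"
    unfolding line_mean_def
    using poisson_majorant[OF f U p vanish, of "Complex _ y"] y
    by (intro nn_integral_mono) (simp add: complex_of_real_def)
  also have "\<dots> = (\<integral>\<^sup>+t. (\<integral>\<^sup>+x. ennreal (poisson_kernel y (x - t)) * ennreal (cmod (f (Complex t 0)) powr p) \<partial>lborel) \<partial>lborel)"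
    by (rule lborel_pair.Fubini') measurable
  also have "\<dots> = (\<integral>\<^sup>+t. ennreal (cmod (f (Complex t 0)) powr p) \<partial>lborel)"
  proof (rule nn_integral_cong)
    fix t
    have "(\<integral>\<^sup>+x. ennreal (poisson_kernel y (x - t)) * ennreal (cmod (f (Complex t 0)) powr p) \<partial>lborel)
       = (\<integral>\<^sup>+x. ennreal (poisson_kernel y (x - t)) \<partial>lborel) * ennreal (cmod (f (Complex t 0)) powr p)"
      by (rule nn_integral_multc) measurable
    also have "(\<integral>\<^sup>+x. ennreal (poisson_kernel y (x - t)) \<partial>lborel) = 1"
      using nn_integral_poisson_kernel_shift[OF y, of t] by (simp only: poisson_kernel_commute[of y t])
    finally show "(\<integral>\<^sup>+x. ennreal (poisson_kernel y (x - t)) * ennreal (cmod (f (Complex t 0)) powr p) \<partial>lborel)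
       = ennreal (cmod (f (Complex t 0)) powr p)" by simp
  qed
  finally show ?thesis by (simp add: line_mean_def)
qed

text \<open>
  Dividing by a power of \<open>1 - \<i> e z\<close> never increases the modulus on the half plane and makes any function of
  polynomial growth vanish at infinity, while the factor tends to 1 as \<open>e \<rightarrow> 0\<close>.
\<close>
lemma damping_factor:
  assumes e: "0 < e" and z: "0 \<le> Im z"
  shows "1 \<le> cmod (1 - \<i> * of_real e * z)"
    and "min 1 e / 2 * (1 + cmod z) \<le> cmod (1 - \<i> * of_real e * z)"
proof -
  have sq: "(cmod (1 - \<i> * of_real e * z))\<^sup>2 = 1 + 2 * e * Im z + e\<^sup>2 * (cmod z)\<^sup>2"
    unfolding cmod_power2 by (simp add: power2_eq_square algebra_simps)
  have ge: "1 + e\<^sup>2 * (cmod z)\<^sup>2 \<le> (cmod (1 - \<i> * of_real e * z))\<^sup>2"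
    using e z unfolding sq by simp
  then have "1\<^sup>2 \<le> (cmod (1 - \<i> * of_real e * z))\<^sup>2"
    using zero_le_mult_iff[of "e\<^sup>2" "(cmod z)\<^sup>2"] by (smt (verit) one_power2 zero_le_power2)
  then show "1 \<le> cmod (1 - \<i> * of_real e * z)" by (rule power2_le_imp_le) simp
  define m where "m = min 1 e"
  have m: "0 < m" "m \<le> 1" "m \<le> e" using e by (auto simp: m_def)
  have m2: "m\<^sup>2 \<le> 1" "m\<^sup>2 \<le> e\<^sup>2" using m by (auto intro: power_mono power_le_one)
  have "(m / 2 * (1 + cmod z))\<^sup>2 = m\<^sup>2 * ((1 + cmod z)\<^sup>2 / 4)" by (simp add: power_mult_distrib power_divide)
  also have "\<dots> \<le> m\<^sup>2 * (1 + (cmod z)\<^sup>2)"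
  proof (rule mult_left_mono)
    have "0 \<le> (1 - cmod z)\<^sup>2" by simp
    then have "2 * cmod z \<le> 1 + cmod z * cmod z" by (simp add: power2_eq_square algebra_simps)
    moreover have "0 \<le> cmod z * cmod z" by simp
    moreover have "(1 + cmod z)\<^sup>2 = 1 + 2 * cmod z + cmod z * cmod z" by (simp add: power2_eq_square algebra_simps)
    ultimately have "(1 + cmod z)\<^sup>2 \<le> 4 + 4 * (cmod z * cmod z)" by linarith
    then show "(1 + cmod z)\<^sup>2 / 4 \<le> 1 + (cmod z)\<^sup>2"
      by (simp add: power2_eq_square[of "cmod z"])
  qed simp
  also have "\<dots> = m\<^sup>2 + m\<^sup>2 * (cmod z)\<^sup>2" by (simp add: algebra_simps)
  also have "\<dots> \<le> 1 + e\<^sup>2 * (cmod z)\<^sup>2" using m2 by (intro add_mono mult_right_mono) auto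
  also have "\<dots> \<le> (cmod (1 - \<i> * of_real e * z))\<^sup>2" by (rule ge)
  finally show "min 1 e / 2 * (1 + cmod z) \<le> cmod (1 - \<i> * of_real e * z)"
    unfolding m_def by (rule power2_le_imp_le) simp
qed

lemma nn_integral_inverse_sqrt_finite:
  "(\<integral>\<^sup>+t. ennreal (\<bar>t - a\<bar> powr (- 1/2)) * indicator {a - 1..a + 1} t \<partial>lborel) < top"
proof -
  have half: "(\<integral>\<^sup>+u. ennreal (u powr (- 1/2)) * indicator {0..1} u \<partial>lborel) = ennreal 2"
  proof -
    have "((\<lambda>u. u powr (- 1/2)) has_integral 1 powr (- 1/2 + 1) / (- 1/2 + 1)) {0..(1::real)}"
      by (rule has_integral_powr_from_0) auto
    then have "(\<integral>\<^sup>+u. ennreal (indicator {0..1} u * u powr (- 1/2)) \<partial>lborel) = ennreal 2"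
      by (intro nn_integral_has_integral_lebesgue) auto
    moreover have "(\<integral>\<^sup>+u. ennreal (u powr (- 1/2)) * indicator {0..1} u \<partial>lborel) = (\<integral>\<^sup>+u. ennreal (indicator {0..1} u * u powr (- 1/2)) \<partial>lborel)"
      by (intro nn_integral_cong) (auto split: split_indicator)
    ultimately show ?thesis by simp
  qed
  have "(\<integral>\<^sup>+t. ennreal (\<bar>t - a\<bar> powr (- 1/2)) * indicator {a - 1..a + 1} t \<partial>lborel)
    \<le> (\<integral>\<^sup>+t. ennreal ((- a + 1 * t) powr (- 1/2)) * indicator {0..1} (- a + 1 * t)
          + ennreal ((a + (-1) * t) powr (- 1/2)) * indicator {0..1} (a + (-1) * t) \<partial>lborel)"
    by (intro nn_integral_mono) (auto split: split_indicator)
  also have "\<dots> = (\<integral>\<^sup>+t. ennreal ((- a + 1 * t) powr (- 1/2)) * indicator {0..1} (- a + 1 * t) \<partial>lborel)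
          + (\<integral>\<^sup>+t. ennreal ((a + (-1) * t) powr (- 1/2)) * indicator {0..1} (a + (-1) * t) \<partial>lborel)"
    by (rule nn_integral_add) measurable
  also have "(\<integral>\<^sup>+t. ennreal ((- a + 1 * t) powr (- 1/2)) * indicator {0..1} (- a + 1 * t) \<partial>lborel) = ennreal 2"
    unfolding half[symmetric] by (rule nn_integral_reflect_shift) auto
  also have "(\<integral>\<^sup>+t. ennreal ((a + (-1) * t) powr (- 1/2)) * indicator {0..1} (a + (-1) * t) \<partial>lborel) = ennreal 2"
    unfolding half[symmetric] by (rule nn_integral_reflect_shift) auto
  finally show ?thesis by (rule le_less_trans) simp
qed

text \<open>
  An integrable weight that dominates, up to a constant, the damped functions on all lines. Its singularities
  \<open>|t\<^sup>2 - 1|\<^bsup>-1/2\<^esup>\<close> are those of the derivative of the map onto the half-strip at the preimages of the corners.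
\<close>
definition edge_weight :: "real \<Rightarrow> real" where
  "edge_weight t = (1 + \<bar>t\<^sup>2 - 1\<bar> powr (- 1/2)) / (1 + \<bar>t\<bar>)\<^sup>2"

lemma measurable_edge_weight [measurable]: "edge_weight \<in> borel_measurable borel"
  unfolding edge_weight_def by measurable

lemma nn_integral_edge_weight_finite: "(\<integral>\<^sup>+t. ennreal (edge_weight t) \<partial>lborel) < top"
proof -
  define s where "s a t = ennreal (\<bar>t - a\<bar> powr (- 1/2)) * indicator {a - 1..a + 1} t" for a t :: real
  have [measurable]: "s a \<in> borel_measurable borel" for a unfolding s_def by measurable
  have "ennreal (edge_weight t) \<le> ennreal (2 * pi) * ennreal (poisson_kernel 1 t) + (s 1 t + s (-1) t)" for t
  proof -
    have den: "1 + t\<^sup>2 \<le> (1 + \<bar>t\<bar>)\<^sup>2" by (simp add: power2_eq_square algebra_simps)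
    have pos: "0 < 1 + t\<^sup>2" by (simp add: add_pos_nonneg)
    have one: "1 \<le> (1 + \<bar>t\<bar>)\<^sup>2" using den zero_le_power2[of t] by linarith
    define A where "A = \<bar>t\<^sup>2 - 1\<bar> powr (- 1/2)"
    have A: "0 \<le> A" by (simp add: A_def)
    have split: "edge_weight t = 1 / (1 + \<bar>t\<bar>)\<^sup>2 + A / (1 + \<bar>t\<bar>)\<^sup>2" by (simp add: edge_weight_def A_def add_divide_distrib)
    have first: "1 / (1 + \<bar>t\<bar>)\<^sup>2 \<le> 1 / (1 + t\<^sup>2)" using den pos by (intro divide_left_mono) auto
    have pk: "2 * pi * poisson_kernel 1 t = 2 / (1 + t\<^sup>2)" by (simp add: poisson_kernel_def add.commute)
    have factor: "\<bar>t\<^sup>2 - 1\<bar> = \<bar>t - 1\<bar> * \<bar>t + 1\<bar>" by (simp add: abs_mult[symmetric] power2_eq_square algebra_simps)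
    show ?thesis
    proof (cases "1 \<le> \<bar>t\<^sup>2 - 1\<bar>")
      case True
      then have "A \<le> 1" unfolding A_def using powr_mono2'[of "-1/2" 1 "\<bar>t\<^sup>2 - 1\<bar>"] by simp
      then have "A / (1 + \<bar>t\<bar>)\<^sup>2 \<le> 1 / (1 + \<bar>t\<bar>)\<^sup>2" by (intro divide_right_mono) auto
      then have "edge_weight t \<le> 2 * pi * poisson_kernel 1 t"
      proof -
        have two: "2 / (1 + t\<^sup>2) = 1 / (1 + t\<^sup>2) + 1 / (1 + t\<^sup>2)" by simp
        show ?thesis unfolding split pk two using first \<open>A / (1 + \<bar>t\<bar>)\<^sup>2 \<le> 1 / (1 + \<bar>t\<bar>)\<^sup>2\<close> by linarith
      qed
      then have "ennreal (edge_weight t) \<le> ennreal (2 * pi) * ennreal (poisson_kernel 1 t)"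
        by (subst ennreal_mult'[symmetric]) (auto intro: ennreal_leI)
      then show ?thesis by (rule order_trans) simp
    next
      case False
      then have small: "\<bar>t\<^sup>2 - 1\<bar> < 1" by simp
      have "A / (1 + \<bar>t\<bar>)\<^sup>2 \<le> A" using A one by (simp add: divide_le_eq mult_le_cancel_left1)
      moreover have "1 / (1 + t\<^sup>2) \<le> 2 / (1 + t\<^sup>2)" using pos by (intro divide_right_mono) auto
      ultimately have le: "edge_weight t \<le> 2 * pi * poisson_kernel 1 t + A" unfolding split pk using first by linarith
      have t2: "t\<^sup>2 < 2" using small by linarith
      have "\<bar>t\<bar>\<^sup>2 < 2\<^sup>2" using t2 by simp
      then have tb: "\<bar>t\<bar> < 2" by (rule power2_less_imp_less) simp
      have "ennreal A \<le> s 1 t + s (-1) t"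
      proof (cases "0 \<le> t")
        case True
        have "\<bar>t - 1\<bar> \<le> \<bar>t\<^sup>2 - 1\<bar>" unfolding factor using True by (simp add: mult_le_cancel_left1)
        then have "A \<le> \<bar>t - 1\<bar> powr (- 1/2)" unfolding A_def
          by (cases "t = 1") (auto intro!: powr_mono2')
        then have "ennreal A \<le> s 1 t" unfolding s_def using True tb by (simp add: ennreal_leI)
        then show ?thesis by (rule order_trans) simp
      next
        case False
        have "\<bar>t + 1\<bar> \<le> \<bar>t\<^sup>2 - 1\<bar>" unfolding factor using False by (simp add: mult_le_cancel_right1)
        then have "A \<le> \<bar>t - (-1)\<bar> powr (- 1/2)" unfolding A_def
          by (cases "t = -1") (auto intro!: powr_mono2')
        then have "ennreal A \<le> s (-1) t" unfolding s_def using False tb by (simp add: ennreal_leI)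
        then show ?thesis by (rule order_trans) simp
      qed
      have "ennreal (edge_weight t) \<le> ennreal (2 * pi * poisson_kernel 1 t + A)" by (rule ennreal_leI[OF le])
      also have "\<dots> = ennreal (2 * pi * poisson_kernel 1 t) + ennreal A"
        using A by (intro ennreal_plus) auto
      also have "ennreal (2 * pi * poisson_kernel 1 t) = ennreal (2 * pi) * ennreal (poisson_kernel 1 t)"
        by (rule ennreal_mult') simp
      finally have "ennreal (edge_weight t) \<le> ennreal (2 * pi) * ennreal (poisson_kernel 1 t) + ennreal A" .
      also have "\<dots> \<le> ennreal (2 * pi) * ennreal (poisson_kernel 1 t) + (s 1 t + s (-1) t)" by (rule add_left_mono) fact
      finally show ?thesis .
    qed
  qed
  then have "(\<integral>\<^sup>+t. ennreal (edge_weight t) \<partial>lborel)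
     \<le> (\<integral>\<^sup>+t. ennreal (2 * pi) * ennreal (poisson_kernel 1 t) + (s 1 t + s (-1) t) \<partial>lborel)"
    by (intro nn_integral_mono) simp
  also have "\<dots> = (\<integral>\<^sup>+t. ennreal (2 * pi) * ennreal (poisson_kernel 1 t) \<partial>lborel) + (\<integral>\<^sup>+t. s 1 t + s (-1) t \<partial>lborel)"
    by (rule nn_integral_add) measurable
  also have "(\<integral>\<^sup>+t. ennreal (2 * pi) * ennreal (poisson_kernel 1 t) \<partial>lborel) = ennreal (2 * pi)"
    by (subst nn_integral_cmult) (auto simp: nn_integral_poisson_kernel)
  also have "(\<integral>\<^sup>+t. s 1 t + s (-1) t \<partial>lborel) = (\<integral>\<^sup>+t. s 1 t \<partial>lborel) + (\<integral>\<^sup>+t. s (-1) t \<partial>lborel)"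
    by (rule nn_integral_add) measurable
  also have "ennreal (2 * pi) + ((\<integral>\<^sup>+t. s 1 t \<partial>lborel) + (\<integral>\<^sup>+t. s (-1) t \<partial>lborel)) < top"
    using nn_integral_inverse_sqrt_finite[of 1] nn_integral_inverse_sqrt_finite[of "-1"]
    unfolding s_def by (intro ennreal_add_less_top[THEN iffD2] conjI ennreal_less_top)
  finally show ?thesis .
qed

lemma borel_measurable_modify_two_points:
  fixes b :: "real \<Rightarrow> real"
  assumes "\<And>n. u n \<in> borel_measurable borel" and "\<And>x. x \<noteq> c \<Longrightarrow> x \<noteq> d \<Longrightarrow> (\<lambda>n. u n x) \<longlonglongrightarrow> b x"
  shows "b \<in> borel_measurable borel"
proof -
  note [measurable] = assms(1)
  have "(\<lambda>x. if x = c then b c else if x = d then b d else b x) \<in> borel_measurable borel"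
    by (rule borel_measurable_LIMSEQ_real[where u = "\<lambda>n x. if x = c then b c else if x = d then b d else u n x"])
      (use assms(2) in auto)
  also have "(\<lambda>x. if x = c then b c else if x = d then b d else b x) = b" by auto
  finally show ?thesis .
qed

text \<open>
  A Phragmen-Lindelof principle in the mean. After damping, the function vanishes at infinity in every half
  plane above a line of positive height, so its mean over the line of height \<open>y\<close> is at most that over lower lines, and these
  converge to the integral of the boundary function by dominated convergence. Fatou's lemma
  removes the damping. The exceptional points \<open>\<plusminus>1\<close> are the preimages of the corners of the domain.
\<close>
lemma line_mean_le_limit_upper:
  fixes h :: "complex \<Rightarrow> complex" and b :: "real \<Rightarrow> real"
  assumes h: "h holomorphic_on {z. 0 < Im z}" and p: "0 < p" and M: "0 \<le> M"
    and growth: "\<And>z. 0 < Im z \<Longrightarrow> cmod (h z) powr p \<le> M * (1 + cmod z) * (1 + cmod (z\<^sup>2 - 1) powr (- 1/2))"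
    and lim: "\<And>x. x \<noteq> 1 \<Longrightarrow> x \<noteq> -1 \<Longrightarrow> ((\<lambda>d. cmod (h (Complex x d)) powr p) \<longlongrightarrow> b x) (at_right 0)"
    and y: "0 < y"
  shows "line_mean h p y \<le> (\<integral>\<^sup>+x. ennreal (b x) \<partial>lborel)"
proof -
  define d where "d n = y / (2 + real n)" for n
  have d: "0 < d n" "d n < y" for n using y by (auto simp: d_def field_simps add_pos_nonneg)
  have d0: "filterlim d (at_right 0) sequentially"
    unfolding filterlim_at
    using d by (auto simp: d_def[abs_def] eventually_sequentially intro!: real_tendsto_divide_at_top filterlim_tendsto_add_at_top[OF tendsto_const filterlim_real_sequentially])
  have limn: "(\<lambda>n. cmod (h (Complex x (d n))) powr p) \<longlonglongrightarrow> b x" if "x \<noteq> 1" "x \<noteq> -1" for x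
    using lim[OF that] d0 by (rule filterlim_compose)
  have h_line [measurable]: "(\<lambda>x. h (Complex x t)) \<in> borel_measurable borel" if "0 < t" for t
    by (rule measurable_line[OF h]) (use that in simp)
  have [measurable]: "(\<lambda>x. h (Complex x (d n))) \<in> borel_measurable borel" for n
    by (rule h_line) (rule d)
  have [measurable]: "b \<in> borel_measurable borel"
    by (rule borel_measurable_modify_two_points[where u = "\<lambda>n x. cmod (h (Complex x (d n))) powr p", OF _ limn]) measurable
  (* k * p >= 3 turns the growth 1 + |z| of |h|^p into the decay (1 + |z|)^-2. *)
  define k where "k = nat \<lceil>3 / p\<rceil>"
  have k: "3 \<le> real k * p"
  proof -
    have "3 / p \<le> real k" unfolding k_def by linarith
    then show ?thesis using p by (simp add: field_simps)
  qed
  define E where "E e z = 1 - \<i> * of_real e * z" for e :: real and z :: complex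
  define f where "f e z = h z / E e z ^ k" for e z
  have E: "1 \<le> cmod (E e z)" "min 1 e / 2 * (1 + cmod z) \<le> cmod (E e z)" if "0 < e" "0 \<le> Im z" for e z
    using damping_factor[OF that] by (auto simp: E_def)
  have f_powr: "cmod (f e z) powr p = cmod (h z) powr p * cmod (E e z) powr (- (real k * p))" if "0 < e" "0 < Im z" for e z
  proof -
    have "0 < cmod (E e z)" using E(1)[of e z] that by linarith
    then have "cmod (f e z) = cmod (h z) / cmod (E e z) powr real k"
      by (simp add: f_def norm_divide norm_power powr_realpow)
    then show ?thesis by (simp add: powr_divide powr_powr powr_minus_divide)
  qed
  have f_le_h: "cmod (f e z) powr p \<le> cmod (h z) powr p" if "0 < e" "0 < Im z" for e z
  proof -
    have "cmod (E e z) powr (- (real k * p)) \<le> cmod (E e z) powr 0"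
      using E(1)[of e z] that k by (intro powr_mono) auto
    then have "cmod (E e z) powr (- (real k * p)) \<le> 1" using E(1)[of e z] that by (simp split: if_splits)
    then show ?thesis unfolding f_powr[OF that] by (intro mult_left_le) auto
  qed
  have f_le: "cmod (f e z) powr p \<le> M * (min 1 e / 2) powr (-3) * ((1 + cmod (z\<^sup>2 - 1) powr (- 1/2)) / (1 + cmod z)\<^sup>2)"
    if e: "0 < e" and z: "0 < Im z" for e z
  proof -
    have c: "0 < min 1 e / 2" using e by simp
    have "cmod (E e z) powr (- (real k * p)) \<le> cmod (E e z) powr (-3)"
      using E(1)[of e z] e z k by (intro powr_mono) auto
    also have "\<dots> \<le> (min 1 e / 2 * (1 + cmod z)) powr (-3)"
      using E(2)[of e z] c e z by (intro powr_mono2') (auto intro!: mult_pos_pos add_pos_nonneg)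
    also have "\<dots> = (min 1 e / 2) powr (-3) * (1 + cmod z) powr (-3)"
      by (rule powr_mult)
    finally have "cmod (f e z) powr p
      \<le> (M * (1 + cmod z) * (1 + cmod (z\<^sup>2 - 1) powr (- 1/2))) * ((min 1 e / 2) powr (-3) * (1 + cmod z) powr (-3))"
      unfolding f_powr[OF e z] using growth[OF z] M by (intro mult_mono) auto
    also have "\<dots> = M * (min 1 e / 2) powr (-3) * ((1 + cmod (z\<^sup>2 - 1) powr (- 1/2)) * ((1 + cmod z) * (1 + cmod z) powr (-3)))"
      by (simp only: ac_simps)
    also have "(1 + cmod z) * (1 + cmod z) powr (-3) = 1 / (1 + cmod z)\<^sup>2"
    proof -
      have pos: "0 < 1 + cmod z" by (simp add: add_pos_nonneg)
      have "(1 + cmod z) powr (-3) = 1 / (1 + cmod z) ^ 3"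
        using pos by (simp add: powr_minus_divide powr_numeral)
      then show ?thesis using pos by (simp add: power2_eq_square power3_eq_cube)
    qed
    also have "(1 + cmod (z\<^sup>2 - 1) powr (- 1/2)) * (1 / (1 + cmod z)\<^sup>2) = (1 + cmod (z\<^sup>2 - 1) powr (- 1/2)) / (1 + cmod z)\<^sup>2"
      by simp
    finally show ?thesis .
  qed
  have holo_f: "f e holomorphic_on {z. 0 < Im z}" if "0 < e" for e
    unfolding f_def
  proof (intro holomorphic_intros h)
    fix z assume z: "z \<in> {z. 0 < Im z}"
    have "1 \<le> cmod (E e z)" using E(1)[of e z] that z by simp
    then show "E e z ^ k \<noteq> 0" by auto
  qed (simp add: E_def, intro holomorphic_intros)
  have step: "line_mean (f e) p y \<le> (\<integral>\<^sup>+x. ennreal (b x) \<partial>lborel)" if e: "0 < e" for e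
  proof -
    define C where "C = M * (min 1 e / 2) powr (-3)"
    have C: "0 \<le> C" using M by (simp add: C_def)
    note fC = f_le[OF e, folded C_def]
    have f_line [measurable]: "(\<lambda>x. f e (Complex x t)) \<in> borel_measurable borel" if "0 < t" for t
      by (rule measurable_line[OF holo_f[OF e]]) (use that in simp)
    have [measurable]: "(\<lambda>x. f e (Complex x (d n))) \<in> borel_measurable borel" for n
      by (rule f_line) (rule d)
    have shift: "line_mean (f e) p y \<le> line_mean (f e) p (d n)" for n
    proof -
      let ?g = "\<lambda>z. f e (z + \<i> * of_real (d n))"
      have "line_mean ?g p (y - d n) \<le> line_mean ?g p 0"
      proof (rule line_mean_le_boundary[OF _ _ _ p])
        show "?g holomorphic_on {z. - d n < Im z}"
          by (rule holomorphic_on_compose_gen[OF _ holo_f[OF e], unfolded o_def]) (auto intro!: holomorphic_intros)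
        show "open {z. - d n < Im z}" by (rule open_halfspace_Im_gt)
        show "{z. 0 \<le> Im z} \<subseteq> {z. - d n < Im z}" using d(1)[of n] by auto
        show "0 < y - d n" using d(2)[of n] by simp
        fix \<eta> :: real assume \<eta>: "0 < \<eta>"
        define B where "B = C * (1 + 1 / d n)"
        have B: "0 \<le> B" using C d(1)[of n] by (simp add: B_def)
        have bound: "cmod (f e w) powr p \<le> B / (1 + cmod w)\<^sup>2" if w: "d n \<le> Im w" for w
        proof -
          have Imw: "0 < Im w" using w d(1)[of n] by linarith
          have "d n \<le> cmod (w - 1)" "d n \<le> cmod (w + 1)"
            using w abs_Im_le_cmod[of "w - 1"] abs_Im_le_cmod[of "w + 1"] by auto
          then have "d n * d n \<le> cmod (w - 1) * cmod (w + 1)" using d(1)[of n] by (intro mult_mono) auto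
          also have "\<dots> = cmod (w\<^sup>2 - 1)" by (simp add: norm_mult[symmetric] power2_eq_square algebra_simps)
          finally have "cmod (w\<^sup>2 - 1) powr (- 1/2) \<le> (d n * d n) powr (- 1/2)"
            using d(1)[of n] by (intro powr_mono2') auto
          also have "\<dots> = 1 / d n" using d(1)[of n] by (simp add: powr_mult powr_add[symmetric] powr_minus_divide)
          finally have "(1 + cmod (w\<^sup>2 - 1) powr (- 1/2)) / (1 + cmod w)\<^sup>2 \<le> (1 + 1 / d n) / (1 + cmod w)\<^sup>2"
            by (intro divide_right_mono) auto
          then have "C * ((1 + cmod (w\<^sup>2 - 1) powr (- 1/2)) / (1 + cmod w)\<^sup>2) \<le> C * ((1 + 1 / d n) / (1 + cmod w)\<^sup>2)"
            using C by (rule mult_left_mono)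
          then show ?thesis using fC[OF Imw] by (simp add: B_def)
        qed
        define R where "R = B / \<eta> powr p + d n + 1"
        have "cmod (?g z) < \<eta>" if z: "0 \<le> Im z" "R \<le> cmod z" for z
        proof -
          let ?w = "z + \<i> * of_real (d n)"
          have "cmod z - d n \<le> cmod ?w" using norm_diff_ineq[of z "\<i> * of_real (d n)"] d(1)[of n] by (simp add: norm_mult)
          then have w: "B / \<eta> powr p + 1 \<le> cmod ?w" using z(2) by (simp add: R_def)
          have Bn: "0 \<le> B / \<eta> powr p" using B by simp
          have one: "1 \<le> 1 + cmod ?w" by simp
          have "B / \<eta> powr p < 1 + cmod ?w" using w by linarith
          also have "\<dots> \<le> (1 + cmod ?w)\<^sup>2" using one by (rule self_le_power) simp
          finally have lt: "B / \<eta> powr p < (1 + cmod ?w)\<^sup>2" .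
          have "0 < \<eta> powr p" using \<eta> by simp
          moreover have "0 < (1 + cmod ?w)\<^sup>2" using one by (intro zero_less_power) linarith
          ultimately have "B / (1 + cmod ?w)\<^sup>2 < \<eta> powr p"
            using lt by (simp only: pos_divide_less_eq mult.commute)
          moreover have "cmod (f e ?w) powr p \<le> B / (1 + cmod ?w)\<^sup>2" using z(1) by (intro bound) simp
          ultimately have small: "cmod (f e ?w) powr p < \<eta> powr p" by linarith
          show ?thesis
          proof (rule ccontr)
            assume "\<not> cmod (?g z) < \<eta>"
            then have "\<eta> powr p \<le> cmod (f e ?w) powr p" using p \<eta> by (intro powr_mono2) auto
            then show False using small by simp
          qed
        qed
        then show "\<exists>R. \<forall>z. 0 \<le> Im z \<and> R \<le> cmod z \<longrightarrow> cmod (?g z) < \<eta>" by blast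
      qed
      moreover have "Complex x t + \<i> * of_real (d n) = Complex x (t + d n)" for x t by (simp add: complex_eq_iff)
      ultimately show ?thesis by (simp add: line_mean_def)
    qed
    define be where "be x = b x * cmod (E e (of_real x)) powr (- (real k * p))" for x
    have [measurable]: "be \<in> borel_measurable borel" unfolding be_def E_def by measurable
    have "(\<lambda>n. line_mean (f e) p (d n)) \<longlonglongrightarrow> (\<integral>\<^sup>+x. ennreal (be x) \<partial>lborel)"
      unfolding line_mean_def
    proof (rule nn_integral_dominated_convergence[where w = "\<lambda>t. ennreal C * ennreal (edge_weight t)"])
      have "(\<integral>\<^sup>+t. ennreal C * ennreal (edge_weight t) \<partial>lborel) = ennreal C * (\<integral>\<^sup>+t. ennreal (edge_weight t) \<partial>lborel)"
        by (rule nn_integral_cmult) measurable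
      also have "\<dots> < \<infinity>" using nn_integral_edge_weight_finite by (simp add: ennreal_mult_less_top)
      finally show "(\<integral>\<^sup>+t. ennreal C * ennreal (edge_weight t) \<partial>lborel) < \<infinity>" .
      have AE: "AE x in lborel. x \<noteq> 1 \<and> x \<noteq> -1"
        by (rule AE_conjI[OF AE_lborel_singleton AE_lborel_singleton])
      show "AE x in lborel. (\<lambda>n. ennreal (cmod (f e (Complex x (d n))) powr p)) \<longlonglongrightarrow> ennreal (be x)"
        using AE
      proof eventually_elim
        case (elim x)
        have "(\<lambda>n. Complex x (d n)) \<longlonglongrightarrow> of_real x"
        proof -
          have "d \<longlonglongrightarrow> 0" using d0 by (simp add: filterlim_at)
          then have "(\<lambda>n. of_real x + \<i> * of_real (d n)) \<longlonglongrightarrow> of_real x + \<i> * of_real 0"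
            by (intro tendsto_intros)
          then show ?thesis by (simp add: Complex_eq)
        qed
        then have "(\<lambda>n. E e (Complex x (d n))) \<longlonglongrightarrow> E e (of_real x)"
          unfolding E_def by (intro tendsto_intros)
        moreover have "E e (of_real x) \<noteq> 0" using E(1)[of e "of_real x"] e by auto
        ultimately have "(\<lambda>n. cmod (h (Complex x (d n))) powr p * cmod (E e (Complex x (d n))) powr (- (real k * p))) \<longlonglongrightarrow> be x"
          unfolding be_def using limn elim by (intro tendsto_intros) auto
        then show ?case using d(1) by (simp add: f_powr[OF e])
      qed
      show "AE x in lborel. ennreal (cmod (f e (Complex x (d n))) powr p) \<le> ennreal C * ennreal (edge_weight x)" for n
        using AE
      proof eventually_elim
        case (elim x)
        let ?z = "Complex x (d n)"
        have "\<bar>x\<bar> \<le> cmod ?z" using abs_Re_le_cmod[of ?z] by simp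
        moreover have "\<bar>x\<^sup>2 - 1\<bar> \<le> cmod (?z\<^sup>2 - 1)"
        proof -
          have "\<bar>x - 1\<bar> \<le> cmod (?z - 1)" "\<bar>x + 1\<bar> \<le> cmod (?z + 1)"
            using abs_Re_le_cmod[of "?z - 1"] abs_Re_le_cmod[of "?z + 1"] by auto
          then have "\<bar>x - 1\<bar> * \<bar>x + 1\<bar> \<le> cmod (?z - 1) * cmod (?z + 1)" by (intro mult_mono) auto
          moreover have "\<bar>x - 1\<bar> * \<bar>x + 1\<bar> = \<bar>x\<^sup>2 - 1\<bar>" by (simp add: abs_mult[symmetric] power2_eq_square algebra_simps)
          moreover have "cmod (?z - 1) * cmod (?z + 1) = cmod (?z\<^sup>2 - 1)" by (simp only: norm_mult[symmetric]) (simp add: power2_eq_square algebra_simps)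
          ultimately show ?thesis by simp
        qed
        moreover have "0 < \<bar>x\<^sup>2 - 1\<bar>" using elim by (auto simp: power2_eq_1_iff)
        ultimately have "(1 + cmod (?z\<^sup>2 - 1) powr (- 1/2)) / (1 + cmod ?z)\<^sup>2 \<le> edge_weight x"
          unfolding edge_weight_def
          by (intro frac_le add_left_mono powr_mono2' power_mono zero_less_power add_nonneg_nonneg add_pos_nonneg) auto
        then have "C * ((1 + cmod (?z\<^sup>2 - 1) powr (- 1/2)) / (1 + cmod ?z)\<^sup>2) \<le> C * edge_weight x"
          using C by (rule mult_left_mono)
        then have "cmod (f e ?z) powr p \<le> C * edge_weight x" using fC[of ?z] d(1)[of n] by simp
        then show ?case using C by (simp add: ennreal_mult'[symmetric] ennreal_leI)
      qed
    qed measurable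
    then have "line_mean (f e) p y \<le> (\<integral>\<^sup>+x. ennreal (be x) \<partial>lborel)"
      using shift by (intro LIMSEQ_le_const) auto
    also have "\<dots> \<le> (\<integral>\<^sup>+x. ennreal (b x) \<partial>lborel)"
    proof (intro nn_integral_mono_AE)
      show "AE x in lborel. ennreal (be x) \<le> ennreal (b x)"
        using AE_conjI[OF AE_lborel_singleton[of "1::real"] AE_lborel_singleton[of "-1::real"]]
      proof eventually_elim
        case (elim x)
        have "0 \<le> b x" using limn[of x] elim by (intro LIMSEQ_le_const[of _ "b x" 0]) auto
        moreover have "cmod (E e (of_real x)) powr (- (real k * p)) \<le> cmod (E e (of_real x)) powr 0"
          using E(1)[of e "of_real x"] e k by (intro powr_mono) auto
        then have "cmod (E e (of_real x)) powr (- (real k * p)) \<le> 1"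
          using E(1)[of e "of_real x"] e by (simp split: if_splits)
        ultimately show ?case unfolding be_def by (intro ennreal_leI mult_left_le) auto
      qed
    qed
    finally show ?thesis .
  qed
  define en where "en n = inverse (real (Suc n))" for n
  have en: "0 < en n" for n by (simp add: en_def)
  have fy [measurable]: "(\<lambda>x. f (en n) (Complex x y)) \<in> borel_measurable borel" for n
    by (rule measurable_line[OF holo_f[OF en]]) (use y in simp)
  show ?thesis
    unfolding line_mean_def
  proof (rule nn_integral_fatou_bound[where u = "\<lambda>n x. ennreal (cmod (f (en n) (Complex x y)) powr p)"])
    show "(\<integral>\<^sup>+x. ennreal (cmod (f (en n) (Complex x y)) powr p) \<partial>lborel) \<le> (\<integral>\<^sup>+x. ennreal (b x) \<partial>lborel)" for n
      using step[OF en[of n]] by (simp add: line_mean_def)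
    show "AE x in lborel. (\<lambda>n. ennreal (cmod (f (en n) (Complex x y)) powr p)) \<longlonglongrightarrow> ennreal (cmod (h (Complex x y)) powr p)"
    proof (intro AE_I2 tendsto_ennrealI)
      fix x
      have "(\<lambda>n. E (en n) (Complex x y)) \<longlonglongrightarrow> 1 - \<i> * of_real 0 * Complex x y"
        unfolding E_def en_def by (intro tendsto_intros LIMSEQ_inverse_real_of_nat)
      then have "(\<lambda>n. cmod (h (Complex x y)) powr p * cmod (E (en n) (Complex x y)) powr (- (real k * p)))
          \<longlonglongrightarrow> cmod (h (Complex x y)) powr p * cmod (1::complex) powr (- (real k * p))"
        by (intro tendsto_intros) auto
      then show "(\<lambda>n. cmod (f (en n) (Complex x y)) powr p) \<longlonglongrightarrow> cmod (h (Complex x y)) powr p"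
        using y by (simp add: f_powr[OF en])
    qed
  qed measurable
qed

section \<open>Arc length on monotone curves as a Carleson measure\<close>

text \<open>
  A square of half side \<open>Im z / 2\<close> around \<open>z\<close> meets only lines of positive height, each of which
  contributes at most \<open>N\<close> to the integral over the square.
\<close>
lemma line_mean_pointwise_bound:
  fixes f :: "complex \<Rightarrow> complex"
  assumes f: "f holomorphic_on {z. 0 < Im z}" and p: "0 < p" and N: "0 \<le> N"
    and bound: "\<And>y. 0 < y \<Longrightarrow> line_mean f p y \<le> ennreal N"
  obtains C where "0 \<le> C" "\<And>z. 0 < Im z \<Longrightarrow> cmod (f z) powr p \<le> C / Im z"
proof -
  obtain C where C: "0 < C" "\<And>F w R. F holomorphic_on square w R \<Longrightarrow> 0 < R \<Longrightarrow>
     ennreal (cmod (F w) powr p) \<le> ennreal (C / R\<^sup>2) * square_integral (\<lambda>z. cmod (F z) powr p) w R"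
    using powr_submean_square[OF p] by metis
  show thesis
  proof (rule that)
    show "0 \<le> 4 * C * N" using C N by simp
    fix z assume z: "0 < Im z"
    define R where "R = Im z / 2"
    have R: "0 < R" using z by (simp add: R_def)
    have sub: "square z R \<subseteq> {z. 0 < Im z}"
    proof
      fix x assume "x \<in> square z R"
      then have "\<bar>Im x - Im z\<bar> \<le> Im z / 2" by (simp add: square_def R_def)
      then show "x \<in> {z. 0 < Im z}" using z unfolding abs_le_iff mem_Collect_eq by linarith
    qed
    have "square_integral (\<lambda>z. cmod (f z) powr p) z R
      \<le> (\<integral>\<^sup>+y. ennreal N * indicator {Im z - R..Im z + R} y \<partial>lborel)"
      unfolding square_integral_def
    proof (rule nn_integral_mono)
      fix y
      show "(\<integral>\<^sup>+x. ennreal (cmod (f (Complex x y)) powr p) * indicator (square z R) (Complex x y) \<partial>lborel)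
        \<le> ennreal N * indicator {Im z - R..Im z + R} y"
      proof (cases "y \<in> {Im z - R..Im z + R}")
        case True
        then have "0 < y" using z by (simp add: R_def)
        have "(\<integral>\<^sup>+x. ennreal (cmod (f (Complex x y)) powr p) * indicator (square z R) (Complex x y) \<partial>lborel) \<le> line_mean f p y"
          unfolding line_mean_def by (intro nn_integral_mono) (auto split: split_indicator)
        also have "\<dots> \<le> ennreal N" by (rule bound) fact
        finally show ?thesis using True by simp
      next
        case False
        then have "Complex x y \<notin> square z R" for x by (auto simp: square_def abs_le_iff)
        then show ?thesis by simp
      qed
    qed
    also have "\<dots> = ennreal N * ennreal (2 * R)" using R by (subst nn_integral_cmult_indicator) auto
    finally have I: "square_integral (\<lambda>z. cmod (f z) powr p) z R \<le> ennreal N * ennreal (2 * R)" .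
    have "ennreal (cmod (f z) powr p) \<le> ennreal (C / R\<^sup>2) * square_integral (\<lambda>z. cmod (f z) powr p) z R"
      by (rule C(2)[OF holomorphic_on_subset[OF f sub] R])
    also have "\<dots> \<le> ennreal (C / R\<^sup>2) * (ennreal N * ennreal (2 * R))"
      using I by (rule mult_left_mono) simp
    also have "\<dots> = ennreal (C / R\<^sup>2 * (N * (2 * R)))"
      using C R N by (subst ennreal_mult'[symmetric], simp, subst ennreal_mult'[symmetric], auto)
    also have "C / R\<^sup>2 * (N * (2 * R)) = 4 * C * N / Im z"
      using z by (simp add: R_def power2_eq_square field_simps)
    finally show "cmod (f z) powr p \<le> 4 * C * N / Im z"
      using C N z by (subst (asm) ennreal_le_iff) auto
  qed
qed

lemma poisson_kernel_le_skew:
  assumes "0 < y" "\<bar>k\<bar> = 1"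
  shows "poisson_kernel y w \<le> 3 * poisson_kernel y (w + k * y)"
proof -
  have k2: "k * k = 1" using assms(2) by (metis abs_mult_self_eq mult_1_right)
  have "(w + k * y)\<^sup>2 + (w - k * y)\<^sup>2 = 2 * w\<^sup>2 + 2 * (k * k) * y\<^sup>2" by (simp add: power2_eq_square algebra_simps)
  moreover have "0 \<le> (w - k * y)\<^sup>2" "0 \<le> w\<^sup>2" by simp_all
  ultimately have "(w + k * y)\<^sup>2 + y\<^sup>2 \<le> 3 * w\<^sup>2 + 3 * y\<^sup>2" unfolding k2 by linarith
  then have le: "(w + k * y)\<^sup>2 + y\<^sup>2 \<le> 3 * (w\<^sup>2 + y\<^sup>2)" by simp
  have pos: "0 < (w + k * y)\<^sup>2 + y\<^sup>2" "0 < w\<^sup>2 + y\<^sup>2" using assms by (simp_all add: add_nonneg_pos)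
  have "y / (w\<^sup>2 + y\<^sup>2) \<le> y * 3 / ((w + k * y)\<^sup>2 + y\<^sup>2)"
  proof -
    have "y * 3 / (3 * (w\<^sup>2 + y\<^sup>2)) \<le> y * 3 / ((w + k * y)\<^sup>2 + y\<^sup>2)"
      using pos assms by (intro divide_left_mono[OF le]) auto
    moreover have "y * 3 / (3 * A) = y / A" for A :: real by simp
    ultimately show ?thesis by (simp only:)
  qed
  then have "y / (w\<^sup>2 + y\<^sup>2) / pi \<le> y * 3 / ((w + k * y)\<^sup>2 + y\<^sup>2) / pi"
    by (rule divide_right_mono) simp
  then show ?thesis by (simp add: poisson_kernel_def mult.commute)
qed

text \<open>
  The curve \<open>Z\<close> is parametrized by \<open>x = Re + k * Im\<close>. Moving the pole of the Poisson kernel horizontally by its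
  height costs a factor 3, so \<open>|f (Z x)|\<^bsup>p/2\<^esup>\<close> is at most three times a Poisson integral at height \<open>Im (Z x)\<close> above
  the point \<open>x\<close> itself, to which the \<open>L\<^sup>2\<close> estimate on graphs applies; \<open>576 = 3\<^sup>2 * 64\<close>.
\<close>
lemma nn_integral_on_skew_graph:
  fixes f :: "complex \<Rightarrow> complex" and Z :: "real \<Rightarrow> complex"
  assumes f: "f holomorphic_on U" and U: "open U" "{z. 0 \<le> Im z} \<subseteq> U" and p: "0 < p"
    and vanish: "\<And>e. 0 < e \<Longrightarrow> \<exists>R. \<forall>z. 0 \<le> Im z \<and> R \<le> cmod z \<longrightarrow> cmod (f z) < e"
    and k: "\<bar>k\<bar> = 1" and Z: "continuous_on UNIV Z" and c: "0 < c" "\<And>x. c \<le> Im (Z x)"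
    and skew: "\<And>x. x \<in> {a..b} \<Longrightarrow> x = Re (Z x) + k * Im (Z x)"
  shows "(\<integral>\<^sup>+x. ennreal (cmod (f (Z x)) powr p) * indicator {a..b} x \<partial>lborel) \<le> 576 * line_mean f p 0"
proof -
  define y where "y x = Im (Z x)" for x
  have y: "0 < y x" "c \<le> y x" for x using c(1) c(2)[of x] by (auto simp: y_def)
  have [measurable]: "y \<in> borel_measurable borel"
    unfolding y_def using Z by (intro borel_measurable_continuous_onI continuous_intros)
  define g where "g t = ennreal (cmod (f (of_real t)) powr (p/2))" for t :: real
  have "(\<lambda>t. f (Complex t 0)) \<in> borel_measurable borel"
    by (rule measurable_line[OF f]) (use U in auto)
  then have [measurable]: "(\<lambda>t. f (of_real t)) \<in> borel_measurable borel" by (simp add: complex_of_real_def)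
  have [measurable]: "g \<in> borel_measurable borel" unfolding g_def by measurable
  let ?P = "\<lambda>x. \<integral>\<^sup>+t. ennreal (poisson_kernel (y x) (x - t)) * g t \<partial>lborel"
  have half: "cmod w powr p = (cmod w powr (p/2))\<^sup>2" for w :: complex
    by (simp add: power2_eq_square powr_add[symmetric])
  have pt: "ennreal (cmod (f (Z x)) powr p) \<le> 9 * (?P x)\<^sup>2" if x: "x \<in> {a..b}" for x
  proof -
    have "ennreal (cmod (f (Z x)) powr (p/2))
      \<le> (\<integral>\<^sup>+t. ennreal (poisson_kernel (y x) (Re (Z x) - t)) * g t \<partial>lborel)"
      unfolding g_def y_def using y(1)[of x] p
      by (intro poisson_majorant[OF f U _ vanish]) (auto simp: y_def)
    also have "\<dots> \<le> (\<integral>\<^sup>+t. 3 * (ennreal (poisson_kernel (y x) (x - t)) * g t) \<partial>lborel)"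
    proof (rule nn_integral_mono)
      fix t
      have "poisson_kernel (y x) (Re (Z x) - t) \<le> 3 * poisson_kernel (y x) (Re (Z x) - t + k * y x)"
        by (rule poisson_kernel_le_skew[OF y(1) k])
      also have "Re (Z x) - t + k * y x = x - t" using skew[OF x] by (simp add: y_def)
      finally have "ennreal (poisson_kernel (y x) (Re (Z x) - t)) \<le> ennreal (3 * poisson_kernel (y x) (x - t))"
        by (rule ennreal_leI)
      also have "\<dots> = 3 * ennreal (poisson_kernel (y x) (x - t))" by (simp add: ennreal_mult')
      finally have "ennreal (poisson_kernel (y x) (Re (Z x) - t)) * g t \<le> 3 * ennreal (poisson_kernel (y x) (x - t)) * g t"
        by (rule mult_right_mono) simp
      then show "ennreal (poisson_kernel (y x) (Re (Z x) - t)) * g t \<le> 3 * (ennreal (poisson_kernel (y x) (x - t)) * g t)"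
        by (simp only: mult.assoc)
    qed
    also have "\<dots> = 3 * ?P x" by (rule nn_integral_cmult) measurable
    finally have "(ennreal (cmod (f (Z x)) powr (p/2)))\<^sup>2 \<le> (3 * ?P x)\<^sup>2" by (rule power_mono) simp
    then show ?thesis unfolding half[of "f (Z x)"] by (simp add: ennreal_power power_mult_distrib)
  qed
  have "(\<integral>\<^sup>+x. ennreal (cmod (f (Z x)) powr p) * indicator {a..b} x \<partial>lborel)
     \<le> (\<integral>\<^sup>+x. 9 * ((?P x)\<^sup>2 * indicator {a..b} x) \<partial>lborel)"
    using pt by (intro nn_integral_mono) (auto split: split_indicator)
  also have "\<dots> = 9 * (\<integral>\<^sup>+x. (?P x)\<^sup>2 * indicator {a..b} x \<partial>lborel)"
    by (rule nn_integral_cmult) measurable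
  also have "\<dots> \<le> 9 * (64 * (\<integral>\<^sup>+t. (g t)\<^sup>2 \<partial>lborel))"
    by (intro mult_left_mono poisson_square_integral_on_graph[OF c(1) y(2)]) auto
  also have "(\<integral>\<^sup>+t. (g t)\<^sup>2 \<partial>lborel) = line_mean f p 0"
    unfolding line_mean_def g_def half
    by (intro nn_integral_cong) (simp add: ennreal_power complex_of_real_def)
  finally show ?thesis by (simp add: mult.assoc[symmetric])
qed

text \<open>
  Along the curve \<open>Re z\<close> and \<open>k * Im z\<close> increase, so \<open>\<tau> = Re z + k * Im z\<close> increases at least as fast as arc
  length and may replace it as parameter; in the parameter \<open>\<tau>\<close> the curve is a skew graph. The decay
  required there is arranged by shifting \<open>f\<close> upwards, which makes it bounded, and damping it.
\<close>
lemma carleson_monotone_curve_upper: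
  fixes f :: "complex \<Rightarrow> complex" and z z' :: "real \<Rightarrow> complex"
  assumes f: "f holomorphic_on {z. 0 < Im z}" and p: "0 < p"
    and bound: "\<And>y. 0 < y \<Longrightarrow> line_mean f p y \<le> N"
    and z: "\<And>u. u \<in> {a..b} \<Longrightarrow> (z has_vector_derivative z' u) (at u)" and z': "continuous_on {a..b} z'"
    and k: "\<bar>k\<bar> = 1" and quadrant: "\<And>u. u \<in> {a..b} \<Longrightarrow> 0 \<le> Re (z' u) \<and> 0 \<le> k * Im (z' u) \<and> z' u \<noteq> 0"
    and upper: "\<And>u. u \<in> {a..b} \<Longrightarrow> 0 < Im (z u)" and ab: "a \<le> b"
  shows "(\<integral>\<^sup>+u. ennreal (cmod (f (z u)) powr p * cmod (z' u)) * indicator {a..b} u \<partial>lborel) \<le> 576 * N"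
proof (cases "N = top")
  case True
  then show ?thesis by (simp add: ennreal_mult_top)
next
  case False
  then obtain Nr where Nr: "N = ennreal Nr" "0 \<le> Nr" by (cases N) auto
  define \<tau> where "\<tau> u = Re (z u) + k * Im (z u)" for u
  define \<tau>' where "\<tau>' u = Re (z' u) + k * Im (z' u)" for u
  have k_cases: "k = 1 \<or> k = -1" using k by linarith
  have cont_z: "continuous_on {a..b} z"
    by (intro continuous_at_imp_continuous_on ballI) (rule has_vector_derivative_continuous, rule z)
  have \<tau>_deriv: "(\<tau> has_real_derivative \<tau>' u) (at u)" if "u \<in> {a..b}" for u
  proof -
    have "((\<lambda>u. Re (z u)) has_vector_derivative Re (z' u)) (at u)"
      "((\<lambda>u. Im (z u)) has_vector_derivative Im (z' u)) (at u)"
      by (rule bounded_linear.has_vector_derivative[OF bounded_linear_Re z[OF that]],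
          rule bounded_linear.has_vector_derivative[OF bounded_linear_Im z[OF that]])
    then show ?thesis unfolding \<tau>_def \<tau>'_def has_real_derivative_iff_has_vector_derivative
      by (intro derivative_intros has_vector_derivative_mult_right)
  qed
  have \<tau>'_ge: "cmod (z' u) \<le> \<tau>' u" and \<tau>'_pos: "0 < \<tau>' u" if "u \<in> {a..b}" for u
  proof -
    have "\<bar>Im (z' u)\<bar> = k * Im (z' u)" "\<bar>Re (z' u)\<bar> = Re (z' u)" using quadrant[OF that] k_cases by auto
    then show "cmod (z' u) \<le> \<tau>' u" using cmod_le[of "z' u"] by (simp add: \<tau>'_def)
    moreover have "0 < cmod (z' u)" using quadrant[OF that] by simp
    ultimately show "0 < \<tau>' u" by linarith
  qed
  have cont_\<tau>: "continuous_on {a..b} \<tau>" unfolding \<tau>_def using cont_z by (intro continuous_intros)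
  have cont_\<tau>': "continuous_on {a..b} \<tau>'" unfolding \<tau>'_def using z' by (intro continuous_intros)
  have \<tau>_less: "\<tau> u < \<tau> v" if "a \<le> u" "u < v" "v \<le> b" for u v
    using that \<tau>_deriv \<tau>'_pos by (intro DERIV_pos_imp_increasing[of u v \<tau>]) (auto, meson atLeastAtMost_iff order_trans)
  have inj: "inj_on \<tau> {a..b}"
    by (rule inj_onI) (metis \<tau>_less atLeastAtMost_iff less_irrefl linorder_neqE_linordered_idom)
  (* The inverse of tau, extended by constants so that the curve is continuous on the whole line. *)
  define \<theta> where "\<theta> x = the_inv_into {a..b} \<tau> (max (\<tau> a) (min (\<tau> b) x))" for x
  have \<tau>ab: "\<tau> a \<le> \<tau> b" using \<tau>_less[of a b] ab by (cases "a = b") auto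
  have image: "\<tau> ` {a..b} = {\<tau> a..\<tau> b}"
  proof
    show "\<tau> ` {a..b} \<subseteq> {\<tau> a..\<tau> b}"
    proof (rule image_subsetI)
      fix u assume "u \<in> {a..b}"
      then show "\<tau> u \<in> {\<tau> a..\<tau> b}" using \<tau>_less[of a u] \<tau>_less[of u b] by (cases "u = a"; cases "u = b") auto
    qed
    show "{\<tau> a..\<tau> b} \<subseteq> \<tau> ` {a..b}"
      using IVT'[of \<tau> a _ b] ab cont_\<tau> by fastforce
  qed
  have clamp: "max (\<tau> a) (min (\<tau> b) x) \<in> \<tau> ` {a..b}" for x unfolding image using \<tau>ab by auto
  have \<theta>_mem: "\<theta> x \<in> {a..b}" for x
    unfolding \<theta>_def by (rule the_inv_into_into[OF inj clamp order_refl])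
  have \<theta>_\<tau>: "\<theta> (\<tau> u) = u" if "u \<in> {a..b}" for u
  proof -
    have "max (\<tau> a) (min (\<tau> b) (\<tau> u)) = \<tau> u"
    proof -
      have "\<tau> u \<in> {\<tau> a..\<tau> b}" using image that by blast
      then show ?thesis by simp
    qed
    then show ?thesis unfolding \<theta>_def using the_inv_into_f_f[OF inj that] by simp
  qed
  have \<tau>_\<theta>: "\<tau> (\<theta> x) = x" if "x \<in> {\<tau> a..\<tau> b}" for x
  proof -
    have "max (\<tau> a) (min (\<tau> b) x) = x" using that by auto
    then show ?thesis unfolding \<theta>_def using f_the_inv_into_f[OF inj, of x] that image by simp
  qed
  have cont_inv: "continuous_on (\<tau> ` {a..b}) (the_inv_into {a..b} \<tau>)"
    by (rule continuous_on_inv[OF cont_\<tau>]) (use the_inv_into_f_f[OF inj] in auto)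
  have cont_\<theta>: "continuous_on UNIV \<theta>"
    unfolding \<theta>_def by (rule continuous_on_compose2[OF cont_inv]) (use clamp in \<open>auto intro!: continuous_intros\<close>)
  define Z where "Z x = z (\<theta> x)" for x
  have cont_Z: "continuous_on UNIV Z"
    unfolding Z_def by (rule continuous_on_compose2[OF cont_z cont_\<theta>]) (use \<theta>_mem in auto)
  obtain c where c: "0 < c" "\<And>x. c \<le> Im (Z x)"
  proof -
    have "continuous_on {a..b} (\<lambda>u. Im (z u))" using cont_z by (intro continuous_intros)
    then obtain u0 where u0: "u0 \<in> {a..b}" "\<forall>u\<in>{a..b}. Im (z u0) \<le> Im (z u)"
      using continuous_attains_inf[of "{a..b}" "\<lambda>u. Im (z u)"] ab by fastforce
    show thesis
    proof (rule that)
      show "0 < Im (z u0)" by (rule upper[OF u0(1)])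
      show "Im (z u0) \<le> Im (Z x)" for x unfolding Z_def using u0(2) \<theta>_mem by blast
    qed
  qed
  have skew: "x = Re (Z x) + k * Im (Z x)" if "x \<in> {\<tau> a..\<tau> b}" for x
    using \<tau>_\<theta>[OF that] by (simp add: \<tau>_def Z_def)
  define W where "W x = cmod (f (Z x)) powr p" for x
  have cont_W: "continuous_on UNIV W"
  proof -
    have "continuous_on UNIV (\<lambda>x. f (Z x))"
      using upper \<theta>_mem by (intro continuous_on_compose2[OF holomorphic_on_imp_continuous_on[OF f] cont_Z]) (auto simp: Z_def)
    then show ?thesis unfolding W_def using p by (intro continuous_intros continuous_on_powr') auto
  qed
  have "(\<integral>\<^sup>+u. ennreal (cmod (f (z u)) powr p * cmod (z' u)) * indicator {a..b} u \<partial>lborel)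
     \<le> (\<integral>\<^sup>+u. ennreal (W (\<tau> u) * \<tau>' u * indicator {a..b} u) \<partial>lborel)"
    using \<tau>'_ge \<theta>_\<tau> by (intro nn_integral_mono) (auto simp: W_def Z_def intro!: ennreal_leI mult_left_mono split: split_indicator)
  also have "\<dots> = (\<integral>\<^sup>+x. ennreal (W x * indicator {\<tau> a..\<tau> b} x) \<partial>lborel)"
  proof (rule nn_integral_substitution[symmetric])
    have [measurable]: "W \<in> borel_measurable borel" using cont_W by (rule borel_measurable_continuous_onI)
    show "set_borel_measurable borel {\<tau> a..\<tau> b} W" unfolding set_borel_measurable_def by measurable
  qed (use \<tau>_deriv cont_\<tau>' \<tau>'_pos ab in \<open>auto intro: less_imp_le\<close>)
  also have "\<dots> = (\<integral>\<^sup>+x. ennreal (cmod (f (Z x)) powr p) * indicator {\<tau> a..\<tau> b} x \<partial>lborel)"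
    by (intro nn_integral_cong) (auto simp: W_def split: split_indicator)
  also have "\<dots> \<le> 576 * N"
  proof -
    obtain C where C: "0 \<le> C" "\<And>z. 0 < Im z \<Longrightarrow> cmod (f z) powr p \<le> C / Im z"
      using line_mean_pointwise_bound[OF f p Nr(2) bound[unfolded Nr(1)]] by metis
    define d where "d n = inverse (real (Suc n))" for n
    have d: "0 < d n" for n by (simp add: d_def)
    have d0: "d \<longlonglongrightarrow> 0" unfolding d_def by (rule LIMSEQ_inverse_real_of_nat)
    define fn where "fn n w = f (w + \<i> * of_real (d n)) / (1 - \<i> * of_real (d n) * w)" for n w
    have damp: "1 \<le> cmod (1 - \<i> * of_real (d n) * w)" if "0 \<le> Im w" for n w
      by (rule damping_factor(1)[OF d that])
    show ?thesis
    proof (rule nn_integral_fatou_bound[where u = "\<lambda>n x. ennreal (cmod (fn n (Z x)) powr p) * indicator {\<tau> a..\<tau> b} x"])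
      have cont_fn: "continuous_on UNIV (\<lambda>x. fn n (Z x))" for n
      proof -
        have "1 - \<i> * of_real (d n) * Z x \<noteq> 0" for x using damp[of "Z x" n] c(1) c(2)[of x] by force
        moreover have "continuous_on UNIV (\<lambda>x. f (Z x + \<i> * of_real (d n)))"
          using c d[of n] by (intro continuous_on_compose2[OF holomorphic_on_imp_continuous_on[OF f]] continuous_intros cont_Z)
            (auto intro: add_pos_pos less_le_trans)
        ultimately show ?thesis unfolding fn_def using cont_Z by (intro continuous_intros) auto
      qed
      then show "(\<lambda>x. ennreal (cmod (fn n (Z x)) powr p) * indicator {\<tau> a..\<tau> b} x) \<in> borel_measurable lborel" for n
        using borel_measurable_continuous_onI[OF cont_fn[of n]] by measurable
      show "AE x in lborel. (\<lambda>n. ennreal (cmod (fn n (Z x)) powr p) * indicator {\<tau> a..\<tau> b} x)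
         \<longlonglongrightarrow> ennreal (cmod (f (Z x)) powr p) * indicator {\<tau> a..\<tau> b} x"
      proof (rule AE_I2)
        fix x
        have pos: "0 < Im (Z x)" using c(1) c(2)[of x] by linarith
        have "(\<lambda>n. Z x + \<i> * of_real (d n)) \<longlonglongrightarrow> Z x + \<i> * of_real 0" using d0 by (intro tendsto_intros)
        moreover have "isCont f (Z x)"
          using holomorphic_on_imp_continuous_on[OF f] pos open_halfspace_Im_gt[of 0]
          by (auto simp: continuous_on_eq_continuous_at)
        ultimately have "(\<lambda>n. f (Z x + \<i> * of_real (d n))) \<longlonglongrightarrow> f (Z x)"
          by (intro isCont_tendsto_compose[of "Z x" f]) auto
        moreover have "(\<lambda>n. 1 - \<i> * of_real (d n) * Z x) \<longlonglongrightarrow> 1 - \<i> * of_real 0 * Z x"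
          using d0 by (intro tendsto_intros)
        ultimately have "(\<lambda>n. fn n (Z x)) \<longlonglongrightarrow> f (Z x) / 1"
          unfolding fn_def by (intro tendsto_divide) auto
        then have "(\<lambda>n. cmod (fn n (Z x)) powr p) \<longlonglongrightarrow> cmod (f (Z x)) powr p"
          using p by (intro tendsto_powr' tendsto_intros) auto
        then show "(\<lambda>n. ennreal (cmod (fn n (Z x)) powr p) * indicator {\<tau> a..\<tau> b} x)
         \<longlonglongrightarrow> ennreal (cmod (f (Z x)) powr p) * indicator {\<tau> a..\<tau> b} x"
          by (cases "x \<in> {\<tau> a..\<tau> b}") (auto intro: tendsto_ennrealI)
      qed
      fix n
      have "(\<integral>\<^sup>+x. ennreal (cmod (fn n (Z x)) powr p) * indicator {\<tau> a..\<tau> b} x \<partial>lborel) \<le> 576 * line_mean (fn n) p 0"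
      proof (rule nn_integral_on_skew_graph[where U = "{w. - d n < Im w}", OF _ _ _ p _ k cont_Z c skew])
        show "open {w. - d n < Im w}" by (rule open_halfspace_Im_gt)
        show "{z. 0 \<le> Im z} \<subseteq> {w. - d n < Im w}" using d[of n] by auto
        show "fn n holomorphic_on {w. - d n < Im w}" unfolding fn_def
        proof (intro holomorphic_intros)
          show "(\<lambda>w. f (w + \<i> * of_real (d n))) holomorphic_on {w. - d n < Im w}"
            by (rule holomorphic_on_compose_gen[OF _ f, unfolded o_def]) (auto intro!: holomorphic_intros)
          fix w assume "w \<in> {w. - d n < Im w}"
          then have "d n * (- d n) < d n * Im w" using d[of n] by (intro mult_strict_left_mono) auto
          moreover have "d n * d n \<le> 1 * 1" using d[of n] by (intro mult_mono) (auto simp: d_def field_simps)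
          ultimately have "0 < Re (1 - \<i> * of_real (d n) * w)" by simp
          then show "1 - \<i> * of_real (d n) * w \<noteq> 0" by (metis less_irrefl zero_complex.sel(1))
        qed
        fix e :: real assume e: "0 < e"
        define B where "B = (C / d n) powr (1 / p)"
        have B: "cmod (f (w + \<i> * of_real (d n))) \<le> B" if "0 \<le> Im w" for w
        proof -
          have "cmod (f (w + \<i> * of_real (d n))) powr p \<le> C / Im (w + \<i> * of_real (d n))"
            using that d[of n] by (intro C) auto
          also have "\<dots> \<le> C / d n" using that d[of n] C(1) by (intro divide_left_mono) auto
          finally have "(cmod (f (w + \<i> * of_real (d n))) powr p) powr (1 / p) \<le> B"
            unfolding B_def using p by (intro powr_mono2) auto
          then show ?thesis using p by (simp add: powr_powr)
        qed
        have B0: "0 \<le> B" by (simp add: B_def)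
        define m where "m = min 1 (d n) / 2"
        have m: "0 < m" using d[of n] by (simp add: m_def)
        have "cmod (fn n w) < e" if w: "0 \<le> Im w" "B / (e * m) \<le> cmod w" for w
        proof -
          have "m * (1 + cmod w) \<le> cmod (1 - \<i> * of_real (d n) * w)"
            unfolding m_def by (rule damping_factor(2)[OF d w(1)])
          moreover have "B < e * (m * (1 + cmod w))"
          proof -
            have "B / (e * m) < 1 + cmod w" using w(2) by linarith
            then show ?thesis using e m by (simp add: divide_less_eq mult.assoc mult.commute mult.left_commute)
          qed
          ultimately have "B < e * cmod (1 - \<i> * of_real (d n) * w)" using e
            by (meson less_le_trans mult_left_mono less_imp_le)
          then have "cmod (f (w + \<i> * of_real (d n))) < e * cmod (1 - \<i> * of_real (d n) * w)"
            using B[OF w(1)] by linarith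
          moreover have "0 < cmod (1 - \<i> * of_real (d n) * w)" using damp[OF w(1), of n] by linarith
          ultimately show ?thesis unfolding fn_def norm_divide by (simp only: pos_divide_less_eq)
        qed
        then show "\<exists>R. \<forall>w. 0 \<le> Im w \<and> R \<le> cmod w \<longrightarrow> cmod (fn n w) < e" by blast
      qed
      also have "\<dots> \<le> 576 * N"
      proof (rule mult_left_mono)
        have "line_mean (fn n) p 0 \<le> line_mean f p (d n)"
          unfolding line_mean_def
        proof (intro nn_integral_mono ennreal_leI powr_mono2)
          fix x
          have "Complex x 0 + \<i> * of_real (d n) = Complex x (d n)" by (simp add: complex_eq_iff)
          then show "cmod (fn n (Complex x 0)) \<le> cmod (f (Complex x (d n)))"
            using damp[of "Complex x 0" n] unfolding fn_def norm_divide
            by (simp add: divide_le_eq mult_le_cancel_left1)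
        qed (use p in auto)
        also have "\<dots> \<le> N" by (rule bound[OF d])
        finally show "line_mean (fn n) p 0 \<le> N" .
      qed simp
      finally show "(\<integral>\<^sup>+x. ennreal (cmod (fn n (Z x)) powr p) * indicator {\<tau> a..\<tau> b} x \<partial>lborel) \<le> 576 * N" .
    qed
  qed
  finally show ?thesis .
qed

lemma measurable_line_powr:
  assumes "f holomorphic_on A" "\<And>x. Complex x y \<in> A"
  shows "(\<lambda>x. ennreal (cmod (f (Complex x y)) powr p)) \<in> borel_measurable borel"
  using measurable_line[OF assms] by measurable

text \<open>
  The lower half plane is reduced to the upper one by \<open>z \<mapsto> - z\<close>, which keeps \<open>z\<^sup>2\<close> and exchanges \<open>\<plusminus>1\<close>.
\<close>
lemma line_mean_reflect:
  assumes "f holomorphic_on A" "\<And>x. Complex x y \<in> A"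
  shows "line_mean (\<lambda>z. f (- z)) p (- y) = line_mean f p y"
proof -
  have "line_mean (\<lambda>z. f (- z)) p (- y) = (\<integral>\<^sup>+x. ennreal (cmod (f (Complex (0 + (-1) * x) y)) powr p) \<partial>lborel)"
  proof -
    have "- Complex x (- y) = Complex (0 + (-1) * x) y" for x by (simp add: complex_eq_iff)
    then show ?thesis unfolding line_mean_def by simp
  qed
  also have "\<dots> = line_mean f p y"
    unfolding line_mean_def by (rule nn_integral_reflect_shift[OF measurable_line_powr[OF assms]]) simp
  finally show ?thesis .
qed

lemma line_mean_le_limit:
  fixes h :: "complex \<Rightarrow> complex" and b :: "real \<Rightarrow> real"
  assumes e: "e = 1 \<or> e = -1"
    and h: "h holomorphic_on {z. 0 < e * Im z}" and p: "0 < p" and M: "0 \<le> M"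
    and growth: "\<And>z. 0 < e * Im z \<Longrightarrow> cmod (h z) powr p \<le> M * (1 + cmod z) * (1 + cmod (z\<^sup>2 - 1) powr (- 1/2))"
    and lim: "\<And>x. x \<noteq> 1 \<Longrightarrow> x \<noteq> -1 \<Longrightarrow> ((\<lambda>d. cmod (h (Complex x (e * d))) powr p) \<longlongrightarrow> b x) (at_right 0)"
    and b: "b \<in> borel_measurable borel" and y: "0 < e * y"
  shows "line_mean h p y \<le> (\<integral>\<^sup>+x. ennreal (b x) \<partial>lborel)"
  using e
proof
  assume "e = 1"
  then show ?thesis
    using line_mean_le_limit_upper[of h p M b y] h p M growth lim y by simp
next
  assume e: "e = -1"
  note [measurable] = b
  have "line_mean h p y = line_mean (\<lambda>z. h (- z)) p (- y)"
    by (rule line_mean_reflect[OF h, symmetric]) (use y in simp)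
  also have "\<dots> \<le> (\<integral>\<^sup>+x. ennreal (b (- x)) \<partial>lborel)"
  proof (rule line_mean_le_limit_upper[OF _ p M])
    show "(\<lambda>z. h (- z)) holomorphic_on {z. 0 < Im z}"
      by (rule holomorphic_on_compose_gen[OF _ h, unfolded o_def]) (auto intro!: holomorphic_intros simp: e)
    show "cmod (h (- z)) powr p \<le> M * (1 + cmod z) * (1 + cmod (z\<^sup>2 - 1) powr (- 1/2))" if "0 < Im z" for z
      using growth[of "- z"] that by (simp add: e)
    show "((\<lambda>d. cmod (h (- Complex x d)) powr p) \<longlongrightarrow> b (- x)) (at_right 0)" if "x \<noteq> 1" "x \<noteq> -1" for x
    proof -
      have "- x \<noteq> 1" "- x \<noteq> -1" using that by auto
      then show ?thesis using lim[of "- x"] by (simp add: e complex_minus)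
    qed
    show "0 < - y" using y e by simp
  qed
  also have "\<dots> = (\<integral>\<^sup>+x. ennreal (b (0 + (-1) * x)) \<partial>lborel)" by simp
  also have "\<dots> = (\<integral>\<^sup>+x. ennreal (b x) \<partial>lborel)"
    by (rule nn_integral_reflect_shift[where h = "\<lambda>x. ennreal (b x)"]) auto
  finally show ?thesis .
qed

lemma carleson_monotone_curve:
  fixes f :: "complex \<Rightarrow> complex" and z z' :: "real \<Rightarrow> complex"
  assumes e: "e = 1 \<or> e = -1"
    and f: "f holomorphic_on {z. 0 < e * Im z}" and p: "0 < p"
    and bound: "\<And>y. 0 < e * y \<Longrightarrow> line_mean f p y \<le> N"
    and z: "\<And>u. u \<in> {a..b} \<Longrightarrow> (z has_vector_derivative z' u) (at u)" and z': "continuous_on {a..b} z'"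
    and k: "\<bar>k\<bar> = 1" and quadrant: "\<And>u. u \<in> {a..b} \<Longrightarrow> 0 \<le> Re (z' u) \<and> 0 \<le> k * Im (z' u) \<and> z' u \<noteq> 0"
    and inside: "\<And>u. u \<in> {a..b} \<Longrightarrow> 0 < e * Im (z u)" and ab: "a \<le> b"
  shows "(\<integral>\<^sup>+u. ennreal (cmod (f (z u)) powr p * cmod (z' u)) * indicator {a..b} u \<partial>lborel) \<le> 576 * N"
  using e
proof
  assume "e = 1"
  then show ?thesis
    using carleson_monotone_curve_upper[of f p N a b z z' k] f p bound z z' k quadrant inside ab by simp
next
  assume e: "e = -1"
  have cont_z: "continuous_on {a..b} z"
    by (intro continuous_at_imp_continuous_on ballI) (rule has_vector_derivative_continuous, rule z)
  define G where "G u = ennreal (cmod (f (z u)) powr p * cmod (z' u)) * indicator {a..b} u" for u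
  have G: "G \<in> borel_measurable borel"
  proof -
    have "continuous_on {a..b} (\<lambda>u. f (z u))"
      by (rule continuous_on_compose2[OF holomorphic_on_imp_continuous_on[OF f] cont_z]) (use inside in auto)
    then have "continuous_on {a..b} (\<lambda>u. cmod (f (z u)) powr p * cmod (z' u))"
      using z' p by (intro continuous_intros continuous_on_powr') auto
    then have "(\<lambda>u. indicator {a..b} u *\<^sub>R (cmod (f (z u)) powr p * cmod (z' u))) \<in> borel_measurable borel"
      by (intro borel_measurable_continuous_on_indicator) auto
    then have "(\<lambda>u. ennreal (indicator {a..b} u *\<^sub>R (cmod (f (z u)) powr p * cmod (z' u)))) \<in> borel_measurable borel"
      by measurable
    also have "(\<lambda>u. ennreal (indicator {a..b} u *\<^sub>R (cmod (f (z u)) powr p * cmod (z' u)))) = G"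
      by (auto simp: G_def fun_eq_iff split: split_indicator)
    finally show ?thesis .
  qed
  have "(\<integral>\<^sup>+u. G u \<partial>lborel) = (\<integral>\<^sup>+u. G (0 + (-1) * u) \<partial>lborel)"
    by (rule nn_integral_reflect_shift[OF G, symmetric]) simp
  also have "\<dots> = (\<integral>\<^sup>+u. ennreal (cmod (f (- (- z (- u)))) powr p * cmod (z' (- u))) * indicator {-b..-a} u \<partial>lborel)"
    by (intro nn_integral_cong) (auto simp: G_def split: split_indicator)
  also have "\<dots> \<le> 576 * N"
  proof (rule carleson_monotone_curve_upper[where f = "\<lambda>w. f (- w)" and z = "\<lambda>u. - z (- u)", OF _ p _ _ _ k])
    show "(\<lambda>w. f (- w)) holomorphic_on {z. 0 < Im z}"
      by (rule holomorphic_on_compose_gen[OF _ f, unfolded o_def]) (auto intro!: holomorphic_intros simp: e)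
    show "line_mean (\<lambda>w. f (- w)) p y \<le> N" if "0 < y" for y
      using line_mean_reflect[OF f, of "- y" p] bound[of "- y"] that by (simp add: e)
    fix u assume "u \<in> {-b..-a}"
    then have u: "- u \<in> {a..b}" by auto
    have "((\<lambda>u. z (- u)) has_vector_derivative (-1) *\<^sub>R z' (- u)) (at u)"
    proof -
      have "(uminus has_vector_derivative (-1::real)) (at u)" by (auto intro!: derivative_eq_intros)
      from vector_diff_chain_at[OF this z[OF u]] show ?thesis by (simp only: o_def)
    qed
    then have "((\<lambda>u. - z (- u)) has_vector_derivative - ((-1) *\<^sub>R z' (- u))) (at u)"
      by (rule has_vector_derivative_minus)
    then show "((\<lambda>u. - z (- u)) has_vector_derivative z' (- u)) (at u)" by simp
    show "0 \<le> Re (z' (- u)) \<and> 0 \<le> k * Im (z' (- u)) \<and> z' (- u) \<noteq> 0" by (rule quadrant[OF u])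
    show "0 < Im (- z (- u))" using inside[OF u] e by simp
  next
    show "continuous_on {-b..-a} (\<lambda>u. z' (- u))"
      by (rule continuous_on_compose2[OF z']) (auto intro!: continuous_intros)
    show "- b \<le> - a" using ab by simp
  qed
  finally show ?thesis by (simp add: G_def)
qed

section \<open>Quasi-norms defined by families of curves\<close>

lemma enn_root_mono: "0 < p \<Longrightarrow> x \<le> y \<Longrightarrow> enn_root p x \<le> enn_root p y"
  by (cases x; cases y) (auto simp: enn_root_def top_unique intro!: ennreal_leI powr_mono2)

lemma enn_root_le_iff:
  assumes p: "0 < p"
  shows "enn_root p x \<le> enn_root p y \<longleftrightarrow> x \<le> y"
proof
  assume le: "enn_root p x \<le> enn_root p y"
  show "x \<le> y"
  proof (cases "x = top \<or> y = top")
    case True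
    then show ?thesis using le by (auto simp: enn_root_def top_unique split: if_splits)
  next
    case False
    then obtain a b where ab: "x = ennreal a" "0 \<le> a" "y = ennreal b" "0 \<le> b" by (cases x; cases y) auto
    then have "a powr (1 / p) \<le> b powr (1 / p)" using le by (simp add: enn_root_def)
    then have "(a powr (1 / p)) powr p \<le> (b powr (1 / p)) powr p"
      using p by - (rule powr_mono2[of p "a powr (1 / p)" "b powr (1 / p)"], auto)
    then have "a \<le> b" using ab(2,4) p by (simp add: powr_powr)
    then show ?thesis unfolding ab(1,3) by (rule ennreal_leI)
  qed
qed (rule enn_root_mono[OF p])

lemma enn_root_surj:
  assumes p: "0 < p"
  obtains y where "z = enn_root p y"
proof (cases z)
  case (real r)
  then have "z = enn_root p (ennreal (r powr p))" using p by (simp add: enn_root_def powr_powr)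
  then show thesis by (rule that)
next
  case top
  then have "z = enn_root p top" by (simp add: enn_root_def)
  then show thesis by (rule that)
qed

lemma enn_root_SUP:
  assumes p: "0 < p"
  shows "(SUP i\<in>A. enn_root p (I i)) = enn_root p (SUP i\<in>A. I i)"
proof (rule antisym)
  show "(SUP i\<in>A. enn_root p (I i)) \<le> enn_root p (SUP i\<in>A. I i)"
    by (intro SUP_least enn_root_mono[OF p] SUP_upper)
  obtain y where y: "(SUP i\<in>A. enn_root p (I i)) = enn_root p y" by (rule enn_root_surj[OF p])
  have "I i \<le> y" if "i \<in> A" for i
    using SUP_upper[OF that, of "\<lambda>i. enn_root p (I i)"] unfolding y enn_root_le_iff[OF p] .
  then show "enn_root p (SUP i\<in>A. I i) \<le> (SUP i\<in>A. enn_root p (I i))"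
    unfolding y enn_root_le_iff[OF p] by (rule SUP_least)
qed

lemma enn_root_finite_iff: "enn_root p x < \<infinity> \<longleftrightarrow> x < \<infinity>"
  by (cases x) (auto simp: enn_root_def)

lemma enn_root_cmult:
  assumes "0 < p" "0 < c"
  shows "enn_root p (ennreal c * x) = ennreal (c powr (1 / p)) * enn_root p x"
  using assms by (cases x)
    (auto simp: enn_root_def ennreal_mult'[symmetric] powr_mult ennreal_mult_top)

text \<open>
  The common form of the four quasi-norms: a supremum of means over a family of curves. Linear structure and
  comparison of such norms need to be discussed only once.
\<close>
definition path_norm :: "real \<Rightarrow> 'i set \<Rightarrow> ('i \<Rightarrow> real \<Rightarrow> complex) \<Rightarrow> (complex \<Rightarrow> complex) \<Rightarrow> ennreal" where
  "path_norm p I \<gamma> F = (SUP i\<in>I. enn_root p (\<integral>\<^sup>+x. ennreal (cmod (F (\<gamma> i x)) powr p) \<partial>lborel))"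

lemma path_norm_eq_enn_root:
  "0 < p \<Longrightarrow> path_norm p I \<gamma> F = enn_root p (SUP i\<in>I. \<integral>\<^sup>+x. ennreal (cmod (F (\<gamma> i x)) powr p) \<partial>lborel)"
  unfolding path_norm_def by (rule enn_root_SUP)

lemma path_norm_le_iff:
  "0 < p \<Longrightarrow> path_norm p I \<gamma> F \<le> enn_root p K \<longleftrightarrow> (\<forall>i\<in>I. (\<integral>\<^sup>+x. ennreal (cmod (F (\<gamma> i x)) powr p) \<partial>lborel) \<le> K)"
  by (simp add: path_norm_eq_enn_root enn_root_le_iff SUP_le_iff)

lemma powr_add_le:
  fixes a b p :: real
  assumes "0 \<le> a" "0 \<le> b" "0 < p"
  shows "(a + b) powr p \<le> 2 powr p * (a powr p + b powr p)"
proof -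
  have "(a + b) powr p \<le> (2 * max a b) powr p" using assms by (intro powr_mono2) auto
  also have "\<dots> = 2 powr p * (max a b) powr p" using assms by (simp add: powr_mult)
  also have "\<dots> \<le> 2 powr p * (a powr p + b powr p)"
    by (intro mult_left_mono) (auto simp: max_def)
  finally show ?thesis .
qed

text \<open>
  For \<open>p < 1\<close> there is no triangle inequality; finiteness of the norm of a sum follows from
  \<open>(a + b)\<^sup>p \<le> 2\<^sup>p (a\<^sup>p + b\<^sup>p)\<close>.
\<close>
lemma complex_subspace_hardy_space:
  assumes p: "0 < p" and \<gamma>: "\<And>i. i \<in> I \<Longrightarrow> continuous_on UNIV (\<gamma> i)" "\<And>i x. i \<in> I \<Longrightarrow> \<gamma> i x \<in> A"
  shows "complex_subspace (hardy_space A (path_norm p I \<gamma>))"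
proof -
  let ?K = "\<lambda>F. SUP i\<in>I. \<integral>\<^sup>+x. ennreal (cmod (F (\<gamma> i x)) powr p) \<partial>lborel"
  have fin: "path_norm p I \<gamma> F < \<infinity> \<longleftrightarrow> ?K F < \<infinity>" for F
    by (simp only: path_norm_eq_enn_root[OF p] enn_root_finite_iff)
  have meas: "(\<lambda>x. ennreal (cmod (F (\<gamma> i x)) powr p)) \<in> borel_measurable lborel" if "F holomorphic_on A" "i \<in> I" for F i
  proof -
    have "continuous_on UNIV (\<lambda>x. F (\<gamma> i x))"
      by (rule continuous_on_compose2[OF holomorphic_on_imp_continuous_on[OF that(1)] \<gamma>(1)[OF that(2)]])
        (use \<gamma>(2)[OF that(2)] in auto)
    then have [measurable]: "(\<lambda>x. F (\<gamma> i x)) \<in> borel_measurable borel" by (rule borel_measurable_continuous_onI)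
    show ?thesis by measurable
  qed
  show ?thesis
    unfolding complex_subspace_def
  proof (intro conjI ballI allI)
    have "?K (\<lambda>_. 0) \<le> 0" using p by (intro SUP_least) simp
    then have "?K (\<lambda>_. 0) < \<infinity>" by (rule le_less_trans) simp
    then show "(\<lambda>_. 0) \<in> hardy_space A (path_norm p I \<gamma>)" unfolding hardy_space_def mem_Collect_eq fin by simp
  next
    fix F G assume "F \<in> hardy_space A (path_norm p I \<gamma>)" "G \<in> hardy_space A (path_norm p I \<gamma>)"
    then have F: "F holomorphic_on A" "\<forall>z. z \<notin> A \<longrightarrow> F z = 0" "?K F < \<infinity>"
      and G: "G holomorphic_on A" "\<forall>z. z \<notin> A \<longrightarrow> G z = 0" "?K G < \<infinity>"
      unfolding hardy_space_def mem_Collect_eq fin by auto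
    have "?K (\<lambda>z. F z + G z) \<le> ennreal (2 powr p) * (?K F + ?K G)"
    proof (rule SUP_least)
      fix i assume i: "i \<in> I"
      have "(\<integral>\<^sup>+x. ennreal (cmod (F (\<gamma> i x) + G (\<gamma> i x)) powr p) \<partial>lborel)
        \<le> (\<integral>\<^sup>+x. ennreal (2 powr p) * (ennreal (cmod (F (\<gamma> i x)) powr p) + ennreal (cmod (G (\<gamma> i x)) powr p)) \<partial>lborel)"
      proof (rule nn_integral_mono)
        fix x
        have "cmod (F (\<gamma> i x) + G (\<gamma> i x)) powr p \<le> (cmod (F (\<gamma> i x)) + cmod (G (\<gamma> i x))) powr p"
          using p by (intro powr_mono2 norm_triangle_ineq) auto
        also have "\<dots> \<le> 2 powr p * (cmod (F (\<gamma> i x)) powr p + cmod (G (\<gamma> i x)) powr p)"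
          using p by (intro powr_add_le) auto
        finally have "ennreal (cmod (F (\<gamma> i x) + G (\<gamma> i x)) powr p)
          \<le> ennreal (2 powr p * (cmod (F (\<gamma> i x)) powr p + cmod (G (\<gamma> i x)) powr p))" by (rule ennreal_leI)
        also have "\<dots> = ennreal (2 powr p) * (ennreal (cmod (F (\<gamma> i x)) powr p) + ennreal (cmod (G (\<gamma> i x)) powr p))"
          by (simp add: ennreal_mult')
        finally show "ennreal (cmod (F (\<gamma> i x) + G (\<gamma> i x)) powr p)
          \<le> ennreal (2 powr p) * (ennreal (cmod (F (\<gamma> i x)) powr p) + ennreal (cmod (G (\<gamma> i x)) powr p))" .
      qed
      also have "\<dots> = ennreal (2 powr p) * (\<integral>\<^sup>+x. ennreal (cmod (F (\<gamma> i x)) powr p) + ennreal (cmod (G (\<gamma> i x)) powr p) \<partial>lborel)"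
        by (intro nn_integral_cmult borel_measurable_add meas F G i)
      also have "(\<integral>\<^sup>+x. ennreal (cmod (F (\<gamma> i x)) powr p) + ennreal (cmod (G (\<gamma> i x)) powr p) \<partial>lborel)
        = (\<integral>\<^sup>+x. ennreal (cmod (F (\<gamma> i x)) powr p) \<partial>lborel) + (\<integral>\<^sup>+x. ennreal (cmod (G (\<gamma> i x)) powr p) \<partial>lborel)"
        by (intro nn_integral_add meas F G i)
      finally show "(\<integral>\<^sup>+x. ennreal (cmod (F (\<gamma> i x) + G (\<gamma> i x)) powr p) \<partial>lborel) \<le> ennreal (2 powr p) * (?K F + ?K G)"
        by (rule order_trans) (intro mult_left_mono add_mono SUP_upper i, simp)
    qed
    also have "\<dots> < \<infinity>" using F(3) G(3) by (simp add: ennreal_mult_less_top)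
    finally show "(\<lambda>z. F z + G z) \<in> hardy_space A (path_norm p I \<gamma>)"
      using F G unfolding hardy_space_def mem_Collect_eq fin by (auto intro: holomorphic_intros)
  next
    fix c F assume "F \<in> hardy_space A (path_norm p I \<gamma>)"
    then have F: "F holomorphic_on A" "\<forall>z. z \<notin> A \<longrightarrow> F z = 0" "?K F < \<infinity>"
      unfolding hardy_space_def mem_Collect_eq fin by auto
    have "?K (\<lambda>z. c * F z) \<le> ennreal (cmod c powr p) * ?K F"
    proof (rule SUP_least)
      fix i assume i: "i \<in> I"
      have "(\<integral>\<^sup>+x. ennreal (cmod (c * F (\<gamma> i x)) powr p) \<partial>lborel)
        = (\<integral>\<^sup>+x. ennreal (cmod c powr p) * ennreal (cmod (F (\<gamma> i x)) powr p) \<partial>lborel)"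
        by (simp add: norm_mult powr_mult ennreal_mult')
      also have "\<dots> = ennreal (cmod c powr p) * (\<integral>\<^sup>+x. ennreal (cmod (F (\<gamma> i x)) powr p) \<partial>lborel)"
        by (intro nn_integral_cmult meas F i)
      finally show "(\<integral>\<^sup>+x. ennreal (cmod (c * F (\<gamma> i x)) powr p) \<partial>lborel) \<le> ennreal (cmod c powr p) * ?K F"
        by (rule ord_eq_le_trans) (intro mult_left_mono SUP_upper i, simp)
    qed
    also have "\<dots> < \<infinity>" using F(3) by (simp add: ennreal_mult_less_top)
    finally show "(\<lambda>z. c * F z) \<in> hardy_space A (path_norm p I \<gamma>)"
      using F unfolding hardy_space_def mem_Collect_eq fin by (auto intro: holomorphic_intros)
  qed
qed

lemma continuous_Gamma_path:
  assumes "0 < s"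
  shows "continuous_on UNIV (Gamma_path s t)"
proof -
  have "Gamma_path s t = (\<lambda>x. Complex (max (- s) (min s x)) (t + max 0 (max (x - s) (- s - x))))"
    using assms by (auto simp: fun_eq_iff Gamma_path_def max_def min_def)
  then show ?thesis unfolding Complex_eq by (auto intro!: continuous_intros)
qed

lemma norm_Omega_plus_eq: "norm_Omega_plus \<sigma> p = path_norm p ({0<..<\<sigma>} \<times> {0<..}) (\<lambda>(s, t). Gamma_path s t)"
  by (simp add: fun_eq_iff norm_Omega_plus_def path_norm_def arc_integral_def split_beta)

lemma norm_Omega_minus_eq: "norm_Omega_minus \<sigma> p = path_norm p ({\<sigma><..} \<times> {..<0}) (\<lambda>(s, t). Gamma_path s t)"
  by (simp add: fun_eq_iff norm_Omega_minus_def path_norm_def arc_integral_def split_beta)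

text \<open>
  The index sets are written with the factors \<open>1\<close> and \<open>- 1\<close> so as to match the sign \<open>e\<close> of the locale below.
\<close>
lemma norm_upper_eq: "norm_upper p = path_norm p {y. 0 < 1 * y} (\<lambda>y x. Complex x y)"
  by (simp add: fun_eq_iff norm_upper_def path_norm_def greaterThan_def)

lemma norm_lower_eq: "norm_lower p = path_norm p {y. 0 < - 1 * y} (\<lambda>y x. Complex x y)"
  by (simp add: fun_eq_iff norm_lower_def path_norm_def lessThan_def)

section \<open>Transplantation by a conformal map\<close>

text \<open>
  The situation common to both operators. \<open>\<Phi>\<close> maps the half plane \<open>0 < e * Im z\<close> conformally onto \<open>\<Omega>\<close> with
  inverse \<open>\<psi>\<close>, and \<open>P\<close> is the set of parameters of the curves \<open>\<Gamma>\<^bsub>s,t\<^esub>\<close> that define the norm on \<open>\<Omega>\<close>. On the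
  real line, \<open>\<xi> x\<close> is the arc length coordinate of the boundary point \<open>\<Phi> x\<close> and \<open>d x\<close> is \<open>|\<Phi>' x|\<close>; the
  points \<open>\<plusminus>1\<close>, which correspond to the corners, are left out.

  Three assumptions carry the argument. \<open>dilate\<close> lets the affine map that takes \<open>\<Gamma>\<^bsub>\<sigma>,0\<^esub>\<close> to \<open>\<Gamma>\<^bsub>s,t\<^esub>\<close> act on \<open>\<Omega>\<close>.
  \<open>cover\<close> says that a square of fixed size around every point of the dilated domain is swept out by
  the horizontal, or else by the vertical, parts of curves of the family, so that functions of finite
  norm are bounded there. \<open>quadrant\<close> makes the preimages of the straight pieces of the curves monotone.
\<close>
locale half_strip_transfer =
  fixes e \<sigma> p M :: real and \<Phi> \<psi> g :: "complex \<Rightarrow> complex" and \<Omega> :: "complex set"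
    and P :: "(real \<times> real) set" and \<xi> d :: "real \<Rightarrow> real"
  assumes e: "e = 1 \<or> e = -1" and \<sigma>: "0 < \<sigma>" and p: "0 < p" and M: "0 \<le> M"
    and open_\<Omega>: "open \<Omega>"
    and \<Phi>_holo: "\<Phi> holomorphic_on {z. 0 < e * Im z}"
    and \<psi>_holo: "\<psi> holomorphic_on \<Omega>"
    and \<Phi>_in: "\<And>z. 0 < e * Im z \<Longrightarrow> \<Phi> z \<in> \<Omega>" and \<psi>_\<Phi>: "\<And>z. 0 < e * Im z \<Longrightarrow> \<psi> (\<Phi> z) = z"
    and \<psi>_in: "\<And>w. w \<in> \<Omega> \<Longrightarrow> 0 < e * Im (\<psi> w)" and \<Phi>_\<psi>: "\<And>w. w \<in> \<Omega> \<Longrightarrow> \<Phi> (\<psi> w) = w"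
    and g_holo: "g holomorphic_on {z. 0 < e * Im z}"
    and g_powr: "\<And>z. 0 < e * Im z \<Longrightarrow> cmod (g z) powr p = cmod (deriv \<Phi> z)"
    and quadrant: "\<And>w. w \<in> \<Omega> \<Longrightarrow> 0 < Re (deriv \<psi> w) \<and> (0 \<le> Re w \<longrightarrow> Im (deriv \<psi> w) \<le> 0) \<and> (Re w \<le> 0 \<longrightarrow> 0 \<le> Im (deriv \<psi> w))"
    and P_pos: "\<And>s t. (s, t) \<in> P \<Longrightarrow> 0 < s"
    and P_in: "\<And>s t x. (s, t) \<in> P \<Longrightarrow> Gamma_path s t x \<in> \<Omega>"
    and dilate: "\<And>s t w. (s, t) \<in> P \<Longrightarrow> w \<in> \<Omega> \<Longrightarrow> \<i> * of_real t + of_real (s / \<sigma>) * w \<in> \<Omega>"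
    and cover: "\<And>s t. (s, t) \<in> P \<Longrightarrow> \<exists>\<delta>>0. \<forall>w\<in>\<Omega>. let v = \<i> * of_real t + of_real (s / \<sigma>) * w in
        (\<exists>s'. \<bar>Re v\<bar> + \<delta> \<le> s' \<and> (\<forall>y. \<bar>y - Im v\<bar> \<le> \<delta> \<longrightarrow> (s', y) \<in> P))
      \<or> (\<exists>t'. t' + \<delta> \<le> Im v \<and> (\<forall>x. \<bar>x - Re v\<bar> \<le> \<delta> \<longrightarrow> x \<noteq> 0 \<and> (\<bar>x\<bar>, t') \<in> P))"
    and exhaust: "\<exists>s t. (\<forall>n::nat. (s n, t n) \<in> P) \<and> s \<longlonglongrightarrow> \<sigma> \<and> t \<longlonglongrightarrow> 0"
    and growth: "\<And>z. 0 < e * Im z \<Longrightarrow> cmod (deriv \<Phi> z) \<le> M * (1 + cmod z) * (1 + cmod (z\<^sup>2 - 1) powr (- 1/2))"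
    and \<xi>_meas: "\<xi> \<in> borel_measurable borel" and d_meas: "d \<in> borel_measurable borel" and d_nonneg: "\<And>x. 0 \<le> d x"
    and boundary: "\<And>x. x \<noteq> 1 \<Longrightarrow> x \<noteq> -1 \<Longrightarrow> ((\<lambda>\<delta>. \<Phi> (Complex x (e * \<delta>))) \<longlongrightarrow> Gamma_path \<sigma> 0 (\<xi> x)) (at_right 0)"
    and boundary_deriv: "\<And>x. x \<noteq> 1 \<Longrightarrow> x \<noteq> -1 \<Longrightarrow> ((\<lambda>\<delta>. cmod (deriv \<Phi> (Complex x (e * \<delta>)))) \<longlongrightarrow> d x) (at_right 0)"
    and arclength: "\<And>G. G \<in> borel_measurable borel \<Longrightarrow> (\<integral>\<^sup>+x. G (\<xi> x) * ennreal (d x) \<partial>lborel) = (\<integral>\<^sup>+x. G x \<partial>lborel)"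
begin

abbreviation H :: "complex set" where "H \<equiv> {z. 0 < e * Im z}"

definition T :: "(complex \<Rightarrow> complex) \<Rightarrow> complex \<Rightarrow> complex" where
  "T F z = (if z \<in> H then F (\<Phi> z) * g z else 0)"

lemma open_H: "open H"
  by (intro open_Collect_less continuous_intros)

lemma \<psi>'_\<Phi>':
  assumes "z \<in> H"
  shows "deriv \<psi> (\<Phi> z) * deriv \<Phi> z = 1"
proof -
  have "(\<Phi> has_field_derivative deriv \<Phi> z) (at z)"
    using \<Phi>_holo open_H assms by (rule holomorphic_derivI)
  moreover have "(\<psi> has_field_derivative deriv \<psi> (\<Phi> z)) (at (\<Phi> z))"
    using \<psi>_holo open_\<Omega> \<Phi>_in assms by (intro holomorphic_derivI) auto
  ultimately have "(\<psi> \<circ> \<Phi> has_field_derivative deriv \<psi> (\<Phi> z) * deriv \<Phi> z) (at z)"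
    by (intro DERIV_chain)
  then have "((\<lambda>z. z) has_field_derivative deriv \<psi> (\<Phi> z) * deriv \<Phi> z) (at z)"
    by (rule has_field_derivative_transform_within_open[OF _ open_H assms]) (use \<psi>_\<Phi> in auto)
  then show ?thesis by (intro DERIV_unique[OF _ DERIV_ident])
qed

lemma \<Phi>'_nonzero: "z \<in> H \<Longrightarrow> deriv \<Phi> z \<noteq> 0" using \<psi>'_\<Phi>'[of z] by auto

lemma g_nonzero: "z \<in> H \<Longrightarrow> g z \<noteq> 0" using g_powr[of z] \<Phi>'_nonzero[of z] by auto

lemma cmod_\<psi>': "w \<in> \<Omega> \<Longrightarrow> cmod (deriv \<psi> w) * cmod (deriv \<Phi> (\<psi> w)) = 1"
  using \<psi>'_\<Phi>'[of "\<psi> w"] \<psi>_in[of w] \<Phi>_\<psi>[of w] by (metis mem_Collect_eq norm_mult norm_one)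

lemma measurable_on_arc:
  assumes "F holomorphic_on \<Omega>" "(s, t) \<in> P"
  shows "(\<lambda>x. ennreal (cmod (F (Gamma_path s t x)) powr p)) \<in> borel_measurable borel"
proof -
  have "continuous_on UNIV (\<lambda>x. F (Gamma_path s t x))"
    by (rule continuous_on_compose2[OF holomorphic_on_imp_continuous_on[OF assms(1)] continuous_Gamma_path])
      (use P_in[OF assms(2)] P_pos[OF assms(2)] in auto)
  then have [measurable]: "(\<lambda>x. F (Gamma_path s t x)) \<in> borel_measurable borel" by (rule borel_measurable_continuous_onI)
  show ?thesis by measurable
qed

abbreviation arc_mean :: "(complex \<Rightarrow> complex) \<Rightarrow> real \<Rightarrow> real \<Rightarrow> ennreal" where
  "arc_mean F s t \<equiv> (\<integral>\<^sup>+x. ennreal (cmod (F (Gamma_path s t x)) powr p) \<partial>lborel)"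

text \<open>
  The integral of \<open>|F|\<^sup>p\<close> over a square that is swept out by pieces of curves of the family is at most
  the width of the square times the bound on the curves.
\<close>
lemma bounded_inside:
  assumes F: "F holomorphic_on \<Omega>" and K: "\<And>s t. (s, t) \<in> P \<Longrightarrow> arc_mean F s t \<le> ennreal K" "0 \<le> K"
    and st: "(s, t) \<in> P"
  obtains B where "0 \<le> B" "\<And>w. w \<in> \<Omega> \<Longrightarrow> cmod (F (\<i> * of_real t + of_real (s / \<sigma>) * w)) powr p \<le> B"
proof -
  obtain C where C: "0 < C" "\<And>F w R. F holomorphic_on square w R \<Longrightarrow> 0 < R \<Longrightarrow>
     ennreal (cmod (F w) powr p) \<le> ennreal (C / R\<^sup>2) * square_integral (\<lambda>z. cmod (F z) powr p) w R"
    using powr_submean_square[OF p] by metis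
  obtain \<delta> where \<delta>: "0 < \<delta>" and cov: "\<And>w. w \<in> \<Omega> \<Longrightarrow> let v = \<i> * of_real t + of_real (s / \<sigma>) * w in
        (\<exists>s'. \<bar>Re v\<bar> + \<delta> \<le> s' \<and> (\<forall>y. \<bar>y - Im v\<bar> \<le> \<delta> \<longrightarrow> (s', y) \<in> P))
      \<or> (\<exists>t'. t' + \<delta> \<le> Im v \<and> (\<forall>x. \<bar>x - Re v\<bar> \<le> \<delta> \<longrightarrow> x \<noteq> 0 \<and> (\<bar>x\<bar>, t') \<in> P))"
    using cover[OF st] by blast
  show thesis
  proof (rule that)
    show "0 \<le> C / \<delta>\<^sup>2 * (K * (2 * \<delta>))" using C K \<delta> by simp
    fix w assume w: "w \<in> \<Omega>"
    define v where "v = \<i> * of_real t + of_real (s / \<sigma>) * w"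
    have "square v \<delta> \<subseteq> \<Omega> \<and> square_integral (\<lambda>z. cmod (F z) powr p) v \<delta> \<le> ennreal K * ennreal (2 * \<delta>)"
      using cov[OF w, folded v_def, unfolded Let_def]
    proof (elim disjE exE conjE)
      fix s' assume s': "\<bar>Re v\<bar> + \<delta> \<le> s'" and inP: "\<forall>y. \<bar>y - Im v\<bar> \<le> \<delta> \<longrightarrow> (s', y) \<in> P"
      have bottom: "Complex x y = Gamma_path s' y x" if "\<bar>x - Re v\<bar> \<le> \<delta>" for x y
        using that s' by (auto simp: Gamma_path_def)
      have sub: "square v \<delta> \<subseteq> \<Omega>"
      proof
        fix z assume z: "z \<in> square v \<delta>"
        then have "z = Gamma_path s' (Im z) (Re z)" using bottom[of "Re z" "Im z"] by (simp add: square_def)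
        moreover have "Gamma_path s' (Im z) (Re z) \<in> \<Omega>" using z inP by (intro P_in) (simp add: square_def)
        ultimately show "z \<in> \<Omega>" by simp
      qed
      have "square_integral (\<lambda>z. cmod (F z) powr p) v \<delta> \<le> (\<integral>\<^sup>+y. ennreal K * indicator {Im v - \<delta>..Im v + \<delta>} y \<partial>lborel)"
        unfolding square_integral_def
      proof (rule nn_integral_mono)
        fix y
        show "(\<integral>\<^sup>+x. ennreal (cmod (F (Complex x y)) powr p) * indicator (square v \<delta>) (Complex x y) \<partial>lborel)
          \<le> ennreal K * indicator {Im v - \<delta>..Im v + \<delta>} y"
        proof (cases "\<bar>y - Im v\<bar> \<le> \<delta>")
          case True
          have "(\<integral>\<^sup>+x. ennreal (cmod (F (Complex x y)) powr p) * indicator (square v \<delta>) (Complex x y) \<partial>lborel) \<le> arc_mean F s' y"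
            by (intro nn_integral_mono) (auto simp: bottom square_def split: split_indicator)
          also have "\<dots> \<le> ennreal K" using True inP by (intro K) auto
          finally show ?thesis using True by (simp add: abs_le_iff algebra_simps)
        next
          case False
          then have "Complex x y \<notin> square v \<delta>" for x by (simp add: square_def)
          then show ?thesis by simp
        qed
      qed
      also have "\<dots> = ennreal K * ennreal (2 * \<delta>)" using \<delta> by (subst nn_integral_cmult_indicator) auto
      finally show ?thesis using sub by simp
    next
      fix t' assume t': "t' + \<delta> \<le> Im v" and inP: "\<forall>x. \<bar>x - Re v\<bar> \<le> \<delta> \<longrightarrow> x \<noteq> 0 \<and> (\<bar>x\<bar>, t') \<in> P"
      (* The vertical line through x consists of parameters of the curve with half width |x|;
         q x y is the parameter of the point at height y. *)
      define q where "q x y = (if 0 < x then x + (y - t') else x - (y - t'))" for x y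
      have side: "Complex x y = Gamma_path \<bar>x\<bar> t' (q x y)" if "x \<noteq> 0" "\<bar>y - Im v\<bar> \<le> \<delta>" for x y
        using that t' by (auto simp: Gamma_path_def q_def complex_eq_iff)
      have sub: "square v \<delta> \<subseteq> \<Omega>"
      proof
        fix z assume z: "z \<in> square v \<delta>"
        then have zP: "Re z \<noteq> 0" "(\<bar>Re z\<bar>, t') \<in> P" using inP by (auto simp: square_def)
        then have "z = Gamma_path \<bar>Re z\<bar> t' (q (Re z) (Im z))" using z side[of "Re z" "Im z"] by (simp add: square_def)
        moreover have "Gamma_path \<bar>Re z\<bar> t' (q (Re z) (Im z)) \<in> \<Omega>" using zP by (intro P_in)
        ultimately show "z \<in> \<Omega>" by simp
      qed
      have "continuous_on (square v \<delta>) (\<lambda>z. cmod (F z) powr p)"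
        using continuous_on_subset[OF holomorphic_on_imp_continuous_on[OF F] sub] p
        by (intro continuous_intros continuous_on_powr') auto
      note sq_meas = measurable_square_integrand[OF this]
      have [measurable]: "(\<lambda>(y, x). ennreal (cmod (F (Complex x y)) powr p) * indicator (square v \<delta>) (Complex x y))
          \<in> borel_measurable (lborel \<Otimes>\<^sub>M lborel)"
        unfolding split_beta' by (rule measurable_compose[OF _ sq_meas]) measurable
      have "square_integral (\<lambda>z. cmod (F z) powr p) v \<delta>
        = (\<integral>\<^sup>+x. (\<integral>\<^sup>+y. ennreal (cmod (F (Complex x y)) powr p) * indicator (square v \<delta>) (Complex x y) \<partial>lborel) \<partial>lborel)"
        unfolding square_integral_def by (rule lborel_pair.Fubini') measurable
      also have "\<dots> \<le> (\<integral>\<^sup>+x. ennreal K * indicator {Re v - \<delta>..Re v + \<delta>} x \<partial>lborel)"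
      proof (rule nn_integral_mono)
        fix x
        show "(\<integral>\<^sup>+y. ennreal (cmod (F (Complex x y)) powr p) * indicator (square v \<delta>) (Complex x y) \<partial>lborel)
          \<le> ennreal K * indicator {Re v - \<delta>..Re v + \<delta>} x"
        proof (cases "\<bar>x - Re v\<bar> \<le> \<delta>")
          case True
          then have xP: "x \<noteq> 0" "(\<bar>x\<bar>, t') \<in> P" using inP by auto
          have "(\<integral>\<^sup>+y. ennreal (cmod (F (Complex x y)) powr p) * indicator (square v \<delta>) (Complex x y) \<partial>lborel)
            \<le> (\<integral>\<^sup>+y. ennreal (cmod (F (Gamma_path \<bar>x\<bar> t' (q x y))) powr p) \<partial>lborel)"
            using xP(1) by (intro nn_integral_mono) (auto simp: side[symmetric] square_def split: split_indicator)
          also have "\<dots> = (\<integral>\<^sup>+y. ennreal (cmod (F (Gamma_path \<bar>x\<bar> t' ((if 0 < x then x - t' else x + t') + (if 0 < x then 1 else -1) * y))) powr p) \<partial>lborel)"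
            by (intro nn_integral_cong) (simp add: q_def algebra_simps)
          also have "\<dots> = arc_mean F \<bar>x\<bar> t'"
            by (rule nn_integral_reflect_shift[OF measurable_on_arc[OF F xP(2)]]) simp
          also have "\<dots> \<le> ennreal K" by (rule K(1)[OF xP(2)])
          finally show ?thesis using True by (simp add: abs_le_iff algebra_simps)
        next
          case False
          then have "Complex x y \<notin> square v \<delta>" for y by (simp add: square_def)
          then show ?thesis by simp
        qed
      qed
      also have "\<dots> = ennreal K * ennreal (2 * \<delta>)" using \<delta> by (subst nn_integral_cmult_indicator) auto
      finally show ?thesis using sub by simp
    qed
    then have sub: "square v \<delta> \<subseteq> \<Omega>" and I: "square_integral (\<lambda>z. cmod (F z) powr p) v \<delta> \<le> ennreal K * ennreal (2 * \<delta>)" by auto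
    have "ennreal (cmod (F v) powr p) \<le> ennreal (C / \<delta>\<^sup>2) * square_integral (\<lambda>z. cmod (F z) powr p) v \<delta>"
      by (rule C(2)[OF holomorphic_on_subset[OF F sub] \<delta>])
    also have "\<dots> \<le> ennreal (C / \<delta>\<^sup>2) * (ennreal K * ennreal (2 * \<delta>))" using I by (rule mult_left_mono) simp
    also have "\<dots> = ennreal (C / \<delta>\<^sup>2 * (K * (2 * \<delta>)))"
      using C \<delta> K by (subst ennreal_mult'[symmetric], simp, subst ennreal_mult'[symmetric], auto)
    finally have "cmod (F v) powr p \<le> C / \<delta>\<^sup>2 * (K * (2 * \<delta>))"
      using C K \<delta> by (subst (asm) ennreal_le_iff) auto
    then show "cmod (F (\<i> * of_real t + of_real (s / \<sigma>) * w)) powr p \<le> C / \<delta>\<^sup>2 * (K * (2 * \<delta>))" by (simp add: v_def)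
  qed
qed

lemma Gamma_path_dilate:
  assumes "0 < s"
  shows "\<i> * of_real t + of_real (s / \<sigma>) * Gamma_path \<sigma> 0 x = Gamma_path s t (s / \<sigma> * x)"
proof -
  define r where "r = s / \<sigma>"
  have r: "0 < r" "s = r * \<sigma>" using assms \<sigma> by (auto simp: r_def)
  have "(r * x < - (r * \<sigma>)) = (x < - \<sigma>)" "(r * x \<le> r * \<sigma>) = (x \<le> \<sigma>)"
    using mult_less_cancel_left_pos[OF r(1), of x "- \<sigma>"] mult_le_cancel_left_pos[OF r(1), of x \<sigma>] by auto
  then show ?thesis unfolding r_def[symmetric] unfolding Gamma_path_def r(2)
    by (auto simp: complex_eq_iff algebra_simps)
qed

lemma g_cmod: "z \<in> H \<Longrightarrow> cmod (F * g z) powr p = cmod F powr p * cmod (deriv \<Phi> z)"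
  using g_powr[of z] by (simp add: norm_mult powr_mult)

text \<open>
  The dilated function is bounded, hence of at most the growth of \<open>\<Phi>'\<close> after multiplication by \<open>g\<close>, and has
  boundary values. The Phragmen-Lindelof principle bounds its line means by the integral of the boundary
  values, and this integral becomes the one over \<open>\<Gamma>\<^bsub>s,t\<^esub>\<close> by the arc length substitution. The
  factor \<open>(s / \<sigma>)\<^bsup>1/p\<^esup>\<close> compensates the change of length under the dilation.
\<close>
lemma line_mean_dilated_le:
  assumes F: "F holomorphic_on \<Omega>" and K: "\<And>s t. (s, t) \<in> P \<Longrightarrow> arc_mean F s t \<le> ennreal K" "0 \<le> K"
    and st: "(s, t) \<in> P" and y: "0 < e * y"
  shows "line_mean (\<lambda>z. F (\<i> * of_real t + of_real (s / \<sigma>) * \<Phi> z) * g z * of_real ((s / \<sigma>) powr (1 / p))) p y \<le> ennreal K"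
proof -
  have s: "0 < s" "0 < s / \<sigma>" using P_pos[OF st] \<sigma> by auto
  define h where "h z = F (\<i> * of_real t + of_real (s / \<sigma>) * \<Phi> z) * g z * of_real ((s / \<sigma>) powr (1 / p))" for z
  obtain B where B: "0 \<le> B" "\<And>w. w \<in> \<Omega> \<Longrightarrow> cmod (F (\<i> * of_real t + of_real (s / \<sigma>) * w)) powr p \<le> B"
    using bounded_inside[OF F K st] by blast
  have h_powr: "cmod (h z) powr p = cmod (F (\<i> * of_real t + of_real (s / \<sigma>) * \<Phi> z)) powr p * cmod (deriv \<Phi> z) * (s / \<sigma>)"
    if "z \<in> H" for z
  proof -
    have "cmod (h z) powr p = cmod (F (\<i> * of_real t + of_real (s / \<sigma>) * \<Phi> z) * g z) powr p * ((s / \<sigma>) powr (1 / p)) powr p"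
      unfolding h_def norm_mult[of _ "of_real _"] powr_mult by simp
    also have "((s / \<sigma>) powr (1 / p)) powr p = s / \<sigma>" using s p \<sigma> by (simp add: powr_powr)
    finally show ?thesis by (simp only: g_cmod[OF that])
  qed
  define G where "G x = cmod (F (Gamma_path s t (s / \<sigma> * x))) powr p * (s / \<sigma>)" for x
  have [measurable]: "(\<lambda>x. F (Gamma_path s t (s / \<sigma> * x))) \<in> borel_measurable borel"
    using P_in[OF st] s(1)
    by (intro borel_measurable_continuous_onI continuous_on_compose2[OF holomorphic_on_imp_continuous_on[OF F]]
        continuous_on_compose2[OF continuous_Gamma_path] continuous_intros) auto
  have [measurable]: "G \<in> borel_measurable borel" unfolding G_def by measurable
  have G0: "0 \<le> G x" for x unfolding G_def using s by (intro mult_nonneg_nonneg) auto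
  note [measurable] = \<xi>_meas d_meas
  have "line_mean h p y \<le> (\<integral>\<^sup>+x. ennreal (G (\<xi> x) * d x) \<partial>lborel)"
  proof (rule line_mean_le_limit[OF e _ p _ _ _ _ y])
    show "h holomorphic_on H" unfolding h_def
      using dilate[OF st] \<Phi>_in
      by (intro holomorphic_intros g_holo holomorphic_on_compose_gen[OF _ F, unfolded o_def] \<Phi>_holo) auto
    show "0 \<le> B * M * (s / \<sigma>)" using B(1) M s(2) by (intro mult_nonneg_nonneg) auto
    show "cmod (h z) powr p \<le> B * M * (s / \<sigma>) * (1 + cmod z) * (1 + cmod (z\<^sup>2 - 1) powr (- 1/2))" if "0 < e * Im z" for z
    proof -
      have "cmod (h z) powr p \<le> B * (M * (1 + cmod z) * (1 + cmod (z\<^sup>2 - 1) powr (- 1/2))) * (s / \<sigma>)"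
      proof -
        have "cmod (F (\<i> * of_real t + of_real (s / \<sigma>) * \<Phi> z)) powr p * cmod (deriv \<Phi> z)
          \<le> B * (M * (1 + cmod z) * (1 + cmod (z\<^sup>2 - 1) powr (- 1/2)))"
          by (rule mult_mono[OF B(2)[OF \<Phi>_in[OF that]] growth[OF that] B(1)]) simp
        then show ?thesis using h_powr[of z] that s(2) by (simp only: mem_Collect_eq mult_right_mono less_imp_le)
      qed
      then show ?thesis by (simp only: ac_simps)
    qed
    show "(\<lambda>x. G (\<xi> x) * d x) \<in> borel_measurable borel" by measurable
    show "((\<lambda>\<delta>. cmod (h (Complex x (e * \<delta>))) powr p) \<longlongrightarrow> G (\<xi> x) * d x) (at_right 0)" if x: "x \<noteq> 1" "x \<noteq> -1" for x
    proof -
      have "((\<lambda>\<delta>. \<i> * of_real t + of_real (s / \<sigma>) * \<Phi> (Complex x (e * \<delta>))) \<longlongrightarrow> Gamma_path s t (s / \<sigma> * \<xi> x)) (at_right 0)"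
        unfolding Gamma_path_dilate[OF s(1), symmetric] using boundary[OF x] by (intro tendsto_intros)
      moreover have "isCont F (Gamma_path s t (s / \<sigma> * \<xi> x))"
        using holomorphic_on_imp_continuous_on[OF F] open_\<Omega> P_in[OF st] by (simp add: continuous_on_eq_continuous_at)
      ultimately have "((\<lambda>\<delta>. F (\<i> * of_real t + of_real (s / \<sigma>) * \<Phi> (Complex x (e * \<delta>)))) \<longlongrightarrow> F (Gamma_path s t (s / \<sigma> * \<xi> x))) (at_right 0)"
        by (rule isCont_tendsto_compose[rotated])
      then have "((\<lambda>\<delta>. cmod (F (\<i> * of_real t + of_real (s / \<sigma>) * \<Phi> (Complex x (e * \<delta>)))) powr p * cmod (deriv \<Phi> (Complex x (e * \<delta>))) * (s / \<sigma>))
          \<longlongrightarrow> cmod (F (Gamma_path s t (s / \<sigma> * \<xi> x))) powr p * d x * (s / \<sigma>)) (at_right 0)"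
        using boundary_deriv[OF x] p by (intro tendsto_intros tendsto_powr') auto
      then have "((\<lambda>\<delta>. cmod (F (\<i> * of_real t + of_real (s / \<sigma>) * \<Phi> (Complex x (e * \<delta>)))) powr p * cmod (deriv \<Phi> (Complex x (e * \<delta>))) * (s / \<sigma>))
          \<longlongrightarrow> G (\<xi> x) * d x) (at_right 0)" by (simp add: G_def mult_ac)
      moreover have "\<forall>\<^sub>F \<delta> in at_right 0. cmod (F (\<i> * of_real t + of_real (s / \<sigma>) * \<Phi> (Complex x (e * \<delta>)))) powr p * cmod (deriv \<Phi> (Complex x (e * \<delta>))) * (s / \<sigma>)
          = cmod (h (Complex x (e * \<delta>))) powr p"
        using eventually_at_right_less[of "0::real"]
      proof eventually_elim
        case (elim \<delta>)
        then have "Complex x (e * \<delta>) \<in> H" using e by auto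
        then show ?case by (simp only: h_powr)
      qed
      ultimately show ?thesis by (rule Lim_transform_eventually)
    qed
  qed
  also have "\<dots> = (\<integral>\<^sup>+x. ennreal (G (\<xi> x)) * ennreal (d x) \<partial>lborel)"
    by (simp add: ennreal_mult' G0)
  also have "\<dots> = (\<integral>\<^sup>+x. ennreal (G x) \<partial>lborel)" by (rule arclength) measurable
  also have "\<dots> = (\<integral>\<^sup>+x. ennreal (s / \<sigma>) * ennreal (cmod (F (Gamma_path s t (0 + s / \<sigma> * x))) powr p) \<partial>lborel)"
  proof -
    have "ennreal (A * r) = ennreal r * ennreal A" if "0 \<le> r" for A r :: real
      using that by (simp add: ennreal_mult'' mult.commute)
    then show ?thesis unfolding G_def using s(2) by (simp only: add_0 less_imp_le)
  qed
  also have "\<dots> = ennreal (s / \<sigma>) * (\<integral>\<^sup>+x. ennreal (cmod (F (Gamma_path s t (0 + s / \<sigma> * x))) powr p) \<partial>lborel)"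
    unfolding add_0 by (rule nn_integral_cmult) measurable
  also have "\<dots> = arc_mean F s t"
    using nn_integral_real_affine[where c = "s / \<sigma>" and t = 0, OF measurable_on_arc[OF F st]] s by (simp only: abs_of_pos)
  also have "\<dots> \<le> ennreal K" by (rule K(1)[OF st])
  finally show ?thesis by (simp add: h_def[abs_def])
qed

lemma line_mean_T_le:
  assumes F: "F holomorphic_on \<Omega>" and K: "\<And>s t. (s, t) \<in> P \<Longrightarrow> arc_mean F s t \<le> K" and y: "0 < e * y"
  shows "line_mean (T F) p y \<le> K"
proof (cases K)
  case (real k)
  obtain s t where st: "\<And>n::nat. (s n, t n) \<in> P" "s \<longlonglongrightarrow> \<sigma>" "t \<longlonglongrightarrow> 0" using exhaust by blast
  define h where "h n z = F (\<i> * of_real (t n) + of_real (s n / \<sigma>) * \<Phi> z) * g z * of_real ((s n / \<sigma>) powr (1 / p))" for n z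
  have h_holo: "h n holomorphic_on H" for n unfolding h_def
    using dilate[OF st(1)] \<Phi>_in
    by (intro holomorphic_intros g_holo holomorphic_on_compose_gen[OF _ F, unfolded o_def] \<Phi>_holo) auto
  have "(\<integral>\<^sup>+x. ennreal (cmod (T F (Complex x y)) powr p) \<partial>lborel) \<le> K"
  proof (rule nn_integral_fatou_bound[where u = "\<lambda>n x. ennreal (cmod (h n (Complex x y)) powr p)"])
    show "(\<lambda>x. ennreal (cmod (h n (Complex x y)) powr p)) \<in> borel_measurable lborel" for n
      using measurable_line_powr[OF h_holo[of n], of y p] y by simp
    show "(\<integral>\<^sup>+x. ennreal (cmod (h n (Complex x y)) powr p) \<partial>lborel) \<le> K" for n
      using line_mean_dilated_le[OF F K[unfolded real(2)] real(1) st(1)[of n] y] by (simp add: line_mean_def h_def real(2))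
    show "AE x in lborel. (\<lambda>n. ennreal (cmod (h n (Complex x y)) powr p)) \<longlonglongrightarrow> ennreal (cmod (T F (Complex x y)) powr p)"
    proof (intro AE_I2 tendsto_ennrealI)
      fix x
      let ?z = "Complex x y"
      have z: "?z \<in> H" using y by simp
      have "(\<lambda>n. \<i> * of_real (t n) + of_real (s n / \<sigma>) * \<Phi> ?z) \<longlonglongrightarrow> \<i> * of_real 0 + of_real (\<sigma> / \<sigma>) * \<Phi> ?z"
        using st \<sigma> by (intro tendsto_intros) auto
      moreover have "isCont F (\<Phi> ?z)"
        using holomorphic_on_imp_continuous_on[OF F] open_\<Omega> \<Phi>_in[of ?z] z by (simp add: continuous_on_eq_continuous_at)
      ultimately have F_lim: "(\<lambda>n. F (\<i> * of_real (t n) + of_real (s n / \<sigma>) * \<Phi> ?z)) \<longlonglongrightarrow> F (\<Phi> ?z)"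
        using \<sigma> by (intro isCont_tendsto_compose[of "\<Phi> ?z" F]) auto
      have "(\<lambda>n. (s n / \<sigma>) powr (1 / p)) \<longlonglongrightarrow> (\<sigma> / \<sigma>) powr (1 / p)"
        using st \<sigma> by (intro tendsto_intros) auto
      then have "(\<lambda>n. h n ?z) \<longlonglongrightarrow> F (\<Phi> ?z) * g ?z * of_real ((\<sigma> / \<sigma>) powr (1 / p))"
        unfolding h_def by (rule tendsto_mult[OF tendsto_mult[OF F_lim tendsto_const] tendsto_of_real])
      then have "(\<lambda>n. h n ?z) \<longlonglongrightarrow> T F ?z" using \<sigma> z by (simp add: T_def)
      then show "(\<lambda>n. cmod (h n ?z) powr p) \<longlonglongrightarrow> cmod (T F ?z) powr p"
        using p by (intro tendsto_powr' tendsto_intros) auto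
    qed
  qed
  then show ?thesis by (simp add: line_mean_def)
qed simp

definition T_inv :: "(complex \<Rightarrow> complex) \<Rightarrow> complex \<Rightarrow> complex" where
  "T_inv f w = (if w \<in> \<Omega> then f (\<psi> w) / g (\<psi> w) else 0)"

lemma T_inv_holo:
  assumes f: "f holomorphic_on H"
  shows "T_inv f holomorphic_on \<Omega>"
proof -
  have "(\<lambda>w. f (\<psi> w) / g (\<psi> w)) holomorphic_on \<Omega>"
    using \<psi>_in g_nonzero
    by (intro holomorphic_intros holomorphic_on_compose_gen[OF \<psi>_holo f, unfolded o_def]
        holomorphic_on_compose_gen[OF \<psi>_holo g_holo, unfolded o_def]) auto
  then show ?thesis by (rule holomorphic_transform) (simp add: T_inv_def)
qed

lemma T_inv_powr:
  assumes "w \<in> \<Omega>"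
  shows "cmod (T_inv f w) powr p = cmod (f (\<psi> w)) powr p * cmod (deriv \<psi> w)"
proof -
  have H: "\<psi> w \<in> H" using \<psi>_in[OF assms] by simp
  have "cmod (T_inv f w) powr p = cmod (f (\<psi> w)) powr p / cmod (deriv \<Phi> (\<psi> w))"
    using assms g_powr[of "\<psi> w"] H by (simp add: T_inv_def norm_divide powr_divide)
  moreover have "1 / cmod (deriv \<Phi> (\<psi> w)) = cmod (deriv \<psi> w)"
    using cmod_\<psi>'[OF assms] by (metis nonzero_eq_divide_eq mult_zero_right zero_neq_one)
  ultimately show ?thesis by (metis times_divide_eq_right mult_1_right)
qed

text \<open>
  The image under \<open>\<psi>\<close> of a straight piece with direction \<open>v\<close> has the derivative \<open>\<psi>' * v\<close>. If this stays
  in one quadrant, the image is monotone and the Carleson estimate applies to it.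
\<close>
lemma segment_integral_le:
  assumes f: "f holomorphic_on H" and N: "\<And>y. 0 < e * y \<Longrightarrow> line_mean f p y \<le> N"
    and k: "\<bar>k\<bar> = 1" and ab: "a \<le> b"
    and line: "\<And>u. u \<in> {a..b} \<Longrightarrow> \<gamma> u = orig + of_real u * v" and inside: "\<And>u. u \<in> {a..b} \<Longrightarrow> \<gamma> u \<in> \<Omega>"
    and v1: "cmod v = 1"
    and dir: "\<And>u. u \<in> {a..b} \<Longrightarrow> 0 \<le> Re (deriv \<psi> (\<gamma> u) * v) \<and> 0 \<le> k * Im (deriv \<psi> (\<gamma> u) * v)"
  shows "(\<integral>\<^sup>+u. ennreal (cmod (T_inv f (\<gamma> u)) powr p) * indicator {a..b} u \<partial>lborel) \<le> 576 * N"
proof -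
  have v: "v \<noteq> 0" using v1 by auto
  define l where "l u = orig + of_real u * v" for u :: real
  have l: "l u \<in> \<Omega>" if "u \<in> {a..b}" for u using line[OF that] inside[OF that] by (simp add: l_def)
  have "(\<integral>\<^sup>+u. ennreal (cmod (T_inv f (\<gamma> u)) powr p) * indicator {a..b} u \<partial>lborel)
    = (\<integral>\<^sup>+u. ennreal (cmod (f (\<psi> (l u))) powr p * cmod (deriv \<psi> (l u) * v)) * indicator {a..b} u \<partial>lborel)"
    using l line by (intro nn_integral_cong) (auto simp: T_inv_powr norm_mult v1 l_def split: split_indicator)
  also have "\<dots> \<le> 576 * N"
  proof (rule carleson_monotone_curve[OF e f p N _ _ k _ _ ab])
    fix u assume u: "u \<in> {a..b}"
    have "(\<psi> has_field_derivative deriv \<psi> (l u)) (at (l u))"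
      using \<psi>_holo open_\<Omega> l[OF u] by (rule holomorphic_derivI)
    moreover have "(l has_vector_derivative v) (at u)"
      unfolding l_def by (auto intro!: derivative_eq_intros simp: has_vector_derivative_def scaleR_conv_of_real)
    ultimately have "(\<psi> \<circ> l has_vector_derivative v * deriv \<psi> (l u)) (at u)"
      by (rule field_vector_diff_chain_at[rotated])
    then show "((\<lambda>u. \<psi> (l u)) has_vector_derivative deriv \<psi> (l u) * v) (at u)" by (simp add: o_def mult.commute)
    have "deriv \<psi> (l u) \<noteq> 0" using quadrant[OF l[OF u]] by (metis less_irrefl zero_complex.sel(1))
    then show "0 \<le> Re (deriv \<psi> (l u) * v) \<and> 0 \<le> k * Im (deriv \<psi> (l u) * v) \<and> deriv \<psi> (l u) * v \<noteq> 0"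
      using dir[OF u] line[OF u] v by (simp add: l_def)
    show "0 < e * Im (\<psi> (l u))" by (rule \<psi>_in[OF l[OF u]])
  next
    have "deriv \<psi> holomorphic_on \<Omega>" using \<psi>_holo open_\<Omega> by (rule holomorphic_deriv)
    then have "continuous_on \<Omega> (deriv \<psi>)" by (rule holomorphic_on_imp_continuous_on)
    moreover have "continuous_on {a..b} l" unfolding l_def by (intro continuous_intros)
    ultimately have "continuous_on {a..b} (\<lambda>u. deriv \<psi> (l u))"
      by (rule continuous_on_compose2) (rule image_subsetI, erule l)
    then show "continuous_on {a..b} (\<lambda>u. deriv \<psi> (l u) * v)" by (intro continuous_intros)
  qed
  finally show ?thesis .
qed

text \<open>
  The curve \<open>\<Gamma>\<^bsub>s,t\<^esub>\<close> is cut at its two corners and at the imaginary axis, where the imaginary part of \<open>\<psi>'\<close> may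
  change sign. Each of the four pieces has a monotone image; \<open>2304 = 4 * 576\<close>.
\<close>
lemma arc_mean_T_inv_le:
  assumes f: "f holomorphic_on H" and N: "\<And>y. 0 < e * y \<Longrightarrow> line_mean f p y \<le> N" and st: "(s, t) \<in> P"
  shows "arc_mean (T_inv f) s t \<le> 2304 * N"
proof -
  have s: "0 < s" by (rule P_pos[OF st])
  define h where "h x = ennreal (cmod (T_inv f (Gamma_path s t x)) powr p)" for x
  have [measurable]: "h \<in> borel_measurable borel"
    unfolding h_def by (rule measurable_on_arc[OF T_inv_holo[OF f] st])
  have quad: "0 < Re (deriv \<psi> (Gamma_path s t x))" "0 \<le> Re (Gamma_path s t x) \<Longrightarrow> Im (deriv \<psi> (Gamma_path s t x)) \<le> 0"
    "Re (Gamma_path s t x) \<le> 0 \<Longrightarrow> 0 \<le> Im (deriv \<psi> (Gamma_path s t x))" for x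
    using quadrant[OF P_in[OF st, of x]] by auto
  have left: "(\<integral>\<^sup>+x. h x * indicator {- s - real n..- s} x \<partial>lborel) \<le> 576 * N" for n :: nat
    unfolding h_def
  proof (rule segment_integral_le[OF f N, where k = "-1" and v = "- \<i>" and orig = "Complex (- s) (t - s)"])
    fix u assume "u \<in> {- s - real n..- s}"
    then show "Gamma_path s t u = Complex (- s) (t - s) + of_real u * - \<i>"
      using s by (auto simp: Gamma_path_def complex_eq_iff)
    then have "Re (Gamma_path s t u) \<le> 0" using s by simp
    then show "0 \<le> Re (deriv \<psi> (Gamma_path s t u) * - \<i>) \<and> 0 \<le> - 1 * Im (deriv \<psi> (Gamma_path s t u) * - \<i>)"
      using quad[of u] by simp
  qed (use P_in[OF st] in auto)
  have bottom_left: "(\<integral>\<^sup>+x. h x * indicator {- s..0} x \<partial>lborel) \<le> 576 * N"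
    unfolding h_def
  proof (rule segment_integral_le[OF f N, where k = 1 and v = 1 and orig = "Complex 0 t"])
    fix u assume "u \<in> {- s..0}"
    then show "Gamma_path s t u = Complex 0 t + of_real u * 1"
      using s by (auto simp: Gamma_path_def complex_eq_iff)
    then have "Re (Gamma_path s t u) \<le> 0" using \<open>u \<in> {- s..0}\<close> by simp
    then show "0 \<le> Re (deriv \<psi> (Gamma_path s t u) * 1) \<and> 0 \<le> 1 * Im (deriv \<psi> (Gamma_path s t u) * 1)"
      using quad[of u] by simp
  qed (use P_in[OF st] s in auto)
  have bottom_right: "(\<integral>\<^sup>+x. h x * indicator {0..s} x \<partial>lborel) \<le> 576 * N"
    unfolding h_def
  proof (rule segment_integral_le[OF f N, where k = "-1" and v = 1 and orig = "Complex 0 t"])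
    fix u assume "u \<in> {0..s}"
    then show "Gamma_path s t u = Complex 0 t + of_real u * 1"
      using s by (auto simp: Gamma_path_def complex_eq_iff)
    then have "0 \<le> Re (Gamma_path s t u)" using \<open>u \<in> {0..s}\<close> by simp
    then show "0 \<le> Re (deriv \<psi> (Gamma_path s t u) * 1) \<and> 0 \<le> - 1 * Im (deriv \<psi> (Gamma_path s t u) * 1)"
      using quad[of u] by simp
  qed (use P_in[OF st] s in auto)
  have right: "(\<integral>\<^sup>+x. h x * indicator {s..s + real n} x \<partial>lborel) \<le> 576 * N" for n :: nat
    unfolding h_def
  proof (rule segment_integral_le[OF f N, where k = 1 and v = "\<i>" and orig = "Complex s (t - s)"])
    fix u assume "u \<in> {s..s + real n}"
    then show "Gamma_path s t u = Complex s (t - s) + of_real u * \<i>"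
      using s by (auto simp: Gamma_path_def complex_eq_iff)
    then have "0 \<le> Re (Gamma_path s t u)" using s by simp
    then show "0 \<le> Re (deriv \<psi> (Gamma_path s t u) * \<i>) \<and> 0 \<le> 1 * Im (deriv \<psi> (Gamma_path s t u) * \<i>)"
      using quad[of u] by simp
  qed (use P_in[OF st] in auto)
  have "(\<integral>\<^sup>+x. h x \<partial>lborel) \<le> 2304 * N"
  proof (rule nn_integral_fatou_bound[where u = "\<lambda>n x. h x * indicator {- s - real n..s + real n} x"])
    show "AE x in lborel. (\<lambda>n. h x * indicator {- s - real n..s + real n} x) \<longlonglongrightarrow> h x"
    proof (intro AE_I2 tendsto_eventually)
      fix x
      obtain m where m: "\<bar>x\<bar> \<le> real m" using real_arch_simple by blast
      have "h x * indicator {- s - real n..s + real n} x = h x" if "m \<le> n" for n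
      proof -
        have "\<bar>x\<bar> \<le> real n" using m that by linarith
        then have "x \<in> {- s - real n..s + real n}" using s by auto
        then show ?thesis by simp
      qed
      then show "\<forall>\<^sub>F n in sequentially. h x * indicator {- s - real n..s + real n} x = h x"
        by (auto simp: eventually_sequentially)
    qed
    fix n
    have "(\<integral>\<^sup>+x. h x * indicator {- s - real n..s + real n} x \<partial>lborel)
      \<le> (\<integral>\<^sup>+x. (h x * indicator {- s - real n..- s} x + h x * indicator {- s..0} x)
               + (h x * indicator {0..s} x + h x * indicator {s..s + real n} x) \<partial>lborel)"
      by (intro nn_integral_mono) (auto split: split_indicator)
    also have "\<dots> = ((\<integral>\<^sup>+x. h x * indicator {- s - real n..- s} x \<partial>lborel) + (\<integral>\<^sup>+x. h x * indicator {- s..0} x \<partial>lborel))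
               + ((\<integral>\<^sup>+x. h x * indicator {0..s} x \<partial>lborel) + (\<integral>\<^sup>+x. h x * indicator {s..s + real n} x \<partial>lborel))"
      by (simp add: nn_integral_add)
    also have "\<dots> \<le> (576 * N + 576 * N) + (576 * N + 576 * N)"
      by (intro add_mono left bottom_left bottom_right right)
    also have "\<dots> = 2304 * N" by (simp add: distrib_right[symmetric])
    finally show "(\<integral>\<^sup>+x. h x * indicator {- s - real n..s + real n} x \<partial>lborel) \<le> 2304 * N" .
  qed measurable
  then show ?thesis by (simp add: h_def)
qed

definition N\<Omega> :: "(complex \<Rightarrow> complex) \<Rightarrow> ennreal" where "N\<Omega> = path_norm p P (\<lambda>(s, t). Gamma_path s t)"
definition NH :: "(complex \<Rightarrow> complex) \<Rightarrow> ennreal" where "NH = path_norm p {y. 0 < e * y} (\<lambda>y x. Complex x y)"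

lemma NH_le_iff: "NH f \<le> enn_root p K \<longleftrightarrow> (\<forall>y. 0 < e * y \<longrightarrow> line_mean f p y \<le> K)"
  unfolding NH_def path_norm_le_iff[OF p] line_mean_def by auto

lemma N\<Omega>_le_iff: "N\<Omega> F \<le> enn_root p K \<longleftrightarrow> (\<forall>s t. (s, t) \<in> P \<longrightarrow> arc_mean F s t \<le> K)"
  unfolding N\<Omega>_def path_norm_le_iff[OF p] by auto

lemma T_holo:
  assumes "F holomorphic_on \<Omega>"
  shows "T F holomorphic_on H"
proof -
  have "(\<lambda>z. F (\<Phi> z) * g z) holomorphic_on H"
    using \<Phi>_in by (intro holomorphic_intros g_holo holomorphic_on_compose_gen[OF \<Phi>_holo assms, unfolded o_def]) auto
  then show ?thesis by (rule holomorphic_transform) (simp add: T_def)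
qed

lemma NH_T_le:
  assumes "F holomorphic_on \<Omega>"
  shows "NH (T F) \<le> N\<Omega> F"
proof -
  obtain K where K: "N\<Omega> F = enn_root p K" by (rule enn_root_surj[OF p])
  then have "arc_mean F s t \<le> K" if "(s, t) \<in> P" for s t using N\<Omega>_le_iff[of F K] that by auto
  then show ?thesis unfolding K NH_le_iff using line_mean_T_le[OF assms] by blast
qed

lemma N\<Omega>_T_inv_le:
  assumes "f holomorphic_on H"
  shows "N\<Omega> (T_inv f) \<le> ennreal (2304 powr (1 / p)) * NH f"
proof -
  obtain K where K: "NH f = enn_root p K" by (rule enn_root_surj[OF p])
  then have "line_mean f p y \<le> K" if "0 < e * y" for y using NH_le_iff[of f K] that by auto
  then have "N\<Omega> (T_inv f) \<le> enn_root p (ennreal 2304 * K)"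
    unfolding N\<Omega>_le_iff using arc_mean_T_inv_le[OF assms] by simp
  also have "\<dots> = ennreal (2304 powr (1 / p)) * NH f" unfolding K using p by (intro enn_root_cmult) auto
  finally show ?thesis .
qed

abbreviation V :: "(complex \<Rightarrow> complex) set" where "V \<equiv> hardy_space \<Omega> N\<Omega>"
abbreviation W :: "(complex \<Rightarrow> complex) set" where "W \<equiv> hardy_space H NH"

lemma T_mem: "F \<in> V \<Longrightarrow> T F \<in> W"
  using NH_T_le[of F] T_holo[of F] by (auto simp: hardy_space_def T_def intro: le_less_trans)

lemma T_inv_mem: "f \<in> W \<Longrightarrow> T_inv f \<in> V"
  using N\<Omega>_T_inv_le[of f] T_inv_holo[of f]
  by (auto simp: hardy_space_def T_inv_def ennreal_mult_less_top intro: le_less_trans)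

lemma T_T_inv:
  assumes "f \<in> W"
  shows "T (T_inv f) = f"
proof
  fix z
  show "T (T_inv f) z = f z"
  proof (cases "z \<in> H")
    case True
    then show ?thesis using \<Phi>_in[of z] \<psi>_\<Phi>[of z] g_nonzero[of z] by (simp add: T_def T_inv_def)
  next
    case False
    then show ?thesis using assms by (simp add: T_def hardy_space_def)
  qed
qed

lemma T_inv_T:
  assumes "F \<in> V"
  shows "T_inv (T F) = F"
proof
  fix w
  show "T_inv (T F) w = F w"
  proof (cases "w \<in> \<Omega>")
    case True
    then show ?thesis using \<psi>_in[of w] \<Phi>_\<psi>[of w] g_nonzero[of "\<psi> w"] by (simp add: T_def T_inv_def)
  next
    case False
    then show ?thesis using assms by (simp add: T_inv_def hardy_space_def)
  qed
qed

lemma inj_on_T: "inj_on T V" by (rule inj_on_inverseI[of V T_inv]) (rule T_inv_T)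

lemma T_image: "T ` V = W"
proof
  show "T ` V \<subseteq> W" using T_mem by blast
  show "W \<subseteq> T ` V" using T_inv_mem T_T_inv by (metis image_eqI subsetI)
qed

lemma inv_into_T: "f \<in> W \<Longrightarrow> inv_into V T f = T_inv f"
  using inv_into_f_f[OF inj_on_T T_inv_mem[of f]] T_T_inv[of f] by simp

lemma linear_T: "linear_between V W T"
  unfolding linear_between_def
proof (intro conjI ballI allI)
  show "complex_subspace V" unfolding N\<Omega>_def
    by (rule complex_subspace_hardy_space[OF p]) (use P_in P_pos continuous_Gamma_path in auto)
  show "complex_subspace W" unfolding NH_def
    by (rule complex_subspace_hardy_space[OF p]) (auto simp: Complex_eq intro!: continuous_intros)
  show "T F \<in> W" if "F \<in> V" for F using that by (rule T_mem)
qed (auto simp: T_def fun_eq_iff algebra_simps)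

lemma ennreal_divide_le:
  fixes x y :: ennreal
  assumes "x \<le> ennreal c * y" "0 \<le> c"
  shows "x / y \<le> ennreal c"
proof (cases "y = 0 \<or> y = top")
  case True
  then show ?thesis
  proof
    assume "y = 0"
    then have "x = 0" using assms(1) by simp
    then show ?thesis by simp
  next
    assume "y = top"
    then show ?thesis by (simp add: divide_ennreal_def)
  qed
next
  case False
  then obtain r where r: "y = ennreal r" "0 < r" by (cases y) (auto simp: less_le)
  have "x \<le> ennreal (c * r)" using assms r by (simp add: ennreal_mult')
  then obtain q where q: "x = ennreal q" "0 \<le> q" by (cases x) (auto simp: top_unique)
  then have "q \<le> c * r" using \<open>x \<le> ennreal (c * r)\<close> assms(2) r by (subst (asm) q, subst (asm) ennreal_le_iff) auto
  then show ?thesis using q r by (simp add: divide_ennreal ennreal_leI field_simps)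
qed

lemma inverse_le_inverse_ennreal:
  fixes x y :: ennreal
  assumes "x \<le> y"
  shows "inverse y \<le> inverse x"
proof (cases "x = 0 \<or> y = top")
  case False
  then have "x \<noteq> top" using assms by (auto simp: top_unique)
  obtain a where a: "x = ennreal a" "0 \<le> a" using \<open>x \<noteq> top\<close> by (cases x) auto
  obtain b where b: "y = ennreal b" "0 \<le> b" using False by (cases y) auto
  have "a \<noteq> 0" using False a by auto
  then have "0 < a" using a by simp
  moreover have "a \<le> b" using assms b(2) unfolding a(1) b(1) by (simp add: ennreal_le_iff)
  ultimately have "ennreal (inverse b) \<le> ennreal (inverse a)" by (intro ennreal_leI le_imp_inverse_le)
  then show ?thesis unfolding a(1) b(1) using \<open>0 < a\<close> \<open>a \<le> b\<close> by (simp add: inverse_ennreal)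
qed auto

lemma op_norm_T_le: "op_norm V N\<Omega> NH T \<le> 1"
  unfolding op_norm_def
proof (rule SUP_least)
  fix F assume "F \<in> {F \<in> V. F \<noteq> (\<lambda>_. 0)}"
  then have "NH (T F) \<le> ennreal 1 * N\<Omega> F" using NH_T_le[of F] by (simp add: hardy_space_def)
  then have "NH (T F) / N\<Omega> F \<le> ennreal 1" by (rule ennreal_divide_le) simp
  then show "NH (T F) / N\<Omega> F \<le> 1" by simp
qed

lemma op_norm_T_inv_finite: "op_norm W NH N\<Omega> (inv_into V T) < \<infinity>"
proof -
  have "op_norm W NH N\<Omega> (inv_into V T) \<le> ennreal (2304 powr (1 / p))"
    unfolding op_norm_def
  proof (rule SUP_least)
    fix f assume "f \<in> {f \<in> W. f \<noteq> (\<lambda>_. 0)}"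
    then have "f \<in> W" "N\<Omega> (T_inv f) \<le> ennreal (2304 powr (1 / p)) * NH f"
      using N\<Omega>_T_inv_le[of f] by (auto simp: hardy_space_def)
    then show "N\<Omega> (inv_into V T f) / NH f \<le> ennreal (2304 powr (1 / p))"
      by (simp add: inv_into_T ennreal_divide_le)
  qed
  also have "\<dots> < \<infinity>" by simp
  finally show ?thesis .
qed

text \<open>
  For a function that is continuous up to the boundary, Fatou's lemma on lines approaching the
  axis bounds the boundary integral by the norm of the image. Elements of the Hardy space vanish off \<open>\<Omega>\<close>, hence
  the cut-off \<open>F0\<close>.
\<close>
lemma op_norm_T_ge:
  assumes F: "F holomorphic_on \<Omega>" and cont: "\<And>x. isCont F (Gamma_path \<sigma> 0 x)"
    and a: "0 < a" "ennreal a \<le> arc_mean F \<sigma> 0"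
    and b: "0 < b" "\<And>s t. (s, t) \<in> P \<Longrightarrow> arc_mean F s t \<le> ennreal b"
  shows "ennreal ((a / b) powr (1 / p)) \<le> op_norm V N\<Omega> NH T"
proof -
  define F0 where "F0 w = (if w \<in> \<Omega> then F w else 0)" for w
  have F0_holo: "F0 holomorphic_on \<Omega>" using F by (rule holomorphic_transform) (simp add: F0_def)
  have TF0: "T F0 = T F" using \<Phi>_in by (auto simp: T_def F0_def fun_eq_iff)
  have N\<Omega>: "N\<Omega> F0 \<le> enn_root p (ennreal b)"
    unfolding N\<Omega>_le_iff F0_def using P_in b(2) by simp
  obtain K where K: "NH (T F) = enn_root p K" by (rule enn_root_surj[OF p])
  then have lm: "line_mean (T F) p y \<le> K" if "0 < e * y" for y using NH_le_iff[of "T F" K] that by auto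
  define \<delta> where "\<delta> n = inverse (real (Suc n))" for n
  have \<delta>: "0 < \<delta> n" for n by (simp add: \<delta>_def)
  have \<delta>0: "filterlim \<delta> (at_right 0) sequentially"
    unfolding filterlim_at \<delta>_def using LIMSEQ_inverse_real_of_nat by auto
  define G where "G x = ennreal (cmod (F (Gamma_path \<sigma> 0 x)) powr p)" for x
  have "continuous_on UNIV (\<lambda>x. F (Gamma_path \<sigma> 0 x))"
    using continuous_Gamma_path[OF \<sigma>, of 0] cont
    by (auto simp: continuous_on_eq_continuous_at intro: isCont_o2)
  then have [measurable]: "(\<lambda>x. F (Gamma_path \<sigma> 0 x)) \<in> borel_measurable borel" by (rule borel_measurable_continuous_onI)
  have [measurable]: "G \<in> borel_measurable borel" unfolding G_def by measurable
  have "ennreal a \<le> (\<integral>\<^sup>+x. G x \<partial>lborel)" using a(2) by (simp add: G_def)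
  also have "\<dots> = (\<integral>\<^sup>+x. G (\<xi> x) * ennreal (d x) \<partial>lborel)" by (rule arclength[symmetric]) measurable
  also have "\<dots> \<le> K"
  proof (rule nn_integral_fatou_bound[where u = "\<lambda>n x. ennreal (cmod (T F (Complex x (e * \<delta> n))) powr p)"])
    have H: "Complex x (e * \<delta> n) \<in> H" for x n using e \<delta>[of n] by auto
    show "(\<lambda>x. ennreal (cmod (T F (Complex x (e * \<delta> n))) powr p)) \<in> borel_measurable lborel" for n
      using measurable_line_powr[OF T_holo[OF F] H] by simp
    show "(\<integral>\<^sup>+x. ennreal (cmod (T F (Complex x (e * \<delta> n))) powr p) \<partial>lborel) \<le> K" for n
      using lm[of "e * \<delta> n"] H[of 0 n] by (simp add: line_mean_def)
    show "AE x in lborel. (\<lambda>n. ennreal (cmod (T F (Complex x (e * \<delta> n))) powr p)) \<longlonglongrightarrow> G (\<xi> x) * ennreal (d x)"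
      using AE_conjI[OF AE_lborel_singleton[of "1::real"] AE_lborel_singleton[of "-1::real"]]
    proof eventually_elim
      case (elim x)
      have "(\<lambda>n. \<Phi> (Complex x (e * \<delta> n))) \<longlonglongrightarrow> Gamma_path \<sigma> 0 (\<xi> x)"
        using boundary elim \<delta>0 by (intro filterlim_compose[OF _ \<delta>0]) auto
      then have "(\<lambda>n. F (\<Phi> (Complex x (e * \<delta> n)))) \<longlonglongrightarrow> F (Gamma_path \<sigma> 0 (\<xi> x))"
        by (rule isCont_tendsto_compose[OF cont])
      moreover have "(\<lambda>n. cmod (deriv \<Phi> (Complex x (e * \<delta> n)))) \<longlonglongrightarrow> d x"
        using boundary_deriv elim \<delta>0 by (intro filterlim_compose[OF _ \<delta>0]) auto
      ultimately have "(\<lambda>n. cmod (F (\<Phi> (Complex x (e * \<delta> n)))) powr p * cmod (deriv \<Phi> (Complex x (e * \<delta> n))))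
          \<longlonglongrightarrow> cmod (F (Gamma_path \<sigma> 0 (\<xi> x))) powr p * d x"
        using p by (intro tendsto_intros tendsto_powr') auto
      then have "(\<lambda>n. cmod (T F (Complex x (e * \<delta> n))) powr p) \<longlonglongrightarrow> cmod (F (Gamma_path \<sigma> 0 (\<xi> x))) powr p * d x"
        using H by (simp add: T_def g_cmod)
      then show ?case unfolding G_def by (simp add: ennreal_mult'[symmetric] tendsto_ennrealI)
    qed
  qed
  finally have "enn_root p (ennreal a) \<le> NH (T F)" unfolding K by (rule enn_root_mono[OF p])
  then have a': "ennreal (a powr (1 / p)) \<le> NH (T F0)" using a(1) by (simp add: enn_root_def TF0)
  have b': "N\<Omega> F0 \<le> ennreal (b powr (1 / p))" using N\<Omega> b(1) by (simp add: enn_root_def)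
  have "F0 \<noteq> (\<lambda>_. 0)"
  proof
    assume "F0 = (\<lambda>_. 0)"
    then have "NH (T F0) \<le> enn_root p 0" unfolding NH_le_iff using p by (simp add: T_def line_mean_def)
    then have "ennreal (a powr (1 / p)) \<le> 0" using a' p by (simp add: enn_root_def)
    then show False using a(1) by simp
  qed
  moreover have "F0 \<in> V"
    using F0_holo le_less_trans[OF b'] by (simp add: hardy_space_def F0_def)
  ultimately have "NH (T F0) / N\<Omega> F0 \<le> op_norm V N\<Omega> NH T"
    unfolding op_norm_def by (intro SUP_upper) auto
  moreover have "ennreal (a powr (1 / p)) / ennreal (b powr (1 / p)) \<le> NH (T F0) / N\<Omega> F0"
    unfolding divide_ennreal_def using a' b' by (intro mult_mono inverse_le_inverse_ennreal) auto
  moreover have "ennreal (a powr (1 / p)) / ennreal (b powr (1 / p)) = ennreal ((a / b) powr (1 / p))"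
    using a(1) b(1) by (simp add: divide_ennreal powr_divide)
  ultimately show ?thesis by simp
qed

end

section \<open>The sine and the boundary of the half-strip\<close>

lemma sin_components: "Re (sin w) = sin (Re w) * cosh (Im w)" "Im (sin w) = cos (Re w) * sinh (Im w)" for w :: complex
  by (simp_all add: Re_sin Im_sin cosh_def sinh_def)

lemma cos_components: "Re (cos w) = cos (Re w) * cosh (Im w)" "Im (cos w) = - (sin (Re w) * sinh (Im w))" for w :: complex
  by (simp_all add: Re_cos Im_cos cosh_def sinh_def field_simps)

lemma cos_Arcsin_csqrt: "cos (Arcsin z) = csqrt (1 - z\<^sup>2)"
proof -
  define q where "q = \<i> * z + csqrt (1 - z\<^sup>2)"
  have q: "q \<noteq> 0" using Arcsin_body_lemma by (simp add: q_def)
  have "q * (csqrt (1 - z\<^sup>2) - \<i> * z) = (csqrt (1 - z\<^sup>2))\<^sup>2 + z\<^sup>2"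
    by (simp add: q_def power2_eq_square algebra_simps)
  then have "q * (csqrt (1 - z\<^sup>2) - \<i> * z) = 1" by simp
  then have inv: "inverse q = csqrt (1 - z\<^sup>2) - \<i> * z" using q by (simp add: inverse_unique)
  have "\<i> * Arcsin z = Ln q" by (simp add: Arcsin_def q_def)
  then have "exp (\<i> * Arcsin z) = q" "exp (- (\<i> * Arcsin z)) = inverse q"
    using q by (simp_all add: exp_minus)
  then have "cos (Arcsin z) = (q + inverse q) / 2" by (simp add: cos_exp_eq)
  then show ?thesis by (simp add: inv) (simp add: q_def)
qed

lemma Re_csqrt_pos: "1 - z\<^sup>2 \<notin> \<real>\<^sub>\<le>\<^sub>0 \<Longrightarrow> 0 < Re (csqrt (1 - z\<^sup>2))"
proof (rule ccontr)
  assume nn: "1 - z\<^sup>2 \<notin> \<real>\<^sub>\<le>\<^sub>0" and "\<not> 0 < Re (csqrt (1 - z\<^sup>2))"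
  then have "Re (csqrt (1 - z\<^sup>2)) = 0" using Re_csqrt[of "1 - z\<^sup>2"] by linarith
  then have "csqrt (1 - z\<^sup>2) = \<i> * of_real (Im (csqrt (1 - z\<^sup>2)))" by (simp add: complex_eq_iff)
  then have "(csqrt (1 - z\<^sup>2))\<^sup>2 = (\<i> * of_real (Im (csqrt (1 - z\<^sup>2))))\<^sup>2" by simp
  then have "1 - z\<^sup>2 = of_real (- ((Im (csqrt (1 - z\<^sup>2)))\<^sup>2))" by (simp add: power_mult_distrib)
  then show False using nn by (metis nonpos_Reals_of_real_iff neg_le_0_iff_le zero_le_power2)
qed

lemma Arcsin_half_strip:
  assumes "Im z \<noteq> 0"
  shows "\<bar>Re (Arcsin z)\<bar> < pi / 2" and "0 < Re (cos (Arcsin z))" and "0 < e * Im z \<Longrightarrow> 0 < e * Im (Arcsin z)"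
proof -
  have "0 < Re (csqrt (1 - z\<^sup>2))" using assms by (intro Re_csqrt_pos one_minus_z2_notin_nonpos_Reals) simp
  then show pos: "0 < Re (cos (Arcsin z))" by (simp add: cos_Arcsin_csqrt)
  then have "0 < cos (Re (Arcsin z)) * cosh (Im (Arcsin z))" unfolding cos_components .
  then have cos: "0 < cos (Re (Arcsin z))" by (rule zero_less_mult_pos2[OF _ cosh_real_pos])
  show a: "\<bar>Re (Arcsin z)\<bar> < pi / 2"
  proof (rule ccontr)
    assume "\<not> \<bar>Re (Arcsin z)\<bar> < pi / 2"
    then have "pi / 2 \<le> \<bar>Re (Arcsin z)\<bar>" "\<bar>Re (Arcsin z)\<bar> \<le> pi" using Re_Arcsin_bound[of z] by auto
    then have "cos \<bar>Re (Arcsin z)\<bar> \<le> cos (pi / 2)" by (intro cos_monotone_0_pi_le) auto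
    then show False using cos by simp
  qed
  assume "0 < e * Im z"
  then have "0 < e * (cos (Re (Arcsin z)) * sinh (Im (Arcsin z)))"
    using sin_components(2)[of "Arcsin z"] by simp
  then have "0 < cos (Re (Arcsin z)) * (e * sinh (Im (Arcsin z)))" by (simp only: ac_simps)
  then have "0 < e * sinh (Im (Arcsin z))" using cos by (simp add: zero_less_mult_iff)
  then show "0 < e * Im (Arcsin z)" by (auto simp: zero_less_mult_iff)
qed

lemma mult_cos_less_sin:
  fixes t :: real
  assumes "0 < t" "t \<le> pi"
  shows "t * cos t < sin t"
proof -
  have "sin 0 - 0 * cos 0 < sin t - t * cos t"
  proof (rule DERIV_pos_imp_increasing_open[OF assms(1)])
    fix x assume "0 < x" "x < t"
    then have "0 < x * sin x" using assms by (intro mult_pos_pos sin_gt_zero) auto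
    moreover have "((\<lambda>x. sin x - x * cos x) has_real_derivative x * sin x) (at x)"
      by (auto intro!: derivative_eq_intros)
    ultimately show "\<exists>y. ((\<lambda>x. sin x - x * cos x) has_real_derivative y) (at x) \<and> 0 < y" by blast
  qed (auto intro!: continuous_intros)
  then show ?thesis by simp
qed

lemma sinh_less_mult_cosh:
  fixes t :: real
  assumes "0 < t"
  shows "sinh t < t * cosh t"
proof -
  have "0 * cosh 0 - sinh 0 < t * cosh t - sinh t"
  proof (rule DERIV_pos_imp_increasing_open[OF assms(1)])
    fix x :: real assume "0 < x" "x < t"
    then have "0 < x * sinh x" by simp
    moreover have "((\<lambda>x. x * cosh x - sinh x) has_real_derivative x * sinh x) (at x)"
      by (auto intro!: derivative_eq_intros)
    ultimately show "\<exists>y. ((\<lambda>x. x * cosh x - sinh x) has_real_derivative y) (at x) \<and> 0 < y" by blast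
  qed (auto intro!: continuous_intros)
  then show ?thesis by simp
qed

lemma le_sinh:
  fixes t :: real
  assumes "0 \<le> t"
  shows "t \<le> sinh t"
proof -
  have "sinh 0 - 0 \<le> sinh t - t"
  proof (rule DERIV_nonneg_imp_nondecreasing[OF assms])
    fix x :: real
    have "((\<lambda>x. sinh x - x) has_real_derivative cosh x - 1) (at x)"
      by (auto intro!: derivative_eq_intros)
    then show "\<exists>y. ((\<lambda>x. sinh x - x) has_real_derivative y) (at x) \<and> 0 \<le> y"
      using cosh_real_ge_1[of x] by (intro exI[of _ "cosh x - 1"]) simp
  qed
  then show ?thesis by simp
qed

lemma third_le_sin:
  fixes t :: real
  assumes "0 \<le> t" "t \<le> pi / 2"
  shows "t / 3 \<le> sin t"
proof (cases "t = 0")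
  case False
  then have t: "0 < t" using assms by simp
  have nn: "0 \<le> sin t" "0 \<le> cos t" using assms by (auto intro: sin_ge_zero cos_ge_zero)
  have "t * cos t \<le> sin t" using mult_cos_less_sin[of t] t assms by simp
  then have "(t * cos t)\<^sup>2 \<le> (sin t)\<^sup>2" using t nn by (intro power_mono) auto
  then have "t\<^sup>2 * (1 - (sin t)\<^sup>2) \<le> (sin t)\<^sup>2" by (simp add: power_mult_distrib cos_squared_eq)
  then have le: "t\<^sup>2 \<le> (sin t)\<^sup>2 * (1 + t\<^sup>2)" by (simp add: algebra_simps)
  have "t \<le> 2" using assms pi_less_4 by simp
  then have "t\<^sup>2 \<le> 2\<^sup>2" using assms by (intro power_mono) auto
  then have "1 + t\<^sup>2 \<le> 9" by simp
  then have "(sin t)\<^sup>2 * (1 + t\<^sup>2) \<le> (sin t)\<^sup>2 * 9" by (intro mult_left_mono) auto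
  then have "(t / 3)\<^sup>2 \<le> (sin t)\<^sup>2" using le by (simp add: power_divide)
  then show ?thesis using nn(1) by (rule power2_le_imp_le)
qed simp

text \<open>
  \<open>sin A - sin B\<close> factors into a sine and a cosine of half sums and differences, and both factors are bounded
  below, the sine by a multiple of its argument. The real half-lines \<open>|x| > 1\<close> are the branch cuts of \<open>Arcsin\<close>; this estimate replaces
  continuity there when they are approached from one side.
\<close>
lemma cmod_diff_le_sin_diff:
  fixes A B :: complex
  assumes A: "\<bar>Re A\<bar> \<le> pi / 2" and B: "\<bar>Re B\<bar> = pi / 2" and Im: "0 < e * Im B" "0 < e * Im A" and e: "e = 1 \<or> e = -1"
  shows "cmod (A - B) \<le> 3 / sinh (\<bar>Im B\<bar> / 2) * cmod (sin A - sin B)"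
proof -
  have cmod_cos: "sinh \<bar>Im w\<bar> \<le> cmod (cos w)" for w :: complex
  proof (rule power2_le_imp_le)
    have "(cmod (cos w))\<^sup>2 = (cos (Re w))\<^sup>2 * (cosh (Im w))\<^sup>2 + (sin (Re w))\<^sup>2 * (sinh (Im w))\<^sup>2"
      by (simp add: cmod_power2 cos_components power_mult_distrib)
    also have "\<dots> = ((cos (Re w))\<^sup>2 + (sin (Re w))\<^sup>2) * (sinh (Im w))\<^sup>2 + (cos (Re w))\<^sup>2"
      unfolding cosh_square_eq by (simp only: algebra_simps mult_1_right)
    finally have "(cmod (cos w))\<^sup>2 = (sinh (Im w))\<^sup>2 + (cos (Re w))\<^sup>2" by simp
    moreover have "(sinh \<bar>Im w\<bar>)\<^sup>2 = (sinh (Im w))\<^sup>2" by (simp add: abs_if)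
    ultimately show "(sinh \<bar>Im w\<bar>)\<^sup>2 \<le> (cmod (cos w))\<^sup>2" by simp
  qed simp
  have cmod_sin: "1/3 * cmod w \<le> cmod (sin w)" if w: "\<bar>Re w\<bar> \<le> pi / 2" for w :: complex
  proof (rule power2_le_imp_le)
    have "(cmod (sin w))\<^sup>2 = (sin (Re w))\<^sup>2 * (cosh (Im w))\<^sup>2 + (cos (Re w))\<^sup>2 * (sinh (Im w))\<^sup>2"
      by (simp add: cmod_power2 sin_components power_mult_distrib)
    also have "\<dots> = ((sin (Re w))\<^sup>2 + (cos (Re w))\<^sup>2) * (sinh (Im w))\<^sup>2 + (sin (Re w))\<^sup>2"
      unfolding cosh_square_eq by (simp only: algebra_simps mult_1_right)
    finally have eq: "(cmod (sin w))\<^sup>2 = (sinh (Im w))\<^sup>2 + (sin (Re w))\<^sup>2" by simp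
    have "(1/3 * \<bar>Re w\<bar>)\<^sup>2 \<le> (sin \<bar>Re w\<bar>)\<^sup>2" using w third_le_sin[of "\<bar>Re w\<bar>"] by (intro power_mono) auto
    also have "(sin \<bar>Re w\<bar>)\<^sup>2 = (sin (Re w))\<^sup>2" by (simp add: abs_if)
    finally have re: "(1/3 * Re w)\<^sup>2 \<le> (sin (Re w))\<^sup>2" by (simp add: power_divide)
    then have "1/3 * \<bar>Im w\<bar> \<le> sinh \<bar>Im w\<bar>" using le_sinh[of "\<bar>Im w\<bar>"] by simp
    then have "(1/3 * \<bar>Im w\<bar>)\<^sup>2 \<le> (sinh \<bar>Im w\<bar>)\<^sup>2" by (intro power_mono) auto
    also have "(sinh \<bar>Im w\<bar>)\<^sup>2 = (sinh (Im w))\<^sup>2" by (simp add: abs_if)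
    finally have im: "(1/3 * Im w)\<^sup>2 \<le> (sinh (Im w))\<^sup>2" by (simp add: power_divide)
    have "(1/3 * cmod w)\<^sup>2 = (1/3 * Re w)\<^sup>2 + (1/3 * Im w)\<^sup>2"
      by (simp add: power_divide cmod_power2 add_divide_distrib)
    then show "(1/3 * cmod w)\<^sup>2 \<le> (cmod (sin w))\<^sup>2" using re im eq by linarith
  qed simp
  have eq: "sin A - sin B = 2 * cos ((A + B) / 2) * sin ((A - B) / 2)"
  proof -
    have "A = (A + B) / 2 + (A - B) / 2" "B = (A + B) / 2 - (A - B) / 2" by (simp_all add: field_simps)
    then have "sin A - sin B = sin ((A + B) / 2 + (A - B) / 2) - sin ((A + B) / 2 - (A - B) / 2)" by (simp only:)
    then show ?thesis by (simp add: sin_add sin_diff)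
  qed
  have s: "0 < sinh (\<bar>Im B\<bar> / 2)" using Im(1) by auto
  have "\<bar>Im B\<bar> / 2 \<le> \<bar>Im ((A + B) / 2)\<bar>" using e Im by auto
  then have "sinh (\<bar>Im B\<bar> / 2) \<le> sinh \<bar>Im ((A + B) / 2)\<bar>" by simp
  also have "\<dots> \<le> cmod (cos ((A + B) / 2))" by (rule cmod_cos)
  finally have c: "sinh (\<bar>Im B\<bar> / 2) \<le> cmod (cos ((A + B) / 2))" .
  have "\<bar>Re ((A - B) / 2)\<bar> \<le> pi / 2" using A B by auto
  then have "1/3 * cmod ((A - B) / 2) \<le> cmod (sin ((A - B) / 2))" by (rule cmod_sin)
  then have d: "cmod (A - B) / 6 \<le> cmod (sin ((A - B) / 2))" by (simp add: norm_divide)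
  have "2 * sinh (\<bar>Im B\<bar> / 2) * (cmod (A - B) / 6) \<le> 2 * cmod (cos ((A + B) / 2)) * cmod (sin ((A - B) / 2))"
    using c d s by (intro mult_mono) auto
  also have "\<dots> = cmod (sin A - sin B)" by (simp add: eq norm_mult)
  finally show ?thesis using s by (simp add: field_simps)
qed

text \<open>
  The boundary value of \<open>Arcsin\<close> at the real point \<open>x\<close>, approached from the half plane \<open>0 < e * Im z\<close>.
\<close>
definition boundary_angle :: "real \<Rightarrow> real \<Rightarrow> complex" where
  "boundary_angle e x = Complex (arcsin (max (-1) (min 1 x))) (e * arcosh (max 1 \<bar>x\<bar>))"

lemma tendsto_Arcsin_boundary:
  assumes e: "e = 1 \<or> e = -1" and x: "x \<noteq> 1" "x \<noteq> -1"
  shows "((\<lambda>d. Arcsin (Complex x (e * d))) \<longlongrightarrow> boundary_angle e x) (at_right 0)"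
proof (cases "\<bar>x\<bar> < 1")
  case True
  have "((\<lambda>d. Complex x (e * d)) \<longlongrightarrow> of_real x) (at_right 0)"
    unfolding Complex_eq by (auto intro!: tendsto_eq_intros)
  then have "((\<lambda>d. Arcsin (Complex x (e * d))) \<longlongrightarrow> Arcsin (of_real x)) (at_right 0)"
    using True by (intro isCont_tendsto_compose[OF isCont_Arcsin]) auto
  moreover have "max (-1) (min 1 x) = x" "max 1 \<bar>x\<bar> = 1" using True by auto
  then have "boundary_angle e x = Arcsin (of_real x)"
    using True of_real_arcsin[of x] by (simp add: boundary_angle_def complex_of_real_def)
  ultimately show ?thesis by simp
next
  case False
  then have x1: "1 < \<bar>x\<bar>" using x by auto
  define B where "B = boundary_angle e x"
  have ReB: "Re B = sgn x * (pi / 2)" using x1 by (auto simp: B_def boundary_angle_def max_def min_def)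
  have ImB: "Im B = e * arcosh \<bar>x\<bar>" using x1 by (simp add: B_def boundary_angle_def max_def)
  have absB: "\<bar>Re B\<bar> = pi / 2" using x1 unfolding ReB by (auto simp: sgn_if)
  have pos: "0 < arcosh \<bar>x\<bar>" using x1 by simp
  have sinB: "sin B = of_real x"
  proof (rule complex_eqI)
    show "Re (sin B) = Re (of_real x)" unfolding sin_components ReB ImB using e x1 by (auto simp: sgn_if)
    show "Im (sin B) = Im (of_real x)" unfolding sin_components ReB ImB using x1 by (auto simp: sgn_if)
  qed
  define k where "k = 3 / sinh (\<bar>Im B\<bar> / 2)"
  have "((\<lambda>d. Arcsin (Complex x (e * d)) - B) \<longlongrightarrow> 0) (at_right 0)"
  proof (rule tendsto_0_le[where K = "\<bar>k\<bar>"])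
    show "((\<lambda>d. Complex x (e * d) - of_real x) \<longlongrightarrow> 0) (at_right 0)"
      unfolding Complex_eq by (auto intro!: tendsto_eq_intros)
    show "\<forall>\<^sub>F d in at_right 0. cmod (Arcsin (Complex x (e * d)) - B) \<le> cmod (Complex x (e * d) - of_real x) * \<bar>k\<bar>"
      using eventually_at_right_less[of "0::real"]
    proof eventually_elim
      case (elim d)
      let ?z = "Complex x (e * d)"
      have "0 < e * Im ?z" "Im ?z \<noteq> 0" using elim e by auto
      note A = Arcsin_half_strip[OF this(2)]
      have "cmod (Arcsin ?z - B) \<le> 3 / sinh (\<bar>Im B\<bar> / 2) * cmod (sin (Arcsin ?z) - sin B)"
        by (rule cmod_diff_le_sin_diff[OF _ _ _ _ e])
          (use A(1) A(3)[OF \<open>0 < e * Im ?z\<close>] absB ImB x1 pos e in auto)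
      also have "\<dots> \<le> \<bar>k\<bar> * cmod (sin (Arcsin ?z) - sin B)" unfolding k_def by (intro mult_right_mono) auto
      finally show ?case by (simp add: sinB mult.commute)
    qed
  qed
  then show ?thesis unfolding B_def by (rule LIM_zero_cancel)
qed

text \<open>
  The rule for compact intervals is applied to \<open>[0, n]\<close>. The images \<open>[g 0, g n]\<close> exhaust the half-line on the left
  because \<open>g\<close> is unbounded.
\<close>
lemma nn_integral_substitution_halfline:
  fixes f :: "real \<Rightarrow> ennreal"
  assumes f: "f \<in> borel_measurable borel"
    and deriv: "\<And>x. 0 \<le> x \<Longrightarrow> (g has_real_derivative g' x) (at x)"
    and cont: "continuous_on {0..} g'" and nonneg: "\<And>x. 0 \<le> x \<Longrightarrow> 0 \<le> g' x"
    and unbounded: "filterlim g at_top at_top"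
  shows "(\<integral>\<^sup>+x. f x * indicator {g 0..} x \<partial>lborel) = (\<integral>\<^sup>+x. f (g x) * ennreal (g' x) * indicator {0..} x \<partial>lborel)"
proof -
  note [measurable] = f
  have mono: "g x \<le> g y" if "0 \<le> x" "x \<le> y" for x y
    using that deriv nonneg by (intro DERIV_nonneg_imp_nondecreasing[of x y g]) (auto, meson order_trans)
  have cont_g: "continuous_on {0..} g"
    by (intro continuous_at_imp_continuous_on ballI DERIV_isCont[OF deriv]) simp
  have "set_borel_measurable borel {0..} g" "set_borel_measurable borel {0..} g'"
    unfolding set_borel_measurable_def
    by (rule borel_measurable_continuous_on_indicator[OF _ cont_g], simp, rule borel_measurable_continuous_on_indicator[OF _ cont], simp)
  then have meas: "(\<lambda>x. f (g x) * ennreal (g' x) * indicator {0..} x) \<in> borel_measurable borel"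
  proof -
    assume *: "set_borel_measurable borel {0..} g" "set_borel_measurable borel {0..} g'"
    have [measurable]: "(\<lambda>x. indicator {0..} x *\<^sub>R g x) \<in> borel_measurable borel" "(\<lambda>x. indicator {0..} x *\<^sub>R g' x) \<in> borel_measurable borel"
      using * unfolding set_borel_measurable_def by blast+
    have "(\<lambda>x. f (g x) * ennreal (g' x) * indicator {0..} x)
      = (\<lambda>x. f (indicator {0..} x *\<^sub>R g x) * ennreal (indicator {0..} x *\<^sub>R g' x) * indicator {0..} x)"
      by (auto simp: fun_eq_iff split: split_indicator)
    moreover have "(\<lambda>x. f (indicator {0..} x *\<^sub>R g x) * ennreal (indicator {0..} x *\<^sub>R g' x) * indicator {0..} x) \<in> borel_measurable borel"
      by measurable
    ultimately show ?thesis by (simp only:)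
  qed
  have eq: "(\<integral>\<^sup>+x. f x * indicator {g 0..g (real (Suc n))} x \<partial>lborel) = (\<integral>\<^sup>+x. f (g x) * ennreal (g' x) * indicator {0..real (Suc n)} x \<partial>lborel)" for n
  proof (rule nn_integral_substitution_aux[OF f])
    show "(g has_real_derivative g' x) (at x)" "0 \<le> g' x" if "x \<in> {0..real (Suc n)}" for x
      using deriv[of x] nonneg[of x] that by simp_all
    show "continuous_on {0..real (Suc n)} g'" by (rule continuous_on_subset[OF cont]) simp
  qed simp_all
  show ?thesis
  proof (rule antisym)
    show "(\<integral>\<^sup>+x. f x * indicator {g 0..} x \<partial>lborel) \<le> (\<integral>\<^sup>+x. f (g x) * ennreal (g' x) * indicator {0..} x \<partial>lborel)"
    proof (rule nn_integral_fatou_bound[where u = "\<lambda>n x. f x * indicator {g 0..g (real (Suc n))} x"])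
      show "AE x in lborel. (\<lambda>n. f x * indicator {g 0..g (real (Suc n))} x) \<longlonglongrightarrow> f x * indicator {g 0..} x"
      proof (intro AE_I2 tendsto_eventually)
        fix x
        have "filterlim (\<lambda>n. g (real (Suc n))) at_top sequentially"
          by (rule filterlim_compose[OF unbounded]) real_asymp
        then have "\<forall>\<^sub>F n in sequentially. x \<le> g (real (Suc n))" by (simp add: filterlim_at_top)
        then show "\<forall>\<^sub>F n in sequentially. f x * indicator {g 0..g (real (Suc n))} x = f x * indicator {g 0..} x"
          by eventually_elim (auto split: split_indicator)
      qed
      show "(\<integral>\<^sup>+x. f x * indicator {g 0..g (real (Suc n))} x \<partial>lborel) \<le> (\<integral>\<^sup>+x. f (g x) * ennreal (g' x) * indicator {0..} x \<partial>lborel)" for n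
        unfolding eq by (intro nn_integral_mono mult_left_mono) (auto split: split_indicator)
    qed measurable
    show "(\<integral>\<^sup>+x. f (g x) * ennreal (g' x) * indicator {0..} x \<partial>lborel) \<le> (\<integral>\<^sup>+x. f x * indicator {g 0..} x \<partial>lborel)"
    proof (rule nn_integral_fatou_bound[where u = "\<lambda>n x. f (g x) * ennreal (g' x) * indicator {0..} x * indicator {..real (Suc n)} x"])
      show "(\<lambda>x. f (g x) * ennreal (g' x) * indicator {0..} x * indicator {..real (Suc n)} x) \<in> borel_measurable lborel" for n
        using meas by measurable
      show "AE x in lborel. (\<lambda>n. f (g x) * ennreal (g' x) * indicator {0..} x * indicator {..real (Suc n)} x) \<longlonglongrightarrow> f (g x) * ennreal (g' x) * indicator {0..} x"
      proof (intro AE_I2 tendsto_eventually)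
        fix x :: real
        have "filterlim (\<lambda>n. real (Suc n)) at_top sequentially" by real_asymp
        then have "\<forall>\<^sub>F n in sequentially. x \<le> real (Suc n)" unfolding filterlim_at_top by blast
        then show "\<forall>\<^sub>F n in sequentially. f (g x) * ennreal (g' x) * indicator {0..} x * indicator {..real (Suc n)} x = f (g x) * ennreal (g' x) * indicator {0..} x"
          by eventually_elim simp
      qed
      fix n
      have "(\<integral>\<^sup>+x. f (g x) * ennreal (g' x) * indicator {0..} x * indicator {..real (Suc n)} x \<partial>lborel)
        = (\<integral>\<^sup>+x. f (g x) * ennreal (g' x) * indicator {0..real (Suc n)} x \<partial>lborel)"
        by (intro nn_integral_cong) (auto split: split_indicator)
      also have "\<dots> = (\<integral>\<^sup>+x. f x * indicator {g 0..g (real (Suc n))} x \<partial>lborel)" by (rule eq[symmetric])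
      also have "\<dots> \<le> (\<integral>\<^sup>+x. f x * indicator {g 0..} x \<partial>lborel)"
        by (intro nn_integral_mono mult_left_mono) (auto split: split_indicator)
      finally show "(\<integral>\<^sup>+x. f (g x) * ennreal (g' x) * indicator {0..} x * indicator {..real (Suc n)} x \<partial>lborel) \<le> \<dots>" .
    qed
  qed
qed

lemma nn_integral_three_pieces:
  fixes f :: "real \<Rightarrow> ennreal"
  assumes [measurable]: "f \<in> borel_measurable borel" and "0 < r"
  shows "(\<integral>\<^sup>+x. f x \<partial>lborel) = (\<integral>\<^sup>+x. f x * indicator {-r..r} x \<partial>lborel)
     + ((\<integral>\<^sup>+x. f x * indicator {r..} x \<partial>lborel) + (\<integral>\<^sup>+x. f (- x) * indicator {r..} x \<partial>lborel))"
proof -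
  have "(\<integral>\<^sup>+x. f x \<partial>lborel) = (\<integral>\<^sup>+x. f x * indicator {-r..r} x + (f x * indicator {r..} x + f x * indicator {..-r} x) \<partial>lborel)"
    by (intro nn_integral_cong_AE, use AE_conjI[OF AE_lborel_singleton[of r] AE_lborel_singleton[of "- r"]] in eventually_elim)
      (use assms(2) in \<open>auto split: split_indicator\<close>)
  also have "\<dots> = (\<integral>\<^sup>+x. f x * indicator {-r..r} x \<partial>lborel)
     + ((\<integral>\<^sup>+x. f x * indicator {r..} x \<partial>lborel) + (\<integral>\<^sup>+x. f x * indicator {..-r} x \<partial>lborel))"
    by (simp add: nn_integral_add)
  also have "(\<integral>\<^sup>+x. f x * indicator {..-r} x \<partial>lborel) = (\<integral>\<^sup>+x. f (0 + (-1) * x) * indicator {..-r} (0 + (-1) * x) \<partial>lborel)"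
    by (rule nn_integral_reflect_shift[symmetric]) auto
  also have "\<dots> = (\<integral>\<^sup>+x. f (- x) * indicator {r..} x \<partial>lborel)"
    by (intro nn_integral_cong) (auto split: split_indicator)
  finally show ?thesis .
qed

text \<open>
  The arc length coordinate of the boundary point over \<open>x\<close>, as a function of its angle: \<open>\<beta>\<close> is the position on the
  bottom edge at the angle \<open>arcsin x\<close> and \<open>\<rho>\<close> the height on a vertical edge at the hyperbolic angle \<open>arcosh |x|\<close>.
  The cut-offs keep the two terms that are not in charge constant, which makes the function continuous.
\<close>
definition arclength_coordinate :: "(real \<Rightarrow> real) \<Rightarrow> (real \<Rightarrow> real) \<Rightarrow> real \<Rightarrow> real" where
  "arclength_coordinate \<beta> \<rho> x = \<beta> (arcsin (max (-1) (min 1 x))) + \<rho> (arcosh (max 1 x)) - \<rho> (arcosh (max 1 (- x)))"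

lemma continuous_arclength_coordinate:
  assumes "continuous_on UNIV \<beta>" "continuous_on UNIV \<rho>"
  shows "continuous_on UNIV (arclength_coordinate \<beta> \<rho>)"
  unfolding arclength_coordinate_def
  by (intro continuous_intros continuous_on_compose2[OF assms(1)] continuous_on_compose2[OF assms(2)]) auto

text \<open>
  Substitute \<open>x = sin t\<close> on \<open>[-1, 1]\<close> and \<open>x = \<plusminus> cosh t\<close> outside, and return with \<open>\<beta>\<close> and \<open>\<rho>\<close>. The
  assumptions on \<open>d\<close> say that it is the Jacobian of the composition.
\<close>
lemma nn_integral_arclength:
  fixes G :: "real \<Rightarrow> ennreal"
  assumes \<sigma>: "0 < \<sigma>" and [measurable]: "G \<in> borel_measurable borel" "d \<in> borel_measurable borel"
    and \<beta>: "\<And>t. (\<beta> has_real_derivative \<beta>' t) (at t)" "continuous_on UNIV \<beta>'" "\<And>t. 0 \<le> \<beta>' t" "\<beta> (pi / 2) = \<sigma>" "\<beta> (- (pi / 2)) = - \<sigma>"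
    and \<rho>: "\<And>t. (\<rho> has_real_derivative \<rho>' t) (at t)" "continuous_on UNIV \<rho>'" "\<And>t. 0 \<le> t \<Longrightarrow> 0 \<le> \<rho>' t" "\<rho> 0 = 0" "filterlim \<rho> at_top at_top"
    and d_mid: "\<And>t. \<bar>t\<bar> < pi / 2 \<Longrightarrow> d (sin t) * cos t = \<beta>' t"
    and d_side: "\<And>t. 0 < t \<Longrightarrow> d (cosh t) * sinh t = \<rho>' t"
    and d_even: "\<And>x. d (- x) = d x" and d_nonneg: "\<And>x. 0 \<le> d x"
  shows "(\<integral>\<^sup>+x. G (arclength_coordinate \<beta> \<rho> x) * ennreal (d x) \<partial>lborel) = (\<integral>\<^sup>+x. G x \<partial>lborel)"
proof -
  let ?\<xi> = "arclength_coordinate \<beta> \<rho>"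
  have "continuous_on UNIV \<beta>" "continuous_on UNIV \<rho>"
    using \<beta>(1) \<rho>(1) by (auto intro!: continuous_at_imp_continuous_on intro: DERIV_isCont)
  then have [measurable]: "?\<xi> \<in> borel_measurable borel"
    by (intro borel_measurable_continuous_onI continuous_arclength_coordinate)
  define f where "f x = G (?\<xi> x) * ennreal (d x)" for x
  have [measurable]: "f \<in> borel_measurable borel" unfolding f_def by measurable
  have mid: "(\<integral>\<^sup>+x. f x * indicator {-1..1} x \<partial>lborel) = (\<integral>\<^sup>+x. G x * indicator {-\<sigma>..\<sigma>} x \<partial>lborel)"
  proof -
    have "(\<integral>\<^sup>+x. f x * indicator {sin (- (pi / 2))..sin (pi / 2)} x \<partial>lborel)
      = (\<integral>\<^sup>+t. f (sin t) * ennreal (cos t) * indicator {- (pi / 2)..pi / 2} t \<partial>lborel)"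
      by (rule nn_integral_substitution_aux) (auto intro!: derivative_eq_intros continuous_intros cos_ge_zero)
    also have "\<dots> = (\<integral>\<^sup>+t. G (\<beta> t) * ennreal (\<beta>' t) * indicator {- (pi / 2)..pi / 2} t \<partial>lborel)"
    proof (intro nn_integral_cong_AE, use AE_conjI[OF AE_lborel_singleton[of "pi/2"] AE_lborel_singleton[of "- (pi/2)"]] in eventually_elim)
      case (elim t)
      show ?case
      proof (cases "t \<in> {- (pi / 2)..pi / 2}")
        case True
        then have t: "\<bar>t\<bar> < pi / 2" using elim by auto
        have "sin t < sin (pi / 2)" "sin (- (pi / 2)) < sin t" using t by (intro sin_monotone_2pi; simp)+
        then have "- 1 < sin t" "sin t < 1" by simp_all
        then have "?\<xi> (sin t) = \<beta> t" using True \<rho>(4) by (simp add: arclength_coordinate_def arcsin_sin max_def min_def)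
        moreover have "ennreal (d (sin t)) * ennreal (cos t) = ennreal (\<beta>' t)"
          using d_mid[OF t] d_nonneg[of "sin t"] by (simp add: ennreal_mult'[symmetric])
        ultimately show ?thesis by (simp add: f_def mult.assoc)
      qed simp
    qed
    also have "\<dots> = (\<integral>\<^sup>+x. G x * indicator {\<beta> (- (pi / 2))..\<beta> (pi / 2)} x \<partial>lborel)"
      by (rule nn_integral_substitution_aux[symmetric, OF _ _ \<beta>(1) continuous_on_subset[OF \<beta>(2)] \<beta>(3)]) simp_all
    finally show ?thesis by (simp add: \<beta>(4,5))
  qed
  have side: "(\<integral>\<^sup>+x. f (m * x) * indicator {1..} x \<partial>lborel) = (\<integral>\<^sup>+x. G (m * x) * indicator {\<sigma>..} x \<partial>lborel)" if m: "m = 1 \<or> m = -1" for m :: real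
  proof -
    have "(\<integral>\<^sup>+x. f (m * x) * indicator {cosh 0..} x \<partial>lborel)
      = (\<integral>\<^sup>+t. f (m * cosh t) * ennreal (sinh t) * indicator {0..} t \<partial>lborel)"
    proof (rule nn_integral_substitution_halfline)
      show "filterlim cosh at_top (at_top::real filter)" by (rule cosh_real_at_top)
    qed (auto intro!: derivative_eq_intros continuous_intros)
    also have "\<dots> = (\<integral>\<^sup>+t. G (m * (\<sigma> + \<rho> t)) * ennreal (\<rho>' t) * indicator {0..} t \<partial>lborel)"
    proof (intro nn_integral_cong_AE, use AE_lborel_singleton[of "0::real"] in eventually_elim)
      case (elim t)
      show ?case
      proof (cases "0 < t")
        case True
        have c: "1 \<le> cosh t" by (rule cosh_real_ge_1)
        have "?\<xi> (m * cosh t) = m * (\<sigma> + \<rho> t)"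
          using m c True \<rho>(4) \<beta>(4,5)
          by (auto simp: arclength_coordinate_def max_def min_def arcosh_cosh_real)
        moreover have "ennreal (d (m * cosh t)) * ennreal (sinh t) = ennreal (\<rho>' t)"
          using d_side[OF True] d_nonneg[of "cosh t"] m by (auto simp: ennreal_mult'[symmetric] d_even)
        ultimately show ?thesis by (simp add: f_def mult.assoc)
      next
        case False
        then show ?thesis using elim by simp
      qed
    qed
    also have "\<dots> = (\<integral>\<^sup>+x. G (m * x) * indicator {\<sigma> + \<rho> 0..} x \<partial>lborel)"
    proof (rule nn_integral_substitution_halfline[symmetric, where f = "\<lambda>x. G (m * x)" and g = "\<lambda>t. \<sigma> + \<rho> t"])
      show "((\<lambda>t. \<sigma> + \<rho> t) has_real_derivative \<rho>' t) (at t)" for t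
        using DERIV_add[OF DERIV_const \<rho>(1)] by simp
      show "continuous_on {0..} \<rho>'" by (rule continuous_on_subset[OF \<rho>(2)]) simp
      show "filterlim (\<lambda>t. \<sigma> + \<rho> t) at_top at_top"
        by (rule filterlim_tendsto_add_at_top[OF tendsto_const \<rho>(5)])
    qed (use \<rho>(3) in simp_all)
    finally show ?thesis by (simp add: \<rho>(4))
  qed
  have "(\<integral>\<^sup>+x. f x \<partial>lborel) = (\<integral>\<^sup>+x. G x \<partial>lborel)"
    using nn_integral_three_pieces[of f 1] nn_integral_three_pieces[of G \<sigma>] mid side[of 1] side[of "-1"] \<sigma> by simp
  then show ?thesis by (simp add: f_def)
qed

section \<open>The conformal map onto the half-strip\<close>

text \<open>
  The segment from 0 to a nonreal point avoids the cuts \<open>|x| \<ge> 1\<close> of the real line, so an integral along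
  it is evaluated by any primitive on the cut plane.
\<close>
lemma Arcsin_primitive:
  assumes "Im z \<noteq> 0"
    and deriv: "\<And>\<zeta>. (Im \<zeta> = 0 \<Longrightarrow> \<bar>Re \<zeta>\<bar> < 1) \<Longrightarrow> (F has_field_derivative f \<zeta>) (at \<zeta>)"
  shows "contour_integral (linepath 0 z) f = F z - F 0"
proof (rule contour_integral_unique)
  let ?S = "{\<zeta>. Im \<zeta> = 0 \<longrightarrow> \<bar>Re \<zeta>\<bar> < 1}"
  have sub: "path_image (linepath 0 z) \<subseteq> ?S"
    using assms(1) by (auto simp: closed_segment_def)
  have "(F has_field_derivative f x) (at x within ?S)" if "x \<in> ?S" for x
    by (rule has_field_derivative_at_within[OF deriv]) (use that in auto)
  from contour_integral_primitive[OF this valid_path_linepath sub]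
  have "(f has_contour_integral F (pathfinish (linepath 0 z)) - F (pathstart (linepath 0 z))) (linepath 0 z)" .
  then show "(f has_contour_integral F z - F 0) (linepath 0 z)"
    by (simp only: pathstart_linepath pathfinish_linepath)
qed

lemma Arcsin_deriv:
  assumes "Im \<zeta> = 0 \<Longrightarrow> \<bar>Re \<zeta>\<bar> < 1"
  shows "(Arcsin has_field_derivative 1 / csqrt (1 - \<zeta>\<^sup>2)) (at \<zeta>)"
  using has_field_derivative_Arcsin[OF assms] by (simp add: cos_Arcsin_csqrt inverse_eq_divide)

lemma Phi_plus_eq:
  assumes "Im z \<noteq> 0"
  shows "Phi_plus \<sigma> z = of_real (2 * \<sigma> / pi) * Arcsin z"
  unfolding Phi_plus_def
  using Arcsin_primitive[OF assms, of Arcsin "\<lambda>\<xi>. 1 / csqrt (1 - \<xi>\<^sup>2)"] Arcsin_deriv by simp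

lemma add_sin_Arcsin_deriv:
  assumes "Im \<zeta> = 0 \<Longrightarrow> \<bar>Re \<zeta>\<bar> < 1"
  shows "((\<lambda>z. (2 * Arcsin z + sin (2 * Arcsin z)) / 4) has_field_derivative csqrt (1 - \<zeta>\<^sup>2)) (at \<zeta>)"
proof -
  define q where "q = csqrt (1 - \<zeta>\<^sup>2)"
  have "q \<noteq> 0" using one_minus_z2_notin_nonpos_Reals[OF assms] by (auto simp: q_def)
  have "((\<lambda>z. (2 * Arcsin z + sin (2 * Arcsin z)) / 4) has_field_derivative
      (2 * (1 / q) + cos (2 * Arcsin \<zeta>) * (2 * (1 / q))) / 4) (at \<zeta>)"
  proof -
    have A: "((\<lambda>z. 2 * Arcsin z) has_field_derivative 2 * (1 / q)) (at \<zeta>)"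
      unfolding q_def by (intro DERIV_cmult Arcsin_deriv assms)
    show ?thesis by (intro DERIV_cdivide DERIV_add A DERIV_chain2[OF DERIV_sin A])
  qed
  also have "cos (2 * Arcsin \<zeta>) = 2 * q\<^sup>2 - 1" unfolding q_def by (simp only: cos_double_cos cos_Arcsin_csqrt)
  also have "(2 * (1 / q) + (2 * q\<^sup>2 - 1) * (2 * (1 / q))) / 4 = q"
    using \<open>q \<noteq> 0\<close> by (simp add: field_simps power2_eq_square)
  finally show ?thesis by (simp add: q_def)
qed

lemma Phi_minus_eq:
  assumes "Im z \<noteq> 0"
  shows "Phi_minus \<sigma> z = of_real (\<sigma> / pi) * (2 * Arcsin z + sin (2 * Arcsin z))"
  unfolding Phi_minus_def
  using Arcsin_primitive[OF assms, of "\<lambda>z. (2 * Arcsin z + sin (2 * Arcsin z)) / 4" "\<lambda>\<xi>. csqrt (1 - \<xi>\<^sup>2)"] add_sin_Arcsin_deriv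
  by (simp add: field_simps)

lemma open_nonreal: "open {z. Im z \<noteq> 0}"
  by (intro open_Collect_neq continuous_intros)

lemma Phi_plus_deriv:
  assumes "Im z \<noteq> 0"
  shows "(Phi_plus \<sigma> has_field_derivative of_real (2 * \<sigma> / pi) / csqrt (1 - z\<^sup>2)) (at z)"
proof -
  have "((\<lambda>z. of_real (2 * \<sigma> / pi) * Arcsin z) has_field_derivative of_real (2 * \<sigma> / pi) * (1 / csqrt (1 - z\<^sup>2))) (at z)"
    using assms by (intro DERIV_cmult Arcsin_deriv) simp
  then have "(Phi_plus \<sigma> has_field_derivative of_real (2 * \<sigma> / pi) * (1 / csqrt (1 - z\<^sup>2))) (at z)"
    by (rule has_field_derivative_transform_within_open[OF _ open_nonreal]) (use assms Phi_plus_eq in auto)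
  then show ?thesis by simp
qed

lemma Phi_minus_deriv:
  assumes "Im z \<noteq> 0"
  shows "(Phi_minus \<sigma> has_field_derivative of_real (4 * \<sigma> / pi) * csqrt (1 - z\<^sup>2)) (at z)"
proof -
  have "((\<lambda>z. of_real (4 * \<sigma> / pi) * ((2 * Arcsin z + sin (2 * Arcsin z)) / 4)) has_field_derivative of_real (4 * \<sigma> / pi) * csqrt (1 - z\<^sup>2)) (at z)"
    using assms by (intro DERIV_cmult add_sin_Arcsin_deriv) simp
  then show ?thesis
    by (rule has_field_derivative_transform_within_open[OF _ open_nonreal]) (use assms in \<open>auto simp: Phi_minus_eq field_simps\<close>)
qed

lemma power_branch_properties:
  assumes branch: "power_branch A h (1 / p) g" and p: "0 < p"
  shows "g holomorphic_on A" and "\<And>z. z \<in> A \<Longrightarrow> cmod (g z) powr p = cmod (h z)"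
proof -
  obtain L where L: "L holomorphic_on A" "\<And>z. z \<in> A \<Longrightarrow> exp (L z) = h z" "\<And>z. z \<in> A \<Longrightarrow> g z = exp (of_real (1 / p) * L z)"
    using branch unfolding power_branch_def by blast
  have "(\<lambda>z. exp (of_real (1 / p) * L z)) holomorphic_on A" using L(1) by (intro holomorphic_intros)
  then show "g holomorphic_on A" by (rule holomorphic_transform) (simp add: L(3))
  show "cmod (g z) powr p = cmod (h z)" if "z \<in> A" for z
  proof -
    have "cmod (g z) powr p = exp (Re (L z) / p) powr p" using L(3)[OF that] by simp
    also have "\<dots> = exp (Re (L z))" using p by (simp add: exp_powr_real)
    also have "\<dots> = cmod (h z)" using L(2)[OF that] by (metis norm_exp_eq_Re)
    finally show ?thesis .
  qed
qed

lemma Gamma_path_arclength_coordinate: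
  assumes \<sigma>: "0 < \<sigma>" and \<beta>: "\<beta> (pi / 2) = \<sigma>" "\<beta> (- (pi / 2)) = - \<sigma>" "\<And>t. \<bar>t\<bar> \<le> pi / 2 \<Longrightarrow> \<bar>\<beta> t\<bar> \<le> \<sigma>"
    and \<rho>: "\<rho> 0 = 0" "\<And>t. 0 \<le> t \<Longrightarrow> 0 \<le> \<rho> t"
  shows "Gamma_path \<sigma> 0 (arclength_coordinate \<beta> \<rho> x) = Complex (\<beta> (arcsin (max (-1) (min 1 x)))) (\<rho> (arcosh (max 1 \<bar>x\<bar>)))"
proof -
  consider "\<bar>x\<bar> \<le> 1" | "1 < x" | "x < -1" by linarith
  then show ?thesis
  proof cases
    case 1
    then have eq: "max (-1) (min 1 x) = x" "max 1 x = 1" "max 1 (- x) = 1" "max 1 \<bar>x\<bar> = 1" by auto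
    have "- (pi / 2) \<le> arcsin x \<and> arcsin x \<le> pi / 2" using 1 by (intro arcsin_bounded) auto
    then have "- (pi / 2) \<le> arcsin x" "arcsin x \<le> pi / 2" by blast+
    then have "\<bar>\<beta> (arcsin x)\<bar> \<le> \<sigma>" by - (rule \<beta>(3), rule abs_leI, assumption, linarith)
    then show ?thesis unfolding arclength_coordinate_def eq by (auto simp: \<rho> Gamma_path_def)
  next
    case 2
    then have eq: "max (-1) (min 1 x) = 1" "max 1 x = x" "max 1 (- x) = 1" "max 1 \<bar>x\<bar> = x" by auto
    have "0 \<le> \<rho> (arcosh x)" using 2 by (intro \<rho>) simp
    then show ?thesis using \<sigma> unfolding arclength_coordinate_def eq by (auto simp: \<rho>(1) \<beta>(1) Gamma_path_def)
  next
    case 3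
    then have eq: "max (-1) (min 1 x) = -1" "max 1 x = 1" "max 1 (- x) = - x" "max 1 \<bar>x\<bar> = - x" by auto
    have "0 \<le> \<rho> (arcosh (- x))" using 3 by (intro \<rho>) simp
    then show ?thesis using \<sigma> unfolding arclength_coordinate_def eq by (auto simp: \<rho>(1) \<beta>(2) Gamma_path_def)
  qed
qed

lemma tendsto_cmod_csqrt:
  assumes "x \<noteq> 1" "x \<noteq> -1"
  shows "((\<lambda>d. sqrt (cmod (1 - (Complex x (e * d))\<^sup>2))) \<longlongrightarrow> sqrt \<bar>1 - x\<^sup>2\<bar>) (at_right 0)"
proof -
  have "((\<lambda>d. sqrt (cmod (1 - (of_real x + \<i> * of_real (e * d))\<^sup>2))) \<longlongrightarrow> sqrt (cmod (1 - (of_real x + \<i> * of_real (e * 0))\<^sup>2))) (at_right 0)"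
    by (intro tendsto_intros)
  moreover have "cmod (1 - (of_real x + \<i> * of_real (e * 0))\<^sup>2) = \<bar>1 - x\<^sup>2\<bar>"
    by (metis add.right_neutral mult_zero_right norm_of_real of_real_0 of_real_1 of_real_diff of_real_power)
  ultimately show ?thesis by (simp add: Complex_eq)
qed

text \<open>
  Position on the bottom edge as a function of the angle, and height on a vertical edge as a function of the hyperbolic
  angle; for a multiple of \<open>Arcsin\<close> both are given by the same linear function.
\<close>
definition edge_length_plus :: "real \<Rightarrow> real \<Rightarrow> real" where
  "edge_length_plus \<sigma> t = 2 * \<sigma> / pi * t"

text \<open>
  The modulus of the derivative of \<open>Phi_plus \<sigma>\<close> on the real line.
\<close>
definition edge_density_plus :: "real \<Rightarrow> real \<Rightarrow> real" where
  "edge_density_plus \<sigma> x = 2 * \<sigma> / pi / sqrt \<bar>1 - x\<^sup>2\<bar>"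

text \<open>
  Here \<open>\<Phi>\<close> is a multiple of \<open>Arcsin\<close> and its inverse is a sine, so all assumptions are explicit: the derivative of
  \<open>sin\<close> is \<open>cos\<close>, whose imaginary part \<open>- sin a sinh b\<close> changes sign exactly on the imaginary axis.
\<close>
lemma half_strip_transfer_plus:
  assumes \<sigma>: "0 < \<sigma>" and p: "0 < p" and branch: "power_branch upper_half_plane (deriv (Phi_plus \<sigma>)) (1 / p) g"
  shows "half_strip_transfer 1 \<sigma> p (2 * \<sigma> / pi) (Phi_plus \<sigma>) (\<lambda>w. sin (of_real (pi / (2 * \<sigma>)) * w)) g (Omega_plus \<sigma>)
    ({0<..<\<sigma>} \<times> {0<..}) (arclength_coordinate (edge_length_plus \<sigma>) (edge_length_plus \<sigma>)) (edge_density_plus \<sigma>)"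
proof -
  define c where "c = pi / (2 * \<sigma>)"
  have c: "0 < c" "c * (2 * \<sigma> / pi) = 1" "2 * \<sigma> / pi = 1 / c" "c * \<sigma> = pi / 2" using \<sigma> by (auto simp: c_def)
  let ?\<psi> = "\<lambda>w. sin (of_real c * w)"
  have dPhi: "deriv (Phi_plus \<sigma>) z = of_real (2 * \<sigma> / pi) / csqrt (1 - z\<^sup>2)" if "0 < 1 * Im z" for z
    using Phi_plus_deriv[of z \<sigma>] that by (intro DERIV_imp_deriv) auto
  have d\<psi>: "deriv ?\<psi> w = of_real c * cos (of_real c * w)" for w
    by (intro DERIV_imp_deriv) (auto intro!: derivative_eq_intros)
  have strip: "\<bar>c * Re w\<bar> < pi / 2 \<and> 0 < c * Im w" if "w \<in> Omega_plus \<sigma>" for w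
  proof -
    have "\<bar>c * Re w\<bar> = c * \<bar>Re w\<bar>" using c by (simp add: abs_mult)
    also have "\<dots> < c * \<sigma>" using that c(1) by (intro mult_strict_left_mono) (auto simp: Omega_plus_def D_def)
    finally show ?thesis using that c by (simp add: Omega_plus_def D_def)
  qed
  note branch' = power_branch_properties[OF branch p]
  have len_deriv: "(edge_length_plus \<sigma> has_real_derivative 2 * \<sigma> / pi) (at t)" for t
    unfolding edge_length_plus_def by (auto intro!: derivative_eq_intros)
  have len_cont: "continuous_on UNIV (edge_length_plus \<sigma>)" unfolding edge_length_plus_def by (intro continuous_intros)
  have "half_strip_transfer 1 \<sigma> p (2 * \<sigma> / pi) (Phi_plus \<sigma>) ?\<psi> g (Omega_plus \<sigma>)
    ({0<..<\<sigma>} \<times> {0<..}) (arclength_coordinate (edge_length_plus \<sigma>) (edge_length_plus \<sigma>)) (edge_density_plus \<sigma>)"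
  proof (rule half_strip_transfer.intro)
    show "(1::real) = 1 \<or> (1::real) = -1" "0 < \<sigma>" "0 < p" "0 \<le> 2 * \<sigma> / pi" using \<sigma> p by auto
    show "open (Omega_plus \<sigma>)" by (simp add: Omega_plus_def open_D)
    show "Phi_plus \<sigma> holomorphic_on {z. 0 < 1 * Im z}"
    proof (rule holomorphic_onI)
      fix z assume "z \<in> {z. 0 < 1 * Im z}"
      then have "Im z \<noteq> 0" by simp
      then show "Phi_plus \<sigma> field_differentiable at z within {z. 0 < 1 * Im z}"
        unfolding field_differentiable_def by (intro exI, rule has_field_derivative_at_within[OF Phi_plus_deriv])
    qed
    show "?\<psi> holomorphic_on Omega_plus \<sigma>" by (intro holomorphic_intros)
    show "Phi_plus \<sigma> z \<in> Omega_plus \<sigma>" if "0 < 1 * Im z" for z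
    proof -
      have nz: "Im z \<noteq> 0" using that by simp
      have "\<bar>Re (Arcsin z)\<bar> < c * \<sigma>" "0 < Im (Arcsin z)" unfolding c(4) using Arcsin_half_strip(1)[OF nz] Arcsin_half_strip(3)[OF nz, of 1] that by auto
      then show ?thesis using c(1) \<sigma> unfolding Phi_plus_eq[OF nz] c(3)
        by (simp add: Omega_plus_def D_def abs_divide divide_less_eq mult.commute)
    qed
    show "?\<psi> (Phi_plus \<sigma> z) = z" if "0 < 1 * Im z" for z
    proof -
      have "of_real c * (of_real (1 / c) * Arcsin z) = Arcsin z" using c(1) by simp
      then show ?thesis using that by (simp only: Phi_plus_eq c(3)) simp
    qed
    show \<psi>_pos: "0 < 1 * Im (?\<psi> w)" if "w \<in> Omega_plus \<sigma>" for w
    proof -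
      have "\<bar>c * Re w\<bar> < pi / 2" "0 < c * Im w" using strip[OF that] by blast+
      then have "0 < cos (c * Re w) * sinh (c * Im w)"
        by (intro mult_pos_pos cos_gt_zero_pi) (auto simp del: zero_less_mult_iff)
      then show ?thesis by (simp add: sin_components del: zero_less_mult_iff)
    qed
    show "Phi_plus \<sigma> (?\<psi> w) = w" if "w \<in> Omega_plus \<sigma>" for w
    proof -
      have "Im (?\<psi> w) \<noteq> 0" using \<psi>_pos[OF that] by linarith
      moreover have "Arcsin (?\<psi> w) = of_real c * w" using strip[OF that] by (intro Arcsin_sin) auto
      ultimately show ?thesis using c(1) unfolding c(3) by (simp add: Phi_plus_eq c(3))
    qed
    show "g holomorphic_on {z. 0 < 1 * Im z}" "\<And>z. 0 < 1 * Im z \<Longrightarrow> cmod (g z) powr p = cmod (deriv (Phi_plus \<sigma>) z)"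
      using branch' by (auto simp: upper_half_plane_def)
    show "0 < Re (deriv ?\<psi> w) \<and> (0 \<le> Re w \<longrightarrow> Im (deriv ?\<psi> w) \<le> 0) \<and> (Re w \<le> 0 \<longrightarrow> 0 \<le> Im (deriv ?\<psi> w))"
      if "w \<in> Omega_plus \<sigma>" for w
    proof -
      have s: "\<bar>c * Re w\<bar> < pi / 2" "0 < c * Im w" using strip[OF that] by blast+
      have "0 < cos (c * Re w) * cosh (c * Im w)"
        by (intro mult_pos_pos cos_gt_zero_pi cosh_real_pos) (use s(1) in linarith)+
      moreover have "0 \<le> sin (c * Re w) * sinh (c * Im w)" if "0 \<le> Re w"
      proof (rule mult_nonneg_nonneg)
        show "0 \<le> sin (c * Re w)"
        proof (rule sin_ge_zero)
          show "0 \<le> c * Re w" using c(1) that by simp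
          show "c * Re w \<le> pi" using s(1) pi_gt_zero by linarith
        qed
      qed (use s(2) in simp)
      moreover have "sin (c * Re w) * sinh (c * Im w) \<le> 0" if "Re w \<le> 0"
      proof (rule mult_nonpos_nonneg)
        have "0 \<le> sin (- (c * Re w))"
        proof (rule sin_ge_zero)
          show "0 \<le> - (c * Re w)" using c(1) that by (simp add: mult_nonneg_nonpos)
          show "- (c * Re w) \<le> pi" using s(1) pi_gt_zero by linarith
        qed
        then show "sin (c * Re w) \<le> 0" by simp
      qed (use s(2) in simp)
      ultimately show ?thesis using c unfolding d\<psi> by (simp add: cos_components zero_le_mult_iff mult_le_0_iff)
    qed
    fix s t assume st: "(s, t) \<in> {0<..<\<sigma>} \<times> {0::real<..}"
    show "0 < s" using st by simp
    show "Gamma_path s t x \<in> Omega_plus \<sigma>" for x using st by (auto simp: Gamma_path_def Omega_plus_def D_def)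
    have scaled: "\<bar>s / \<sigma> * Re w\<bar> < s" if "w \<in> Omega_plus \<sigma>" for w
    proof -
      have "\<bar>s / \<sigma> * Re w\<bar> = s / \<sigma> * \<bar>Re w\<bar>" using st \<sigma> by (simp add: abs_mult)
      also have "\<dots> < s / \<sigma> * \<sigma>" using that st \<sigma> by (intro mult_strict_left_mono) (auto simp: Omega_plus_def D_def)
      finally show ?thesis using \<sigma> by simp
    qed
    have Re_Im: "Re (\<i> * of_real t + of_real (s / \<sigma>) * w) = s / \<sigma> * Re w"
      "Im (\<i> * of_real t + of_real (s / \<sigma>) * w) = t + s / \<sigma> * Im w" for w by simp_all
    have Im_gt: "t < t + s / \<sigma> * Im w" if "w \<in> Omega_plus \<sigma>" for w
      using that st \<sigma> by (simp add: Omega_plus_def D_def)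
    show "\<i> * of_real t + of_real (s / \<sigma>) * w \<in> Omega_plus \<sigma>" if "w \<in> Omega_plus \<sigma>" for w
      using scaled[OF that] Im_gt[OF that] st unfolding Omega_plus_def D_def mem_Collect_eq Re_Im by auto
    define \<delta> where "\<delta> = min ((\<sigma> - s) / 2) (t / 2)"
    have \<delta>: "0 < \<delta>" "\<delta> \<le> (\<sigma> - s) / 2" "\<delta> \<le> t / 2"
      unfolding \<delta>_def by (use st in simp) (rule min.cobounded1 min.cobounded2)+
    show "\<exists>\<delta>>0. \<forall>w\<in>Omega_plus \<sigma>. let v = \<i> * of_real t + of_real (s / \<sigma>) * w in
        (\<exists>s'. \<bar>Re v\<bar> + \<delta> \<le> s' \<and> (\<forall>y. \<bar>y - Im v\<bar> \<le> \<delta> \<longrightarrow> (s', y) \<in> {0<..<\<sigma>} \<times> {0<..}))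
      \<or> (\<exists>t'. t' + \<delta> \<le> Im v \<and> (\<forall>x. \<bar>x - Re v\<bar> \<le> \<delta> \<longrightarrow> x \<noteq> 0 \<and> (\<bar>x\<bar>, t') \<in> {0<..<\<sigma>} \<times> {0<..}))"
      unfolding Let_def Re_Im
    (* The bottom edges of the curves with half width (s + sigma) / 2 sweep out the square. *)
    proof (rule exI[of _ \<delta>], intro conjI \<delta>(1) ballI disjI1 exI[of _ "(s + \<sigma>) / 2"] allI impI)
      fix w assume w: "w \<in> Omega_plus \<sigma>"
      have "\<delta> \<le> \<sigma> / 2 - s / 2" using \<delta>(2) by (simp add: diff_divide_distrib)
      then show "\<bar>s / \<sigma> * Re w\<bar> + \<delta> \<le> (s + \<sigma>) / 2" using scaled[OF w] by (simp add: add_divide_distrib)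
      fix y assume "\<bar>y - (t + s / \<sigma> * Im w)\<bar> \<le> \<delta>"
      then have "0 < y" using Im_gt[OF w] \<delta>(1,3) st by auto
      then show "((s + \<sigma>) / 2, y) \<in> {0<..<\<sigma>} \<times> {0<..}" using st by auto
    qed
  next
    show "\<exists>s t. (\<forall>n::nat. (s n, t n) \<in> {0<..<\<sigma>} \<times> {0::real<..}) \<and> s \<longlonglongrightarrow> \<sigma> \<and> t \<longlonglongrightarrow> 0"
    proof (intro exI conjI allI)
      show "(\<sigma> * (1 - 1 / (2 + real n)), 1 / (1 + real n)) \<in> {0<..<\<sigma>} \<times> {0<..}" for n
        using \<sigma> by (simp add: field_simps add_pos_nonneg)
      show "(\<lambda>n. \<sigma> * (1 - 1 / (2 + real n))) \<longlonglongrightarrow> \<sigma>" using \<sigma> by real_asymp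
      show "(\<lambda>n. 1 / (1 + real n)) \<longlonglongrightarrow> 0" by real_asymp
    qed
    show "cmod (deriv (Phi_plus \<sigma>) z) \<le> 2 * \<sigma> / pi * (1 + cmod z) * (1 + cmod (z\<^sup>2 - 1) powr (- 1 / 2))"
      if "0 < 1 * Im z" for z
    proof -
      have "cmod (deriv (Phi_plus \<sigma>) z) = 2 * \<sigma> / pi / sqrt (cmod (1 - z\<^sup>2))"
        unfolding dPhi[OF that] using \<sigma> by (simp add: norm_divide norm_mult)
      also have "\<dots> = 2 * \<sigma> / pi * cmod (z\<^sup>2 - 1) powr (- 1 / 2)"
        by (simp add: norm_minus_commute[of 1] powr_minus_divide powr_half_sqrt)
      also have "\<dots> \<le> 2 * \<sigma> / pi * ((1 + cmod z) * (1 + cmod (z\<^sup>2 - 1) powr (- 1 / 2)))"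
      proof (rule mult_left_mono)
        have "1 * (1 + cmod (z\<^sup>2 - 1) powr (- 1 / 2)) \<le> (1 + cmod z) * (1 + cmod (z\<^sup>2 - 1) powr (- 1 / 2))"
          by (intro mult_right_mono add_nonneg_nonneg) auto
        then show "cmod (z\<^sup>2 - 1) powr (- 1 / 2) \<le> (1 + cmod z) * (1 + cmod (z\<^sup>2 - 1) powr (- 1 / 2))" by (rule order_trans[rotated]) simp
      qed (use \<sigma> in simp)
      finally show ?thesis by (simp only: mult.assoc)
    qed
    show "arclength_coordinate (edge_length_plus \<sigma>) (edge_length_plus \<sigma>) \<in> borel_measurable borel"
      by (intro borel_measurable_continuous_onI continuous_arclength_coordinate len_cont)
    show meas_d: "edge_density_plus \<sigma> \<in> borel_measurable borel" unfolding edge_density_plus_def by measurable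
    show "0 \<le> edge_density_plus \<sigma> x" for x using \<sigma> by (simp add: edge_density_plus_def)
    show "((\<lambda>\<delta>. Phi_plus \<sigma> (Complex x (1 * \<delta>))) \<longlongrightarrow> Gamma_path \<sigma> 0 (arclength_coordinate (edge_length_plus \<sigma>) (edge_length_plus \<sigma>) x)) (at_right 0)"
      if x: "x \<noteq> 1" "x \<noteq> -1" for x
    proof -
      have "((\<lambda>\<delta>. of_real (2 * \<sigma> / pi) * Arcsin (Complex x (1 * \<delta>))) \<longlongrightarrow> of_real (2 * \<sigma> / pi) * boundary_angle 1 x) (at_right 0)"
        using x by (intro tendsto_intros tendsto_Arcsin_boundary) auto
      moreover have "of_real (2 * \<sigma> / pi) * boundary_angle 1 x = Gamma_path \<sigma> 0 (arclength_coordinate (edge_length_plus \<sigma>) (edge_length_plus \<sigma>) x)"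
      proof (subst Gamma_path_arclength_coordinate[OF \<sigma>])
        show "\<bar>edge_length_plus \<sigma> t\<bar> \<le> \<sigma>" if "\<bar>t\<bar> \<le> pi / 2" for t
        proof -
          have "\<bar>edge_length_plus \<sigma> t\<bar> = 2 * \<sigma> / pi * \<bar>t\<bar>" using \<sigma> by (simp add: edge_length_plus_def abs_mult)
          also have "\<dots> \<le> 2 * \<sigma> / pi * (pi / 2)" using that \<sigma> by (intro mult_left_mono) auto
          finally show ?thesis by simp
        qed
      qed (use \<sigma> in \<open>auto simp: edge_length_plus_def boundary_angle_def complex_eq_iff\<close>)
      moreover have "\<forall>\<^sub>F \<delta> in at_right 0. of_real (2 * \<sigma> / pi) * Arcsin (Complex x (1 * \<delta>)) = Phi_plus \<sigma> (Complex x (1 * \<delta>))"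
        using eventually_at_right_less[of "0::real"] by eventually_elim (simp add: Phi_plus_eq)
      ultimately show ?thesis by (simp only:) (rule Lim_transform_eventually)
    qed
    show "((\<lambda>\<delta>. cmod (deriv (Phi_plus \<sigma>) (Complex x (1 * \<delta>)))) \<longlongrightarrow> edge_density_plus \<sigma> x) (at_right 0)"
      if x: "x \<noteq> 1" "x \<noteq> -1" for x
    proof (rule Lim_transform_eventually)
      have "\<bar>1 - x\<^sup>2\<bar> \<noteq> 0" using x by (auto simp: power2_eq_1_iff)
      then show "((\<lambda>\<delta>. 2 * \<sigma> / pi / sqrt (cmod (1 - (Complex x (1 * \<delta>))\<^sup>2))) \<longlongrightarrow> edge_density_plus \<sigma> x) (at_right 0)"
        unfolding edge_density_plus_def by (intro tendsto_divide tendsto_const tendsto_cmod_csqrt x) simp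
      show "\<forall>\<^sub>F \<delta> in at_right 0. 2 * \<sigma> / pi / sqrt (cmod (1 - (Complex x (1 * \<delta>))\<^sup>2)) = cmod (deriv (Phi_plus \<sigma>) (Complex x (1 * \<delta>)))"
        using eventually_at_right_less[of "0::real"]
        by eventually_elim (use \<sigma> in \<open>simp add: dPhi norm_divide norm_mult\<close>)
    qed
    show "(\<integral>\<^sup>+x. G (arclength_coordinate (edge_length_plus \<sigma>) (edge_length_plus \<sigma>) x) * ennreal (edge_density_plus \<sigma> x) \<partial>lborel) = (\<integral>\<^sup>+x. G x \<partial>lborel)"
      if G: "G \<in> borel_measurable borel" for G
    proof (rule nn_integral_arclength[OF \<sigma> G meas_d, where \<beta>' = "\<lambda>_. 2 * \<sigma> / pi" and \<rho>' = "\<lambda>_. 2 * \<sigma> / pi"])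
      show "edge_density_plus \<sigma> (sin t) * cos t = 2 * \<sigma> / pi" if "\<bar>t\<bar> < pi / 2" for t
      proof -
        have "0 < cos t" using that by (intro cos_gt_zero_pi) auto
        moreover have "1 - (sin t)\<^sup>2 = (cos t)\<^sup>2" by (simp add: cos_squared_eq)
        ultimately show ?thesis by (simp add: edge_density_plus_def)
      qed
      show "edge_density_plus \<sigma> (cosh t) * sinh t = 2 * \<sigma> / pi" if "0 < t" for t
      proof -
        have "1 - (cosh t)\<^sup>2 = - ((sinh t)\<^sup>2)" by (simp add: cosh_square_eq)
        then show ?thesis using that by (simp add: edge_density_plus_def)
      qed
      show "filterlim (edge_length_plus \<sigma>) at_top at_top"
        unfolding edge_length_plus_def using \<sigma>
        by (intro filterlim_tendsto_pos_mult_at_top[OF tendsto_const _ filterlim_ident]) auto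
    qed (use \<sigma> in \<open>auto simp: edge_density_plus_def len_deriv, simp_all add: edge_length_plus_def\<close>)
  qed
  then show ?thesis by (simp add: c_def)
qed

section \<open>The conformal map onto the exterior of the half-strip\<close>

text \<open>
  On the segment from \<open>a\<close> to \<open>b\<close> the real part of \<open>f / (b - a)\<close> is strictly increasing.
\<close>
lemma inj_on_if_Re_deriv_pos:
  assumes S: "convex S" and deriv: "\<And>z. z \<in> S \<Longrightarrow> (f has_field_derivative f' z) (at z)" and pos: "\<And>z. z \<in> S \<Longrightarrow> 0 < Re (f' z)"
  shows "inj_on f S"
proof (rule inj_onI, rule ccontr)
  fix a b assume ab: "a \<in> S" "b \<in> S" "f a = f b" "a \<noteq> b"
  define h where "h t = Re (f (a + of_real t * (b - a)) / (b - a))" for t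
  have "h 0 < h 1"
  proof (rule DERIV_pos_imp_increasing[where f = h])
    fix t :: real assume t: "0 \<le> t" "t \<le> 1"
    have "a + of_real t * (b - a) = (1 - t) *\<^sub>R a + t *\<^sub>R b" by (simp add: scaleR_conv_of_real algebra_simps)
    then have mem: "a + of_real t * (b - a) \<in> S" using convexD_alt[OF S ab(1,2) t] by simp
    have "((\<lambda>t. a + of_real t * (b - a)) has_vector_derivative (b - a)) (at t)"
      by (auto intro!: derivative_eq_intros)
    from field_vector_diff_chain_at[OF this deriv[OF mem]]
    have "((\<lambda>t. f (a + of_real t * (b - a))) has_vector_derivative (b - a) * f' (a + of_real t * (b - a))) (at t)"
      by (simp only: o_def)
    then have "((\<lambda>t. f (a + of_real t * (b - a)) / (b - a)) has_vector_derivative (b - a) * f' (a + of_real t * (b - a)) / (b - a)) (at t)"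
      by (rule has_vector_derivative_divide)
    then have "((\<lambda>t. Re (f (a + of_real t * (b - a)) / (b - a))) has_vector_derivative Re (f' (a + of_real t * (b - a)))) (at t)"
      using bounded_linear.has_vector_derivative[OF bounded_linear_Re] ab(4) by fastforce
    then have "(h has_real_derivative Re (f' (a + of_real t * (b - a)))) (at t)"
      by (simp only: h_def[abs_def] has_real_derivative_iff_has_vector_derivative)
    then show "\<exists>y. (h has_real_derivative y) (at t) \<and> 0 < y" using pos[OF mem] by blast
  qed simp
  then show False using ab(3) by (simp add: h_def)
qed

text \<open>
  In the variable \<open>w = Arcsin z\<close>, which ranges over a half-strip, the map onto the exterior domain is a multiple
  of \<open>2 w + sin (2 w)\<close>.
\<close>
lemma add_sin_components:
  "Re (2 * w + sin (2 * w)) = 2 * Re w + sin (2 * Re w) * cosh (2 * Im w)"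
  "Im (2 * w + sin (2 * w)) = 2 * Im w + cos (2 * Re w) * sinh (2 * Im w)"
  by (simp_all add: sin_components)

text \<open>
  Let \<open>A\<close> be twice the distance of \<open>|Re w|\<close> from \<open>\<pi> / 2\<close> and \<open>B = 2 |Im w|\<close>. If the imaginary part of the image is not
  negative, then \<open>B \<le> cos A sinh B\<close>; as \<open>A cos A < sin A\<close> and \<open>sinh B < B cosh B\<close>, this
  implies \<open>A < sin A cosh B\<close>, which says that the real part exceeds \<open>\<pi>\<close> in absolute value.
\<close>
lemma add_sin_avoids_half_strip:
  assumes a: "\<bar>Re w\<bar> < pi / 2" and b: "Im w < 0"
  shows "pi < \<bar>Re (2 * w + sin (2 * w))\<bar> \<or> Im (2 * w + sin (2 * w)) < 0"
proof (rule disjCI, rule ccontr)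
  assume neg: "\<not> Im (2 * w + sin (2 * w)) < 0" and le: "\<not> pi < \<bar>Re (2 * w + sin (2 * w))\<bar>"
  define A B where "A = pi - 2 * \<bar>Re w\<bar>" and "B = - 2 * Im w"
  have AB: "0 < A" "A \<le> pi" "0 < B" using a b by (auto simp: A_def B_def)
  have cosA: "cos A = - cos (2 * Re w)" and sinA: "sin A = \<bar>sin (2 * Re w)\<bar>"
  proof -
    show "cos A = - cos (2 * Re w)" by (cases "0 \<le> Re w") (simp_all add: A_def cos_diff abs_if)
    have "0 \<le> sin A" using AB by (intro sin_ge_zero) auto
    moreover have "\<bar>sin A\<bar> = \<bar>sin (2 * Re w)\<bar>" by (cases "0 \<le> Re w") (simp_all add: A_def sin_diff abs_if)
    ultimately show "sin A = \<bar>sin (2 * Re w)\<bar>" by simp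
  qed
  have ImB: "2 * Im w = - B" by (simp add: B_def)
  have "B \<le> cos A * sinh B"
    using neg unfolding add_sin_components ImB cosA by simp
  then have "0 < cos A * sinh B" using AB by linarith
  then have cpos: "0 < cos A" using AB by (simp add: zero_less_mult_iff)
  have "A * B \<le> A * (cos A * sinh B)" using \<open>B \<le> cos A * sinh B\<close> AB by (intro mult_left_mono) auto
  also have "\<dots> = (A * cos A) * sinh B" by simp
  also have "\<dots> < sin A * sinh B" using mult_cos_less_sin[of A] AB by (intro mult_strict_right_mono) auto
  also have "\<dots> \<le> sin A * (B * cosh B)" using sinh_less_mult_cosh[of B] AB sinA by (intro mult_left_mono) auto
  finally have "A * B < (sin A * cosh B) * B" by (simp add: mult_ac)
  then have gt: "A < sin A * cosh B" using AB by simp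
  have "\<bar>Re (2 * w + sin (2 * w))\<bar> = 2 * \<bar>Re w\<bar> + \<bar>sin (2 * Re w)\<bar> * cosh B"
  proof (cases "0 \<le> Re w")
    case True
    then have "0 \<le> sin (2 * Re w)" using a by (intro sin_ge_zero) auto
    then show ?thesis using True unfolding add_sin_components ImB by simp
  next
    case False
    then have "0 \<le> sin (- (2 * Re w))" using a by (intro sin_ge_zero) auto
    then have "sin (2 * Re w) * cosh B \<le> 0" by (intro mult_nonpos_nonneg) auto
    moreover have "\<bar>sin (2 * Re w)\<bar> = - sin (2 * Re w)" using \<open>0 \<le> sin (- (2 * Re w))\<close> by simp
    ultimately show ?thesis using False unfolding add_sin_components ImB by (simp add: abs_if)
  qed
  then show False using gt le unfolding sinA by (simp add: A_def)
qed

lemma add_sin_le_pi: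
  fixes t :: real
  assumes "0 \<le> t" "t \<le> pi"
  shows "t + sin t \<le> pi"
  using sin_x_le_x[of "pi - t"] assms by simp

text \<open>
  The boundary of the half-strip is mapped into the region that the image avoids, so a sequence of image points
  that converges outside this region has no preimages that accumulate there.
\<close>
lemma add_sin_boundary:
  assumes a: "\<bar>Re w\<bar> \<le> pi / 2" and b: "Im w \<le> 0" and bd: "\<bar>Re w\<bar> = pi / 2 \<or> Im w = 0"
  shows "\<bar>Re (2 * w + sin (2 * w))\<bar> \<le> pi \<and> 0 \<le> Im (2 * w + sin (2 * w))"
proof (cases "Im w = 0")
  case True
  have "\<bar>2 * Re w + sin (2 * Re w)\<bar> \<le> pi"
  proof (cases "0 \<le> Re w")
    case True
    moreover have "0 \<le> sin (2 * Re w)" using a True by (intro sin_ge_zero) auto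
    ultimately show ?thesis using add_sin_le_pi[of "2 * Re w"] a by simp
  next
    case False
    moreover have "0 \<le> sin (- (2 * Re w))" using a False by (intro sin_ge_zero) auto
    ultimately show ?thesis using add_sin_le_pi[of "- (2 * Re w)"] a by simp
  qed
  then show ?thesis using True unfolding add_sin_components by simp
next
  case False
  then have "2 * Re w = pi \<or> 2 * Re w = - pi" using bd by linarith
  moreover have "- (2 * Im w) \<le> sinh (- (2 * Im w))" using b by (intro le_sinh) simp
  ultimately show ?thesis unfolding add_sin_components by (elim disjE) simp_all
qed

text \<open>
  \<open>|sin (2 w)|\<close> grows exponentially in \<open>|Im w|\<close>, so preimages of bounded sets are bounded. A crude quadratic bound
  suffices.
\<close>
lemma add_sin_growth:
  assumes "\<bar>Re w\<bar> \<le> pi / 2"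
  shows "(Im w)\<^sup>2 \<le> 2 * cmod (2 * w + sin (2 * w)) + 2 * pi + 1"
proof -
  define y where "y = 2 * \<bar>Im w\<bar>"
  have y: "0 \<le> y" by (simp add: y_def)
  have "sinh y \<le> cmod (sin (2 * w))"
  proof (rule power2_le_imp_le)
    have sq: "(sinh y)\<^sup>2 = (sinh (2 * Im w))\<^sup>2" by (simp add: y_def abs_if)
    have "(cmod (sin (2 * w)))\<^sup>2 = (sin (2 * Re w))\<^sup>2 * (1 + (sinh y)\<^sup>2) + (1 - (sin (2 * Re w))\<^sup>2) * (sinh y)\<^sup>2"
      unfolding sq by (simp add: cmod_power2 sin_components power_mult_distrib cosh_square_eq cos_squared_eq)
    also have "\<dots> = (sin (2 * Re w))\<^sup>2 + (sinh y)\<^sup>2" by (simp add: algebra_simps)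
    finally show "(sinh y)\<^sup>2 \<le> (cmod (sin (2 * w)))\<^sup>2" by simp
  qed simp
  also have "\<dots> \<le> cmod (2 * w + sin (2 * w)) + cmod (2 * w)"
    using norm_triangle_ineq4[of "2 * w + sin (2 * w)" "2 * w"] by simp
  also have "cmod (2 * w) \<le> pi + y"
    using cmod_le[of w] assms by (simp add: y_def norm_mult)
  finally have K: "sinh y \<le> cmod (2 * w + sin (2 * w)) + (pi + y)" by simp
  have "1 + y + y\<^sup>2 / 2 \<le> exp y" using y by (rule exp_lower_Taylor_quadratic)
  moreover have "exp (- y) \<le> 1" using y by simp
  moreover have "sinh y = (exp y - exp (- y)) / 2" by (simp add: sinh_field_def)
  ultimately have "y / 2 + y\<^sup>2 / 4 \<le> sinh y" by argo
  moreover have "0 \<le> (y - 2)\<^sup>2" by simp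
  then have "0 \<le> y\<^sup>2 - 4 * y + 4" by (simp add: power2_eq_square algebra_simps)
  moreover have "y\<^sup>2 = 4 * (Im w)\<^sup>2" by (simp add: y_def power_mult_distrib)
  ultimately show ?thesis using K by linarith
qed

lemma Omega_minus_eq: "0 < \<sigma> \<Longrightarrow> Omega_minus \<sigma> = {w. \<sigma> < \<bar>Re w\<bar> \<or> Im w < 0}"
  by (auto simp: Omega_minus_def closure_D)

lemma open_Omega_minus: "open (Omega_minus \<sigma>)" by (simp add: Omega_minus_def open_Compl)

lemma connected_Omega_minus:
  assumes "0 < \<sigma>"
  shows "connected (Omega_minus \<sigma>)"
proof -
  have "connected ({w. Re w < - \<sigma>} \<union> {w. Im w < 0})"
  proof (rule connected_Un)
    have "Complex (- \<sigma> - 1) (- 1) \<in> {w. Re w < - \<sigma>} \<inter> {w. Im w < 0}" by simp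
    then show "{w. Re w < - \<sigma>} \<inter> {w. Im w < 0} \<noteq> {}" by blast
  qed (auto intro!: convex_connected convex_halfspace_Re_lt convex_halfspace_Im_lt)
  then have "connected (({w. Re w < - \<sigma>} \<union> {w. Im w < 0}) \<union> {w. \<sigma> < Re w})"
  proof (rule connected_Un)
    have "Complex (\<sigma> + 1) (- 1) \<in> ({w. Re w < - \<sigma>} \<union> {w. Im w < 0}) \<inter> {w. \<sigma> < Re w}" by simp
    then show "({w. Re w < - \<sigma>} \<union> {w. Im w < 0}) \<inter> {w. \<sigma> < Re w} \<noteq> {}" by blast
  qed (auto intro!: convex_connected convex_halfspace_Re_gt)
  moreover have "({w. Re w < - \<sigma>} \<union> {w. Im w < 0}) \<union> {w. \<sigma> < Re w} = Omega_minus \<sigma>"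
    unfolding Omega_minus_eq[OF assms] by auto
  ultimately show ?thesis by simp
qed

lemma Phi_minus_scaled:
  assumes "0 < \<sigma>" "Im z \<noteq> 0"
  shows "Re (Phi_minus \<sigma> z) = \<sigma> / pi * Re (2 * Arcsin z + sin (2 * Arcsin z))"
    "Im (Phi_minus \<sigma> z) = \<sigma> / pi * Im (2 * Arcsin z + sin (2 * Arcsin z))"
  unfolding Phi_minus_eq[OF assms(2)] by (simp_all only: Re_complex_of_real Im_complex_of_real times_complex.simps mult_zero_left diff_zero add_0_right)

lemma Phi_minus_in_Omega_minus:
  assumes \<sigma>: "0 < \<sigma>" and z: "Im z < 0"
  shows "Phi_minus \<sigma> z \<in> Omega_minus \<sigma>"
proof -
  have nz: "Im z \<noteq> 0" using z by simp
  have "\<bar>Re (Arcsin z)\<bar> < pi / 2" "Im (Arcsin z) < 0"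
    using Arcsin_half_strip(1)[OF nz] Arcsin_half_strip(3)[OF nz, of "-1"] z by auto
  from add_sin_avoids_half_strip[OF this] show ?thesis
  proof
    assume *: "pi < \<bar>Re (2 * Arcsin z + sin (2 * Arcsin z))\<bar>"
    have "\<sigma> = \<sigma> / pi * pi" by simp
    also have "\<dots> < \<sigma> / pi * \<bar>Re (2 * Arcsin z + sin (2 * Arcsin z))\<bar>" using * \<sigma> by (intro mult_strict_left_mono) auto
    also have "\<dots> = \<bar>Re (Phi_minus \<sigma> z)\<bar>" unfolding Phi_minus_scaled[OF \<sigma> nz] abs_mult using \<sigma> by simp
    finally show ?thesis by (simp add: Omega_minus_eq[OF \<sigma>])
  next
    assume "Im (2 * Arcsin z + sin (2 * Arcsin z)) < 0"
    then have "Im (Phi_minus \<sigma> z) < 0" unfolding Phi_minus_scaled[OF \<sigma> nz] using \<sigma> by (intro mult_pos_neg) auto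
    then show ?thesis by (simp add: Omega_minus_eq[OF \<sigma>])
  qed
qed

lemma inj_on_Phi_minus:
  assumes \<sigma>: "0 < \<sigma>"
  shows "inj_on (Phi_minus \<sigma>) {z. Im z < 0}"
proof (rule inj_on_if_Re_deriv_pos)
  show "(Phi_minus \<sigma> has_field_derivative of_real (4 * \<sigma> / pi) * csqrt (1 - z\<^sup>2)) (at z)" if "z \<in> {z. Im z < 0}" for z
    using that by (intro Phi_minus_deriv) auto
  show "0 < Re (of_real (4 * \<sigma> / pi) * csqrt (1 - z\<^sup>2))" if "z \<in> {z. Im z < 0}" for z
  proof -
    have "0 < Re (csqrt (1 - z\<^sup>2))" using that by (intro Re_csqrt_pos one_minus_z2_notin_nonpos_Reals) auto
    then have "0 < 4 * \<sigma> / pi * Re (csqrt (1 - z\<^sup>2))" using \<sigma> by (intro mult_pos_pos) auto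
    then show ?thesis by simp
  qed
qed (rule convex_halfspace_Im_lt)

lemma Phi_minus_holomorphic: "Phi_minus \<sigma> holomorphic_on {z. Im z < 0}"
proof (rule holomorphic_onI)
  fix z assume "z \<in> {z. Im z < 0}"
  then have "Im z \<noteq> 0" by simp
  then show "Phi_minus \<sigma> field_differentiable at z within {z. Im z < 0}"
    unfolding field_differentiable_def by (intro exI, rule has_field_derivative_at_within[OF Phi_minus_deriv])
qed

lemma Phi_minus_bounded_preimages:
  assumes \<sigma>: "0 < \<sigma>" and z: "Im z \<noteq> 0"
  shows "(Im (Arcsin z))\<^sup>2 \<le> 2 * pi / \<sigma> * cmod (Phi_minus \<sigma> z) + 2 * pi + 1"
proof -
  have "cmod (Phi_minus \<sigma> z) = \<sigma> / pi * cmod (2 * Arcsin z + sin (2 * Arcsin z))"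
    unfolding Phi_minus_eq[OF z] norm_mult norm_of_real using \<sigma> by simp
  then have "cmod (2 * Arcsin z + sin (2 * Arcsin z)) = pi / \<sigma> * cmod (Phi_minus \<sigma> z)"
    using \<sigma> by (simp add: field_simps)
  with add_sin_growth[of "Arcsin z"] Arcsin_half_strip(1)[OF z] show ?thesis by simp
qed

text \<open>
  The image is open and \<open>Omega_minus \<sigma>\<close> is connected, so it remains to see that the image is relatively closed.
  A convergent sequence of image points has preimages in a bounded part of the half-strip of the variable
  \<open>\<omega> = Arcsin z\<close>; a limit point of these on its boundary would be mapped into the closure of
  \<open>D \<sigma> 0\<close>, which \<open>Omega_minus \<sigma>\<close> excludes.
\<close>
lemma Phi_minus_image:
  assumes \<sigma>: "0 < \<sigma>"
  shows "Phi_minus \<sigma> ` {z. Im z < 0} = Omega_minus \<sigma>"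
proof -
  let ?\<Phi> = "Phi_minus \<sigma>" and ?H = "{z::complex. Im z < 0}"
  have sub: "?\<Phi> ` ?H \<subseteq> Omega_minus \<sigma>" using Phi_minus_in_Omega_minus[OF \<sigma>] by auto
  have "open (?\<Phi> ` ?H)"
    using Phi_minus_holomorphic _ inj_on_Phi_minus[OF \<sigma>] by (rule open_mapping_thm3) (rule open_halfspace_Im_lt)
  moreover have "?\<Phi> (- \<i>) \<in> ?\<Phi> ` ?H" by simp
  moreover have limit: "w \<in> ?\<Phi> ` ?H" if w: "w \<in> Omega_minus \<sigma>" and lim: "v \<longlonglongrightarrow> w" and v: "\<And>n. v n \<in> ?\<Phi> ` ?H" for v w
  proof -
    have "\<forall>n. \<exists>z. Im z < 0 \<and> v n = ?\<Phi> z" using v by auto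
    then obtain z where z: "\<And>n. Im (z n) < 0" "\<And>n. v n = ?\<Phi> (z n)" by metis
    have nz: "Im (z n) \<noteq> 0" for n using z(1)[of n] by simp
    obtain B where B: "\<And>n. cmod (v n) \<le> B" using convergent_imp_bounded[OF lim] by (auto simp: bounded_iff)
    define C where "C = 2 * pi / \<sigma> * B + 2 * pi + 1"
    have "(Im (Arcsin (z n)))\<^sup>2 \<le> C" for n
    proof -
      have "(Im (Arcsin (z n)))\<^sup>2 \<le> 2 * pi / \<sigma> * cmod (v n) + 2 * pi + 1" unfolding z(2) by (rule Phi_minus_bounded_preimages[OF \<sigma> nz])
      also have "\<dots> \<le> C" unfolding C_def using B[of n] \<sigma> by (intro add_mono mult_left_mono) auto
      finally show ?thesis .
    qed
    then have "\<bar>Im (Arcsin (z n))\<bar> \<le> sqrt C" for n using real_sqrt_le_mono[of "(Im (Arcsin (z n)))\<^sup>2" C] by simp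
    then have "cmod (Arcsin (z n)) \<le> pi / 2 + sqrt C" for n
      using cmod_le[of "Arcsin (z n)"] Arcsin_half_strip(1)[OF nz[of n]] by (smt (verit))
    then have "bounded (range (\<lambda>n. Arcsin (z n)))" by (auto simp: bounded_iff)
    then obtain \<omega> r where r: "strict_mono (r :: nat \<Rightarrow> nat)" "((\<lambda>n. Arcsin (z n)) \<circ> r) \<longlonglongrightarrow> \<omega>"
      using bounded_imp_convergent_subsequence by blast
    then have \<omega>: "(\<lambda>n. Arcsin (z (r n))) \<longlonglongrightarrow> \<omega>" by (simp add: o_def)
    have "(\<lambda>n. \<bar>Re (Arcsin (z (r n)))\<bar>) \<longlonglongrightarrow> \<bar>Re \<omega>\<bar>" by (intro tendsto_intros \<omega>)
    then have re: "\<bar>Re \<omega>\<bar> \<le> pi / 2"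
      by (rule LIMSEQ_le_const2) (use Arcsin_half_strip(1)[OF nz] in \<open>auto intro: less_imp_le\<close>)
    have "(\<lambda>n. Im (Arcsin (z (r n)))) \<longlonglongrightarrow> Im \<omega>" by (intro tendsto_intros \<omega>)
    then have im: "Im \<omega> \<le> 0"
    proof (rule LIMSEQ_le_const2)
      show "\<exists>N. \<forall>n\<ge>N. Im (Arcsin (z (r n))) \<le> 0"
        using Arcsin_half_strip(3)[OF nz, of "-1"] z(1) by (auto intro!: less_imp_le)
    qed
    have "(\<lambda>n. of_real (\<sigma> / pi) * (2 * Arcsin (z (r n)) + sin (2 * Arcsin (z (r n))))) \<longlonglongrightarrow> of_real (\<sigma> / pi) * (2 * \<omega> + sin (2 * \<omega>))"
      by (intro tendsto_intros \<omega>)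
    then have "(v \<circ> r) \<longlonglongrightarrow> of_real (\<sigma> / pi) * (2 * \<omega> + sin (2 * \<omega>))"
      by (simp only: o_def z(2) Phi_minus_eq[OF nz])
    then have weq: "w = of_real (\<sigma> / pi) * (2 * \<omega> + sin (2 * \<omega>))"
      using LIMSEQ_subseq_LIMSEQ[OF lim r(1)] by (rule LIMSEQ_unique[rotated])
    have inside: "\<bar>Re \<omega>\<bar> < pi / 2 \<and> Im \<omega> < 0"
    proof (rule ccontr)
      assume "\<not> (\<bar>Re \<omega>\<bar> < pi / 2 \<and> Im \<omega> < 0)"
      then have bd: "\<bar>Re \<omega>\<bar> = pi / 2 \<or> Im \<omega> = 0" using re im by linarith
      define k where "k = 2 * \<omega> + sin (2 * \<omega>)"
      have k: "\<bar>Re k\<bar> \<le> pi" "0 \<le> Im k" using add_sin_boundary[OF re im bd] by (simp_all only: k_def)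
      have "\<bar>Re w\<bar> = \<sigma> / pi * \<bar>Re k\<bar>" "Im w = \<sigma> / pi * Im k"
        unfolding weq k_def[symmetric] using \<sigma> by (simp_all add: abs_mult)
      moreover have "\<sigma> / pi * \<bar>Re k\<bar> \<le> \<sigma> / pi * pi" using k \<sigma> by (intro mult_left_mono) auto
      moreover have "0 \<le> \<sigma> / pi * Im k" using k \<sigma> by simp
      ultimately show False using w by (auto simp: Omega_minus_eq[OF \<sigma>])
    qed
    have "0 < cos (Re \<omega>)" using inside by (intro cos_gt_zero_pi) linarith+
    then have "Im (sin \<omega>) < 0" unfolding sin_components using inside by (intro mult_pos_neg) auto
    moreover have "Arcsin (sin \<omega>) = \<omega>" using inside by (intro Arcsin_sin) auto
    ultimately have "?\<Phi> (sin \<omega>) = w" unfolding weq by (subst Phi_minus_eq) auto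
    then show ?thesis using \<open>Im (sin \<omega>) < 0\<close> by blast
  qed
  have "closedin (top_of_set (Omega_minus \<sigma>)) (?\<Phi> ` ?H)"
    unfolding closedin_limpt islimpt_sequential using sub limit by blast
  moreover have "openin (top_of_set (Omega_minus \<sigma>)) (?\<Phi> ` ?H)"
    using \<open>open (?\<Phi> ` ?H)\<close> sub by (simp add: openin_open_eq open_Omega_minus)
  ultimately have "?\<Phi> ` ?H = {} \<or> ?\<Phi> ` ?H = Omega_minus \<sigma>"
    using connected_Omega_minus[OF \<sigma>] unfolding connected_clopen by blast
  then show ?thesis using \<open>?\<Phi> (- \<i>) \<in> ?\<Phi> ` ?H\<close> by blast
qed

text \<open>
  The position on the bottom edge and the height on a vertical edge: the real part of \<open>\<sigma> / \<pi> * (2 \<omega> + sin (2 \<omega>))\<close> at \<open>\<omega> = t\<close>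
  and its imaginary part at \<open>\<omega> = \<pi> / 2 - \<i> t\<close>. The density is the modulus of the derivative of \<open>Phi_minus \<sigma>\<close>.
\<close>
definition bottom_length_minus :: "real \<Rightarrow> real \<Rightarrow> real" where
  "bottom_length_minus \<sigma> t = \<sigma> / pi * (2 * t + sin (2 * t))"

definition side_length_minus :: "real \<Rightarrow> real \<Rightarrow> real" where
  "side_length_minus \<sigma> t = \<sigma> / pi * (sinh (2 * t) - 2 * t)"

definition edge_density_minus :: "real \<Rightarrow> real \<Rightarrow> real" where
  "edge_density_minus \<sigma> x = 4 * \<sigma> / pi * sqrt \<bar>1 - x\<^sup>2\<bar>"

lemma bottom_length_minus_bounds:
  assumes \<sigma>: "0 < \<sigma>" and t: "\<bar>t\<bar> \<le> pi / 2"
  shows "\<bar>bottom_length_minus \<sigma> t\<bar> \<le> \<sigma>"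
proof -
  have "\<bar>2 * t + sin (2 * t)\<bar> \<le> pi" using add_sin_boundary[of "of_real t"] t unfolding add_sin_components by simp
  then have "\<sigma> / pi * \<bar>2 * t + sin (2 * t)\<bar> \<le> \<sigma> / pi * pi" using \<sigma> by (intro mult_left_mono) auto
  then show ?thesis using \<sigma> by (simp add: bottom_length_minus_def abs_mult)
qed

lemma boundary_values_minus:
  assumes \<sigma>: "0 < \<sigma>"
  shows "of_real (\<sigma> / pi) * (2 * boundary_angle (-1) x + sin (2 * boundary_angle (-1) x))
    = Gamma_path \<sigma> 0 (arclength_coordinate (bottom_length_minus \<sigma>) (side_length_minus \<sigma>) x)"
proof (subst Gamma_path_arclength_coordinate[OF \<sigma>])
  show "\<bar>bottom_length_minus \<sigma> t\<bar> \<le> \<sigma>" if "\<bar>t\<bar> \<le> pi / 2" for t by (rule bottom_length_minus_bounds[OF \<sigma> that])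
  show "0 \<le> side_length_minus \<sigma> t" if "0 \<le> t" for t
    using le_sinh[of "2 * t"] that \<sigma> by (simp add: side_length_minus_def)
  define \<theta> \<eta> where "\<theta> = arcsin (max (-1) (min 1 x))" and "\<eta> = arcosh (max 1 \<bar>x\<bar>)"
  have B: "boundary_angle (-1) x = Complex \<theta> (- \<eta>)" by (simp add: boundary_angle_def \<theta>_def \<eta>_def)
  have "(sin (2 * \<theta>) = 0 \<and> cos (2 * \<theta>) = -1) \<or> \<eta> = 0"
  proof -
    consider "\<bar>x\<bar> \<le> 1" | "1 < x" | "x < -1" by linarith
    then show ?thesis by cases (auto simp: \<theta>_def \<eta>_def)
  qed
  then show "of_real (\<sigma> / pi) * (2 * boundary_angle (-1) x + sin (2 * boundary_angle (-1) x))
    = Complex (bottom_length_minus \<sigma> (arcsin (max (-1) (min 1 x)))) (side_length_minus \<sigma> (arcosh (max 1 \<bar>x\<bar>)))"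
    unfolding \<theta>_def[symmetric] \<eta>_def[symmetric] B
    by (auto simp: complex_eq_iff sin_components bottom_length_minus_def side_length_minus_def)
qed (simp_all add: bottom_length_minus_def side_length_minus_def)

text \<open>
  The inverse is not elementary; its derivative is obtained as the reciprocal of \<open>\<Phi>' = 4 \<sigma> / \<pi> * cos \<omega>\<close>, and
  the sign of \<open>Re w\<close> is that of \<open>Re \<omega>\<close>.
\<close>
lemma half_strip_transfer_minus:
  assumes \<sigma>: "0 < \<sigma>" and p: "0 < p" and branch: "power_branch lower_half_plane (deriv (Phi_minus \<sigma>)) (1 / p) g"
  shows "\<exists>\<psi>. half_strip_transfer (-1) \<sigma> p (4 * \<sigma> / pi) (Phi_minus \<sigma>) \<psi> g (Omega_minus \<sigma>)
    ({\<sigma><..} \<times> {..<0}) (arclength_coordinate (bottom_length_minus \<sigma>) (side_length_minus \<sigma>)) (edge_density_minus \<sigma>)"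
proof -
  have H: "{z. 0 < - 1 * Im z} = {z::complex. Im z < 0}" by simp
  obtain \<psi> where \<psi>: "\<psi> holomorphic_on (Phi_minus \<sigma> ` {z. Im z < 0})"
    "\<And>z. z \<in> {z. Im z < 0} \<Longrightarrow> deriv (Phi_minus \<sigma>) z * deriv \<psi> (Phi_minus \<sigma> z) = 1"
    "\<And>z. z \<in> {z. Im z < 0} \<Longrightarrow> \<psi> (Phi_minus \<sigma> z) = z"
    by (rule holomorphic_has_inverse[OF Phi_minus_holomorphic open_halfspace_Im_lt inj_on_Phi_minus[OF \<sigma>]]) (erule that, assumption+)
  have onto: "\<exists>z. Im z < 0 \<and> w = Phi_minus \<sigma> z" if "w \<in> Omega_minus \<sigma>" for w
    using that unfolding Phi_minus_image[OF \<sigma>, symmetric] by auto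
  have dPhi: "deriv (Phi_minus \<sigma>) z = of_real (4 * \<sigma> / pi) * csqrt (1 - z\<^sup>2)" if "Im z < 0" for z
    using Phi_minus_deriv[of z \<sigma>] that by (intro DERIV_imp_deriv) auto
  note branch' = power_branch_properties[OF branch p]
  have len_deriv: "(bottom_length_minus \<sigma> has_real_derivative \<sigma> / pi * (2 + 2 * cos (2 * t))) (at t)"
    "(side_length_minus \<sigma> has_real_derivative \<sigma> / pi * (2 * cosh (2 * t) - 2)) (at t)" for t
    unfolding bottom_length_minus_def side_length_minus_def by (auto intro!: derivative_eq_intros)
  have len_cont: "continuous_on UNIV (bottom_length_minus \<sigma>)" "continuous_on UNIV (side_length_minus \<sigma>)"
    unfolding bottom_length_minus_def side_length_minus_def by (intro continuous_intros; simp)+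
  have "half_strip_transfer (-1) \<sigma> p (4 * \<sigma> / pi) (Phi_minus \<sigma>) \<psi> g (Omega_minus \<sigma>)
    ({\<sigma><..} \<times> {..<0}) (arclength_coordinate (bottom_length_minus \<sigma>) (side_length_minus \<sigma>)) (edge_density_minus \<sigma>)"
  proof (rule half_strip_transfer.intro)
    show "(-1::real) = 1 \<or> (-1::real) = -1" "0 < \<sigma>" "0 < p" "0 \<le> 4 * \<sigma> / pi" using \<sigma> p by auto
    show "open (Omega_minus \<sigma>)" by (rule open_Omega_minus)
    show "Phi_minus \<sigma> holomorphic_on {z. 0 < - 1 * Im z}" unfolding H by (rule Phi_minus_holomorphic)
    show "\<psi> holomorphic_on Omega_minus \<sigma>" using \<psi>(1) unfolding Phi_minus_image[OF \<sigma>] .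
    show "Phi_minus \<sigma> z \<in> Omega_minus \<sigma>" if "0 < - 1 * Im z" for z using that by (intro Phi_minus_in_Omega_minus \<sigma>) simp
    show "\<psi> (Phi_minus \<sigma> z) = z" if "0 < - 1 * Im z" for z using that by (intro \<psi>(3)) simp
    show "0 < - 1 * Im (\<psi> w)" if "w \<in> Omega_minus \<sigma>" for w using onto[OF that] \<psi>(3) by auto
    show "Phi_minus \<sigma> (\<psi> w) = w" if "w \<in> Omega_minus \<sigma>" for w using onto[OF that] \<psi>(3) by auto
    show "g holomorphic_on {z. 0 < - 1 * Im z}" "\<And>z. 0 < - 1 * Im z \<Longrightarrow> cmod (g z) powr p = cmod (deriv (Phi_minus \<sigma>) z)"
      using branch' by (auto simp: lower_half_plane_def)
    show "0 < Re (deriv \<psi> w) \<and> (0 \<le> Re w \<longrightarrow> Im (deriv \<psi> w) \<le> 0) \<and> (Re w \<le> 0 \<longrightarrow> 0 \<le> Im (deriv \<psi> w))"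
      if w: "w \<in> Omega_minus \<sigma>" for w
    proof -
      obtain z where z: "Im z < 0" "w = Phi_minus \<sigma> z" using onto[OF w] by blast
      have nz: "Im z \<noteq> 0" using z by simp
      define \<omega> where "\<omega> = Arcsin z"
      have \<omega>: "\<bar>Re \<omega>\<bar> < pi / 2" "Im \<omega> < 0" "0 < Re (cos \<omega>)"
        using Arcsin_half_strip(1,2)[OF nz] Arcsin_half_strip(3)[OF nz, of "-1"] z by (auto simp: \<omega>_def)
      define q where "q = deriv (Phi_minus \<sigma>) z"
      have q: "q = of_real (4 * \<sigma> / pi) * cos \<omega>" unfolding q_def dPhi[OF z(1)] \<omega>_def cos_Arcsin_csqrt ..
      have "q * deriv \<psi> w = 1" using \<psi>(2) z by (simp add: q_def)
      then have d: "deriv \<psi> w = 1 / q" by (auto simp: eq_divide_eq mult.commute)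
      have re_q: "0 < Re q" unfolding q using \<omega>(3) \<sigma> by simp
      have N: "0 < (Re q)\<^sup>2 + (Im q)\<^sup>2" using re_q by (simp add: add_pos_nonneg)
      have dre: "Re (deriv \<psi> w) = Re q / ((Re q)\<^sup>2 + (Im q)\<^sup>2)" and dim: "Im (deriv \<psi> w) = - Im q / ((Re q)\<^sup>2 + (Im q)\<^sup>2)"
        unfolding d by (simp_all add: Re_divide Im_divide)
      have im_q: "Im q = 4 * \<sigma> / pi * (sin (Re \<omega>) * sinh (- Im \<omega>))" unfolding q by (simp add: cos_components)
      have re_w: "Re w = \<sigma> / pi * (2 * Re \<omega> + sin (2 * Re \<omega>) * cosh (2 * Im \<omega>))"
        unfolding z(2) Phi_minus_scaled[OF \<sigma> nz] \<omega>_def add_sin_components ..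
      have right: "0 \<le> Im q" if "0 \<le> Re \<omega>"
      proof -
        have "0 \<le> sin (Re \<omega>)" using that \<omega>(1) by (intro sin_ge_zero) auto
        then show ?thesis unfolding im_q using \<sigma> \<omega>(2) by (intro mult_nonneg_nonneg) auto
      qed
      have left: "Im q \<le> 0" if "Re \<omega> \<le> 0"
      proof -
        have "0 \<le> sin (- Re \<omega>)" using that \<omega>(1) by (intro sin_ge_zero) auto
        then have *: "sin (Re \<omega>) * sinh (- Im \<omega>) \<le> 0" using \<omega>(2) by (intro mult_nonpos_nonneg) auto
        show ?thesis unfolding im_q by (rule mult_nonneg_nonpos[OF _ *]) (use \<sigma> in simp)
      qed
      have pos: "0 < Re w" if "0 < Re \<omega>"
      proof -
        have "0 \<le> sin (2 * Re \<omega>)" using that \<omega>(1) by (intro sin_ge_zero) auto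
        then have "0 \<le> sin (2 * Re \<omega>) * cosh (2 * Im \<omega>)" by simp
        then show ?thesis unfolding re_w using that \<sigma> by (intro mult_pos_pos add_pos_nonneg) auto
      qed
      have neg: "Re w < 0" if "Re \<omega> < 0"
      proof -
        have "0 \<le> sin (- (2 * Re \<omega>))" using that \<omega>(1) by (intro sin_ge_zero) auto
        then have "sin (2 * Re \<omega>) * cosh (2 * Im \<omega>) \<le> 0" by (intro mult_nonpos_nonneg) auto
        then show ?thesis unfolding re_w using that \<sigma> by (intro mult_pos_neg) auto
      qed
      have "0 \<le> Re w \<Longrightarrow> 0 \<le> Im q" using right neg by (cases "0 \<le> Re \<omega>") auto
      moreover have "Re w \<le> 0 \<Longrightarrow> Im q \<le> 0" using left pos by (cases "Re \<omega> \<le> 0") auto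
      ultimately show ?thesis unfolding dre dim using N re_q by (auto simp: divide_simps)
    qed
    fix s t assume st: "(s, t) \<in> {\<sigma><..} \<times> {..<0::real}"
    show "0 < s" using st \<sigma> by simp
    show "Gamma_path s t x \<in> Omega_minus \<sigma>" for x using st by (auto simp: Gamma_path_def Omega_minus_eq[OF \<sigma>])
    have scaled: "s < \<bar>s / \<sigma> * Re w\<bar>" if "\<sigma> < \<bar>Re w\<bar>" for w
    proof -
      have "s / \<sigma> * \<sigma> < s / \<sigma> * \<bar>Re w\<bar>" using that st \<sigma> by (intro mult_strict_left_mono) auto
      also have "\<dots> = \<bar>s / \<sigma> * Re w\<bar>" using st \<sigma> by (simp add: abs_mult)
      finally show ?thesis using \<sigma> by simp
    qed
    have lowered: "t + s / \<sigma> * Im w < t" if "Im w < 0" for w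
      using mult_pos_neg[of "s / \<sigma>" "Im w"] that st \<sigma> by simp
    have Re_Im: "Re (\<i> * of_real t + of_real (s / \<sigma>) * w) = s / \<sigma> * Re w"
      "Im (\<i> * of_real t + of_real (s / \<sigma>) * w) = t + s / \<sigma> * Im w" for w by simp_all
    show "\<i> * of_real t + of_real (s / \<sigma>) * w \<in> Omega_minus \<sigma>" if "w \<in> Omega_minus \<sigma>" for w
      using that scaled[of w] lowered[of w] st unfolding Omega_minus_eq[OF \<sigma>] mem_Collect_eq Re_Im by auto
    define \<delta> where "\<delta> = min ((s - \<sigma>) / 2) (- t / 2)"
    have \<delta>: "0 < \<delta>" "\<delta> \<le> (s - \<sigma>) / 2" "\<delta> \<le> - t / 2"
      unfolding \<delta>_def by (use st in simp) (rule min.cobounded1 min.cobounded2)+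
    show "\<exists>\<delta>>0. \<forall>w\<in>Omega_minus \<sigma>. let v = \<i> * of_real t + of_real (s / \<sigma>) * w in
        (\<exists>s'. \<bar>Re v\<bar> + \<delta> \<le> s' \<and> (\<forall>y. \<bar>y - Im v\<bar> \<le> \<delta> \<longrightarrow> (s', y) \<in> {\<sigma><..} \<times> {..<0}))
      \<or> (\<exists>t'. t' + \<delta> \<le> Im v \<and> (\<forall>x. \<bar>x - Re v\<bar> \<le> \<delta> \<longrightarrow> x \<noteq> 0 \<and> (\<bar>x\<bar>, t') \<in> {\<sigma><..} \<times> {..<0}))"
      unfolding Let_def Re_Im
    proof (rule exI[of _ \<delta>], intro conjI \<delta>(1) ballI)
      fix w assume w: "w \<in> Omega_minus \<sigma>"
      have st': "\<sigma> < s" "t < 0" using st by auto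
      show "(\<exists>s'. \<bar>s / \<sigma> * Re w\<bar> + \<delta> \<le> s' \<and> (\<forall>y. \<bar>y - (t + s / \<sigma> * Im w)\<bar> \<le> \<delta> \<longrightarrow> (s', y) \<in> {\<sigma><..} \<times> {..<0}))
        \<or> (\<exists>t'. t' + \<delta> \<le> t + s / \<sigma> * Im w \<and> (\<forall>x. \<bar>x - s / \<sigma> * Re w\<bar> \<le> \<delta> \<longrightarrow> x \<noteq> 0 \<and> (\<bar>x\<bar>, t') \<in> {\<sigma><..} \<times> {..<0}))"
      (* To the sides of the strip the vertical edges of low curves pass through the square, below it
         the bottom edges of wide curves do. *)
      proof (cases "\<sigma> < \<bar>Re w\<bar>")
        case True
        have "x \<noteq> 0 \<and> \<sigma> < \<bar>x\<bar>" if "\<bar>x - s / \<sigma> * Re w\<bar> \<le> \<delta>" for x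
        proof -
          have "s - \<delta> < \<bar>s / \<sigma> * Re w\<bar> - \<delta>" using scaled[OF True] by simp
          also have "\<dots> \<le> \<bar>x\<bar>" using that by linarith
          finally have "s - \<delta> < \<bar>x\<bar>" .
          moreover have "\<sigma> < s - \<delta>" using \<delta>(2) st' by (simp add: field_simps)
          ultimately have "\<sigma> < \<bar>x\<bar>" by (rule less_trans[rotated])
          then show ?thesis using \<sigma> by auto
        qed
        then have "\<exists>t'. t' + \<delta> \<le> t + s / \<sigma> * Im w \<and> (\<forall>x. \<bar>x - s / \<sigma> * Re w\<bar> \<le> \<delta> \<longrightarrow> x \<noteq> 0 \<and> (\<bar>x\<bar>, t') \<in> {\<sigma><..} \<times> {..<0})"
          by (intro exI[of _ "min (- 1) (t + s / \<sigma> * Im w - \<delta>)"]) auto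
        then show ?thesis ..
      next
        case False
        then have "Im w < 0" using w by (auto simp: Omega_minus_eq[OF \<sigma>])
        have "y < 0" if "\<bar>y - (t + s / \<sigma> * Im w)\<bar> \<le> \<delta>" for y
        proof -
          have "y \<le> (t + s / \<sigma> * Im w) + \<delta>" using that by linarith
          also have "\<dots> < t + \<delta>" using lowered[OF \<open>Im w < 0\<close>] by simp
          also have "\<dots> < 0" using \<delta>(3) st' by (simp add: field_simps)
          finally show ?thesis .
        qed
        moreover have "\<bar>s / \<sigma> * Re w\<bar> + \<delta> \<le> \<bar>s / \<sigma> * Re w\<bar> + \<delta> + \<sigma>" "\<sigma> < \<bar>s / \<sigma> * Re w\<bar> + \<delta> + \<sigma>"
          using \<sigma> \<delta>(1) by (simp_all only: le_add_same_cancel1 less_add_same_cancel2 add_nonneg_pos abs_ge_zero less_imp_le)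
        ultimately have "\<exists>s'. \<bar>s / \<sigma> * Re w\<bar> + \<delta> \<le> s' \<and> (\<forall>y. \<bar>y - (t + s / \<sigma> * Im w)\<bar> \<le> \<delta> \<longrightarrow> (s', y) \<in> {\<sigma><..} \<times> {..<0})"
          by (intro exI[of _ "\<bar>s / \<sigma> * Re w\<bar> + \<delta> + \<sigma>"]) blast
        then show ?thesis ..
      qed
    qed
  next
    show "\<exists>s t. (\<forall>n::nat. (s n, t n) \<in> {\<sigma><..} \<times> {..<0::real}) \<and> s \<longlonglongrightarrow> \<sigma> \<and> t \<longlonglongrightarrow> 0"
    proof (intro exI conjI allI)
      show "(\<sigma> + 1 / (1 + real n), - 1 / (1 + real n)) \<in> {\<sigma><..} \<times> {..<0}" for n by simp
      show "(\<lambda>n. \<sigma> + 1 / (1 + real n)) \<longlonglongrightarrow> \<sigma>" using \<sigma> by real_asymp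
      show "(\<lambda>n. - 1 / (1 + real n)) \<longlonglongrightarrow> 0" by real_asymp
    qed
    show "cmod (deriv (Phi_minus \<sigma>) z) \<le> 4 * \<sigma> / pi * (1 + cmod z) * (1 + cmod (z\<^sup>2 - 1) powr (- 1 / 2))"
      if "0 < - 1 * Im z" for z
    proof -
      have "cmod (1 - z\<^sup>2) \<le> 1 + (cmod z)\<^sup>2" using norm_triangle_ineq4[of 1 "z\<^sup>2"] by (simp add: norm_power)
      also have "\<dots> \<le> (1 + cmod z)\<^sup>2" by (simp add: power2_eq_square algebra_simps)
      finally have root: "sqrt (cmod (1 - z\<^sup>2)) \<le> 1 + cmod z" by (intro real_le_lsqrt) auto
      have "cmod (deriv (Phi_minus \<sigma>) z) = 4 * \<sigma> / pi * sqrt (cmod (1 - z\<^sup>2))"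
        using that \<sigma> by (simp add: dPhi norm_mult norm_divide)
      also have "\<dots> \<le> 4 * \<sigma> / pi * (1 + cmod z)" using root \<sigma> by (intro mult_left_mono) auto
      also have "\<dots> = 4 * \<sigma> / pi * (1 + cmod z) * 1" by simp
      also have "\<dots> \<le> 4 * \<sigma> / pi * (1 + cmod z) * (1 + cmod (z\<^sup>2 - 1) powr (- 1 / 2))"
        using \<sigma> by (intro mult_left_mono) auto
      finally show ?thesis .
    qed
    show "arclength_coordinate (bottom_length_minus \<sigma>) (side_length_minus \<sigma>) \<in> borel_measurable borel"
      by (intro borel_measurable_continuous_onI continuous_arclength_coordinate len_cont)
    show meas_d: "edge_density_minus \<sigma> \<in> borel_measurable borel" unfolding edge_density_minus_def by measurable
    show "0 \<le> edge_density_minus \<sigma> x" for x using \<sigma> by (simp add: edge_density_minus_def)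
    show "((\<lambda>\<delta>. Phi_minus \<sigma> (Complex x (- 1 * \<delta>))) \<longlongrightarrow> Gamma_path \<sigma> 0 (arclength_coordinate (bottom_length_minus \<sigma>) (side_length_minus \<sigma>) x)) (at_right 0)"
      if x: "x \<noteq> 1" "x \<noteq> -1" for x
    proof (rule Lim_transform_eventually)
      have "((\<lambda>\<delta>. Arcsin (Complex x (- 1 * \<delta>))) \<longlongrightarrow> boundary_angle (- 1) x) (at_right 0)"
        using x by (intro tendsto_Arcsin_boundary) auto
      then have "((\<lambda>\<delta>. of_real (\<sigma> / pi) * (2 * Arcsin (Complex x (- 1 * \<delta>)) + sin (2 * Arcsin (Complex x (- 1 * \<delta>)))))
        \<longlongrightarrow> of_real (\<sigma> / pi) * (2 * boundary_angle (- 1) x + sin (2 * boundary_angle (- 1) x))) (at_right 0)"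
        by (intro tendsto_intros)
      then show "((\<lambda>\<delta>. of_real (\<sigma> / pi) * (2 * Arcsin (Complex x (- 1 * \<delta>)) + sin (2 * Arcsin (Complex x (- 1 * \<delta>)))))
        \<longlongrightarrow> Gamma_path \<sigma> 0 (arclength_coordinate (bottom_length_minus \<sigma>) (side_length_minus \<sigma>) x)) (at_right 0)"
        unfolding boundary_values_minus[OF \<sigma>] .
      show "\<forall>\<^sub>F \<delta> in at_right 0. of_real (\<sigma> / pi) * (2 * Arcsin (Complex x (- 1 * \<delta>)) + sin (2 * Arcsin (Complex x (- 1 * \<delta>))))
        = Phi_minus \<sigma> (Complex x (- 1 * \<delta>))"
        using eventually_at_right_less[of "0::real"] by eventually_elim (simp add: Phi_minus_eq)
    qed
    show "((\<lambda>\<delta>. cmod (deriv (Phi_minus \<sigma>) (Complex x (- 1 * \<delta>)))) \<longlongrightarrow> edge_density_minus \<sigma> x) (at_right 0)"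
      if x: "x \<noteq> 1" "x \<noteq> -1" for x
    proof (rule Lim_transform_eventually)
      show "((\<lambda>\<delta>. 4 * \<sigma> / pi * sqrt (cmod (1 - (Complex x (- 1 * \<delta>))\<^sup>2))) \<longlongrightarrow> edge_density_minus \<sigma> x) (at_right 0)"
        unfolding edge_density_minus_def by (intro tendsto_mult tendsto_const tendsto_cmod_csqrt x)
      show "\<forall>\<^sub>F \<delta> in at_right 0. 4 * \<sigma> / pi * sqrt (cmod (1 - (Complex x (- 1 * \<delta>))\<^sup>2)) = cmod (deriv (Phi_minus \<sigma>) (Complex x (- 1 * \<delta>)))"
        using eventually_at_right_less[of "0::real"]
        by eventually_elim (use \<sigma> in \<open>simp add: dPhi norm_mult norm_divide\<close>)
    qed
    show "(\<integral>\<^sup>+x. G (arclength_coordinate (bottom_length_minus \<sigma>) (side_length_minus \<sigma>) x) * ennreal (edge_density_minus \<sigma> x) \<partial>lborel) = (\<integral>\<^sup>+x. G x \<partial>lborel)"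
      if G: "G \<in> borel_measurable borel" for G
    proof (rule nn_integral_arclength[OF \<sigma> G meas_d len_deriv(1) _ _ _ _ len_deriv(2)])
      show "continuous_on UNIV (\<lambda>t. \<sigma> / pi * (2 + 2 * cos (2 * t)))" "continuous_on UNIV (\<lambda>t. \<sigma> / pi * (2 * cosh (2 * t) - 2))"
        by (intro continuous_intros; simp)+
      show "0 \<le> \<sigma> / pi * (2 + 2 * cos (2 * t))" for t
        by (rule mult_nonneg_nonneg) (use \<sigma> cos_ge_minus_one[of "2 * t"] in \<open>simp, linarith\<close>)
      show "0 \<le> \<sigma> / pi * (2 * cosh (2 * t) - 2)" for t
        by (rule mult_nonneg_nonneg) (use \<sigma> cosh_real_ge_1[of "2 * t"] in \<open>simp, linarith\<close>)
      show "edge_density_minus \<sigma> (sin t) * cos t = \<sigma> / pi * (2 + 2 * cos (2 * t))" if "\<bar>t\<bar> < pi / 2" for t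
      proof -
        have "0 < cos t" using that by (intro cos_gt_zero_pi) auto
        moreover have "1 - (sin t)\<^sup>2 = (cos t)\<^sup>2" by (simp add: cos_squared_eq)
        ultimately show ?thesis by (simp add: edge_density_minus_def cos_double_cos power2_eq_square)
      qed
      show "edge_density_minus \<sigma> (cosh t) * sinh t = \<sigma> / pi * (2 * cosh (2 * t) - 2)" if "0 < t" for t
      proof -
        have "1 - (cosh t)\<^sup>2 = - ((sinh t)\<^sup>2)" by (simp add: cosh_square_eq)
        moreover have "2 * cosh (2 * t) - 2 = 4 * (sinh t)\<^sup>2" by (simp add: cosh_double cosh_square_eq)
        ultimately show ?thesis using that by (simp add: edge_density_minus_def power2_eq_square)
      qed
      show "filterlim (side_length_minus \<sigma>) at_top at_top"
        unfolding side_length_minus_def sinh_field_def using \<sigma> by real_asymp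
    qed (use \<sigma> in \<open>auto simp: edge_density_minus_def bottom_length_minus_def side_length_minus_def\<close>)
  qed
  then show ?thesis by blast
qed

section \<open>Test functions and the operator norms\<close>

text \<open>
  The branch point \<open>- e \<i> \<sigma>\<close> lies at distance \<open>\<sigma>\<close> from the bottom edge, outside the closure of the domain: below
  the half-strip for \<open>e = 1\<close>, inside it for \<open>e = -1\<close>.
\<close>
definition test_function :: "real \<Rightarrow> real \<Rightarrow> real \<Rightarrow> complex \<Rightarrow> complex" where
  "test_function e \<sigma> p w = exp (of_real (- 2 / p) * Ln (of_real \<sigma> - of_real e * \<i> * w))"

lemma differentiable_test_function:
  assumes "0 < \<sigma> + e * Im w \<or> e * Re w \<noteq> 0"
  shows "test_function e \<sigma> p field_differentiable at w"
proof -
  have "of_real \<sigma> - of_real e * \<i> * w \<notin> \<real>\<^sub>\<le>\<^sub>0" using assms by (auto simp: complex_nonpos_Reals_iff)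
  then show ?thesis
    unfolding test_function_def field_differentiable_def
    by (intro exI) (rule derivative_eq_intros refl | assumption)+
qed

lemma test_function_powr:
  assumes p: "0 < p" and w: "0 < \<sigma> + e * Im w \<or> e * Re w \<noteq> 0" and e: "e = 1 \<or> e = -1"
  shows "cmod (test_function e \<sigma> p w) powr p = 1 / ((Re w)\<^sup>2 + (\<sigma> + e * Im w)\<^sup>2)"
proof -
  define q where "q = of_real \<sigma> - of_real e * \<i> * w"
  have "Re q = \<sigma> + e * Im w" "Im q = - (e * Re w)" by (simp_all add: q_def)
  then have cq: "(cmod q)\<^sup>2 = (Re w)\<^sup>2 + (\<sigma> + e * Im w)\<^sup>2" and "q \<noteq> 0"
    using e w by (auto simp: cmod_power2 complex_eq_iff)
  have "cmod (test_function e \<sigma> p w) powr p = exp (- 2 / p * ln (cmod q)) powr p"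
    using \<open>q \<noteq> 0\<close> by (simp add: test_function_def q_def)
  also have "\<dots> = exp (- 2 * ln (cmod q))" using p by (simp add: exp_powr_real)
  also have "\<dots> = 1 / (cmod q)\<^sup>2"
  proof -
    have "exp (- 2 * ln (cmod q)) = inverse (exp (ln (cmod q)) * exp (ln (cmod q)))"
      by (simp only: exp_add[symmetric] exp_minus[symmetric]) simp
    moreover have "exp (ln (cmod q)) = cmod q" using \<open>q \<noteq> 0\<close> by simp
    ultimately show ?thesis by (simp only: power2_eq_square inverse_eq_divide)
  qed
  finally show ?thesis by (simp only: cq)
qed

lemma inverse_square_sum_eq_poisson_kernel: "0 < \<sigma> \<Longrightarrow> 1 / (x\<^sup>2 + \<sigma>\<^sup>2) = pi / \<sigma> * poisson_kernel \<sigma> x"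
  by (simp add: poisson_kernel_def)

lemma inverse_square_sum_le_poisson_kernel:
  assumes \<sigma>: "0 < \<sigma>" and le: "u\<^sup>2 + \<sigma>\<^sup>2 \<le> a\<^sup>2 + b\<^sup>2"
  shows "ennreal (1 / (a\<^sup>2 + b\<^sup>2)) \<le> ennreal (pi / \<sigma>) * ennreal (poisson_kernel \<sigma> u)"
proof -
  have "0 < u\<^sup>2 + \<sigma>\<^sup>2" using \<sigma> by (simp add: add_nonneg_pos)
  then have "1 / (a\<^sup>2 + b\<^sup>2) \<le> 1 / (u\<^sup>2 + \<sigma>\<^sup>2)" using le by (intro divide_left_mono) auto
  then show ?thesis using \<sigma> unfolding inverse_square_sum_eq_poisson_kernel[OF \<sigma>]
    by (simp add: ennreal_mult'[symmetric] ennreal_leI)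
qed

lemma test_function_bottom_edge:
  assumes \<sigma>: "0 < \<sigma>" and p: "0 < p" and e: "e = 1 \<or> e = -1"
  shows "ennreal (pi / (2 * \<sigma>)) \<le> (\<integral>\<^sup>+x. ennreal (cmod (test_function e \<sigma> p (Gamma_path \<sigma> 0 x)) powr p) \<partial>lborel)"
proof -
  have "(\<integral>\<^sup>+x. ennreal (1 / (x\<^sup>2 + \<sigma>\<^sup>2)) * indicator {-\<sigma>..\<sigma>} x \<partial>lborel)
    = ennreal (pi / \<sigma> * (arctan (\<sigma> / \<sigma>) / pi) - pi / \<sigma> * (arctan (- \<sigma> / \<sigma>) / pi))"
  proof (rule nn_integral_FTC_Icc)
    show "((\<lambda>x. pi / \<sigma> * (arctan (x / \<sigma>) / pi)) has_real_derivative 1 / (x\<^sup>2 + \<sigma>\<^sup>2)) (at x)" for x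
      unfolding inverse_square_sum_eq_poisson_kernel[OF \<sigma>] by (intro DERIV_cmult poisson_kernel_primitive \<sigma>)
  qed (use \<sigma> in auto)
  also have "pi / \<sigma> * (arctan (\<sigma> / \<sigma>) / pi) - pi / \<sigma> * (arctan (- \<sigma> / \<sigma>) / pi) = pi / (2 * \<sigma>)"
    using \<sigma> by (simp add: arctan_one arctan_minus field_simps)
  finally have "ennreal (pi / (2 * \<sigma>)) = (\<integral>\<^sup>+x. ennreal (1 / (x\<^sup>2 + \<sigma>\<^sup>2)) * indicator {-\<sigma>..\<sigma>} x \<partial>lborel)" ..
  also have "\<dots> \<le> (\<integral>\<^sup>+x. ennreal (cmod (test_function e \<sigma> p (Gamma_path \<sigma> 0 x)) powr p) \<partial>lborel)"
  proof (rule nn_integral_mono)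
    fix x
    show "ennreal (1 / (x\<^sup>2 + \<sigma>\<^sup>2)) * indicator {-\<sigma>..\<sigma>} x \<le> ennreal (cmod (test_function e \<sigma> p (Gamma_path \<sigma> 0 x)) powr p)"
    proof (cases "x \<in> {-\<sigma>..\<sigma>}")
      case True
      then have G: "Gamma_path \<sigma> 0 x = of_real x" by (auto simp: Gamma_path_def complex_eq_iff)
      show ?thesis unfolding G using True \<sigma> p e by (subst test_function_powr) auto
    qed simp
  qed
  finally show ?thesis .
qed

lemma nn_integral_poisson_kernel_rays:
  assumes "0 < y"
  shows "(\<integral>\<^sup>+x. ennreal (poisson_kernel y (x - s)) * indicator {s..} x \<partial>lborel) = ennreal (1/2)"
    and "(\<integral>\<^sup>+x. ennreal (poisson_kernel y (x + s)) * indicator {..-s} x \<partial>lborel) = ennreal (1/2)"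
proof -
  have "(\<integral>\<^sup>+x. ennreal (poisson_kernel y (x - s)) * indicator {s..} x \<partial>lborel)
    = (\<integral>\<^sup>+x. ennreal (poisson_kernel y x) * indicator {0..} x \<partial>lborel)"
    by (subst nn_integral_real_affine[where c = 1 and t = s]) (auto intro!: nn_integral_cong split: split_indicator)
  then show right: "(\<integral>\<^sup>+x. ennreal (poisson_kernel y (x - s)) * indicator {s..} x \<partial>lborel) = ennreal (1/2)"
    using nn_integral_poisson_kernel_halfline[OF assms] by simp
  have "(\<integral>\<^sup>+x. ennreal (poisson_kernel y (x + s)) * indicator {..-s} x \<partial>lborel)
    = (\<integral>\<^sup>+x. ennreal (poisson_kernel y x) * indicator {0..} x \<partial>lborel)"
  proof (subst nn_integral_real_affine[where c = "-1" and t = "- s"])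
    have "ennreal (poisson_kernel y (- s + - 1 * x + s)) * indicator {..- s} (- s + - 1 * x) = ennreal (poisson_kernel y x) * indicator {0..} x" for x
      by (simp split: split_indicator)
    then show "ennreal \<bar>- 1\<bar> * (\<integral>\<^sup>+x. ennreal (poisson_kernel y (- s + - 1 * x + s)) * indicator {..- s} (- s + - 1 * x) \<partial>lborel)
      = (\<integral>\<^sup>+x. ennreal (poisson_kernel y x) * indicator {0..} x \<partial>lborel)" by simp
  qed auto
  then show "(\<integral>\<^sup>+x. ennreal (poisson_kernel y (x + s)) * indicator {..-s} x \<partial>lborel) = ennreal (1/2)"
    using nn_integral_poisson_kernel_halfline[OF assms] by simp
qed

text \<open>
  At horizontal position \<open>u\<close> on the bottom edge, and at distance \<open>u\<close> from the corner on a vertical edge, the squared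
  distance from the branch point is at least \<open>u\<^sup>2 + \<sigma>\<^sup>2\<close>. One whole Poisson kernel and two halves make the constant 2.
\<close>
lemma test_function_arc_plus:
  assumes \<sigma>: "0 < \<sigma>" and p: "0 < p" and s: "0 < s" and t: "0 < t"
  shows "(\<integral>\<^sup>+x. ennreal (cmod (test_function 1 \<sigma> p (Gamma_path s t x)) powr p) \<partial>lborel) \<le> ennreal (2 * pi / \<sigma>)"
proof -
  let ?k = "\<lambda>x. ennreal (poisson_kernel \<sigma> x)"
  have "(\<integral>\<^sup>+x. ennreal (cmod (test_function 1 \<sigma> p (Gamma_path s t x)) powr p) \<partial>lborel)
    \<le> (\<integral>\<^sup>+x. ennreal (pi / \<sigma>) * (?k x + (?k (x - s) * indicator {s..} x + ?k (x + s) * indicator {..-s} x)) \<partial>lborel)"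
  proof (rule nn_integral_mono)
    fix x
    note bound = inverse_square_sum_le_poisson_kernel[OF \<sigma>]
    have sum: "(\<sigma> + c)\<^sup>2 \<ge> c\<^sup>2 + \<sigma>\<^sup>2" if "0 \<le> c" for c using that \<sigma> by (simp add: power2_sum)
    have Im: "0 < Im (Gamma_path s t x)" using t by (auto simp: Gamma_path_def)
    have val: "cmod (test_function 1 \<sigma> p (Gamma_path s t x)) powr p = 1 / ((Re (Gamma_path s t x))\<^sup>2 + (\<sigma> + Im (Gamma_path s t x))\<^sup>2)"
      using test_function_powr[OF p, of \<sigma> 1 "Gamma_path s t x"] Im \<sigma> by simp
    consider "x < - s" | "-s \<le> x" "x \<le> s" | "s < x" by linarith
    then show "ennreal (cmod (test_function 1 \<sigma> p (Gamma_path s t x)) powr p)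
      \<le> ennreal (pi / \<sigma>) * (?k x + (?k (x - s) * indicator {s..} x + ?k (x + s) * indicator {..-s} x))"
    proof cases
      case 1
      have "(x + s)\<^sup>2 \<le> (t + (- s - x))\<^sup>2" using 1 t by (intro power2_le_iff_abs_le[THEN iffD2]) auto
      then have "(x + s)\<^sup>2 + \<sigma>\<^sup>2 \<le> (t + (- s - x))\<^sup>2 + \<sigma>\<^sup>2" by simp
      also have "\<dots> \<le> (\<sigma> + (t + (- s - x)))\<^sup>2" using 1 t by (intro sum) simp
      also have "\<dots> \<le> (- s)\<^sup>2 + (\<sigma> + (t + (- s - x)))\<^sup>2" by simp
      finally have "(x + s)\<^sup>2 + \<sigma>\<^sup>2 \<le> (- s)\<^sup>2 + (\<sigma> + (t + (- s - x)))\<^sup>2" .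
      from bound[OF this] have "ennreal (cmod (test_function 1 \<sigma> p (Gamma_path s t x)) powr p) \<le> ennreal (pi / \<sigma>) * ?k (x + s)"
        unfolding val using 1 by (simp add: Gamma_path_def)
      also have "\<dots> \<le> ennreal (pi / \<sigma>) * (?k x + (?k (x - s) * indicator {s..} x + ?k (x + s) * indicator {..-s} x))"
        using 1 by (intro mult_left_mono) (auto split: split_indicator)
      finally show ?thesis .
    next
      case 2
      have "\<sigma>\<^sup>2 \<le> (\<sigma> + t)\<^sup>2" using \<sigma> t by (intro power_mono) auto
      then have "x\<^sup>2 + \<sigma>\<^sup>2 \<le> x\<^sup>2 + (\<sigma> + t)\<^sup>2" by simp
      from bound[OF this] have "ennreal (cmod (test_function 1 \<sigma> p (Gamma_path s t x)) powr p) \<le> ennreal (pi / \<sigma>) * ?k x"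
        unfolding val using 2 by (simp add: Gamma_path_def)
      also have "\<dots> \<le> ennreal (pi / \<sigma>) * (?k x + (?k (x - s) * indicator {s..} x + ?k (x + s) * indicator {..-s} x))"
        by (intro mult_left_mono) auto
      finally show ?thesis .
    next
      case 3
      have "(x - s)\<^sup>2 \<le> (t + (x - s))\<^sup>2" using 3 t by (intro power2_le_iff_abs_le[THEN iffD2]) auto
      then have "(x - s)\<^sup>2 + \<sigma>\<^sup>2 \<le> (t + (x - s))\<^sup>2 + \<sigma>\<^sup>2" by simp
      also have "\<dots> \<le> (\<sigma> + (t + (x - s)))\<^sup>2" using 3 t by (intro sum) simp
      also have "\<dots> \<le> s\<^sup>2 + (\<sigma> + (t + (x - s)))\<^sup>2" by simp
      finally have "(x - s)\<^sup>2 + \<sigma>\<^sup>2 \<le> s\<^sup>2 + (\<sigma> + (t + (x - s)))\<^sup>2" .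
      from bound[OF this] have "ennreal (cmod (test_function 1 \<sigma> p (Gamma_path s t x)) powr p) \<le> ennreal (pi / \<sigma>) * ?k (x - s)"
        unfolding val using 3 s by (simp add: Gamma_path_def)
      also have "\<dots> \<le> ennreal (pi / \<sigma>) * (?k x + (?k (x - s) * indicator {s..} x + ?k (x + s) * indicator {..-s} x))"
        using 3 by (intro mult_left_mono) (auto split: split_indicator)
      finally show ?thesis .
    qed
  qed
  also have "\<dots> = ennreal (pi / \<sigma>) * ((\<integral>\<^sup>+x. ?k x \<partial>lborel) + ((\<integral>\<^sup>+x. ?k (x - s) * indicator {s..} x \<partial>lborel) + (\<integral>\<^sup>+x. ?k (x + s) * indicator {..-s} x \<partial>lborel)))"
    by (simp add: nn_integral_cmult nn_integral_add)
  also have "\<dots> = ennreal (pi / \<sigma>) * ennreal 2"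
  proof -
    have "ennreal (1/2) + ennreal (1/2) = 1" by (subst ennreal_plus[symmetric]) auto
    then show ?thesis unfolding nn_integral_poisson_kernel_rays[OF \<sigma>] nn_integral_poisson_kernel[OF \<sigma>] by simp
  qed
  also have "\<dots> = ennreal (2 * pi / \<sigma>)"
    using \<sigma> by (subst ennreal_mult[symmetric]) (auto simp: mult.commute)
  finally show ?thesis .
qed

text \<open>
  Each vertical edge stays at horizontal distance \<open>s > \<sigma>\<close> from the branch point and may now pass it at its
  own height, so it costs a full Poisson kernel, centred at the parameter \<open>\<plusminus>\<tau>\<close> of that height.
\<close>
lemma test_function_arc_minus:
  assumes \<sigma>: "0 < \<sigma>" and p: "0 < p" and s: "\<sigma> < s" and t: "t < 0"
  shows "(\<integral>\<^sup>+x. ennreal (cmod (test_function (-1) \<sigma> p (Gamma_path s t x)) powr p) \<partial>lborel) \<le> ennreal (3 * pi / \<sigma>)"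
proof -
  let ?k = "\<lambda>x. ennreal (poisson_kernel \<sigma> x)"
  define \<tau> where "\<tau> = s + \<sigma> - t"
  have shift: "(\<integral>\<^sup>+x. ?k (x - c) \<partial>lborel) = 1" for c
    using nn_integral_poisson_kernel_shift[OF \<sigma>, of c] by (simp only: poisson_kernel_commute)
  have "(\<integral>\<^sup>+x. ennreal (cmod (test_function (-1) \<sigma> p (Gamma_path s t x)) powr p) \<partial>lborel)
    \<le> (\<integral>\<^sup>+x. ennreal (pi / \<sigma>) * (?k x + (?k (x - \<tau>) + ?k (x - (- \<tau>)))) \<partial>lborel)"
  proof (rule nn_integral_mono)
    fix x
    note bound = inverse_square_sum_le_poisson_kernel[OF \<sigma>]
    have "0 < \<sigma> + (-1) * Im (Gamma_path s t x) \<or> (-1) * Re (Gamma_path s t x) \<noteq> 0" using s t \<sigma> by (auto simp: Gamma_path_def)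
    then have val: "cmod (test_function (-1) \<sigma> p (Gamma_path s t x)) powr p = 1 / ((Re (Gamma_path s t x))\<^sup>2 + (\<sigma> - Im (Gamma_path s t x))\<^sup>2)"
      using test_function_powr[OF p, of \<sigma> "-1" "Gamma_path s t x"] by simp
    have s2: "\<sigma>\<^sup>2 \<le> s\<^sup>2" using s \<sigma> by (intro power_mono) auto
    consider "x < - s" | "-s \<le> x" "x \<le> s" | "s < x" by linarith
    then show "ennreal (cmod (test_function (-1) \<sigma> p (Gamma_path s t x)) powr p)
      \<le> ennreal (pi / \<sigma>) * (?k x + (?k (x - \<tau>) + ?k (x - (- \<tau>))))"
    proof cases
      case 1
      have eq: "\<sigma> - (t + (- s - x)) = x - (- \<tau>)" by (simp add: \<tau>_def)
      have "(x - (- \<tau>))\<^sup>2 + \<sigma>\<^sup>2 \<le> (- s)\<^sup>2 + (\<sigma> - (t + (- s - x)))\<^sup>2" unfolding eq using s2 by simp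
      from bound[OF this] have "ennreal (cmod (test_function (-1) \<sigma> p (Gamma_path s t x)) powr p) \<le> ennreal (pi / \<sigma>) * ?k (x - (- \<tau>))"
        unfolding val using 1 by (simp add: Gamma_path_def)
      also have "\<dots> \<le> ennreal (pi / \<sigma>) * (?k x + (?k (x - \<tau>) + ?k (x - (- \<tau>))))"
        by (intro mult_left_mono) (auto simp: add_increasing)
      finally show ?thesis .
    next
      case 2
      have "\<sigma>\<^sup>2 \<le> (\<sigma> - t)\<^sup>2" using \<sigma> t by (intro power_mono) auto
      then have "x\<^sup>2 + \<sigma>\<^sup>2 \<le> x\<^sup>2 + (\<sigma> - t)\<^sup>2" by simp
      from bound[OF this] have "ennreal (cmod (test_function (-1) \<sigma> p (Gamma_path s t x)) powr p) \<le> ennreal (pi / \<sigma>) * ?k x"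
        unfolding val using 2 by (simp add: Gamma_path_def)
      also have "\<dots> \<le> ennreal (pi / \<sigma>) * (?k x + (?k (x - \<tau>) + ?k (x - (- \<tau>))))"
        by (intro mult_left_mono) auto
      finally show ?thesis .
    next
      case 3
      have "\<sigma> - (t + (x - s)) = - (x - \<tau>)" by (simp add: \<tau>_def)
      then have eq: "(\<sigma> - (t + (x - s)))\<^sup>2 = (x - \<tau>)\<^sup>2" by (simp only: power2_minus)
      have "(x - \<tau>)\<^sup>2 + \<sigma>\<^sup>2 \<le> s\<^sup>2 + (\<sigma> - (t + (x - s)))\<^sup>2" unfolding eq using s2 by simp
      from bound[OF this] have "ennreal (cmod (test_function (-1) \<sigma> p (Gamma_path s t x)) powr p) \<le> ennreal (pi / \<sigma>) * ?k (x - \<tau>)"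
        unfolding val using 3 s \<sigma> by (simp add: Gamma_path_def)
      also have "\<dots> \<le> ennreal (pi / \<sigma>) * (?k x + (?k (x - \<tau>) + ?k (x - (- \<tau>))))"
        by (intro mult_left_mono) (auto simp: add_increasing add_increasing2)
      finally show ?thesis .
    qed
  qed
  also have "\<dots> = ennreal (pi / \<sigma>) * ((\<integral>\<^sup>+x. ?k x \<partial>lborel) + ((\<integral>\<^sup>+x. ?k (x - \<tau>) \<partial>lborel) + (\<integral>\<^sup>+x. ?k (x - (- \<tau>)) \<partial>lborel)))"
    by (simp add: nn_integral_cmult nn_integral_add)
  also have "\<dots> = ennreal (pi / \<sigma>) * ennreal 3"
    unfolding shift nn_integral_poisson_kernel[OF \<sigma>] by simp
  also have "\<dots> = ennreal (3 * pi / \<sigma>)"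
    using \<sigma> by (subst ennreal_mult[symmetric]) (auto simp: mult.commute)
  finally show ?thesis .
qed

theorem theorem6p18:
  fixes \<sigma> p :: real and g_plus g_minus :: "complex \<Rightarrow> complex"
  assumes "0 < \<sigma>" and "0 < p"
    and "power_branch upper_half_plane (deriv (Phi_plus \<sigma>)) (1 / p) g_plus"
    and "power_branch lower_half_plane (deriv (Phi_minus \<sigma>)) (1 / p) g_minus"
  shows "(linear_between (Hp_Omega_plus \<sigma> p) (Hp_upper p) (T_plus \<sigma> g_plus)
      \<and> inj_on (T_plus \<sigma> g_plus) (Hp_Omega_plus \<sigma> p)
      \<and> T_plus \<sigma> g_plus ` Hp_Omega_plus \<sigma> p = Hp_upper p
      \<and> ennreal (5 powr (- 1 / p))
          \<le> op_norm (Hp_Omega_plus \<sigma> p) (norm_Omega_plus \<sigma> p) (norm_upper p) (T_plus \<sigma> g_plus)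
      \<and> op_norm (Hp_Omega_plus \<sigma> p) (norm_Omega_plus \<sigma> p) (norm_upper p) (T_plus \<sigma> g_plus) \<le> 1
      \<and> op_norm (Hp_upper p) (norm_upper p) (norm_Omega_plus \<sigma> p)
          (inv_into (Hp_Omega_plus \<sigma> p) (T_plus \<sigma> g_plus)) < \<infinity>)
    \<and> (linear_between (Hp_Omega_minus \<sigma> p) (Hp_lower p) (T_minus \<sigma> g_minus)
      \<and> inj_on (T_minus \<sigma> g_minus) (Hp_Omega_minus \<sigma> p)
      \<and> T_minus \<sigma> g_minus ` Hp_Omega_minus \<sigma> p = Hp_lower p
      \<and> ennreal (6 powr (- 1 / p))
          \<le> op_norm (Hp_Omega_minus \<sigma> p) (norm_Omega_minus \<sigma> p) (norm_lower p) (T_minus \<sigma> g_minus)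
      \<and> op_norm (Hp_Omega_minus \<sigma> p) (norm_Omega_minus \<sigma> p) (norm_lower p) (T_minus \<sigma> g_minus) \<le> 1
      \<and> op_norm (Hp_lower p) (norm_lower p) (norm_Omega_minus \<sigma> p)
          (inv_into (Hp_Omega_minus \<sigma> p) (T_minus \<sigma> g_minus)) < \<infinity>)"
proof
  note \<sigma> = assms(1) and p = assms(2)
  interpret half_strip_transfer 1 \<sigma> p "2 * \<sigma> / pi" "Phi_plus \<sigma>" "\<lambda>w. sin (of_real (pi / (2 * \<sigma>)) * w)" g_plus "Omega_plus \<sigma>"
    "{0<..<\<sigma>} \<times> {0<..}" "arclength_coordinate (edge_length_plus \<sigma>) (edge_length_plus \<sigma>)" "edge_density_plus \<sigma>"
    by (rule half_strip_transfer_plus[OF assms(1-3)])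
  have T: "T_plus \<sigma> g_plus = T" by (simp add: fun_eq_iff T_plus_def T_def upper_half_plane_def)
  have N: "norm_Omega_plus \<sigma> p = N\<Omega>" "norm_upper p = NH" unfolding N\<Omega>_def NH_def by (rule norm_Omega_plus_eq norm_upper_eq)+
  have S: "Hp_Omega_plus \<sigma> p = V" "Hp_upper p = W"
    unfolding Hp_Omega_plus_def Hp_upper_def N upper_half_plane_def by simp_all
  have hol: "test_function 1 \<sigma> p holomorphic_on Omega_plus \<sigma>"
    by (rule holomorphic_onI, rule field_differentiable_at_within, rule differentiable_test_function) (use \<sigma> in \<open>auto simp: Omega_plus_def D_def\<close>)
  have cont: "isCont (test_function 1 \<sigma> p) (Gamma_path \<sigma> 0 x)" for x
    by (rule field_differentiable_imp_continuous_at, rule differentiable_test_function) (use \<sigma> in \<open>auto simp: Gamma_path_def\<close>)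
  (* The test function gives the ratio 1/4, which exceeds 1/5. *)
  have "5 powr (- 1 / p) = (1 / 5) powr (1 / p)" by (simp add: powr_divide powr_minus_divide)
  also have "\<dots> \<le> (pi / (2 * \<sigma>) / (2 * pi / \<sigma>)) powr (1 / p)" using \<sigma> p by (intro powr_mono2) (auto simp: field_simps)
  finally have "ennreal (5 powr (- 1 / p)) \<le> ennreal ((pi / (2 * \<sigma>) / (2 * pi / \<sigma>)) powr (1 / p))" by (rule ennreal_leI)
  also have "\<dots> \<le> op_norm V N\<Omega> NH T"
    by (rule op_norm_T_ge[OF hol cont _ test_function_bottom_edge[OF \<sigma> p]]) (use \<sigma> p in \<open>auto intro!: test_function_arc_plus\<close>)
  finally have "ennreal (5 powr (- 1 / p)) \<le> op_norm V N\<Omega> NH T" .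
  then show "linear_between (Hp_Omega_plus \<sigma> p) (Hp_upper p) (T_plus \<sigma> g_plus)
      \<and> inj_on (T_plus \<sigma> g_plus) (Hp_Omega_plus \<sigma> p)
      \<and> T_plus \<sigma> g_plus ` Hp_Omega_plus \<sigma> p = Hp_upper p
      \<and> ennreal (5 powr (- 1 / p))
          \<le> op_norm (Hp_Omega_plus \<sigma> p) (norm_Omega_plus \<sigma> p) (norm_upper p) (T_plus \<sigma> g_plus)
      \<and> op_norm (Hp_Omega_plus \<sigma> p) (norm_Omega_plus \<sigma> p) (norm_upper p) (T_plus \<sigma> g_plus) \<le> 1
      \<and> op_norm (Hp_upper p) (norm_upper p) (norm_Omega_plus \<sigma> p)
          (inv_into (Hp_Omega_plus \<sigma> p) (T_plus \<sigma> g_plus)) < \<infinity>"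
    unfolding S N T by (intro conjI linear_T inj_on_T T_image op_norm_T_le op_norm_T_inv_finite)
next
  note \<sigma> = assms(1) and p = assms(2)
  obtain \<psi> where "half_strip_transfer (-1) \<sigma> p (4 * \<sigma> / pi) (Phi_minus \<sigma>) \<psi> g_minus (Omega_minus \<sigma>)
    ({\<sigma><..} \<times> {..<0}) (arclength_coordinate (bottom_length_minus \<sigma>) (side_length_minus \<sigma>)) (edge_density_minus \<sigma>)"
    using half_strip_transfer_minus[OF assms(1,2,4)] by blast
  then interpret half_strip_transfer "-1" \<sigma> p "4 * \<sigma> / pi" "Phi_minus \<sigma>" \<psi> g_minus "Omega_minus \<sigma>"
    "{\<sigma><..} \<times> {..<0}" "arclength_coordinate (bottom_length_minus \<sigma>) (side_length_minus \<sigma>)" "edge_density_minus \<sigma>" .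
  have T: "T_minus \<sigma> g_minus = T" by (simp add: fun_eq_iff T_minus_def T_def lower_half_plane_def)
  have N: "norm_Omega_minus \<sigma> p = N\<Omega>" "norm_lower p = NH" unfolding N\<Omega>_def NH_def by (rule norm_Omega_minus_eq norm_lower_eq)+
  have S: "Hp_Omega_minus \<sigma> p = V" "Hp_lower p = W"
    unfolding Hp_Omega_minus_def Hp_lower_def N lower_half_plane_def by simp_all
  have hol: "test_function (-1) \<sigma> p holomorphic_on Omega_minus \<sigma>"
    by (rule holomorphic_onI, rule field_differentiable_at_within, rule differentiable_test_function) (use \<sigma> in \<open>auto simp: Omega_minus_eq\<close>)
  have cont: "isCont (test_function (-1) \<sigma> p) (Gamma_path \<sigma> 0 x)" for x
    by (rule field_differentiable_imp_continuous_at, rule differentiable_test_function) (use \<sigma> in \<open>auto simp: Gamma_path_def\<close>)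
  have "6 powr (- 1 / p) = (1 / 6) powr (1 / p)" by (simp add: powr_divide powr_minus_divide)
  also have "1 / 6 = pi / (2 * \<sigma>) / (3 * pi / \<sigma>)" using \<sigma> by (simp add: field_simps)
  finally have "ennreal (6 powr (- 1 / p)) = ennreal ((pi / (2 * \<sigma>) / (3 * pi / \<sigma>)) powr (1 / p))" by simp
  also have "\<dots> \<le> op_norm V N\<Omega> NH T"
    by (rule op_norm_T_ge[OF hol cont _ test_function_bottom_edge[OF \<sigma> p]]) (use \<sigma> p in \<open>auto intro!: test_function_arc_minus\<close>)
  finally have "ennreal (6 powr (- 1 / p)) \<le> op_norm V N\<Omega> NH T" .
  then show "linear_between (Hp_Omega_minus \<sigma> p) (Hp_lower p) (T_minus \<sigma> g_minus)
      \<and> inj_on (T_minus \<sigma> g_minus) (Hp_Omega_minus \<sigma> p)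
      \<and> T_minus \<sigma> g_minus ` Hp_Omega_minus \<sigma> p = Hp_lower p
      \<and> ennreal (6 powr (- 1 / p))
          \<le> op_norm (Hp_Omega_minus \<sigma> p) (norm_Omega_minus \<sigma> p) (norm_lower p) (T_minus \<sigma> g_minus)
      \<and> op_norm (Hp_Omega_minus \<sigma> p) (norm_Omega_minus \<sigma> p) (norm_lower p) (T_minus \<sigma> g_minus) \<le> 1
      \<and> op_norm (Hp_lower p) (norm_lower p) (norm_Omega_minus \<sigma> p)
          (inv_into (Hp_Omega_minus \<sigma> p) (T_minus \<sigma> g_minus)) < \<infinity>"
    unfolding S N T by (intro conjI linear_T inj_on_T T_image op_norm_T_le op_norm_T_inv_finite)
qed

end
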